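(* Let $g$ be an automorphism of $\mathbb{C}[t]$ of finite order $p>1$ which preserves $\mathbb{C}t$, and let $D=f(t)\frac{d}{dt}$, $f(t)\in\mathbb{C}[t]$, be a derivation of $\mathbb{C}[t]$. Then there exists a finite-dimensional $g$-twisted $(\mathbb{C}[t],D)$-module $(M,Y_M)$ with $Y_M(t,x)\neq 0$ if and only if $f(t)=c_1t+c_{p+1}t^{p+1}$ where $c_1,c_{p+1}\in\mathbb{C}$ and $c_{p+1}\neq 0$. In this case, let $\gamma_p$ be any fixed $p$-th root of $(-pc_{p+1})^{-1}$, i.e. $\gamma_p\in\mathbb{C}$ with $\gamma_p^p=(-pc_{p+1})^{-1}$. Then for every positive integer $n$, any $n$-dimensional indecomposable $g$-twisted $(\mathbb{C}[t],D)$-module $(M,Y_M)$ which satisfies $Y_M(t,x)\neq 0$ is isomorphic to one of the following $p$ $g$-twisted $(\mathbb{C}[t],D)$-modules $(M^{(p,l)}_n,Y_{M^{(p,l)}_n})$, $0\leq l\leq p-1$: (1) In the case $c_1=0$, $M^{(p,l)}_n=\mathbb{C}^n$ and $$Y_{M^{(p,l)}_n}(t,x)=\gamma_p\zeta_p^{l}x^{-1/p}(E_n-x^{-1}J_n)^{-1/p}.$$ (2) In the case $c_1\neq 0$, $M^{(p,l)}_n=\mathbb{C}^n$ and $$Y_{M^{(p,l)}_n}(t,x)=\gamma_p\zeta_p^{l}\Bigl(\frac{-1+\exp(-c_1px)}{-c_1p}\Bigr)^{-1/p}\Bigl(E_n-\frac{\exp(-c_1px)}{-1+\exp(-c_1p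x)}J_n\Bigr)^{-1/p}.$$
   Context: Vertex algebra $(\mathbb{C}[t],D)$: for a derivation $D$ of $\mathbb{C}[t]$, $(\mathbb{C}[t],D)$ denotes the vertex algebra with underlying space $\mathbb{C}[t]$, vacuum vector $1$, and $Y(a,x)b=\sum_{i\ge 0}\frac{1}{i!}(D^ia)b\,x^i$ for $a,b\in\mathbb{C}[t]$. Writing $Y(a,x)=\sum_{k\in\mathbb{Z}}a_kx^{-k-1}$, this means $a_{-1-i}b=\frac{1}{i!}(D^ia)b$ for $i\ge 0$ and $a_kb=0$ for $k\ge 0$. Twisted modules: let $g$ be a $\mathbb{C}$-algebra automorphism of $\mathbb{C}[t]$ of finite order $p$ preserving $\mathbb{C}t$, so $gt=\xi t$ with $\xi$ a primitive $p$-th root of unity. For $0\le r\le p-1$ put $\mathbb{C}[t]^r=\{a\in\mathbb{C}[t]\mid ga=\xi^ra\}$ (so $t\in\mathbb{C}[t]^1$ when $p>1$). A $g$-twisted $(\mathbb{C}[t],D)$-module (as a vertex algebra) is a complex vector space $M$ with a linear map $Y_M(\cdot,x):\mathbb{C}[t]\to(\mathrm{End}\,M)[[x^{1/p},x^{-1/p}]]$, $Y_M(v,x)=\sum_{i\in\frac1p\mathbb{Z}}v_ix^{-i-1}$, such that: (1) $Y_M(u,x)=\sum_{i\in r/p+\mathbb{Z}}u_ix^{-i-1}$ for $u\in\mathbb{C}[t]^r$; (2) $Y_M(u,x)w\in M((x^{1/p}))$ for $u\in\mathbb{C}[t]$, $w\in M$; (3) $Y_M(1,x)=\mathrm{id}_M$;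 (4) for $u\in\mathbb{C}[t]^r$, $v\in\mathbb{C}[t]^s$, $m\in r/p+\mathbb{Z}$, $n\in s/p+\mathbb{Z}$, $l\in\mathbb{Z}$, $$\sum_{i=0}^{\infty}\binom{m}{i}(u_{l+i}v)_{m+n-i}=\sum_{i=0}^{\infty}\binom{l}{i}(-1)^i\bigl(u_{l+m-i}v_{n+i}+(-1)^{l+1}v_{l+n-i}u_{m+i}\bigr).$$ Submodules, isomorphisms and indecomposability (not a direct sum of two nonzero submodules) are with respect to the action of all the operators $u_i$. A structure $(M,Y_M)$ is determined by $Y_M(t,x)$, via $Y_M(P(t),x)=P(Y_M(t,x))$ for $P(t)\in\mathbb{C}[t]$; this is how the modules are specified by giving $Y(t,x)$. Notation: $\zeta_p$ is a primitive $p$-th root of unity; $E_n$ is the $n\times n$ identity matrix; $J_n$ is the $n\times n$ nilpotent Jordan block with entries $1$ at positions $(i,i+1)$, $1\le i\le n-1$, and $0$ elsewhere. $\mathrm{End}(\mathbb{C}^n)$ is identified with $n\times n$ matrices. Expressions in $\exp(\lambda x)=\sum_{i\ge0}(\lambda x)^i/i!$ are formal (Laurent) series in $x$. For $G(x)\in x\mathbb{C}[[x]]$ and $m\in\mathbb{Q}$, $(x(1+G(x)))^m=x^m\sum_{i\ge0}\binom{m}{i}G(x)^i$ (note $\frac{-1+\exp(-c_1px)}{-c_1p}$ has the form $x(1+G(x))$). For $F(x)\in\mathbb{C}((x))$, $m\in\mathbb{Q}$ and a nilpotent $n\times n$ matrix $H$, $(E_n+F(x)H)^m=\sum_{i\ge0}\binom{m}{i}(F(x)H)^i$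 (a finite sum). *)

theory Defs
  imports
    "Jordan_Normal_Form.VS_Connect"
    "Jordan_Normal_Form.Jordan_Normal_Form"
    "HOL-Computational_Algebra.Formal_Laurent_Series"
begin

no_notation fls_nth (infixl "$$" 75)

abbreviation tvar :: "complex poly" where
  "tvar \<equiv> [:0, 1:]"

definition poly_alg_automorphism :: "(complex poly \<Rightarrow> complex poly) \<Rightarrow> bool" where
  "poly_alg_automorphism g \<longleftrightarrow>
     bij g \<and> g 1 = 1 \<and>
     (\<forall>a b. g (a + b) = g a + g b) \<and>
     (\<forall>a b. g (a * b) = g a * g b) \<and>
     (\<forall>c a. g (Polynomial.smult c a) = Polynomial.smult c (g a))"

definition has_order :: "('a \<Rightarrow> 'a) \<Rightarrow> nat \<Rightarrow> bool" where
  "has_order g p \<longleftrightarrow> p > 0 \<and> g ^^ p = id \<and> (\<forall>k. 0 < k \<and> k < p \<longrightarrow> g ^^ k \<noteq> id)"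

definition line_t :: "complex poly set" where
  "line_t = {Polynomial.smult c tvar | c. True}"

definition primitive_root :: "nat \<Rightarrow> complex \<Rightarrow> bool" where
  "primitive_root p z \<longleftrightarrow> p > 0 \<and> z ^ p = 1 \<and> (\<forall>k. 0 < k \<and> k < p \<longrightarrow> z ^ k \<noteq> 1)"

text \<open>If \<open>g\<close> preserves the line spanned by \<open>t\<close>, then \<open>g t = \<xi> t\<close> with
  \<open>\<xi> = eigenvalue_t g\<close>.\<close>

definition eigenvalue_t :: "(complex poly \<Rightarrow> complex poly) \<Rightarrow> complex" where
  "eigenvalue_t g = coeff (g tvar) 1"

definition graded_part :: "(complex poly \<Rightarrow> complex poly) \<Rightarrow> nat \<Rightarrow> complex poly set" where
  "graded_part g r = {a. g a = Polynomial.smult (eigenvalue_t g ^ r) a}"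

text \<open>\<open>va_prod D a k b\<close> is the product \<open>a\<^sub>k b\<close>, that is, the coefficient of
  \<open>x\<close> to the power \<open>-k-1\<close> in \<open>Y(a,x)b\<close>.\<close>

definition va_prod ::
  "(complex poly \<Rightarrow> complex poly) \<Rightarrow> complex poly \<Rightarrow> int \<Rightarrow> complex poly \<Rightarrow> complex poly" where
  "va_prod D a k b =
     (if k < 0
      then Polynomial.smult (1 / fact (nat (- 1 - k))) ((D ^^ nat (- 1 - k)) a) * b
      else 0)"

definition derivation_of :: "complex poly \<Rightarrow> complex poly \<Rightarrow> complex poly" where
  "derivation_of f a = f * pderiv a"

text \<open>The sum of a finitely supported sequence of vectors. In the twisted Jacobi identity
  below both sequences are finitely supported, because \<open>u\<^sub>k v = 0\<close> for \<open>k \<ge> 0\<close> and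
  because of the truncation condition.\<close>

definition fsum :: "(complex, 'm) module \<Rightarrow> (nat \<Rightarrow> 'm) \<Rightarrow> 'm" where
  "fsum M h = finsum M h {i. h i \<noteq> \<zero>\<^bsub>M\<^esub>}"

text \<open>A field \<open>Y(u,x)\<close> is given by its modes: \<open>Y u i\<close> is the operator \<open>u\<^sub>i\<close>, the coefficient
  of \<open>x\<close> to the power \<open>-i-1\<close>, for rational \<open>i\<close>. Only \<open>i\<close> in \<open>(1/p)\<int>\<close> occur.
  Operators are only relevant on \<open>carrier M\<close>.\<close>

locale twisted_module = vectorspace class_ring M
  for M :: "(complex, 'm) module" (structure) +
  fixes p :: nat
    and g :: "complex poly \<Rightarrow> complex poly"
    and D :: "complex poly \<Rightarrow> complex poly"
    and Y :: "complex poly \<Rightarrow> rat \<Rightarrow> 'm \<Rightarrow> 'm"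
  assumes mode_linear: "linear_map class_ring M M (Y u i)"
    and mode_exponents: "of_nat p * i \<notin> \<int> \<Longrightarrow> w \<in> carrier M \<Longrightarrow> Y u i w = \<zero>"
    and field_add: "w \<in> carrier M \<Longrightarrow> Y (u + v) i w = Y u i w \<oplus> Y v i w"
    and field_smult: "w \<in> carrier M \<Longrightarrow> Y (Polynomial.smult c u) i w = c \<odot> Y u i w"
    and grading: "r < p \<Longrightarrow> u \<in> graded_part g r \<Longrightarrow> i - of_nat r / of_nat p \<notin> \<int> \<Longrightarrow>
        w \<in> carrier M \<Longrightarrow> Y u i w = \<zero>"
    and truncation: "w \<in> carrier M \<Longrightarrow> \<exists>N. \<forall>i>N. Y u i w = \<zero>"
    and vacuum: "w \<in> carrier M \<Longrightarrow> Y 1 i w = (if i = - 1 then w else \<zero>)"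
    and jacobi: "r < p \<Longrightarrow> s < p \<Longrightarrow> u \<in> graded_part g r \<Longrightarrow> v \<in> graded_part g s \<Longrightarrow>
        m - of_nat r / of_nat p \<in> \<int> \<Longrightarrow> n - of_nat s / of_nat p \<in> \<int> \<Longrightarrow> w \<in> carrier M \<Longrightarrow>
        fsum M (\<lambda>i. (of_rat m gchoose i) \<odot>
          Y (va_prod D u (l + int i) v) (m + n - of_nat i) w)
        = fsum M (\<lambda>i. ((of_int l gchoose i) * (- 1) ^ i) \<odot>
            (Y u (of_int l + m - of_nat i) (Y v (n + of_nat i) w)
             \<oplus> ((- 1) powi (l + 1)) \<odot> Y v (of_int l + n - of_nat i) (Y u (m + of_nat i) w)))"

definition field_nonzero ::
  "(complex, 'm) module \<Rightarrow> (complex poly \<Rightarrow> rat \<Rightarrow> 'm \<Rightarrow> 'm) \<Rightarrow> complex poly \<Rightarrow> bool" where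
  "field_nonzero M Y u \<longleftrightarrow> (\<exists>i. \<exists>w\<in>carrier M. Y u i w \<noteq> \<zero>\<^bsub>M\<^esub>)"

definition field_submodule ::
  "(complex, 'm) module \<Rightarrow> (complex poly \<Rightarrow> rat \<Rightarrow> 'm \<Rightarrow> 'm) \<Rightarrow> 'm set \<Rightarrow> bool" where
  "field_submodule M Y W \<longleftrightarrow>
     VectorSpace.subspace class_ring W M \<and> (\<forall>u i. \<forall>w\<in>W. Y u i w \<in> W)"

definition field_indecomposable ::
  "(complex, 'm) module \<Rightarrow> (complex poly \<Rightarrow> rat \<Rightarrow> 'm \<Rightarrow> 'm) \<Rightarrow> bool" where
  "field_indecomposable M Y \<longleftrightarrow>
     \<not> (\<exists>W1 W2. field_submodule M Y W1 \<and> field_submodule M Y W2 \<and>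
          W1 \<noteq> {\<zero>\<^bsub>M\<^esub>} \<and> W2 \<noteq> {\<zero>\<^bsub>M\<^esub>} \<and>
          W1 \<inter> W2 = {\<zero>\<^bsub>M\<^esub>} \<and> module.submodule_sum M W1 W2 = carrier M)"

definition field_isomorphic ::
  "(complex, 'm) module \<Rightarrow> (complex poly \<Rightarrow> rat \<Rightarrow> 'm \<Rightarrow> 'm) \<Rightarrow>
   (complex, 'k) module \<Rightarrow> (complex poly \<Rightarrow> rat \<Rightarrow> 'k \<Rightarrow> 'k) \<Rightarrow> bool" where
  "field_isomorphic M Y N Z \<longleftrightarrow>
     (\<exists>\<phi>. \<phi> \<in> LinearCombinations.module_hom class_ring M N \<and> bij_betw \<phi> (carrier M) (carrier N) \<and>
        (\<forall>u i. \<forall>w\<in>carrier M. \<phi> (Y u i w) = Z u i (\<phi> w)))"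

text \<open>Matrix-valued Laurent series in \<open>x\<close> to the power \<open>1/p\<close> are represented by matrices over
  \<open>complex fls\<close>, the variable of the Laurent series being \<open>z\<close> with \<open>z ^ p = x\<close>.
  Thus \<open>fls_compose_power F p\<close> is the series \<open>F(x)\<close> written in terms of \<open>z\<close>.\<close>

definition eval_poly_mat :: "nat \<Rightarrow> complex poly \<Rightarrow> complex fls mat \<Rightarrow> complex fls mat" where
  "eval_poly_mat n P A =
     mat n n (\<lambda>(a, b). \<Sum>k\<le>degree P. fls_const (coeff P k) * (A ^\<^sub>m k) $$ (a, b))"

text \<open>The modes of the structure with \<open>Y(t,x) = T\<close> and \<open>Y(P(t),x) = P(T)\<close>. The power
  \<open>-i-1\<close> of \<open>x\<close> is the power \<open>-p(i+1)\<close> of \<open>z\<close>.\<close>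

definition series_field ::
  "nat \<Rightarrow> nat \<Rightarrow> complex fls mat \<Rightarrow> complex poly \<Rightarrow> rat \<Rightarrow> complex vec \<Rightarrow> complex vec" where
  "series_field p n T u i w =
     (if of_nat p * i \<in> \<int>
      then map_mat (\<lambda>F. fls_nth F \<lfloor>- (of_nat p * (i + 1))\<rfloor>) (eval_poly_mat n u T) *\<^sub>v w
      else 0\<^sub>v n)"

text \<open>The power \<open>m\<close> of \<open>1 + A\<close> for an \<open>n \<times> n\<close> matrix \<open>A\<close> with \<open>A ^ n = 0\<close>; the
  binomial series stops before \<open>k = n\<close>.\<close>

definition binomial_mat :: "nat \<Rightarrow> complex \<Rightarrow> complex fls mat \<Rightarrow> complex fls mat" where
  "binomial_mat n m A =
     mat n n (\<lambda>(a, b). \<Sum>k<n. fls_const (m gchoose k) * (A ^\<^sub>m k) $$ (a, b))"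

text \<open>\<open>root_power p k G\<close> is \<open>x(1 + G(x))\<close> to the power \<open>k/p\<close>, for \<open>G\<close> without
  constant term, as a series in \<open>z\<close>.\<close>

definition root_power :: "nat \<Rightarrow> int \<Rightarrow> complex fps \<Rightarrow> complex fls" where
  "root_power p k G =
     fls_X_intpow k *
     fls_compose_power (fps_to_fls (fps_compose (fps_binomial (of_int k / of_nat p)) G)) p"

definition T_zero :: "nat \<Rightarrow> complex \<Rightarrow> nat \<Rightarrow> complex fls mat" where
  "T_zero p a n =
     (fls_const a * root_power p (- 1) 0) \<cdot>\<^sub>m
     binomial_mat n (- 1 / of_nat p)
       (fls_compose_power (- fls_X_inv) p \<cdot>\<^sub>m jordan_block n 0)"

text \<open>\<open>exp_G b\<close> is the series \<open>G\<close> with \<open>(exp(b x) - 1)/b = x(1 + G(x))\<close>.\<close>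

definition exp_G :: "complex \<Rightarrow> complex fps" where
  "exp_G b = fps_shift 1 (fps_const (1 / b) * (fps_exp b - 1)) - 1"

definition T_nonzero :: "nat \<Rightarrow> complex \<Rightarrow> complex \<Rightarrow> nat \<Rightarrow> complex fls mat" where
  "T_nonzero p c1 a n =
     (let b = - (c1 * of_nat p); e = fps_to_fls (fps_exp b) in
      (fls_const a * root_power p (- 1) (exp_G b)) \<cdot>\<^sub>m
      binomial_mat n (- 1 / of_nat p)
        (fls_compose_power (- (e / (- 1 + e))) p \<cdot>\<^sub>m jordan_block n 0))"

end

theory Submission
  imports Defs
begin

text \<open>Let \<open>z ^ p = x\<close>. In a basis of a finite-dimensional module, the field \<open>Y(t,x)\<close> is a matrix \<open>T\<close> of Laurent
  series in \<open>z\<close>. The Jacobi identity has three consequences. For \<open>l = 0\<close>, the modes commute. For \<open>l = - 1\<close>, the field of a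
  product is the product of the fields, so \<open>Y(u,x) = u(T)\<close> for all polynomials \<open>u\<close>. For
  \<open>l = - k - 1\<close> and the vacuum vector, the field of \<open>D ^ k u\<close> is the \<open>k\<close>-th derivative of the field
  of \<open>u\<close>, as far as it is visible in the grade of \<open>u\<close>; in particular \<open>T' = f\<^sub>1(T)\<close>, where \<open>f\<^sub>1\<close> is the
  component of \<open>f\<close> of grade 1. If \<open>T\<close> is nonzero, the formulas for all \<open>k\<close> force \<open>f = f\<^sub>1\<close>
  (\<open>homogeneous_from_orbit\<close>, \<open>homogeneous_derivation\<close>). Conversely, each matrix with commuting coefficients,
  exponents congruent to \<open>- 1\<close> modulo \<open>p\<close> and \<open>T' = f(T)\<close> defines a module
  (\<open>series_field_twisted_module\<close>), since the Jacobi identity holds for commuting Laurent series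
  with the derivation \<open>d/dx\<close> (\<open>scalar_jacobi\<close>). So the theorem is about the matrix equation
  \<open>T' = f(T)\<close> (locale \<open>matrix_solution\<close>).

  All matrices derived from \<open>T\<close> live in the bicommutant of its coefficients, a commutative algebra that is closed
  under differentiation. Two simple facts make it useful. Every element is invertible on the image of an
  idempotent and nilpotent on the kernel (\<open>fitting\<close>), and idempotents are constant, since a
  commutative idempotent has derivative zero (\<open>idempotent_const\<close>). So idempotents split the module, and in an
  indecomposable module they are trivial.

  A nonzero solution is not nilpotent, as the grading shows (\<open>nilpotent_solution\<close>). On the image of the
  idempotent that belongs to \<open>T\<close>, the coefficients of \<open>T\<close> have a common eigenvector, and its
  eigenvalue is a nonzero series \<open>\<tau>\<close> with \<open>\<tau>' = f(\<tau>)\<close> (\<open>eigen_data\<close>). As the exponents of \<open>\<tau>\<close> are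
  congruent to \<open>- 1\<close> modulo \<open>p\<close>, the orders of the two sides agree only if \<open>\<tau>\<close> has a simple pole in \<open>z\<close> and the degree of \<open>f\<close> is \<open>p + 1\<close>;
  together with the grading, this leaves \<open>f(t) = c\<^sub>1 t + c t ^ (p + 1)\<close> with nonzero \<open>c\<close>
  (\<open>scalar_solution\<close>).

  For such \<open>f\<close> the equation is of Bernoulli type: the inverse \<open>p\<close>-th power \<open>S\<close> of an
  invertible solution satisfies \<open>S' = - p c\<^sub>1 S - p c\<close>. Its solutions differ by constant matrices times a scalar
  series, so \<open>S = \<alpha> (1 + \<kappa> H)\<close> with explicit series \<open>\<alpha>\<close> and \<open>\<kappa>\<close> and a constant
  matrix \<open>H\<close> (locale \<open>scalar_data\<close>). If the module is indecomposable, the common eigenvector shows that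
  \<open>H\<close> is singular, hence nilpotent; so the binomial series provides a root of \<open>S\<close>, and
  \<open>T\<close> differs from it by a matrix \<open>C\<close> with \<open>C ^ p = 1\<close>. The projection to an eigenspace of
  \<open>C\<close> is an idempotent, so \<open>C\<close> is a power of \<open>\<zeta>\<close>. Subspaces that are invariant under \<open>H\<close> are
  submodules, and therefore \<open>H\<close> is similar to a single Jordan block (\<open>nilpotent_indecomposable_jordan\<close>). Thus
  \<open>T\<close> becomes one of the \<open>p\<close> standard series after a constant change of basis
  (\<open>classification\<close>).\<close>

section \<open>The derivation of Laurent series in a root of the variable\<close>

text \<open>The derivation \<open>d/dx\<close> in the variable \<open>z\<close> with \<open>z ^ p = x\<close>: it is \<open>z ^ (1 - p) / p\<close> times \<open>d/dz\<close>.\<close>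

definition ddx :: "nat \<Rightarrow> complex fls \<Rightarrow> complex fls" where
  "ddx p F = fls_const (1 / of_nat p) * (fls_X_intpow (1 - int p) * fls_deriv F)"

lemma ddx_nth: "p > 0 \<Longrightarrow> fls_nth (ddx p F) k = of_int (k + int p) / of_nat p * fls_nth F (k + int p)"
  unfolding ddx_def fls_X_intpow_times_conv_shift(1) by (simp add: field_simps)

lemma ddx_add: "ddx p (F + G) = ddx p F + ddx p G"
  unfolding ddx_def by (simp add: fls_deriv_add algebra_simps)

lemma ddx_0 [simp]: "ddx p 0 = 0"
  unfolding ddx_def by simp

lemma ddx_const [simp]: "ddx p (fls_const c) = 0"
  unfolding ddx_def by simp

lemma ddx_mult: "ddx p (F * G) = ddx p F * G + F * ddx p G"
  unfolding ddx_def by (simp only: fls_deriv_mult algebra_simps)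

lemma ddx_diff: "ddx p (F - G) = ddx p F - ddx p G"
  unfolding ddx_def by (simp add: fls_deriv_sub algebra_simps)

lemma ddx_1 [simp]: "ddx p 1 = 0"
  unfolding ddx_def by simp

lemma ddx_sum: "ddx p (\<Sum>i\<in>A. F i) = (\<Sum>i\<in>A. ddx p (F i))"
  by (induction A rule: infinite_finite_induct) (auto simp: ddx_add)

lemma ddx_power: "ddx p (F ^ Suc k) = fls_const (of_nat (Suc k)) * F ^ k * ddx p F"
proof (induction k)
  case (Suc k)
  have "ddx p (F ^ Suc (Suc k)) = ddx p F * F ^ Suc k + F * (fls_const (of_nat (Suc k)) * F ^ k * ddx p F)"
    by (subst power_Suc) (simp only: ddx_mult Suc)
  also have "\<dots> = (1 + fls_const (of_nat (Suc k))) * F ^ Suc k * ddx p F"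
    by (simp add: algebra_simps del: of_nat_Suc)
  also have "(1 + fls_const (of_nat (Suc k))) = fls_const (of_nat (Suc (Suc k)) :: complex)"
    by (metis fls_const_1 fls_plus_const of_nat_Suc)
  finally show ?case .
qed simp

lemma ddx_eq_0_imp_const:
  assumes "p > 0" and "ddx p F = 0"
  shows "F = fls_const (fls_nth F 0)"
proof (rule fls_eqI)
  fix k
  have "fls_nth (ddx p F) (k - int p) = of_int k / of_nat p * fls_nth F k"
    using ddx_nth[OF assms(1), of F "k - int p"] by simp
  thus "fls_nth F k = fls_nth (fls_const (fls_nth F 0)) k"
    using assms by auto
qed

lemma ddx_compose_power:
  assumes "p > 0"
  shows "ddx p (fls_compose_power F p) = fls_compose_power (fls_deriv F) p"
proof (rule fls_eqI)
  fix k
  show "fls_nth (ddx p (fls_compose_power F p)) k = fls_nth (fls_compose_power (fls_deriv F) p) k"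
  proof (cases "int p dvd k")
    case True
    then obtain j where "k = int p * j" by auto
    with assms show ?thesis
      by (simp add: ddx_nth fls_nth_compose_power field_simps)
  next
    case False
    hence "\<not> int p dvd k + int p" by simp
    with False assms show ?thesis
      by (simp add: ddx_nth fls_nth_compose_power)
  qed
qed

text \<open>Differentiation lowers the order by \<open>p\<close>, since \<open>x = z ^ p\<close>; only order 0 is exceptional, because the leading term may then be a constant.\<close>

lemma subdegree_ddx:
  assumes "p > 0" "F \<noteq> 0" "fls_subdegree F \<noteq> 0"
  shows "fls_subdegree (ddx p F) = fls_subdegree F - int p"
    and "ddx p F \<noteq> 0"
proof -
  have *: "fls_nth (ddx p F) (fls_subdegree F - int p) \<noteq> 0"
    using assms by (simp add: ddx_nth)
  thus "ddx p F \<noteq> 0" by auto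
  show "fls_subdegree (ddx p F) = fls_subdegree F - int p"
    using * by (rule fls_subdegree_eqI) (use assms in \<open>simp add: ddx_nth\<close>)
qed


section \<open>Linear dependence\<close>

text \<open>Chains of vectors and powers of a matrix call for this one-sided form, which expresses a member by later
  ones. A dependency exists because a square matrix with a zero row is singular, and the first vector with a nonzero coefficient can
  be solved for.\<close>

lemma linear_dependency:
  fixes v :: "nat \<Rightarrow> nat \<Rightarrow> 'a::field"
  shows "\<exists>j\<le>m. \<exists>a. \<forall>r<m. v j r = (\<Sum>k\<in>{j<..m}. a k * v k r)"
proof -
  \<comment> \<open>the zero row is the last one\<close>
  define A where "A = mat (Suc m) (Suc m) (\<lambda>(r, k). if r < m then v k r else 0)"
  have A: "A \<in> carrier_mat (Suc m) (Suc m)" by (simp add: A_def)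
  have "A\<^sup>T *\<^sub>v unit_vec (Suc m) m = 0\<^sub>v (Suc m)"
    by (rule eq_vecI) (auto simp: A_def)
  moreover have "unit_vec (Suc m) m \<noteq> (0\<^sub>v (Suc m) :: 'a vec)" by simp
  ultimately have "det A\<^sup>T = 0"
    by (subst det_0_iff_vec_prod_zero_field[of _ "Suc m"]) (use A in \<open>auto intro!: exI[of _ "unit_vec (Suc m) m"]\<close>)
  hence "det A = 0" using det_transpose[OF A] by simp
  then obtain x where x: "x \<in> carrier_vec (Suc m)" "x \<noteq> 0\<^sub>v (Suc m)" "A *\<^sub>v x = 0\<^sub>v (Suc m)"
    using det_0_iff_vec_prod_zero_field[OF A] by auto
  have rel: "(\<Sum>k\<le>m. x $ k * v k r) = 0" if "r < m" for r
  proof -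
    have "0 = (A *\<^sub>v x) $ r" using x that by simp
    also have "\<dots> = (\<Sum>k\<le>m. x $ k * v k r)"
      using that x(1) by (auto simp: A_def scalar_prod_def atLeast0LessThan lessThan_Suc_atMost mult.commute intro!: sum.cong)
    finally show ?thesis by simp
  qed
  have "\<exists>j. j \<le> m \<and> x $ j \<noteq> 0"
  proof (rule ccontr)
    assume "\<not> ?thesis"
    hence "x = 0\<^sub>v (Suc m)" using x(1) by (intro eq_vecI) auto
    with x(2) show False by simp
  qed
  define j where "j = (LEAST j. j \<le> m \<and> x $ j \<noteq> 0)"
  have j: "j \<le> m" "x $ j \<noteq> 0"
    using LeastI_ex[OF \<open>\<exists>j. _\<close>] by (auto simp: j_def)
  have min: "x $ i = 0" if "i < j" for i
    using not_less_Least[of i "\<lambda>j. j \<le> m \<and> x $ j \<noteq> 0"] that j(1) by (auto simp: j_def)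
  show ?thesis
  proof (intro exI[of _ j] conjI exI[of _ "\<lambda>k. - x $ k / x $ j"] allI impI)
    fix r assume r: "r < m"
    have "0 = (\<Sum>k\<in>{j..m}. x $ k * v k r)"
      using rel[OF r] by (subst sum.mono_neutral_left[of "{..m}"]) (auto simp: min)
    also have "{j..m} = insert j {j<..m}" using j(1) by auto
    also have "(\<Sum>k\<in>insert j {j<..m}. x $ k * v k r) = x $ j * v j r + (\<Sum>k\<in>{j<..m}. x $ k * v k r)"
      by simp
    finally have "x $ j * v j r = - (\<Sum>k\<in>{j<..m}. x $ k * v k r)"
      by (simp add: eq_neg_iff_add_eq_0)
    hence "v j r = - (\<Sum>k\<in>{j<..m}. x $ k * v k r) / x $ j"
      using j(2) by (simp add: field_simps)
    also have "\<dots> = (\<Sum>k\<in>{j<..m}. - x $ k / x $ j * v k r)"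
      by (simp add: sum_negf sum_divide_distrib)
    finally show "v j r = (\<Sum>k\<in>{j<..m}. - x $ k / x $ j * v k r)" .
  qed (use j in auto)
qed

text \<open>A matrix of size \<open>n\<close> is a vector of length \<open>n * n\<close>, whose entry number \<open>r * n + s\<close> is the entry \<open>(r, s)\<close>.\<close>

lemma linear_dependency_mat:
  fixes X :: "nat \<Rightarrow> 'a::field mat"
  assumes "\<And>k. X k \<in> carrier_mat n n"
  shows "\<exists>j m a. j \<le> m \<and> (\<forall>r<n. \<forall>s<n. X j $$ (r, s) = (\<Sum>k\<in>{j<..m}. a k * X k $$ (r, s)))"
proof -
  obtain j a where j: "j \<le> n * n"
    and a: "\<forall>r<n * n. X j $$ (r div n, r mod n) = (\<Sum>k\<in>{j<..n * n}. a k * X k $$ (r div n, r mod n))"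
    using linear_dependency[of "n * n" "\<lambda>k r. X k $$ (r div n, r mod n)"] by auto
  have "X j $$ (r, s) = (\<Sum>k\<in>{j<..n * n}. a k * X k $$ (r, s))" if "r < n" "s < n" for r s
  proof -
    have "r * n + s < n * n"
    proof -
      have "r * n + s < Suc r * n" using that by simp
      also have "\<dots> \<le> n * n" using that by (intro mult_right_mono) auto
      finally show ?thesis .
    qed
    with a have "X j $$ ((r * n + s) div n, (r * n + s) mod n) = (\<Sum>k\<in>{j<..n * n}. a k * X k $$ ((r * n + s) div n, (r * n + s) mod n))"
      by blast
    with that show ?thesis by simp
  qed
  with j show ?thesis by blast
qed

section \<open>Matrices of Laurent series\<close>

lemma index_mult_mat_sum:
  assumes "A \<in> carrier_mat n m" "B \<in> carrier_mat m k" "i < n" "j < k"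
  shows "(A * B) $$ (i, j) = (\<Sum>l<m. A $$ (i, l) * B $$ (l, j))"
  using assms by (auto simp: scalar_prod_def atLeast0LessThan)

lemma index_mult_vec_sum:
  assumes "A \<in> carrier_mat n m" "v \<in> carrier_vec m" "i < n"
  shows "(A *\<^sub>v v) $ i = (\<Sum>l<m. A $$ (i, l) * v $ l)"
  using assms by (auto simp: scalar_prod_def atLeast0LessThan)

lemma mult_carrier_square [simp]:
  "A \<in> carrier_mat n n \<Longrightarrow> B \<in> carrier_mat n n \<Longrightarrow> A * B \<in> carrier_mat n n"
  by (rule mult_carrier_mat)

abbreviation const_mat :: "complex mat \<Rightarrow> complex fls mat" where
  "const_mat \<equiv> map_mat fls_const"

text \<open>A matrix of Laurent series is also a Laurent series of constant matrices; these are its coefficients.\<close>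

definition coeff_mat :: "complex fls mat \<Rightarrow> int \<Rightarrow> complex mat" where
  "coeff_mat X k = map_mat (\<lambda>F. fls_nth F k) X"

definition mat_ddx :: "nat \<Rightarrow> complex fls mat \<Rightarrow> complex fls mat" where
  "mat_ddx p X = map_mat (ddx p) X"

lemma coeff_mat_carrier [simp]: "coeff_mat X k \<in> carrier_mat n m \<longleftrightarrow> X \<in> carrier_mat n m"
  by (simp add: coeff_mat_def)

lemma coeff_mat_index [simp]:
  "i < dim_row X \<Longrightarrow> j < dim_col X \<Longrightarrow> coeff_mat X k $$ (i, j) = fls_nth (X $$ (i, j)) k"
  by (simp add: coeff_mat_def)

lemma coeff_mat_dim [simp]:
  "dim_row (coeff_mat X k) = dim_row X" "dim_col (coeff_mat X k) = dim_col X"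
  by (simp_all add: coeff_mat_def)

lemma mat_ddx_dim [simp]:
  "dim_row (mat_ddx p X) = dim_row X" "dim_col (mat_ddx p X) = dim_col X"
  by (simp_all add: mat_ddx_def)

lemma mat_ddx_carrier [simp]: "mat_ddx p X \<in> carrier_mat n m \<longleftrightarrow> X \<in> carrier_mat n m"
  by (simp add: mat_ddx_def)

lemma fls_nth_sum: "fls_nth (\<Sum>i\<in>A. F i) k = (\<Sum>i\<in>A. fls_nth (F i) k)"
  by (induction A rule: infinite_finite_induct) auto

lemma fls_const_sum: "fls_const (\<Sum>i\<in>A. F i) = (\<Sum>i\<in>A. fls_const (F i :: complex))"
  by (induction A rule: infinite_finite_induct) (auto simp flip: fls_plus_const)

lemma coeff_mat_const_mult:
  assumes "A \<in> carrier_mat n n" "X \<in> carrier_mat n n"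
  shows "coeff_mat (const_mat A * X) k = A * coeff_mat X k"
    and "coeff_mat (X * const_mat A) k = coeff_mat X k * A"
  by (rule eq_matI; use assms in \<open>auto simp: coeff_mat_def scalar_prod_def fls_nth_sum intro!: sum.cong\<close>)+

lemma mat_eq_coeff_matI:
  assumes "X \<in> carrier_mat n m" "Y \<in> carrier_mat n m" "\<And>k. coeff_mat X k = coeff_mat Y k"
  shows "X = Y"
proof (rule eq_matI)
  fix i j assume ij: "i < dim_row Y" "j < dim_col Y"
  show "X $$ (i, j) = Y $$ (i, j)"
  proof (rule fls_eqI)
    fix k
    show "fls_nth (X $$ (i, j)) k = fls_nth (Y $$ (i, j)) k"
      using arg_cong[OF assms(3)[of k], of "\<lambda>A. A $$ (i, j)"] assms(1,2) ij by (simp add: coeff_mat_def)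
  qed
qed (use assms in auto)

text \<open>Multiplication by a constant matrix acts on each coefficient separately.\<close>

lemma commute_const_mat_iff:
  assumes "A \<in> carrier_mat n n" "X \<in> carrier_mat n n"
  shows "X * const_mat A = const_mat A * X \<longleftrightarrow> (\<forall>k. coeff_mat X k * A = A * coeff_mat X k)"
proof
  assume "X * const_mat A = const_mat A * X"
  thus "\<forall>k. coeff_mat X k * A = A * coeff_mat X k"
    using coeff_mat_const_mult[OF assms] by metis
next
  assume "\<forall>k. coeff_mat X k * A = A * coeff_mat X k"
  thus "X * const_mat A = const_mat A * X"
    by (intro mat_eq_coeff_matI[of _ n n]) (use assms in \<open>auto simp: coeff_mat_const_mult[OF assms]\<close>)
qed

lemma const_mat_mult:
  assumes "A \<in> carrier_mat n n" "B \<in> carrier_mat n n"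
  shows "const_mat (A * B) = const_mat A * const_mat B"
  by (rule eq_matI; use assms in \<open>auto simp: scalar_prod_def fls_const_sum intro!: sum.cong\<close>)

lemma const_mat_one [simp]: "const_mat (1\<^sub>m n) = 1\<^sub>m n"
  by (rule eq_matI) auto

lemma const_mat_inj: "const_mat A = const_mat B \<Longrightarrow> A = B"
proof (rule eq_matI)
  assume eq: "const_mat A = const_mat B"
  show d: "dim_row A = dim_row B" "dim_col A = dim_col B"
    using arg_cong[OF eq, of dim_row] arg_cong[OF eq, of dim_col] by auto
  fix i j assume "i < dim_row B" "j < dim_col B"
  thus "A $$ (i, j) = B $$ (i, j)"
    using arg_cong[OF eq, of "\<lambda>X. fls_nth (X $$ (i, j)) 0"] d by simp
qed

lemma const_mat_pow:
  "A \<in> carrier_mat n n \<Longrightarrow> const_mat (A ^\<^sub>m k) = const_mat A ^\<^sub>m k"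
  by (induction k) (auto simp: const_mat_mult[of _ n])

lemma mat_ddx_mult:
  assumes "X \<in> carrier_mat n n" "Y \<in> carrier_mat n n"
  shows "mat_ddx p (X * Y) = mat_ddx p X * Y + X * mat_ddx p Y"
  by (rule eq_matI; use assms in \<open>auto simp: mat_ddx_def scalar_prod_def ddx_sum ddx_mult sum.distrib\<close>)

lemma mat_ddx_add:
  assumes "X \<in> carrier_mat n n" "Y \<in> carrier_mat n n"
  shows "mat_ddx p (X + Y) = mat_ddx p X + mat_ddx p Y"
  by (rule eq_matI; use assms in \<open>auto simp: mat_ddx_def ddx_add\<close>)

lemma mat_ddx_const [simp]: "A \<in> carrier_mat n n \<Longrightarrow> mat_ddx p (const_mat A) = 0\<^sub>m n n"
  by (rule eq_matI) (auto simp: mat_ddx_def)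

lemma mat_ddx_one [simp]: "mat_ddx p (1\<^sub>m n) = 0\<^sub>m n n"
  by (rule eq_matI) (auto simp: mat_ddx_def)

lemma mat_ddx_eq_0_imp_const:
  assumes "p > 0" "X \<in> carrier_mat n n" "mat_ddx p X = 0\<^sub>m n n"
  shows "X = const_mat (coeff_mat X 0)"
proof (rule eq_matI)
  fix i j assume ij: "i < dim_row (const_mat (coeff_mat X 0))" "j < dim_col (const_mat (coeff_mat X 0))"
  hence "ddx p (X $$ (i, j)) = mat_ddx p X $$ (i, j)" by (simp add: mat_ddx_def coeff_mat_def)
  also have "\<dots> = 0" using ij assms by (simp add: coeff_mat_def)
  finally show "X $$ (i, j) = const_mat (coeff_mat X 0) $$ (i, j)"
    using ddx_eq_0_imp_const[OF assms(1)] ij by (simp add: coeff_mat_def)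
qed (auto simp: coeff_mat_def)

lemma mult_pow_mat_commute:
  assumes "X \<in> carrier_mat n n" "Y \<in> carrier_mat n n" "X * Y = Y * X"
  shows "X ^\<^sub>m k * Y = Y * X ^\<^sub>m k"
proof (induction k)
  case (Suc k)
  have "X ^\<^sub>m Suc k * Y = X ^\<^sub>m k * (X * Y)"
    using assms by (simp add: assoc_mult_mat[of _ n n _ n _ n])
  also have "\<dots> = (X ^\<^sub>m k * Y) * X"
    using assms by (simp add: assoc_mult_mat[of _ n n _ n _ n])
  finally show ?case using assms Suc by (simp add: assoc_mult_mat[of _ n n _ n _ n])
qed (use assms in auto)

lemma pow_mat_Suc_left: "X \<in> carrier_mat n n \<Longrightarrow> X ^\<^sub>m Suc k = X * X ^\<^sub>m k"
  using mult_pow_mat_commute[of X n X k] by simp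

lemma pow_mat_add: "X \<in> carrier_mat n n \<Longrightarrow> X ^\<^sub>m (j + k) = X ^\<^sub>m j * X ^\<^sub>m k"
  by (induction k) (auto simp: assoc_mult_mat[of _ n n _ n _ n])

lemma pow_mat_mult_commute:
  assumes "X \<in> carrier_mat n n" "Y \<in> carrier_mat n n" "X * Y = Y * X"
  shows "(X * Y) ^\<^sub>m k = X ^\<^sub>m k * Y ^\<^sub>m k"
proof (induction k)
  case (Suc k)
  have "(X * Y) ^\<^sub>m Suc k = X ^\<^sub>m k * (Y ^\<^sub>m k * X) * Y"
    using assms(1,2) by (simp add: Suc assoc_mult_mat[of _ n n _ n _ n])
  also have "Y ^\<^sub>m k * X = X * Y ^\<^sub>m k"
    using mult_pow_mat_commute[of Y n X k] assms by simp
  finally show ?case using assms(1,2) by (simp add: assoc_mult_mat[of _ n n _ n _ n])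
qed (use assms in auto)

lemma pow_mat_smult:
  fixes X :: "'a::comm_semiring_1 mat"
  shows "X \<in> carrier_mat n n \<Longrightarrow> (c \<cdot>\<^sub>m X) ^\<^sub>m k = c ^ k \<cdot>\<^sub>m X ^\<^sub>m k"
  by (induction k) (auto simp: mult_smult_assoc_mat[of _ n n] mult_smult_distrib[of _ n n] ac_simps
     intro!: eq_matI)

lemma one_pow_mat [simp]: "1\<^sub>m n ^\<^sub>m k = 1\<^sub>m n"
  by (induction k) auto

section \<open>Polynomials in a matrix\<close>

lemma eval_poly_mat_carrier [simp]: "eval_poly_mat n P A \<in> carrier_mat n n"
  by (simp add: eval_poly_mat_def)

lemma eval_poly_mat_dim [simp]:
  "dim_row (eval_poly_mat n P A) = n" "dim_col (eval_poly_mat n P A) = n"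
  by (simp_all add: eval_poly_mat_def)

lemma eval_poly_mat_index:
  assumes "degree P \<le> N" "a < n" "b < n"
  shows "eval_poly_mat n P A $$ (a, b) = (\<Sum>k\<le>N. fls_const (coeff P k) * (A ^\<^sub>m k) $$ (a, b))"
proof -
  have "(\<Sum>k\<le>N. fls_const (coeff P k) * (A ^\<^sub>m k) $$ (a, b)) =
        (\<Sum>k\<le>degree P. fls_const (coeff P k) * (A ^\<^sub>m k) $$ (a, b))"
    by (rule sum.mono_neutral_right) (use assms in \<open>auto simp: coeff_eq_0\<close>)
  with assms show ?thesis by (simp add: eval_poly_mat_def)
qed

lemma eval_poly_mat_add: "eval_poly_mat n (P + Q) A = eval_poly_mat n P A + eval_poly_mat n Q A"
proof (rule eq_matI)
  fix a b assume "a < dim_row (eval_poly_mat n P A + eval_poly_mat n Q A)"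
    and "b < dim_col (eval_poly_mat n P A + eval_poly_mat n Q A)"
  hence ab: "a < n" "b < n" by auto
  let ?N = "max (degree P) (degree Q)"
  show "eval_poly_mat n (P + Q) A $$ (a, b) = (eval_poly_mat n P A + eval_poly_mat n Q A) $$ (a, b)"
    using ab eval_poly_mat_index[of "P + Q" ?N a n b A] eval_poly_mat_index[of P ?N a n b A]
      eval_poly_mat_index[of Q ?N a n b A]
    by (simp add: degree_add_le sum.distrib[symmetric] distrib_right[symmetric] fls_plus_const)
qed auto

lemma eval_poly_mat_smult:
  "eval_poly_mat n (Polynomial.smult c P) A = fls_const c \<cdot>\<^sub>m eval_poly_mat n P A"
proof (rule eq_matI)
  fix a b assume "a < dim_row (fls_const c \<cdot>\<^sub>m eval_poly_mat n P A)"
    and "b < dim_col (fls_const c \<cdot>\<^sub>m eval_poly_mat n P A)"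
  hence ab: "a < n" "b < n" by auto
  show "eval_poly_mat n (Polynomial.smult c P) A $$ (a, b) = (fls_const c \<cdot>\<^sub>m eval_poly_mat n P A) $$ (a, b)"
    using ab eval_poly_mat_index[of "Polynomial.smult c P" "degree P" a n b A]
      eval_poly_mat_index[of P "degree P" a n b A]
    by (simp add: degree_smult_le sum_distrib_left mult.assoc[symmetric])
qed auto

lemma eval_poly_mat_0 [simp]: "eval_poly_mat n 0 A = 0\<^sub>m n n"
  by (rule eq_matI) (auto simp: eval_poly_mat_def)

lemma eval_poly_mat_pCons:
  assumes A: "A \<in> carrier_mat n n"
  shows "eval_poly_mat n (pCons c P) A = fls_const c \<cdot>\<^sub>m 1\<^sub>m n + A * eval_poly_mat n P A"
proof (rule eq_matI)
  fix a b assume "a < dim_row (fls_const c \<cdot>\<^sub>m 1\<^sub>m n + A * eval_poly_mat n P A)"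
    and "b < dim_col (fls_const c \<cdot>\<^sub>m 1\<^sub>m n + A * eval_poly_mat n P A)"
  hence ab: "a < n" "b < n" using A by auto
  have "eval_poly_mat n (pCons c P) A $$ (a, b) =
      (\<Sum>k\<le>Suc (degree P). fls_const (coeff (pCons c P) k) * (A ^\<^sub>m k) $$ (a, b))"
    by (rule eval_poly_mat_index) (use ab in \<open>auto simp: degree_pCons_le\<close>)
  also have "\<dots> = fls_const c * (A ^\<^sub>m 0) $$ (a, b)
      + (\<Sum>k\<le>degree P. fls_const (coeff P k) * (A ^\<^sub>m Suc k) $$ (a, b))"
    by (subst sum.atMost_Suc_shift) (simp del: pow_mat.simps)
  also have "(\<Sum>k\<le>degree P. fls_const (coeff P k) * (A ^\<^sub>m Suc k) $$ (a, b)) =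
      (\<Sum>k\<le>degree P. \<Sum>l<n. A $$ (a, l) * (fls_const (coeff P k) * (A ^\<^sub>m k) $$ (l, b)))"
  proof (rule sum.cong[OF refl])
    fix k
    have "(A ^\<^sub>m Suc k) $$ (a, b) = (\<Sum>l<n. A $$ (a, l) * (A ^\<^sub>m k) $$ (l, b))"
      unfolding pow_mat_Suc_left[OF A]
      by (rule index_mult_mat_sum) (use A ab in auto)
    thus "fls_const (coeff P k) * (A ^\<^sub>m Suc k) $$ (a, b) =
       (\<Sum>l<n. A $$ (a, l) * (fls_const (coeff P k) * (A ^\<^sub>m k) $$ (l, b)))"
      by (simp add: sum_distrib_left mult_ac)
  qed
  also have "\<dots> = (\<Sum>l<n. A $$ (a, l) * eval_poly_mat n P A $$ (l, b))"
    by (subst sum.swap) (use ab in \<open>auto simp: eval_poly_mat_index[OF order.refl] sum_distrib_left intro!: sum.cong\<close>)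
  also have "\<dots> = (A * eval_poly_mat n P A) $$ (a, b)"
    by (rule index_mult_mat_sum[symmetric]) (use A ab in auto)
  finally show "eval_poly_mat n (pCons c P) A $$ (a, b) =
      (fls_const c \<cdot>\<^sub>m 1\<^sub>m n + A * eval_poly_mat n P A) $$ (a, b)"
    using A ab by simp
qed (use A in auto)

lemma eval_poly_mat_mult:
  assumes A: "A \<in> carrier_mat n n"
  shows "eval_poly_mat n (P * Q) A = eval_poly_mat n P A * eval_poly_mat n Q A"
proof (induction P)
  case (pCons c P)
  have "eval_poly_mat n (pCons c P * Q) A
      = fls_const c \<cdot>\<^sub>m eval_poly_mat n Q A + (0 \<cdot>\<^sub>m 1\<^sub>m n + A * (eval_poly_mat n P A * eval_poly_mat n Q A))"
    using A pCons by (simp add: mult_pCons_left eval_poly_mat_add eval_poly_mat_smult eval_poly_mat_pCons)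
  also have "\<dots> = fls_const c \<cdot>\<^sub>m eval_poly_mat n Q A + (A * eval_poly_mat n P A) * eval_poly_mat n Q A"
    using A by (auto simp: assoc_mult_mat[of _ n n _ n _ n])
  also have "\<dots> = (fls_const c \<cdot>\<^sub>m 1\<^sub>m n + A * eval_poly_mat n P A) * eval_poly_mat n Q A"
    using A by (subst add_mult_distrib_mat[of _ n n]) (auto simp: mult_smult_assoc_mat[of _ n n _ n])
  finally show ?case using A by (simp add: eval_poly_mat_pCons)
qed auto

lemma eval_poly_mat_1 [simp]: "A \<in> carrier_mat n n \<Longrightarrow> eval_poly_mat n 1 A = 1\<^sub>m n"
  by (rule eq_matI) (auto simp: eval_poly_mat_def)

lemma eval_poly_mat_tvar: "A \<in> carrier_mat n n \<Longrightarrow> eval_poly_mat n tvar A = A"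
  using eval_poly_mat_pCons[of A n 0 1]
  by (auto simp: one_pCons[symmetric] right_mult_one_mat[of A n n])

lemma eval_poly_mat_power:
  "A \<in> carrier_mat n n \<Longrightarrow> eval_poly_mat n (P ^ k) A = eval_poly_mat n P A ^\<^sub>m k"
proof (induction k)
  case (Suc k)
  have "eval_poly_mat n (P ^ Suc k) A = eval_poly_mat n P A ^\<^sub>m k * eval_poly_mat n P A"
    using Suc by (simp add: eval_poly_mat_mult power_Suc2 del: power_Suc)
  thus ?case by simp
qed simp

lemma eval_poly_mat_monom:
  assumes "A \<in> carrier_mat n n"
  shows "eval_poly_mat n (monom c k) A = fls_const c \<cdot>\<^sub>m A ^\<^sub>m k"
proof -
  have "monom c k = Polynomial.smult c (tvar ^ k)"
    by (simp add: monom_altdef)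
  thus ?thesis using assms
    by (simp add: eval_poly_mat_smult eval_poly_mat_power eval_poly_mat_tvar)
qed

lemma eval_poly_mat_commute:
  assumes A: "A \<in> carrier_mat n n" and X: "X \<in> carrier_mat n n" and c: "A * X = X * A"
  shows "eval_poly_mat n P A * X = X * eval_poly_mat n P A"
proof (induction P)
  case (pCons a P)
  have "A * eval_poly_mat n P A * X = A * (X * eval_poly_mat n P A)"
    using A X pCons by (simp add: assoc_mult_mat[of _ n n _ n _ n])
  also have "\<dots> = (A * X) * eval_poly_mat n P A"
    using A X by (simp add: assoc_mult_mat[of _ n n _ n _ n])
  also have "\<dots> = X * (A * eval_poly_mat n P A)"
    using A X by (simp add: c assoc_mult_mat[of _ n n _ n _ n])
  finally have *: "A * eval_poly_mat n P A * X = X * (A * eval_poly_mat n P A)" .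
  show ?case unfolding eval_poly_mat_pCons[OF A]
    using A X * by (simp add: add_mult_distrib_mat[of _ n n] mult_add_distrib_mat[of _ n n _ n]
        mult_smult_assoc_mat[of _ n n _ n] mult_smult_distrib[of _ n n _ n])
qed (use X in auto)

text \<open>The chain rule needs that the matrix commutes with its derivative; otherwise already the two summands of the derivative of a square do not agree.\<close>

lemma mat_ddx_eval_poly_mat:
  assumes A: "A \<in> carrier_mat n n" and c: "A * mat_ddx p A = mat_ddx p A * A"
  shows "mat_ddx p (eval_poly_mat n P A) = eval_poly_mat n (pderiv P) A * mat_ddx p A"
proof (induction P)
  case 0
  have "mat_ddx p (0\<^sub>m n n) = 0\<^sub>m n n" by (rule eq_matI) (auto simp: mat_ddx_def)
  thus ?case using A by simp
next
  case (pCons a P)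
  have cm: "eval_poly_mat n P A * mat_ddx p A = mat_ddx p A * eval_poly_mat n P A"
    using A c by (intro eval_poly_mat_commute) auto
  have "mat_ddx p (fls_const a \<cdot>\<^sub>m 1\<^sub>m n) = 0\<^sub>m n n"
    by (rule eq_matI) (auto simp: mat_ddx_def)
  hence "mat_ddx p (eval_poly_mat n (pCons a P) A) =
      mat_ddx p A * eval_poly_mat n P A + A * (eval_poly_mat n (pderiv P) A * mat_ddx p A)"
    using A pCons by (simp add: eval_poly_mat_pCons mat_ddx_add[of _ n] mat_ddx_mult[of _ n])
  also have "\<dots> = (eval_poly_mat n P A + A * eval_poly_mat n (pderiv P) A) * mat_ddx p A"
    using A cm by (simp add: add_mult_distrib_mat[of _ n n] assoc_mult_mat[of _ n n _ n _ n])
  also have "eval_poly_mat n P A + A * eval_poly_mat n (pderiv P) A = eval_poly_mat n (pderiv (pCons a P)) A"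
    using A by (auto simp: pderiv_pCons eval_poly_mat_add eval_poly_mat_pCons intro!: arg_cong2[where f = "(+)"])
  finally show ?case .
qed

section \<open>The bicommutant of commuting constant matrices\<close>

text \<open>The size is a parameter because a generic sum would need a zero matrix that fits all sizes.\<close>

definition mat_sum :: "nat \<Rightarrow> nat set \<Rightarrow> (nat \<Rightarrow> 'a::comm_ring_1) \<Rightarrow> (nat \<Rightarrow> 'a mat) \<Rightarrow> 'a mat" where
  "mat_sum n K a X = mat n n (\<lambda>(r, s). \<Sum>k\<in>K. a k * X k $$ (r, s))"

lemma mat_sum_carrier [simp]: "mat_sum n K a X \<in> carrier_mat n n"
  by (simp add: mat_sum_def)

lemma mat_sum_dim [simp]: "dim_row (mat_sum n K a X) = n" "dim_col (mat_sum n K a X) = n"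
  by (simp_all add: mat_sum_def)

lemma mat_sum_index: "r < n \<Longrightarrow> s < n \<Longrightarrow> mat_sum n K a X $$ (r, s) = (\<Sum>k\<in>K. a k * X k $$ (r, s))"
  by (simp add: mat_sum_def)

lemma mat_sum_cong: "(\<And>k. k \<in> K \<Longrightarrow> X k = Y k) \<Longrightarrow> mat_sum n K a X = mat_sum n K a Y"
  by (auto simp: mat_sum_def intro!: cong_mat sum.cong)

lemma mat_sum_mult_right:
  assumes "\<And>k. k \<in> K \<Longrightarrow> X k \<in> carrier_mat n n" "W \<in> carrier_mat n n"
  shows "mat_sum n K a X * W = mat_sum n K a (\<lambda>k. X k * W)"
proof (rule eq_matI)
  fix r s assume "r < dim_row (mat_sum n K a (\<lambda>k. X k * W))" "s < dim_col (mat_sum n K a (\<lambda>k. X k * W))"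
  hence rs: "r < n" "s < n" by auto
  have "(mat_sum n K a X * W) $$ (r, s) = (\<Sum>l<n. (\<Sum>k\<in>K. a k * X k $$ (r, l)) * W $$ (l, s))"
    by (subst index_mult_mat_sum[of _ n n _ n]) (use rs assms in \<open>auto simp: mat_sum_index\<close>)
  also have "\<dots> = (\<Sum>l<n. \<Sum>k\<in>K. a k * (X k $$ (r, l) * W $$ (l, s)))"
    by (simp add: sum_distrib_right mult.assoc)
  also have "\<dots> = (\<Sum>k\<in>K. \<Sum>l<n. a k * (X k $$ (r, l) * W $$ (l, s)))"
    by (rule sum.swap)
  also have "\<dots> = (\<Sum>k\<in>K. a k * (X k * W) $$ (r, s))"
  proof (rule sum.cong[OF refl])
    fix k assume "k \<in> K"
    thus "(\<Sum>l<n. a k * (X k $$ (r, l) * W $$ (l, s))) = a k * (X k * W) $$ (r, s)"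
      by (subst index_mult_mat_sum[of _ n n _ n]) (use rs assms in \<open>auto simp: sum_distrib_left\<close>)
  qed
  finally show "(mat_sum n K a X * W) $$ (r, s) = mat_sum n K a (\<lambda>k. X k * W) $$ (r, s)"
    using rs by (simp add: mat_sum_index)
qed (use assms in auto)

lemma mat_sum_mult_left:
  assumes "\<And>k. k \<in> K \<Longrightarrow> X k \<in> carrier_mat n n" "W \<in> carrier_mat n n"
  shows "W * mat_sum n K a X = mat_sum n K a (\<lambda>k. W * X k)"
proof (rule eq_matI)
  fix r s assume "r < dim_row (mat_sum n K a (\<lambda>k. W * X k))" "s < dim_col (mat_sum n K a (\<lambda>k. W * X k))"
  hence rs: "r < n" "s < n" by auto
  have "(W * mat_sum n K a X) $$ (r, s) = (\<Sum>l<n. W $$ (r, l) * (\<Sum>k\<in>K. a k * X k $$ (l, s)))"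
    by (subst index_mult_mat_sum[of _ n n _ n]) (use rs assms in \<open>auto simp: mat_sum_index\<close>)
  also have "\<dots> = (\<Sum>l<n. \<Sum>k\<in>K. a k * (W $$ (r, l) * X k $$ (l, s)))"
    by (simp add: sum_distrib_left mult_ac)
  also have "\<dots> = (\<Sum>k\<in>K. \<Sum>l<n. a k * (W $$ (r, l) * X k $$ (l, s)))"
    by (rule sum.swap)
  also have "\<dots> = (\<Sum>k\<in>K. a k * (W * X k) $$ (r, s))"
  proof (rule sum.cong[OF refl])
    fix k assume "k \<in> K"
    thus "(\<Sum>l<n. a k * (W $$ (r, l) * X k $$ (l, s))) = a k * (W * X k) $$ (r, s)"
      by (subst index_mult_mat_sum[of _ n n _ n]) (use rs assms in \<open>auto simp: sum_distrib_left\<close>)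
  qed
  finally show "(W * mat_sum n K a X) $$ (r, s) = mat_sum n K a (\<lambda>k. W * X k) $$ (r, s)"
    using rs by (simp add: mat_sum_index)
qed (use assms in auto)

lemma fls_times_nth_bounds:
  fixes f g :: "complex fls"
  assumes "\<And>k. k < N \<Longrightarrow> fls_nth f k = 0" "\<And>k. k < N' \<Longrightarrow> fls_nth g k = 0"
  shows "fls_nth (f * g) m = (\<Sum>k=N..m-N'. fls_nth f k * fls_nth g (m - k))"
proof (cases "f = 0 \<or> g = 0")
  case False
  hence "N \<le> fls_subdegree f" "N' \<le> fls_subdegree g"
    using assms by (auto intro!: fls_subdegree_geI)
  thus ?thesis unfolding fls_times_nth(2)
    by (intro sum.mono_neutral_left) auto
qed auto

lemma coeff_mat_bounded_below:
  assumes X: "X \<in> carrier_mat n n"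
  obtains N where "\<forall>k<N. coeff_mat X k = 0\<^sub>m n n"
proof
  let ?S = "insert 0 ((\<lambda>(r, s). fls_subdegree (X $$ (r, s))) ` ({..<n} \<times> {..<n}))"
  show "\<forall>k<Min ?S. coeff_mat X k = 0\<^sub>m n n"
  proof (intro allI impI eq_matI)
    fix k i j assume k: "k < Min ?S" and "i < dim_row (0\<^sub>m n n :: complex mat)" "j < dim_col (0\<^sub>m n n :: complex mat)"
    hence ij: "i < n" "j < n" by auto
    have "Min ?S \<le> fls_subdegree (X $$ (i, j))"
      by (rule Min_le) (use ij in \<open>auto intro!: image_eqI[where x = "(i, j)"]\<close>)
    hence "fls_nth (X $$ (i, j)) k = 0" by (intro fls_eq0_below_subdegree less_le_trans[OF k])
    with ij X show "coeff_mat X k $$ (i, j) = 0\<^sub>m n n $$ (i, j)" by simp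
  qed (use X in \<open>auto simp: coeff_mat_def\<close>)
qed

lemma coeff_mat_mult_index:
  assumes X: "X \<in> carrier_mat n n" and Y: "Y \<in> carrier_mat n n"
    and N: "\<forall>k<N. coeff_mat X k = 0\<^sub>m n n" and N': "\<forall>k<N'. coeff_mat Y k = 0\<^sub>m n n"
    and ij: "i < n" "j < n"
  shows "coeff_mat (X * Y) m $$ (i, j) = (\<Sum>k=N..m-N'. (coeff_mat X k * coeff_mat Y (m - k)) $$ (i, j))"
proof -
  have X0: "fls_nth (X $$ (i, l)) k = 0" if "k < N" "l < n" for k l
    using arg_cong[OF N[rule_format, OF that(1)], of "\<lambda>M. M $$ (i, l)"] X ij that by simp
  have Y0: "fls_nth (Y $$ (l, j)) k = 0" if "k < N'" "l < n" for k l
    using arg_cong[OF N'[rule_format, OF that(1)], of "\<lambda>M. M $$ (l, j)"] Y ij that by simp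
  have "coeff_mat (X * Y) m $$ (i, j) = (\<Sum>l<n. fls_nth (X $$ (i, l) * Y $$ (l, j)) m)"
    using X Y ij by (subst coeff_mat_index) (auto simp: index_mult_mat_sum[of X n n Y n] fls_nth_sum simp del: index_mult_mat(1))
  also have "\<dots> = (\<Sum>l<n. \<Sum>k=N..m-N'. fls_nth (X $$ (i, l)) k * fls_nth (Y $$ (l, j)) (m - k))"
    by (rule sum.cong[OF refl], rule fls_times_nth_bounds) (use X0 Y0 in auto)
  also have "\<dots> = (\<Sum>k=N..m-N'. \<Sum>l<n. fls_nth (X $$ (i, l)) k * fls_nth (Y $$ (l, j)) (m - k))"
    by (rule sum.swap)
  also have "\<dots> = (\<Sum>k=N..m-N'. (coeff_mat X k * coeff_mat Y (m - k)) $$ (i, j))"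
    by (rule sum.cong[OF refl], subst index_mult_mat_sum[of _ n n _ n]) (use X Y ij in auto)
  finally show ?thesis .
qed

text \<open>Let \<open>G\<close> be a set of commuting constant matrices. Its commutant \<open>Z\<close> consists of the matrices of Laurent
  series that commute with \<open>G\<close>, and its bicommutant \<open>D\<close> of those that commute with \<open>Z\<close>. As \<open>G\<close> is commutative, \<open>D\<close> is a
  commutative algebra, and it contains everything that is built from \<open>G\<close> by polynomials, differentiation, Fitting projections and
  infinite series.\<close>

locale commuting_matrices =
  fixes n p :: nat and G :: "complex mat set"
  assumes p_pos: "p > 0"
    and G_carrier: "A \<in> G \<Longrightarrow> A \<in> carrier_mat n n"
    and G_commute: "A \<in> G \<Longrightarrow> B \<in> G \<Longrightarrow> A * B = B * A"
begin

definition Z :: "complex fls mat set" where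
  "Z = {X \<in> carrier_mat n n. \<forall>A\<in>G. X * const_mat A = const_mat A * X}"

definition D :: "complex fls mat set" where
  "D = {X \<in> carrier_mat n n. \<forall>W\<in>Z. X * W = W * X}"

lemma Z_carrier: "X \<in> Z \<Longrightarrow> X \<in> carrier_mat n n"
  by (simp add: Z_def)

lemma D_I:
  assumes "X \<in> carrier_mat n n" "\<And>W. W \<in> carrier_mat n n \<Longrightarrow> W \<in> Z \<Longrightarrow> X * W = W * X"
  shows "X \<in> D"
  unfolding D_def using assms Z_carrier by blast

lemma D_carrier [simp]: "X \<in> D \<Longrightarrow> X \<in> carrier_mat n n"
  by (simp add: D_def)

lemma D_dim [simp]: "X \<in> D \<Longrightarrow> dim_row X = n" "X \<in> D \<Longrightarrow> dim_col X = n"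
  using D_carrier by blast+

lemma D_Z_commute: "X \<in> D \<Longrightarrow> W \<in> Z \<Longrightarrow> X * W = W * X"
  unfolding D_def by blast

lemma const_mat_in_Z_iff:
  "B \<in> carrier_mat n n \<Longrightarrow> const_mat B \<in> Z \<longleftrightarrow> (\<forall>A\<in>G. B * A = A * B)"
  using const_mat_mult[of B n] const_mat_mult[of _ n B] const_mat_inj[of "B * _" "_ * B"]
  unfolding Z_def by (simp add: G_carrier) (metis G_carrier)

lemma G_in_Z: "A \<in> G \<Longrightarrow> const_mat A \<in> Z"
  by (simp add: const_mat_in_Z_iff G_carrier G_commute)

lemma G_in_D: "A \<in> G \<Longrightarrow> const_mat A \<in> D"
  unfolding D_def Z_def using G_carrier by auto

lemma D_sub_Z: "X \<in> D \<Longrightarrow> X \<in> Z"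
  using D_Z_commute[OF _ G_in_Z] by (auto simp: Z_def)

lemma D_commute: "X \<in> D \<Longrightarrow> Y \<in> D \<Longrightarrow> X * Y = Y * X"
  by (simp add: D_Z_commute D_sub_Z)

lemma D_assoc: "X \<in> D \<Longrightarrow> Y \<in> D \<Longrightarrow> W \<in> D \<Longrightarrow> X * Y * W = X * (Y * W)"
  by (simp add: assoc_mult_mat[of _ n n _ n _ n])

lemma D_left_commute: "X \<in> D \<Longrightarrow> Y \<in> D \<Longrightarrow> W \<in> D \<Longrightarrow> X * (Y * W) = Y * (X * W)"
  using D_assoc[of X Y W] D_assoc[of Y X W] D_commute[of X Y] by simp

lemmas D_ac = D_assoc D_commute D_left_commute

lemma D_mult [simp]: "X \<in> D \<Longrightarrow> Y \<in> D \<Longrightarrow> X * Y \<in> D"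
proof -
  assume X: "X \<in> D" and Y: "Y \<in> D"
  have "X * Y * W = W * (X * Y)" if W: "W \<in> Z" for W
  proof -
    have "X * Y * W = X * (W * Y)"
      using X Y Z_carrier[OF W] by (simp add: assoc_mult_mat[of _ n n _ n _ n] D_Z_commute[OF Y W])
    also have "\<dots> = W * X * Y"
      using X Y Z_carrier[OF W] by (simp add: assoc_mult_mat[of _ n n _ n _ n, symmetric] D_Z_commute[OF X W])
    finally show ?thesis
      using X Y Z_carrier[OF W] by (simp add: assoc_mult_mat[of _ n n _ n _ n])
  qed
  with X Y show "X * Y \<in> D" by (intro D_I) auto
qed

lemma D_one [simp]: "1\<^sub>m n \<in> D"
  by (rule D_I) auto

lemma D_zero [simp]: "0\<^sub>m n n \<in> D"
  by (rule D_I) auto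

lemma D_add [simp]: "X \<in> D \<Longrightarrow> Y \<in> D \<Longrightarrow> X + Y \<in> D"
  by (rule D_I)
     (simp_all add: D_Z_commute add_mult_distrib_mat[of _ n n _ _ n] mult_add_distrib_mat[of _ n n _ n])

lemma D_minus [simp]: "X \<in> D \<Longrightarrow> Y \<in> D \<Longrightarrow> X - Y \<in> D"
  by (rule D_I)
     (simp_all add: D_Z_commute minus_mult_distrib_mat[of _ n n _ _ n] mult_minus_distrib_mat[of _ n n _ n]
        minus_carrier_mat)

lemma D_smult [simp]: "X \<in> D \<Longrightarrow> F \<cdot>\<^sub>m X \<in> D"
  by (rule D_I) (simp_all add: D_Z_commute mult_smult_assoc_mat[of _ n n _ n] mult_smult_distrib[of _ n n _ n])

lemma D_pow [simp]: "X \<in> D \<Longrightarrow> X ^\<^sub>m k \<in> D"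
  by (induction k) auto

lemma D_mat_sum: "(\<And>k. k \<in> K \<Longrightarrow> X k \<in> D) \<Longrightarrow> mat_sum n K a X \<in> D"
  by (rule D_I) (simp_all add: D_Z_commute mat_sum_mult_left mat_sum_mult_right cong: mat_sum_cong)

lemma D_eval_poly_mat [simp]: "X \<in> D \<Longrightarrow> eval_poly_mat n P X \<in> D"
  by (induction P) (auto simp: eval_poly_mat_pCons)

lemma Z_mat_ddx: "X \<in> Z \<Longrightarrow> mat_ddx p X \<in> Z"
proof -
  assume X: "X \<in> Z"
  have "mat_ddx p X * const_mat A = const_mat A * mat_ddx p X" if A: "A \<in> G" for A
  proof -
    have c: "A \<in> carrier_mat n n" "X \<in> carrier_mat n n" using A X by (auto simp: G_carrier Z_def)
    have "X * const_mat A = const_mat A * X" using X A unfolding Z_def by blast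
    hence "mat_ddx p (X * const_mat A) = mat_ddx p (const_mat A * X)" by (rule arg_cong)
    thus ?thesis using c by (simp add: mat_ddx_mult[of _ n])
  qed
  with X show ?thesis unfolding Z_def by auto
qed

text \<open>Differentiate \<open>X * W = W * X\<close> and cancel the terms with the derivative of \<open>W\<close>, which lies in \<open>Z\<close>, too.\<close>

lemma D_mat_ddx [simp]: "X \<in> D \<Longrightarrow> mat_ddx p X \<in> D"
proof -
  assume X: "X \<in> D"
  have "mat_ddx p X * W = W * mat_ddx p X" if W: "W \<in> Z" for W
  proof -
    have [simp]: "X \<in> carrier_mat n n" "W \<in> carrier_mat n n" using X Z_carrier[OF W] by auto
    have "mat_ddx p (X * W) = mat_ddx p (W * X)"
      using X W by (simp add: D_Z_commute)
    hence "mat_ddx p X * W + X * mat_ddx p W = mat_ddx p W * X + W * mat_ddx p X"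
      by (simp add: mat_ddx_mult[of _ n])
    also have "mat_ddx p W * X = X * mat_ddx p W"
      using D_Z_commute[OF X Z_mat_ddx[OF W]] by simp
    finally have eq: "mat_ddx p X * W + X * mat_ddx p W = X * mat_ddx p W + W * mat_ddx p X" .
    show ?thesis
    proof (rule eq_matI)
      fix i j assume "i < dim_row (W * mat_ddx p X)" "j < dim_col (W * mat_ddx p X)"
      hence ij: "i < n" "j < n" using carrier_matD[of X n n] carrier_matD[of W n n] by auto
      have "(A + B) $$ (i, j) = A $$ (i, j) + B $$ (i, j)" if "B \<in> carrier_mat n n" for A B :: "complex fls mat"
        using that ij by simp
      with arg_cong[OF eq, of "\<lambda>M. M $$ (i, j)"]
      show "(mat_ddx p X * W) $$ (i, j) = (W * mat_ddx p X) $$ (i, j)"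
        by (simp del: index_mult_mat index_add_mat)
    qed (use carrier_matD[of X n n] carrier_matD[of W n n] in auto)
  qed
  with X show ?thesis by (intro D_I) auto
qed

lemma coeff_mat_in_Z: "W \<in> Z \<Longrightarrow> const_mat (coeff_mat W k) \<in> Z"
  using commute_const_mat_iff[of _ n W]
  by (subst const_mat_in_Z_iff) (auto simp: Z_def G_carrier)

text \<open>If \<open>X\<close> commutes with \<open>W\<close> in \<open>Z\<close>, it commutes with the coefficients of \<open>W\<close>, since these are in \<open>Z\<close>
  as well; comparing coefficients again shows that the coefficients of \<open>X\<close> commute with those of \<open>W\<close>.\<close>

lemma coeff_mat_in_D:
  assumes X: "X \<in> D"
  shows "const_mat (coeff_mat X k) \<in> D"
proof -
  have "const_mat (coeff_mat X k) * W = W * const_mat (coeff_mat X k)" if W: "W \<in> Z" for W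
  proof -
    have c: "X \<in> carrier_mat n n" "W \<in> carrier_mat n n" using X Z_carrier[OF W] by auto
    have "coeff_mat X k * coeff_mat W j = coeff_mat W j * coeff_mat X k" for j
      using D_Z_commute[OF X coeff_mat_in_Z[OF W, of j]] c commute_const_mat_iff[of "coeff_mat W j" n X] by simp
    hence "W * const_mat (coeff_mat X k) = const_mat (coeff_mat X k) * W"
      using c by (subst commute_const_mat_iff) auto
    thus ?thesis ..
  qed
  with X show ?thesis by (intro D_I) auto
qed

lemma coeff_mat_commute:
  assumes "X \<in> D" "Y \<in> D"
  shows "coeff_mat X j * coeff_mat Y k = coeff_mat Y k * coeff_mat X j"
  using D_commute[OF coeff_mat_in_D[OF assms(1), of j] coeff_mat_in_D[OF assms(2), of k]] assms
  by (simp add: const_mat_inj flip: const_mat_mult[of _ n])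

text \<open>Being an infinite combination of its coefficients, \<open>X\<close> need not lie in the algebra
  that they generate. But each coefficient of \<open>X * W\<close> is a finite sum of products of coefficients, which is
  why the bicommutant contains \<open>X\<close>.\<close>

lemma D_of_coeff_mat:
  assumes X: "X \<in> carrier_mat n n" and co: "\<And>k. coeff_mat X k \<in> G"
  shows "X \<in> D"
proof (rule D_I[OF X])
  fix W assume c: "W \<in> carrier_mat n n" and W: "W \<in> Z"
  have cm: "coeff_mat X k * coeff_mat W l = coeff_mat W l * coeff_mat X k" for k l
  proof -
    have "W * const_mat (coeff_mat X k) = const_mat (coeff_mat X k) * W"
      using W co unfolding Z_def by blast
    thus ?thesis using c X commute_const_mat_iff[of "coeff_mat X k" n W] by simp
  qed
  obtain N where N: "\<forall>k<N. coeff_mat X k = 0\<^sub>m n n" using coeff_mat_bounded_below[OF X] .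
  obtain N' where N': "\<forall>k<N'. coeff_mat W k = 0\<^sub>m n n" using coeff_mat_bounded_below[OF c] .
  show "X * W = W * X"
  proof (rule mat_eq_coeff_matI[of _ n n])
    fix m
    show "coeff_mat (X * W) m = coeff_mat (W * X) m"
    proof (rule eq_matI)
      fix i j assume "i < dim_row (coeff_mat (W * X) m)" "j < dim_col (coeff_mat (W * X) m)"
      hence ij: "i < n" "j < n" using c X by (auto simp: coeff_mat_def)
      have "coeff_mat (X * W) m $$ (i, j) = (\<Sum>k=N..m-N'. (coeff_mat X k * coeff_mat W (m - k)) $$ (i, j))"
        by (rule coeff_mat_mult_index[OF X c N N' ij])
      also have "\<dots> = (\<Sum>k=N'..m-N. (coeff_mat W k * coeff_mat X (m - k)) $$ (i, j))"
        by (rule sum.reindex_bij_witness[of _ "\<lambda>k. m - k" "\<lambda>k. m - k"]) (auto simp: cm simp del: index_mult_mat)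
      also have "\<dots> = coeff_mat (W * X) m $$ (i, j)"
        by (rule coeff_mat_mult_index[OF c X N' N ij, symmetric])
      finally show "coeff_mat (X * W) m $$ (i, j) = coeff_mat (W * X) m $$ (i, j)" .
    qed (use X c in auto)
  qed (use X c in auto)
qed

end

section \<open>Idempotents and eigenvectors in the bicommutant\<close>

lemma mult_vec_carrier_square [simp]:
  "A \<in> carrier_mat n n \<Longrightarrow> v \<in> carrier_vec n \<Longrightarrow> A *\<^sub>v v \<in> carrier_vec n"
  by (rule mult_mat_vec_carrier)

lemma mult_mat_zero_vec [simp]:
  "A \<in> carrier_mat n n \<Longrightarrow> A *\<^sub>v 0\<^sub>v n = (0\<^sub>v n :: 'a :: semiring_0 vec)"
  by (auto intro!: eq_vecI)

context commuting_matrices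
begin

text \<open>Fitting's lemma in the bicommutant. The powers of \<open>X\<close> are linearly dependent, so
  \<open>X ^ j = X ^ (j + 1) * Q\<close> with a polynomial \<open>Q\<close> in \<open>X\<close>; iterating this shows that
  \<open>e = X ^ k * Q ^ k\<close> is idempotent. It projects to the part of the space on which \<open>X\<close> is
  invertible: \<open>X\<close> is nilpotent if \<open>e = 0\<close>, and invertible if \<open>e = 1\<close>.\<close>

lemma fitting:
  assumes X: "X \<in> D"
  obtains k e Y where "k \<ge> 1" "Y \<in> D" "e \<in> D" "e * e = e" "e = X ^\<^sub>m k * Y" "X ^\<^sub>m k * e = X ^\<^sub>m k"
proof -
  have Xc: "X \<in> carrier_mat n n" using X by simp
  obtain j m a where jm: "j \<le> m"
    and dep: "\<forall>r<n. \<forall>s<n. (X ^\<^sub>m j) $$ (r, s) = (\<Sum>k\<in>{j<..m}. a k * (X ^\<^sub>m k) $$ (r, s))"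
    using linear_dependency_mat[of "\<lambda>k. X ^\<^sub>m k" n] X by auto
  define Q where "Q = mat_sum n {j<..m} a (\<lambda>k. X ^\<^sub>m (k - Suc j))"
  have Q: "Q \<in> D" unfolding Q_def by (rule D_mat_sum) (use X in auto)
  have "X ^\<^sub>m Suc j * Q = mat_sum n {j<..m} a (\<lambda>k. X ^\<^sub>m Suc j * X ^\<^sub>m (k - Suc j))"
    unfolding Q_def by (rule mat_sum_mult_left) (use Xc in auto)
  also have "\<dots> = mat_sum n {j<..m} a (\<lambda>k. X ^\<^sub>m k)"
    by (rule mat_sum_cong) (use Xc in \<open>simp add: pow_mat_add[symmetric] del: pow_mat.simps\<close>)
  also have "\<dots> = X ^\<^sub>m j"
    by (rule eq_matI) (use dep carrier_matD[OF pow_carrier_mat[OF Xc, of j]] in \<open>auto simp: mat_sum_index simp del: pow_mat_dim\<close>)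
  finally have step: "X ^\<^sub>m Suc j * Q = X ^\<^sub>m j" .
  \<comment> \<open>the exponent is raised by one, to make it positive\<close>
  define k where "k = Suc j"
  have XD: "X ^\<^sub>m i \<in> D" and QD: "Q ^\<^sub>m i \<in> D" for i using X Q by auto
  have k1: "X ^\<^sub>m k = X ^\<^sub>m Suc k * Q"
  proof -
    have "X ^\<^sub>m Suc k * Q = (X * X ^\<^sub>m k) * Q" by (simp only: pow_mat_Suc_left[OF Xc])
    also have "\<dots> = X * (X ^\<^sub>m k * Q)" by (rule D_assoc[OF X XD Q])
    also have "\<dots> = X * X ^\<^sub>m j" by (simp only: k_def step)
    also have "\<dots> = X ^\<^sub>m k" by (simp only: k_def pow_mat_Suc_left[OF Xc])
    finally show ?thesis ..
  qed
  have iter: "X ^\<^sub>m k = X ^\<^sub>m (k + i) * Q ^\<^sub>m i" for i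
  proof (induction i)
    case (Suc i)
    have "X ^\<^sub>m (k + i) = X ^\<^sub>m i * X ^\<^sub>m k" using Xc by (simp add: pow_mat_add[symmetric] add.commute)
    also have "\<dots> = X ^\<^sub>m i * (X ^\<^sub>m Suc k * Q)" by (subst k1) simp
    also have "\<dots> = X ^\<^sub>m (k + Suc i) * Q"
      using Xc XD Q by (simp add: D_assoc[symmetric] pow_mat_add[symmetric] add.commute del: pow_mat.simps)
    finally have "X ^\<^sub>m (k + i) * Q ^\<^sub>m i = X ^\<^sub>m (k + Suc i) * Q * Q ^\<^sub>m i"
      by (rule arg_cong)
    also have "\<dots> = X ^\<^sub>m (k + Suc i) * (Q * Q ^\<^sub>m i)"
      using XD Q QD by (intro D_assoc)
    also have "Q * Q ^\<^sub>m i = Q ^\<^sub>m Suc i" by (rule pow_mat_Suc_left[OF D_carrier[OF Q], symmetric])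
    finally show ?case using Suc by simp
  qed (use right_mult_one_mat[of "X ^\<^sub>m k" n n] Q XD[of k] in auto)
  define e where "e = X ^\<^sub>m k * Q ^\<^sub>m k"
  have eD: "e \<in> D" by (simp add: e_def XD QD)
  have Xe: "X ^\<^sub>m k * e = X ^\<^sub>m k"
    using iter[of k] Xc XD QD by (simp add: e_def D_assoc[symmetric] pow_mat_add)
  have "e * e = e * X ^\<^sub>m k * Q ^\<^sub>m k"
    using D_assoc[OF eD XD[of k] QD[of k]] by (simp only: e_def)
  also have "\<dots> = X ^\<^sub>m k * e * Q ^\<^sub>m k" by (simp only: D_commute[OF eD XD])
  also have "\<dots> = e" by (simp only: Xe) (simp only: e_def)
  finally have "e * e = e" .
  from that[OF _ QD eD this e_def Xe] show ?thesis by (simp add: k_def)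
qed

text \<open>An idempotent has no derivative: from \<open>e * e = e\<close> and commutativity \<open>e' = 2 e e'\<close>, multiplication
  by \<open>e\<close> turns this into \<open>e e' = 2 e e'\<close>, so both sides vanish. Therefore idempotents of the
  bicommutant are constant matrices, which can split a module.\<close>

lemma idempotent_const:
  assumes e: "e \<in> D" and idem: "e * e = e"
  shows "e = const_mat (coeff_mat e 0)"
proof (rule mat_ddx_eq_0_imp_const[OF p_pos])
  let ?d = "mat_ddx p e"
  have d: "?d \<in> D" using e by simp
  have twice: "?d = e * ?d + e * ?d"
    using mat_ddx_mult[of e n e p] e d D_commute[OF d e] by (simp add: idem)
  have "e * ?d = e * (e * ?d + e * ?d)" using twice by simp
  also have "\<dots> = (e * e) * ?d + (e * e) * ?d"
    using e d by (simp add: mult_add_distrib_mat[of _ n n _ n] D_assoc)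
  finally have eq: "e * ?d = e * ?d + e * ?d" by (simp add: idem)
  have "e * ?d = 0\<^sub>m n n"
  proof (rule eq_matI)
    fix i j assume "i < dim_row (0\<^sub>m n n :: complex fls mat)" "j < dim_col (0\<^sub>m n n :: complex fls mat)"
    thus "(e * ?d) $$ (i, j) = 0\<^sub>m n n $$ (i, j)"
      using arg_cong[OF eq, of "\<lambda>M. M $$ (i, j)"] e by (simp del: index_mult_mat)
  qed (use e in auto)
  thus "?d = 0\<^sub>m n n" using twice by simp
qed (use e in auto)

end

definition eval_poly_vec :: "nat \<Rightarrow> complex mat \<Rightarrow> complex vec \<Rightarrow> complex poly \<Rightarrow> complex vec" where
  "eval_poly_vec n A v q = vec n (\<lambda>r. \<Sum>i\<le>degree q. coeff q i * (A ^\<^sub>m i *\<^sub>v v) $ r)"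

lemma eval_poly_vec_carrier [simp]: "eval_poly_vec n A v q \<in> carrier_vec n"
  by (simp add: eval_poly_vec_def)

lemma eval_poly_vec_dim [simp]: "dim_vec (eval_poly_vec n A v q) = n"
  by (simp add: eval_poly_vec_def)

lemma eval_poly_vec_index:
  "degree q \<le> N \<Longrightarrow> r < n \<Longrightarrow> eval_poly_vec n A v q $ r = (\<Sum>i\<le>N. coeff q i * (A ^\<^sub>m i *\<^sub>v v) $ r)"
  unfolding eval_poly_vec_def
  by (simp del: index_mult_mat_vec, rule sum.mono_neutral_left) (auto simp: coeff_eq_0)

lemma eval_poly_vec_eigen:
  assumes A: "A \<in> carrier_mat n n" and B: "B \<in> carrier_mat n n" and v: "v \<in> carrier_vec n"
    and comm: "A * B = B * A" and eig: "B *\<^sub>v v = c \<cdot>\<^sub>v v"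
  shows "B *\<^sub>v eval_poly_vec n A v q = c \<cdot>\<^sub>v eval_poly_vec n A v q"
proof (rule eq_vecI)
  fix r assume "r < dim_vec (c \<cdot>\<^sub>v eval_poly_vec n A v q)"
  hence r: "r < n" by (simp add: eval_poly_vec_def)
  have pw: "(\<Sum>l<n. B $$ (r, l) * (A ^\<^sub>m i *\<^sub>v v) $ l) = c * (A ^\<^sub>m i *\<^sub>v v) $ r" for i
  proof -
    have "(\<Sum>l<n. B $$ (r, l) * (A ^\<^sub>m i *\<^sub>v v) $ l) = (B *\<^sub>v (A ^\<^sub>m i *\<^sub>v v)) $ r"
      by (subst index_mult_vec_sum[of B n n]) (use A B v r in auto)
    also have "B *\<^sub>v (A ^\<^sub>m i *\<^sub>v v) = (A ^\<^sub>m i * B) *\<^sub>v v"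
      using A B v mult_pow_mat_commute[OF A B comm] by (simp add: assoc_mult_mat_vec[of _ n n _ n, symmetric])
    also have "\<dots> = A ^\<^sub>m i *\<^sub>v (c \<cdot>\<^sub>v v)"
      using A B v eig by (simp add: assoc_mult_mat_vec[of _ n n _ n])
    also have "\<dots> = c \<cdot>\<^sub>v (A ^\<^sub>m i *\<^sub>v v)"
      by (rule mult_mat_vec[of _ n n]) (use A v in auto)
    finally show ?thesis using r A by simp
  qed
  have "(B *\<^sub>v eval_poly_vec n A v q) $ r = (\<Sum>l<n. B $$ (r, l) * eval_poly_vec n A v q $ l)"
    by (rule index_mult_vec_sum[OF B _ r]) simp
  also have "\<dots> = (\<Sum>l<n. \<Sum>i\<le>degree q. coeff q i * (B $$ (r, l) * (A ^\<^sub>m i *\<^sub>v v) $ l))"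
    by (simp add: eval_poly_vec_def sum_distrib_left mult_ac del: index_mult_mat_vec)
  also have "\<dots> = (\<Sum>i\<le>degree q. coeff q i * (\<Sum>l<n. B $$ (r, l) * (A ^\<^sub>m i *\<^sub>v v) $ l))"
    by (subst sum.swap) (simp add: sum_distrib_left)
  also have "\<dots> = (c \<cdot>\<^sub>v eval_poly_vec n A v q) $ r"
    using r unfolding pw by (simp add: eval_poly_vec_def sum_distrib_left mult_ac del: index_mult_mat_vec)
  finally show "(B *\<^sub>v eval_poly_vec n A v q) $ r = (c \<cdot>\<^sub>v eval_poly_vec n A v q) $ r" .
qed (use B in \<open>auto simp: eval_poly_vec_def\<close>)

lemma eval_poly_vec_linear_factor:
  assumes A: "A \<in> carrier_mat n n" and v: "v \<in> carrier_vec n"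
  shows "eval_poly_vec n A v ([:-c, 1:] * q) = A *\<^sub>v eval_poly_vec n A v q - c \<cdot>\<^sub>v eval_poly_vec n A v q"
proof (rule eq_vecI)
  fix r assume "r < dim_vec (A *\<^sub>v eval_poly_vec n A v q - c \<cdot>\<^sub>v eval_poly_vec n A v q)"
  hence r: "r < n" by (simp add: eval_poly_vec_def)
  let ?N = "Suc (degree q)"
  have "[:-c, 1:] * q = Polynomial.smult (-c) q + pCons 0 q" by simp
  have deg: "degree ([:-c, 1:] * q) \<le> ?N"
    by (rule order.trans[OF degree_mult_le]) auto
  have "eval_poly_vec n A v ([:-c, 1:] * q) $ r = (\<Sum>i\<le>?N. coeff ([:-c, 1:] * q) i * (A ^\<^sub>m i *\<^sub>v v) $ r)"
    by (rule eval_poly_vec_index[OF deg r])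
  also have "\<dots> = (\<Sum>i\<le>?N. coeff (pCons 0 q) i * (A ^\<^sub>m i *\<^sub>v v) $ r) - c * (\<Sum>i\<le>?N. coeff q i * (A ^\<^sub>m i *\<^sub>v v) $ r)"
    by (simp add: sum_subtractf algebra_simps sum_distrib_left del: sum.atMost_Suc index_mult_mat_vec)
  also have "(\<Sum>i\<le>?N. coeff q i * (A ^\<^sub>m i *\<^sub>v v) $ r) = eval_poly_vec n A v q $ r"
    by (rule eval_poly_vec_index[symmetric]) (use r in auto)
  also have "(\<Sum>i\<le>?N. coeff (pCons 0 q) i * (A ^\<^sub>m i *\<^sub>v v) $ r) = (\<Sum>i\<le>degree q. coeff q i * (A ^\<^sub>m Suc i *\<^sub>v v) $ r)"
    by (subst sum.atMost_Suc_shift) (simp del: index_mult_mat_vec pow_mat.simps(2))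
  also have "\<dots> = (\<Sum>i\<le>degree q. \<Sum>l<n. A $$ (r, l) * (coeff q i * (A ^\<^sub>m i *\<^sub>v v) $ l))"
  proof (rule sum.cong[OF refl])
    fix i
    have "(A ^\<^sub>m Suc i *\<^sub>v v) $ r = (A *\<^sub>v (A ^\<^sub>m i *\<^sub>v v)) $ r"
      using A v by (simp add: pow_mat_Suc_left assoc_mult_mat_vec[of _ n n _ n] del: pow_mat.simps index_mult_mat_vec)
    also have "\<dots> = (\<Sum>l<n. A $$ (r, l) * (A ^\<^sub>m i *\<^sub>v v) $ l)"
      by (subst index_mult_vec_sum[of A n n]) (use A v r in auto)
    finally show "coeff q i * (A ^\<^sub>m Suc i *\<^sub>v v) $ r = (\<Sum>l<n. A $$ (r, l) * (coeff q i * (A ^\<^sub>m i *\<^sub>v v) $ l))"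
      by (simp add: sum_distrib_left mult_ac del: index_mult_mat_vec pow_mat.simps)
  qed
  also have "\<dots> = (\<Sum>l<n. A $$ (r, l) * eval_poly_vec n A v q $ l)"
    by (subst sum.swap) (simp add: eval_poly_vec_def sum_distrib_left del: index_mult_mat_vec)
  also have "\<dots> = (A *\<^sub>v eval_poly_vec n A v q) $ r"
    by (rule index_mult_vec_sum[OF A _ r, symmetric]) simp
  finally show "eval_poly_vec n A v ([:-c, 1:] * q) $ r = (A *\<^sub>v eval_poly_vec n A v q - c \<cdot>\<^sub>v eval_poly_vec n A v q) $ r"
    using r A by (simp add: eval_poly_vec_def del: index_mult_mat_vec)
qed (use A in \<open>auto simp: eval_poly_vec_def\<close>)

text \<open>A nonzero polynomial \<open>q\<close> of least degree with \<open>q(A) v = 0\<close> has a root \<open>c\<close>; dividing it by the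
  linear factor and applying the quotient to \<open>v\<close> gives an eigenvector. An eigenvector of the form \<open>q(A) v\<close>
  is wanted because it inherits from \<open>v\<close> to be an eigenvector of each matrix that commutes with \<open>A\<close>.\<close>

lemma eigenvector_in_cyclic_subspace:
  assumes A: "A \<in> carrier_mat n n" and v: "v \<in> carrier_vec n" "v \<noteq> 0\<^sub>v n"
  shows "\<exists>q c. eval_poly_vec n A v q \<noteq> 0\<^sub>v n \<and> A *\<^sub>v eval_poly_vec n A v q = c \<cdot>\<^sub>v eval_poly_vec n A v q"
proof -
  define P where "P = (\<lambda>q. q \<noteq> 0 \<and> eval_poly_vec n A v q = 0\<^sub>v n)"
  have "\<exists>q. P q"
  proof -
    obtain j a where "j \<le> n" and dep: "\<forall>r<n. (A ^\<^sub>m j *\<^sub>v v) $ r = (\<Sum>k\<in>{j<..n}. a k * (A ^\<^sub>m k *\<^sub>v v) $ r)"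
      using linear_dependency[of n "\<lambda>k r. (A ^\<^sub>m k *\<^sub>v v) $ r"] by auto
    define q where "q = monom 1 j - (\<Sum>k\<in>{j<..n}. monom (a k) k)"
    have co: "coeff q i = (if i = j then 1 else if j < i \<and> i \<le> n then - a i else 0)" for i
    proof -
      have "coeff (\<Sum>k\<in>{j<..n}. monom (a k) k) i = (\<Sum>k\<in>{j<..n}. if k = i then a k else 0)"
        by (simp add: coeff_sum coeff_monom)
      also have "\<dots> = (if j < i \<and> i \<le> n then a i else 0)" by (subst sum.delta) auto
      finally show ?thesis unfolding q_def by simp
    qed
    have "q \<noteq> 0" using co[of j] by auto
    moreover have dq: "degree q \<le> n" using \<open>j \<le> n\<close> by (intro degree_le) (auto simp: co)
    have "eval_poly_vec n A v q = 0\<^sub>v n"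
    proof (rule eq_vecI)
      fix r assume "r < dim_vec (0\<^sub>v n :: complex vec)"
      hence r: "r < n" by simp
      have "eval_poly_vec n A v q $ r = (\<Sum>i\<le>n. coeff q i * (A ^\<^sub>m i *\<^sub>v v) $ r)"
        by (rule eval_poly_vec_index[OF dq r])
      also have "\<dots> = (\<Sum>i\<in>insert j {j<..n}. coeff q i * (A ^\<^sub>m i *\<^sub>v v) $ r)"
        using \<open>j \<le> n\<close> by (intro sum.mono_neutral_right) (auto simp: co)
      also have "\<dots> = (A ^\<^sub>m j *\<^sub>v v) $ r - (\<Sum>k\<in>{j<..n}. a k * (A ^\<^sub>m k *\<^sub>v v) $ r)"
        by (simp add: co sum_negf del: index_mult_mat_vec)
      also have "\<dots> = 0" using dep r by simp
      finally show "eval_poly_vec n A v q $ r = 0\<^sub>v n $ r" using r by simp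
    qed (simp add: eval_poly_vec_def)
    ultimately show ?thesis unfolding P_def by blast
  qed
  then obtain q where q: "P q" and min: "\<And>q'. P q' \<Longrightarrow> degree q \<le> degree q'"
    using ex_has_least_nat[of P _ degree] by blast
  have "degree q \<noteq> 0"
  proof
    assume "degree q = 0"
    then obtain a where a: "q = [:a:]" by (meson degree_eq_zeroE)
    have "eval_poly_vec n A v q $ r = a * v $ r" if "r < n" for r
      using that v A by (simp add: a eval_poly_vec_def)
    hence "v $ r = 0" if "r < n" for r
      using q that a by (auto simp: P_def)
    thus False using v by (metis eq_vecI carrier_vecD index_zero_vec)
  qed
  then obtain c where "poly q c = 0"
    using fundamental_theorem_of_algebra[of q] constant_degree[of q] by auto
  then obtain q' where q': "q = [:-c, 1:] * q'"
    by (auto simp: poly_eq_0_iff_dvd dvd_def)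
  have "q' \<noteq> 0" using q q' by (auto simp: P_def)
  hence "degree q = Suc (degree q')" unfolding q' by (subst degree_mult_eq) auto
  hence "\<not> P q'" using min[of q'] by auto
  hence nz: "eval_poly_vec n A v q' \<noteq> 0\<^sub>v n" using \<open>q' \<noteq> 0\<close> by (simp add: P_def)
  have eq: "A *\<^sub>v eval_poly_vec n A v q' - c \<cdot>\<^sub>v eval_poly_vec n A v q' = 0\<^sub>v n"
    using q eval_poly_vec_linear_factor[OF A v(1), of c q'] by (simp add: P_def q')
  have "A *\<^sub>v eval_poly_vec n A v q' = c \<cdot>\<^sub>v eval_poly_vec n A v q'"
  proof (rule eq_vecI)
    fix r assume "r < dim_vec (c \<cdot>\<^sub>v eval_poly_vec n A v q')"
    hence "r < n" by (simp add: eval_poly_vec_def)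
    thus "(A *\<^sub>v eval_poly_vec n A v q') $ r = (c \<cdot>\<^sub>v eval_poly_vec n A v q') $ r"
      using arg_cong[OF eq, of "\<lambda>v :: complex vec. v $ r"] A by (simp add: eval_poly_vec_def del: index_mult_mat_vec)
  qed (use A in \<open>auto simp: eval_poly_vec_def\<close>)
  with nz show ?thesis by blast
qed

context commuting_matrices
begin

text \<open>The set \<open>G\<close> may be infinite, so the eigenvector cannot be found by treating one matrix after
  another. If it did not exist, there would be an infinite sequence of vectors, each an eigenvector of
  one more matrix than its predecessor. One of the first \<open>n + 1\<close> members is a combination of later
  members, and these are all eigenvectors, for the same eigenvalue, of a matrix for which the former is none.

  The second property of \<open>w\<close> allows to look for \<open>w\<close> in the image of a given idempotent.\<close>

lemma common_eigenvector:
  assumes w0: "w0 \<in> carrier_vec n" "w0 \<noteq> 0\<^sub>v n"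
  obtains w where "w \<in> carrier_vec n" "w \<noteq> 0\<^sub>v n" "\<And>A. A \<in> G \<Longrightarrow> \<exists>c. A *\<^sub>v w = c \<cdot>\<^sub>v w"
    "\<And>B c. B \<in> carrier_mat n n \<Longrightarrow> \<forall>A\<in>G. A * B = B * A \<Longrightarrow> B *\<^sub>v w0 = c \<cdot>\<^sub>v w0 \<Longrightarrow> B *\<^sub>v w = c \<cdot>\<^sub>v w"
proof -
  define pres where "pres = (\<lambda>v w. \<forall>B c. B \<in> carrier_mat n n \<longrightarrow> (\<forall>A\<in>G. A * B = B * A) \<longrightarrow>
      B *\<^sub>v v = c \<cdot>\<^sub>v v \<longrightarrow> B *\<^sub>v w = c \<cdot>\<^sub>v (w :: complex vec))"
  define good where "good = (\<lambda>w. w \<in> carrier_vec n \<and> w \<noteq> 0\<^sub>v n \<and> pres w0 w)"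
  have "\<exists>w. good w \<and> (\<forall>A\<in>G. \<exists>c. A *\<^sub>v w = c \<cdot>\<^sub>v w)"
  proof (rule ccontr)
    assume none: "\<not> ?thesis"
    \<comment> \<open>the step from one vector of the sequence to the next\<close>
    define R where "R = (\<lambda>(_::nat) v w. pres v w \<and>
        (\<exists>A\<in>G. (\<nexists>c. A *\<^sub>v v = c \<cdot>\<^sub>v v) \<and> (\<exists>c. A *\<^sub>v w = c \<cdot>\<^sub>v w)))"
    have "\<exists>f. \<forall>k. good (f k) \<and> R k (f k) (f (Suc k))"
    proof (rule dependent_nat_choice[where P = "\<lambda>_. good"])
      show "\<exists>w. good w" using w0 by (auto simp: good_def pres_def)
    next
      fix v and k :: nat assume v: "good v"
      then obtain A where A: "A \<in> G" "\<nexists>c. A *\<^sub>v v = c \<cdot>\<^sub>v v" using none by blast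
      obtain q c where q: "eval_poly_vec n A v q \<noteq> 0\<^sub>v n"
        "A *\<^sub>v eval_poly_vec n A v q = c \<cdot>\<^sub>v eval_poly_vec n A v q"
        using eigenvector_in_cyclic_subspace[OF G_carrier[OF A(1)], of v] v by (auto simp: good_def)
      have "pres v (eval_poly_vec n A v q)"
        unfolding pres_def using A v by (auto intro!: eval_poly_vec_eigen simp: G_carrier good_def)
      with v q A show "\<exists>w. good w \<and> R k v w"
        by (intro exI[of _ "eval_poly_vec n A v q"]) (auto simp: good_def R_def pres_def)
    qed
    then obtain f where f: "\<And>k. good (f k)" "\<And>k. R k (f k) (f (Suc k))" by blast
    have mono: "pres (f i) (f (i + d))" for i d
      by (induction d) (use f(2) in \<open>force simp: R_def pres_def\<close>)+
    obtain j a where "j \<le> n" and dep: "\<forall>r<n. f j $ r = (\<Sum>k\<in>{j<..n}. a k * f k $ r)"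
      using linear_dependency[of n "\<lambda>k r. f k $ r"] by auto
    obtain A c where A: "A \<in> G" "\<nexists>c. A *\<^sub>v f j = c \<cdot>\<^sub>v f j" and c: "A *\<^sub>v f (Suc j) = c \<cdot>\<^sub>v f (Suc j)"
      using f(2)[of j] by (auto simp: R_def)
    have Ac: "A \<in> carrier_mat n n" using A G_carrier by blast
    have fc: "f k \<in> carrier_vec n" for k using f(1) by (simp add: good_def)
    have eig: "A *\<^sub>v f k = c \<cdot>\<^sub>v f k" if "j < k" for k
    proof -
      have "pres (f (Suc j)) (f k)" using mono[of "Suc j" "k - Suc j"] that by simp
      thus ?thesis using A(1) c Ac G_commute unfolding pres_def by blast
    qed
    have "A *\<^sub>v f j = c \<cdot>\<^sub>v f j"
    proof (rule eq_vecI)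
      fix r assume "r < dim_vec (c \<cdot>\<^sub>v f j)"
      hence r: "r < n" using fc[of j] by simp
      have "(A *\<^sub>v f j) $ r = (\<Sum>l<n. A $$ (r, l) * (\<Sum>k\<in>{j<..n}. a k * f k $ l))"
        unfolding index_mult_vec_sum[OF Ac fc r] using dep by (intro sum.cong) auto
      also have "\<dots> = (\<Sum>l<n. \<Sum>k\<in>{j<..n}. a k * (A $$ (r, l) * f k $ l))"
        by (simp add: sum_distrib_left mult_ac)
      also have "\<dots> = (\<Sum>k\<in>{j<..n}. a k * (A *\<^sub>v f k) $ r)"
        unfolding index_mult_vec_sum[OF Ac fc r] by (subst sum.swap) (simp add: sum_distrib_left)
      also have "\<dots> = (\<Sum>k\<in>{j<..n}. a k * (c * f k $ r))"
        using eig r carrier_vecD[OF fc] by (intro sum.cong) auto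
      also have "\<dots> = c * f j $ r"
        using dep r by (simp add: sum_distrib_left mult_ac)
      finally show "(A *\<^sub>v f j) $ r = (c \<cdot>\<^sub>v f j) $ r" using r carrier_vecD[OF fc[of j]] by simp
    qed (use Ac carrier_vecD[OF fc[of j]] in auto)
    with A(2) show False by blast
  qed
  thus ?thesis using that unfolding good_def pres_def by blast
qed

end

section \<open>Series with exponents in a fixed residue class\<close>

text \<open>All exponents of \<open>z\<close> are congruent to \<open>- r\<close>. The sign is that of the modes: the mode \<open>u\<^sub>m\<close>
  belongs to the power \<open>- m - 1\<close> of \<open>x\<close>, so fields of elements of grade \<open>r\<close> have grade \<open>r\<close> in this sense.\<close>

definition graded_fls :: "nat \<Rightarrow> int \<Rightarrow> complex fls \<Rightarrow> bool" where
  "graded_fls p r F \<longleftrightarrow> (\<forall>k. fls_nth F k \<noteq> 0 \<longrightarrow> int p dvd k + r)"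

lemma graded_fls_0 [simp]: "graded_fls p r 0"
  by (simp add: graded_fls_def)

lemma graded_fls_add: "graded_fls p r F \<Longrightarrow> graded_fls p r G \<Longrightarrow> graded_fls p r (F + G)"
  unfolding graded_fls_def by (metis add.right_neutral fls_plus_nth)

lemma graded_fls_sum: "(\<And>i. i \<in> A \<Longrightarrow> graded_fls p r (F i)) \<Longrightarrow> graded_fls p r (\<Sum>i\<in>A. F i)"
  by (induction A rule: infinite_finite_induct) (auto intro: graded_fls_add)

lemma graded_fls_const_mult: "graded_fls p r F \<Longrightarrow> graded_fls p r (fls_const c * F)"
  by (auto simp: graded_fls_def)

lemma graded_fls_mult:
  assumes "graded_fls p r F" "graded_fls p s G"
  shows "graded_fls p (r + s) (F * G)"
  unfolding graded_fls_def
proof (intro allI impI)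
  fix k assume "fls_nth (F * G) k \<noteq> 0"
  then obtain i where "fls_nth F i * fls_nth G (k - i) \<noteq> 0"
    unfolding fls_times_nth(2) by (meson sum.not_neutral_contains_not_neutral)
  hence "int p dvd i + r" "int p dvd k - i + s"
    using assms by (auto simp: graded_fls_def)
  hence "int p dvd (i + r) + (k - i + s)" by (rule dvd_add)
  thus "int p dvd k + (r + s)" by (simp add: algebra_simps)
qed

lemma graded_fls_1 [simp]: "graded_fls p 0 1"
  by (simp add: graded_fls_def)

lemma graded_fls_power: "graded_fls p r F \<Longrightarrow> graded_fls p (int i * r) (F ^ i)"
proof (induction i)
  case (Suc i)
  from graded_fls_mult[OF Suc.prems Suc.IH[OF Suc.prems]] show ?case by (simp add: algebra_simps)
qed simp

lemma graded_fls_ddx: "p > 0 \<Longrightarrow> graded_fls p r F \<Longrightarrow> graded_fls p r (ddx p F)"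
  unfolding graded_fls_def
  by (auto simp: ddx_nth) (metis add.assoc add.commute dvd_add_triv_right_iff)

lemma graded_fls_unique:
  assumes "graded_fls p r F" "graded_fls p s F" "\<not> int p dvd r - s"
  shows "F = 0"
proof (rule fls_eqI)
  fix k
  have "fls_nth F k = 0"
  proof (rule ccontr)
    assume "fls_nth F k \<noteq> 0"
    hence "int p dvd (k + r) - (k + s)" using assms by (intro dvd_diff) (auto simp: graded_fls_def)
    with assms(3) show False by simp
  qed
  thus "fls_nth F k = fls_nth 0 k" by simp
qed

lemma graded_fls_cong: "graded_fls p r F \<Longrightarrow> int p dvd r - s \<Longrightarrow> graded_fls p s F"
  unfolding graded_fls_def
proof (intro allI impI)
  fix k assume *: "\<forall>k. fls_nth F k \<noteq> 0 \<longrightarrow> int p dvd k + r" "int p dvd r - s" "fls_nth F k \<noteq> 0"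
  hence "int p dvd k + r" by blast
  from dvd_diff[OF this *(2)] show "int p dvd k + s" by (simp add: algebra_simps)
qed

definition graded_mat :: "nat \<Rightarrow> int \<Rightarrow> complex fls mat \<Rightarrow> bool" where
  "graded_mat p r X \<longleftrightarrow> (\<forall>i<dim_row X. \<forall>j<dim_col X. graded_fls p r (X $$ (i, j)))"

lemma graded_mat_mult:
  assumes "graded_mat p r X" "graded_mat p s Y" "X \<in> carrier_mat n n" "Y \<in> carrier_mat n n"
  shows "graded_mat p (r + s) (X * Y)"
  unfolding graded_mat_def
proof (intro allI impI)
  fix i j assume "i < dim_row (X * Y)" "j < dim_col (X * Y)"
  thus "graded_fls p (r + s) ((X * Y) $$ (i, j))"
    using assms by (subst index_mult_mat_sum[of X n n Y n])
      (auto intro!: graded_fls_sum graded_fls_mult simp: graded_mat_def)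
qed

lemma graded_mat_pow:
  assumes "graded_mat p r X" "X \<in> carrier_mat n n"
  shows "graded_mat p (int i * r) (X ^\<^sub>m i)"
proof (induction i)
  case 0
  show ?case using assms(2) by (auto simp: graded_mat_def)
next
  case (Suc i)
  have "graded_mat p (int i * r + r) (X ^\<^sub>m i * X)"
    using Suc assms by (intro graded_mat_mult) auto
  thus ?case by (simp add: algebra_simps)
qed

text \<open>Such a series has order 0, as differentiation would lower any other order; so 0 is one of its exponents.\<close>

lemma ddx_eigen_graded:
  assumes "p > 0" "F \<noteq> 0" "ddx p F = fls_const c * F" "graded_fls p r F"
  shows "int p dvd r"
proof -
  have "fls_subdegree F = 0"
  proof (rule ccontr)
    assume ne: "fls_subdegree F \<noteq> 0"
    note sd = subdegree_ddx[OF assms(1,2) ne]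
    hence "c \<noteq> 0" using assms(3) by auto
    hence "fls_subdegree (fls_const c * F) = fls_subdegree F" using assms(2) by simp
    with sd(1) assms(1,3) show False by simp
  qed
  hence "fls_nth F 0 \<noteq> 0" using nth_fls_subdegree_nonzero[OF assms(2)] by simp
  thus ?thesis using assms(4) by (auto simp: graded_fls_def)
qed

section \<open>Scalar solutions\<close>

definition poly_fls :: "complex poly \<Rightarrow> complex fls \<Rightarrow> complex fls" where
  "poly_fls f F = (\<Sum>i\<le>degree f. fls_const (coeff f i) * F ^ i)"

text \<open>At a pole, the leading term of the polynomial dominates.\<close>

lemma subdegree_poly_fls_neg:
  assumes g: "g \<noteq> 0" and F: "F \<noteq> 0" "fls_subdegree F < 0"
  shows "poly_fls g F \<noteq> 0" "fls_subdegree (poly_fls g F) = int (degree g) * fls_subdegree F"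
proof -
  let ?e = "fls_subdegree F" and ?d = "degree g"
  have low: "fls_nth (fls_const (coeff g i) * F ^ i) k = 0" if "k < int i * ?e" for i k
    using that F by (simp add: fls_subdegree_pow)
  have lt: "int ?d * ?e < int i * ?e" if "i < ?d" for i
    using that F(2) by (simp add: mult_less_cancel_right)
  have "fls_nth (poly_fls g F) (int ?d * ?e) = fls_nth (fls_const (coeff g ?d) * F ^ ?d) (int ?d * ?e)"
    unfolding poly_fls_def fls_nth_sum
    by (subst sum.remove[of _ ?d]) (use low lt in \<open>auto intro!: sum.neutral simp del: fls_mult_const_nth\<close>)
  also have "\<dots> = coeff g ?d * fls_nth (F ^ ?d) (int ?d * ?e)" by simp
  also have "\<dots> \<noteq> 0" using g F(1) nth_fls_subdegree_nonzero[of "F ^ ?d"] by (simp add: fls_subdegree_pow)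
  finally have *: "fls_nth (poly_fls g F) (int ?d * ?e) \<noteq> 0" .
  thus "poly_fls g F \<noteq> 0" by auto
  show "fls_subdegree (poly_fls g F) = int ?d * ?e"
  proof (rule fls_subdegree_eqI[OF *])
    fix k assume k: "k < int ?d * ?e"
    have "k < int i * ?e" if "i \<le> ?d" for i
      using lt[of i] that k by (cases "i = ?d") auto
    thus "fls_nth (poly_fls g F) k = 0"
      unfolding poly_fls_def fls_nth_sum by (intro sum.neutral) (auto simp: low simp del: fls_mult_const_nth)
  qed
qed

text \<open>Comparing the orders of both sides decides everything. If \<open>\<tau>\<close> vanished at the origin, the order \<open>e - p\<close>
  of its derivative would have to be 0 or at least \<open>e\<close>, so \<open>e = p\<close>, which is not congruent to \<open>- 1\<close>. So
  \<open>\<tau>\<close> has a pole of order \<open>d = - e\<close>, and \<open>(degree f - 1) * d = p\<close> together with \<open>d\<close> congruent to 1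
  modulo \<open>p\<close> leaves only \<open>d = 1\<close> and degree \<open>p + 1\<close>. Finally the terms of \<open>f\<close> of degree not congruent to 1
  sum up to a polynomial with root \<open>\<tau>\<close>, so they vanish.\<close>

lemma scalar_solution:
  assumes p: "p > 1" and \<tau>: "\<tau> \<noteq> 0" and gr: "graded_fls p 1 \<tau>" and ode: "ddx p \<tau> = poly_fls f \<tau>"
  shows "fls_subdegree \<tau> = -1"
    and "\<exists>c1 c. c \<noteq> 0 \<and> f = monom c1 1 + monom c (p + 1)"
proof -
  define e where "e = fls_subdegree \<tau>"
  have pe: "int p dvd e + 1" using gr \<tau> by (auto simp: graded_fls_def e_def)
  have e0: "e \<noteq> 0" using pe p by auto
  note sd = subdegree_ddx[of p \<tau>, folded e_def]
  have sd1: "fls_subdegree (poly_fls f \<tau>) = e - int p" and sd2: "poly_fls f \<tau> \<noteq> 0"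
    using sd p \<tau> e0 ode by auto
  have f0: "f \<noteq> 0" using sd2 by (auto simp: poly_fls_def)
  have neg: "e < 0"
  proof (rule ccontr)
    assume "\<not> e < 0"
    hence e: "e > 0" using e0 by simp
    have low: "fls_nth (fls_const (coeff f i) * \<tau> ^ i) k = 0" if "k < int i * e" for i k
      using that \<tau> by (simp add: fls_subdegree_pow e_def)
    have "e - int p \<ge> 0"
    proof (rule ccontr)
      assume "\<not> ?thesis"
      hence "fls_nth (poly_fls f \<tau>) (e - int p) = 0"
        unfolding poly_fls_def fls_nth_sum
        using e by (intro sum.neutral ballI low) (auto intro: less_le_trans[of _ 0])
      thus False using sd1 sd2 nth_fls_subdegree_nonzero by metis
    qed
    moreover have "e - int p \<le> 0"
    proof (rule ccontr)
      assume gt: "\<not> ?thesis"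
      \<comment> \<open>the constant coefficient vanishes, so the value has at least the order of \<open>\<tau>\<close>\<close>
      have "coeff f 0 = fls_nth (poly_fls f \<tau>) 0"
        unfolding poly_fls_def fls_nth_sum
        by (subst sum.remove[of _ 0]) (use e in \<open>auto intro!: sum.neutral low simp: zero_less_mult_iff simp del: fls_mult_const_nth simp: fls_nth_sum\<close>)
      also have "\<dots> = 0" using gt sd1 by simp
      finally have c0: "coeff f 0 = 0" .
      have "fls_nth (poly_fls f \<tau>) (e - int p) = 0"
        unfolding poly_fls_def fls_nth_sum
      proof (intro sum.neutral ballI)
        fix i assume "i \<in> {..degree f}"
        show "fls_nth (fls_const (coeff f i) * \<tau> ^ i) (e - int p) = 0"
        proof (cases "i = 0")
          case False
          hence "e \<le> int i * e" using e by (simp add: mult_le_cancel_right1)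
          thus ?thesis using p by (intro low) auto
        qed (use c0 in auto)
      qed
      thus False using sd1 sd2 nth_fls_subdegree_nonzero by metis
    qed
    ultimately have "e = int p" by simp
    thus False using pe p by auto
  qed
  have eq: "int (degree f) * e = e - int p"
    using subdegree_poly_fls_neg(2)[OF f0 \<tau>] neg sd1 by (simp add: e_def)
  hence "int p = (int (degree f) - 1) * (- e)" by (simp add: algebra_simps)
  hence "- e dvd int p" by simp
  hence "- e \<le> int p" using p by (intro zdvd_imp_le) auto
  moreover have "- e - 1 \<ge> int p" if "- e \<noteq> 1"
  proof -
    have "int p dvd - e - 1" using pe by (metis dvd_minus_iff minus_add_distrib uminus_add_conv_diff diff_minus_eq_add add_uminus_conv_diff)
    thus ?thesis using that neg by (intro zdvd_imp_le) auto
  qed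
  ultimately have e1: "e = -1" by (cases "- e = 1") auto
  thus "fls_subdegree \<tau> = -1" by (simp add: e_def)
  have deg: "degree f = p + 1" using eq e1 by simp
  \<comment> \<open>the terms of \<open>f\<close> that violate the grading\<close>
  define g where "g = Abs_poly (\<lambda>i. if int p dvd int i - 1 then 0 else coeff f i)"
  have cg: "coeff g i = (if int p dvd int i - 1 then 0 else coeff f i)" for i
    unfolding g_def by (subst coeff_Abs_poly[of "degree f"]) (auto simp: coeff_eq_0)
  have "g = 0"
  proof (rule ccontr)
    assume g0: "g \<noteq> 0"
    have dg: "degree g \<le> degree f" by (rule degree_le) (auto simp: cg coeff_eq_0)
    have pg: "poly_fls g \<tau> = (\<Sum>i\<le>degree f. fls_const (coeff g i) * \<tau> ^ i)"
      unfolding poly_fls_def by (rule sum.mono_neutral_left) (use dg in \<open>auto simp: coeff_eq_0\<close>)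
    have "fls_nth (poly_fls g \<tau>) k = 0" for k
    proof (cases "int p dvd k + 1")
      case True
      have "fls_nth (fls_const (coeff g i) * \<tau> ^ i) k = 0" for i
      proof (cases "int p dvd int i - 1")
        case False
        have "fls_nth (\<tau> ^ i) k = 0"
        proof (rule ccontr)
          assume "fls_nth (\<tau> ^ i) k \<noteq> 0"
          hence "int p dvd k + int i" using graded_fls_power[OF gr, of i] by (auto simp: graded_fls_def)
          hence "int p dvd (k + int i) - (k + 1)" using True by (rule dvd_diff)
          with False show False by simp
        qed
        thus ?thesis by simp
      qed (simp add: cg)
      thus ?thesis unfolding pg fls_nth_sum by (intro sum.neutral) auto
    next
      case False
      have eq: "fls_nth (fls_const (coeff g i) * \<tau> ^ i) k = fls_nth (fls_const (coeff f i) * \<tau> ^ i) k" for i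
      proof (cases "int p dvd int i - 1")
        case True
        have "fls_nth (\<tau> ^ i) k = 0"
        proof (rule ccontr)
          assume "fls_nth (\<tau> ^ i) k \<noteq> 0"
          hence "int p dvd k + int i" using graded_fls_power[OF gr, of i] by (auto simp: graded_fls_def)
          hence "int p dvd (k + int i) - (int i - 1)" using True by (rule dvd_diff)
          with False show False by simp
        qed
        thus ?thesis by simp
      qed (simp add: cg)
      have "fls_nth (poly_fls g \<tau>) k = fls_nth (poly_fls f \<tau>) k"
        unfolding pg unfolding poly_fls_def fls_nth_sum by (intro sum.cong refl eq)
      also have "\<dots> = fls_nth (ddx p \<tau>) k" by (simp add: ode)
      also have "\<dots> = 0" using graded_fls_ddx[OF _ gr] p False by (auto simp: graded_fls_def)
      finally show ?thesis .
    qed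
    hence "poly_fls g \<tau> = 0" by (intro fls_eqI) simp
    thus False using subdegree_poly_fls_neg(1)[OF g0 \<tau>] neg by (simp add: e_def)
  qed
  hence zero: "coeff f i = 0" if "\<not> int p dvd int i - 1" for i
    using cg[of i] that by simp
  have "f = monom (coeff f 1) 1 + monom (coeff f (p + 1)) (p + 1)"
  proof (rule poly_eqI)
    fix i
    show "coeff f i = coeff (monom (coeff f 1) 1 + monom (coeff f (p + 1)) (p + 1)) i"
    proof (cases "i = 1 \<or> i = p + 1")
      case True
      thus ?thesis using p by auto
    next
      case False
      have "coeff f i = 0"
      proof (cases "i > p + 1")
        case True
        thus ?thesis using deg by (simp add: coeff_eq_0)
      next
        case le: False
        have "\<not> int p dvd int i - 1"
        proof
          assume dvd: "int p dvd int i - 1"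
          show False
          proof (cases "i = 0")
            case True
            thus False using dvd p by simp
          next
            case i0: False
            hence "int p \<le> int i - 1" using False dvd by (intro zdvd_imp_le) auto
            thus False using le False by simp
          qed
        qed
        thus ?thesis by (rule zero)
      qed
      thus ?thesis using False by simp
    qed
  qed
  moreover have "coeff f (p + 1) \<noteq> 0" using f0 deg leading_coeff_0_iff by metis
  ultimately show "\<exists>c1 c. c \<noteq> 0 \<and> f = monom c1 1 + monom c (p + 1)" by blast
qed

section \<open>Matrix solutions\<close>

lemma one_smult_mat [simp]: "(1 :: 'a :: semiring_1) \<cdot>\<^sub>m A = A"
  by (rule eq_matI) auto

context commuting_matrices
begin

lemma mat_ddx_pow:
  assumes X: "X \<in> D"
  shows "mat_ddx p (X ^\<^sub>m Suc k) = fls_const (of_nat (Suc k)) \<cdot>\<^sub>m (X ^\<^sub>m k * mat_ddx p X)"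
proof -
  have Xc: "X \<in> carrier_mat n n" using X by simp
  have "mat_ddx p (eval_poly_mat n (monom 1 (Suc k)) X) = eval_poly_mat n (pderiv (monom 1 (Suc k))) X * mat_ddx p X"
    by (rule mat_ddx_eval_poly_mat[OF Xc D_commute]) (use X in auto)
  thus ?thesis using Xc
    by (simp add: eval_poly_mat_monom pderiv_monom mult_smult_assoc_mat[of _ n n _ n] del: of_nat_Suc pow_mat.simps)
qed

end

text \<open>The matrices \<open>T\<close> that occur as \<open>Y(t,x)\<close>. They solve the differential equation of the derivation
  \<open>f d/dt\<close>, and their coefficients are the modes of \<open>t\<close>, which commute.\<close>

locale matrix_solution =
  fixes n p :: nat and T :: "complex fls mat" and f :: "complex poly"
  assumes p_gt_1: "p > 1"
    and T_carrier: "T \<in> carrier_mat n n"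
    and T_commute: "coeff_mat T j * coeff_mat T k = coeff_mat T k * coeff_mat T j"
    and T_graded: "graded_mat p 1 T"
    and T_ode: "mat_ddx p T = eval_poly_mat n f T"
begin

sublocale commuting_matrices n p "range (coeff_mat T)"
  by unfold_locales (use p_gt_1 T_carrier T_commute in auto)

lemma T_in_D [simp]: "T \<in> D"
  by (rule D_of_coeff_mat[OF T_carrier]) auto

text \<open>Let \<open>k + 1\<close> be the nilpotency index, and suppose that \<open>k\<close> is at least 1. The derivative of
  \<open>T ^ (k + 1) = 0\<close> shows that \<open>f\<close> has no constant term, so the entries of \<open>T ^ k\<close> are multiplied by a constant when they are
  differentiated. This also holds for \<open>T ^ (k - 1)\<close>, up to a multiple of \<open>T ^ k\<close>, which vanishes because it belongs to another
  grade. Therefore 0 is among the exponents of both powers, and \<open>p\<close> divides both \<open>k\<close> and \<open>k - 1\<close>, which is absurd.\<close>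

lemma nilpotent_solution:
  assumes nil: "T ^\<^sub>m K = 0\<^sub>m n n"
  shows "T = 0\<^sub>m n n"
proof (rule ccontr)
  assume T0: "T \<noteq> 0\<^sub>m n n"
  note T = T_carrier
  define m where "m = (LEAST m. T ^\<^sub>m m = 0\<^sub>m n n)"
  have m: "T ^\<^sub>m m = 0\<^sub>m n n" unfolding m_def by (rule LeastI[of _ K]) (rule nil)
  have below: "T ^\<^sub>m i \<noteq> 0\<^sub>m n n" if "i < m" for i
    using not_less_Least[of i "\<lambda>m. T ^\<^sub>m m = 0\<^sub>m n n"] that by (auto simp: m_def)
  have above: "T ^\<^sub>m i = 0\<^sub>m n n" if "i \<ge> m" for i
    using pow_mat_add[OF T, of m "i - m"] that m T by simp
  have "m \<noteq> 0"
  proof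
    assume "m = 0"
    hence "1\<^sub>m n = (0\<^sub>m n n :: complex fls mat)" using m T by simp
    hence "T = 0\<^sub>m n n" using T by (metis left_mult_one_mat left_mult_zero_mat)
    with T0 show False by simp
  qed
  moreover have "m \<noteq> 1" using m T T0 by auto
  ultimately have m2: "m \<ge> 2" by simp
  obtain f0 f1 f2 h where f: "f = pCons f0 (pCons f1 (pCons f2 h))"
    by (metis pCons_cases)
  define H where "H = eval_poly_mat n h T"
  have [simp]: "H \<in> D" by (simp add: H_def)
  have ode: "mat_ddx p T = fls_const f0 \<cdot>\<^sub>m 1\<^sub>m n + T * (fls_const f1 \<cdot>\<^sub>m 1\<^sub>m n + T * (fls_const f2 \<cdot>\<^sub>m 1\<^sub>m n + T * H))"
    using T by (simp add: T_ode f eval_poly_mat_pCons H_def)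
  \<comment> \<open>\<open>T ^ (i + 3)\<close> will be zero, so only the terms of \<open>f\<close> of degree at most 2 matter\<close>
  have expand: "T ^\<^sub>m i * mat_ddx p T = fls_const f0 \<cdot>\<^sub>m T ^\<^sub>m i + (fls_const f1 \<cdot>\<^sub>m T ^\<^sub>m (i + 1)
      + (fls_const f2 \<cdot>\<^sub>m T ^\<^sub>m (i + 2) + T ^\<^sub>m (i + 3) * H))" for i
  proof -
    have *: "T ^\<^sub>m j * (fls_const c \<cdot>\<^sub>m 1\<^sub>m n + T * X) = fls_const c \<cdot>\<^sub>m T ^\<^sub>m j + T ^\<^sub>m (j + 1) * X"
      if "X \<in> D" for X c j
      using that T by (simp add: mult_add_distrib_mat[of _ n n _ n] mult_smult_distrib[of _ n n _ n]
          right_mult_one_mat[of _ n n] assoc_mult_mat[of _ n n _ n _ n])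
    show ?thesis unfolding ode using T
      by (simp add: * numeral_eq_Suc del: pow_mat.simps)
  qed
  have f0: "f0 = 0"
  proof -
    have "mat_ddx p (T ^\<^sub>m Suc (m - 1)) = 0\<^sub>m n n"
      using m2 above[of "Suc (m - 1)"] by (auto intro!: eq_matI simp: mat_ddx_def)
    hence "fls_const (of_nat (Suc (m - 1))) \<cdot>\<^sub>m (T ^\<^sub>m (m - 1) * mat_ddx p T) = 0\<^sub>m n n"
      by (subst (asm) mat_ddx_pow) simp
    moreover have "T ^\<^sub>m (m - 1) * mat_ddx p T = fls_const f0 \<cdot>\<^sub>m T ^\<^sub>m (m - 1)"
      unfolding expand using m2 T by (subst (1 2 3) above) auto
    ultimately have eq: "fls_const (of_nat (Suc (m - 1))) \<cdot>\<^sub>m (fls_const f0 \<cdot>\<^sub>m T ^\<^sub>m (m - 1)) = 0\<^sub>m n n" by simp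
    have "\<exists>i<n. \<exists>j<n. (T ^\<^sub>m (m - 1)) $$ (i, j) \<noteq> 0"
      using below[of "m - 1"] m2 T by (auto intro!: eq_matI)
    then obtain i j where ij: "i < n" "j < n" "(T ^\<^sub>m (m - 1)) $$ (i, j) \<noteq> 0" by blast
    have "dim_row (T ^\<^sub>m (m - 1)) = n" "dim_col (T ^\<^sub>m (m - 1)) = n"
      using carrier_matD[OF pow_carrier_mat[OF T]] by blast+
    thus ?thesis using arg_cong[OF eq, of "\<lambda>M. M $$ (i, j)"] ij by (auto simp del: pow_mat_dim of_nat_Suc)
  qed
  have entry: "\<exists>i<n. \<exists>j<n. (T ^\<^sub>m k) $$ (i, j) \<noteq> 0" if "k < m" for k
    using below[OF that] carrier_matD[OF pow_carrier_mat[OF T, of k]] by (auto intro!: eq_matI simp del: pow_mat_dim)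
  have dims: "dim_row (T ^\<^sub>m k) = n" "dim_col (T ^\<^sub>m k) = n" for k
    using carrier_matD[OF pow_carrier_mat[OF T]] by blast+
  have gr: "graded_fls p (int k) ((T ^\<^sub>m k) $$ (i, j))" if "i < n" "j < n" for i j k
    using graded_mat_pow[OF T_graded T, of k] that dims by (auto simp: graded_mat_def)
  define k where "k = m - 1"
  have k: "k \<ge> 1" "k < m" "Suc k = m" using m2 by (auto simp: k_def)
  have "int p dvd int k"
  proof -
    obtain i j where ij: "i < n" "j < n" "(T ^\<^sub>m k) $$ (i, j) \<noteq> 0" using entry[of k] k by blast
    have "T ^\<^sub>m (k - 1) * mat_ddx p T = fls_const f1 \<cdot>\<^sub>m T ^\<^sub>m k"
      unfolding expand using k T above[of "Suc k"] above[of "k + 2"] by (auto simp: f0 simp del: pow_mat.simps)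
    hence "mat_ddx p (T ^\<^sub>m k) = fls_const (of_nat k) \<cdot>\<^sub>m (fls_const f1 \<cdot>\<^sub>m T ^\<^sub>m k)"
      using mat_ddx_pow[of T "k - 1"] k by simp
    from arg_cong[OF this, of "\<lambda>M. M $$ (i, j)"]
    have "ddx p ((T ^\<^sub>m k) $$ (i, j)) = fls_const (of_nat k * f1) * (T ^\<^sub>m k) $$ (i, j)"
      using ij dims by (simp add: mat_ddx_def mult.assoc[symmetric])
    from ddx_eigen_graded[OF p_pos ij(3) this gr[OF ij(1,2)]] show ?thesis .
  qed
  hence kp: "k \<ge> p" using k by (intro dvd_imp_le) auto
  have "int p dvd int (k - 1)"
  proof -
    obtain i j where ij: "i < n" "j < n" "(T ^\<^sub>m (k - 1)) $$ (i, j) \<noteq> 0" using entry[of "k - 1"] k by force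
    have ex: "k - 2 + 1 = k - 1" "k - 2 + 2 = k" "k - 2 + 3 = Suc k" "Suc (k - 2) = k - 1" using kp p_gt_1 by auto
    have "T ^\<^sub>m (k - 2) * mat_ddx p T = fls_const f1 \<cdot>\<^sub>m T ^\<^sub>m (k - 1) + fls_const f2 \<cdot>\<^sub>m T ^\<^sub>m k"
      unfolding expand ex using T above[of "Suc k"] k by (auto simp: f0 dims simp del: pow_mat.simps intro!: eq_matI)
    hence "mat_ddx p (T ^\<^sub>m (k - 1)) = fls_const (of_nat (k - 1)) \<cdot>\<^sub>m (fls_const f1 \<cdot>\<^sub>m T ^\<^sub>m (k - 1) + fls_const f2 \<cdot>\<^sub>m T ^\<^sub>m k)"
      using mat_ddx_pow[of T "k - 2"] ex by simp
    from arg_cong[OF this, of "\<lambda>M. M $$ (i, j)"]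
    have eq: "ddx p ((T ^\<^sub>m (k - 1)) $$ (i, j)) = fls_const (of_nat (k - 1)) *
        (fls_const f1 * (T ^\<^sub>m (k - 1)) $$ (i, j) + fls_const f2 * (T ^\<^sub>m k) $$ (i, j))"
      using ij dims by (simp add: mat_ddx_def del: of_nat_diff)
    let ?F = "(T ^\<^sub>m (k - 1)) $$ (i, j)" and ?c = "of_nat (k - 1) :: complex"
    let ?R = "ddx p ?F + fls_const (- (?c * f1)) * ?F"
    have R: "?R = fls_const (?c * f2) * (T ^\<^sub>m k) $$ (i, j)"
      unfolding eq by (simp add: algebra_simps del: of_nat_diff flip: fls_const_mult_const)
    have "graded_fls p (int (k - 1)) ?R"
      using gr[OF ij(1,2)] p_pos by (intro graded_fls_add graded_fls_ddx graded_fls_const_mult) auto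
    moreover have "graded_fls p (int k) ?R"
      unfolding R using gr[OF ij(1,2)] by (intro graded_fls_const_mult)
    moreover have "\<not> int p dvd int (k - 1) - int k" using k p_gt_1 by simp
    ultimately have "?R = 0" by (rule graded_fls_unique)
    hence "ddx p ?F = fls_const (?c * f1) * ?F" by (simp add: add_eq_0_iff)
    from ddx_eigen_graded[OF p_pos ij(3) this gr[OF ij(1,2)]] show ?thesis .
  qed
  hence "int p dvd int k - int (k - 1)" using \<open>int p dvd int k\<close> by (intro dvd_diff)
  thus False using k p_gt_1 by simp
qed

end

section \<open>Eigenvalues of solutions\<close>

lemma mat_eq_by_vecI:
  fixes A B :: "'a::semiring_1 mat"
  assumes A: "A \<in> carrier_mat n n" and B: "B \<in> carrier_mat n n"
    and eq: "\<And>v. v \<in> carrier_vec n \<Longrightarrow> A *\<^sub>v v = B *\<^sub>v v"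
  shows "A = B"
proof (rule eq_matI)
  fix i j assume ij: "i < dim_row B" "j < dim_col B"
  have "(A *\<^sub>v unit_vec n j) $ i = (B *\<^sub>v unit_vec n j) $ i" using eq by simp
  thus "A $$ (i, j) = B $$ (i, j)" using ij A B by simp
qed (use A B in auto)

lemma const_mat_mult_vec:
  assumes "A \<in> carrier_mat n n" "v \<in> carrier_vec n"
  shows "const_mat A *\<^sub>v map_vec fls_const v = map_vec fls_const (A *\<^sub>v v)"
  by (rule eq_vecI) (use assms in \<open>auto simp: scalar_prod_def fls_const_sum\<close>)

lemma coeff_mat_mult_vec:
  assumes "X \<in> carrier_mat n n" "v \<in> carrier_vec n" "r < n"
  shows "fls_nth ((X *\<^sub>v map_vec fls_const v) $ r) k = (coeff_mat X k *\<^sub>v v) $ r"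
  using assms by (auto simp: scalar_prod_def fls_nth_sum)

lemma coeff_mat_0_mat [simp]: "coeff_mat (0\<^sub>m n n) k = 0\<^sub>m n n"
  by (rule eq_matI) auto

lemma eval_poly_mat_eigenvector:
  assumes X: "X \<in> carrier_mat n n" and v: "v \<in> carrier_vec n" and eig: "X *\<^sub>v v = \<tau> \<cdot>\<^sub>v v"
  shows "X ^\<^sub>m i *\<^sub>v v = \<tau> ^ i \<cdot>\<^sub>v v"
    and "eval_poly_mat n f X *\<^sub>v v = poly_fls f \<tau> \<cdot>\<^sub>v v"
proof -
  show pw: "X ^\<^sub>m i *\<^sub>v v = \<tau> ^ i \<cdot>\<^sub>v v" for i
  proof (induction i)
    case (Suc i)
    have "X ^\<^sub>m Suc i *\<^sub>v v = X ^\<^sub>m i *\<^sub>v (\<tau> \<cdot>\<^sub>v v)"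
      using X v by (simp add: assoc_mult_mat_vec[of _ n n _ n] eig)
    also have "\<dots> = \<tau> \<cdot>\<^sub>v (X ^\<^sub>m i *\<^sub>v v)" by (rule mult_mat_vec[of _ n n]) (use X v in auto)
    finally show ?case by (simp add: Suc smult_smult_assoc mult.commute)
  qed (use X v in auto)
  show "eval_poly_mat n f X *\<^sub>v v = poly_fls f \<tau> \<cdot>\<^sub>v v"
  proof (rule eq_vecI)
    fix r assume "r < dim_vec (poly_fls f \<tau> \<cdot>\<^sub>v v)"
    hence r: "r < n" using v by simp
    have "(eval_poly_mat n f X *\<^sub>v v) $ r = (\<Sum>l<n. (\<Sum>k\<le>degree f. fls_const (coeff f k) * (X ^\<^sub>m k) $$ (r, l)) * v $ l)"
      by (subst index_mult_vec_sum[of _ n n]) (use r v in \<open>auto simp: eval_poly_mat_index[OF order.refl]\<close>)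
    also have "\<dots> = (\<Sum>l<n. \<Sum>k\<le>degree f. fls_const (coeff f k) * ((X ^\<^sub>m k) $$ (r, l) * v $ l))"
      by (simp add: sum_distrib_right mult.assoc)
    also have "\<dots> = (\<Sum>k\<le>degree f. fls_const (coeff f k) * (X ^\<^sub>m k *\<^sub>v v) $ r)"
      unfolding index_mult_vec_sum[OF pow_carrier_mat[OF X] v r] by (subst sum.swap) (simp add: sum_distrib_left)
    also have "\<dots> = (poly_fls f \<tau> \<cdot>\<^sub>v v) $ r"
      unfolding pw using r v by (simp add: poly_fls_def sum_distrib_right mult.assoc)
    finally show "(eval_poly_mat n f X *\<^sub>v v) $ r = (poly_fls f \<tau> \<cdot>\<^sub>v v) $ r" .
  qed (use v in auto)
qed

context matrix_solution
begin

text \<open>The coefficients of \<open>T\<close> have a common eigenvector in the image of the constant idempotent \<open>e\<close>.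
  Its eigenvalues are the coefficients of a scalar solution \<open>\<tau>\<close>, which is nonzero because \<open>T\<close>
  is invertible on that image.\<close>

lemma eigen_data:
  assumes e: "e \<in> D" "e * e = e" "e \<noteq> 0\<^sub>m n n" and Te: "e = T ^\<^sub>m k * Y" "k \<ge> 1" "Y \<in> D"
  obtains w \<tau> where "w \<in> carrier_vec n" "w \<noteq> 0\<^sub>v n"
    "T *\<^sub>v map_vec fls_const w = \<tau> \<cdot>\<^sub>v map_vec fls_const w"
    "\<tau> \<noteq> 0" "graded_fls p 1 \<tau>" "ddx p \<tau> = poly_fls f \<tau>"
proof -
  define E where "E = coeff_mat e 0"
  have E: "E \<in> carrier_mat n n" and eE: "e = const_mat E"
    using e idempotent_const[OF e(1,2)] by (auto simp: E_def)
  have EE: "E * E = E" using e(2) E by (simp add: eE const_mat_mult[symmetric] const_mat_inj)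
  have "\<exists>u\<in>carrier_vec n. E *\<^sub>v u \<noteq> 0\<^sub>v n"
  proof (rule ccontr)
    assume "\<not> ?thesis"
    hence "E = 0\<^sub>m n n"
      by (intro mat_eq_by_vecI[OF E]) (auto intro!: eq_vecI)
    hence "e = 0\<^sub>m n n" by (auto simp: eE intro!: eq_matI)
    with e(3) show False by simp
  qed
  then obtain u where u: "u \<in> carrier_vec n" "E *\<^sub>v u \<noteq> 0\<^sub>v n" by blast
  have comm: "\<forall>A\<in>range (coeff_mat T). A * E = E * A"
    using D_sub_Z[OF e(1)] const_mat_in_Z_iff[OF E] by (simp add: eE)
  have Eu: "E *\<^sub>v (E *\<^sub>v u) = 1 \<cdot>\<^sub>v (E *\<^sub>v u)"
    using E u EE by (simp add: assoc_mult_mat_vec[of _ n n _ n, symmetric])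
  from common_eigenvector[of "E *\<^sub>v u"] obtain w where w: "w \<in> carrier_vec n" "w \<noteq> 0\<^sub>v n"
    and eig: "\<And>A. A \<in> range (coeff_mat T) \<Longrightarrow> \<exists>c. A *\<^sub>v w = c \<cdot>\<^sub>v w"
    and Ew: "E *\<^sub>v w = 1 \<cdot>\<^sub>v w"
    using u E comm Eu by (metis mult_vec_carrier_square)
  define v where "v = map_vec fls_const w"
  have v: "v \<in> carrier_vec n" using w by (simp add: v_def)
  have "\<forall>k. \<exists>c. coeff_mat T k *\<^sub>v w = c \<cdot>\<^sub>v w" using eig by blast
  then obtain c where c: "\<And>k. coeff_mat T k *\<^sub>v w = c k \<cdot>\<^sub>v w" by metis
  obtain r where r: "r < n" "w $ r \<noteq> 0" using w by (metis carrier_vecD eq_vecI index_zero_vec)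
  define \<tau> where "\<tau> = fls_const (1 / w $ r) * (T *\<^sub>v v) $ r"
  have nth: "fls_nth ((T *\<^sub>v v) $ s) k = c k * w $ s" if "s < n" for s k
    unfolding v_def using coeff_mat_mult_vec[OF T_carrier w(1) that] c w that by simp
  have \<tau>nth: "fls_nth \<tau> k = c k" for k
    using nth[OF r(1)] r(2) by (simp add: \<tau>_def)
  have Tv: "T *\<^sub>v v = \<tau> \<cdot>\<^sub>v v"
  proof (rule eq_vecI)
    fix s assume "s < dim_vec (\<tau> \<cdot>\<^sub>v v)"
    hence s: "s < n" using v by simp
    thus "(T *\<^sub>v v) $ s = (\<tau> \<cdot>\<^sub>v v) $ s"
      using w nth[OF s, unfolded v_def] by (intro fls_eqI) (simp add: \<tau>nth v_def del: index_mult_mat_vec)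
  qed (use T_carrier v in auto)
  have "\<tau> \<noteq> 0"
  proof
    assume "\<tau> = 0"
    hence Tk: "T ^\<^sub>m k *\<^sub>v v = 0\<^sub>v n"
      using eval_poly_mat_eigenvector(1)[OF T_carrier v Tv, of k] Te(2) v by (auto intro!: eq_vecI)
    have "v = e *\<^sub>v v" using Ew E w by (simp add: eE v_def const_mat_mult_vec)
    also have "e = Y * T ^\<^sub>m k" using Te by (simp add: D_commute)
    also have "(Y * T ^\<^sub>m k) *\<^sub>v v = Y *\<^sub>v (T ^\<^sub>m k *\<^sub>v v)"
      using Te T_carrier v by (intro assoc_mult_mat_vec[of _ n n _ n]) auto
    also have "\<dots> = 0\<^sub>v n" using Te by (auto simp: Tk intro!: eq_vecI)
    finally have "v $ r = 0" using r by simp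
    thus False using r w by (simp add: v_def)
  qed
  moreover have "graded_fls p 1 \<tau>"
  proof -
    have "graded_fls p 1 (fls_const (w $ l) * T $$ (r, l))" if "l < n" for l
      using T_graded T_carrier r that by (intro graded_fls_const_mult) (auto simp: graded_mat_def)
    moreover have "(T *\<^sub>v v) $ r = (\<Sum>l<n. fls_const (w $ l) * T $$ (r, l))"
      unfolding index_mult_vec_sum[OF T_carrier v r(1)] using w by (simp add: v_def mult.commute)
    ultimately show ?thesis
      unfolding \<tau>_def by (simp only:) (intro graded_fls_const_mult[of p 1 "sum _ _"] graded_fls_sum, auto)
  qed
  moreover have "ddx p \<tau> = poly_fls f \<tau>"
  proof -
    have "(mat_ddx p T *\<^sub>v v) $ r = ddx p ((T *\<^sub>v v) $ r)"
      using T_carrier r w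
      by (simp add: index_mult_vec_sum[of _ n n _ r] v mat_ddx_def ddx_sum ddx_mult del: index_mult_mat_vec)
         (simp add: v_def)
    also have "\<dots> = ddx p \<tau> * fls_const (w $ r)"
      unfolding Tv using r w by (simp add: v_def ddx_mult)
    also have "mat_ddx p T *\<^sub>v v = poly_fls f \<tau> \<cdot>\<^sub>v v"
      unfolding T_ode by (rule eval_poly_mat_eigenvector(2)[OF T_carrier v Tv])
    finally have "poly_fls f \<tau> * fls_const (w $ r) = ddx p \<tau> * fls_const (w $ r)"
      using r w by (simp add: v_def)
    thus ?thesis using r by simp
  qed
  ultimately show ?thesis using that[of w \<tau>] w Tv by (simp add: v_def)
qed

lemma fitting_T:
  assumes "T \<noteq> 0\<^sub>m n n"
  obtains k e Y where "k \<ge> 1" "Y \<in> D" "e \<in> D" "e * e = e" "e = T ^\<^sub>m k * Y" "e \<noteq> 0\<^sub>m n n"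
proof -
  obtain k e Y where *: "k \<ge> 1" "Y \<in> D" "e \<in> D" "e * e = e" "e = T ^\<^sub>m k * Y" "T ^\<^sub>m k * e = T ^\<^sub>m k"
    by (rule fitting[OF T_in_D])
  have "e \<noteq> 0\<^sub>m n n"
  proof
    assume "e = 0\<^sub>m n n"
    hence "T ^\<^sub>m k = 0\<^sub>m n n" using *(6) right_mult_zero_mat[OF pow_carrier_mat[OF T_carrier]] by metis
    with nilpotent_solution assms show False by blast
  qed
  with * that show ?thesis by blast
qed

text \<open>A nonzero solution is not nilpotent, so it is invertible on a nonzero summand, where it has a nonzero scalar solution as eigenvalue.\<close>

theorem nonzero_solution_form:
  assumes "T \<noteq> 0\<^sub>m n n"
  shows "\<exists>c1 c. c \<noteq> 0 \<and> f = monom c1 1 + monom c (p + 1)"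
  using fitting_T[OF assms] eigen_data scalar_solution(2)[OF p_gt_1] by metis

end

section \<open>Invariant subspaces and idempotents\<close>

definition vec_subspace :: "nat \<Rightarrow> complex vec set \<Rightarrow> bool" where
  "vec_subspace n W \<longleftrightarrow> W \<subseteq> carrier_vec n \<and> 0\<^sub>v n \<in> W \<and> (\<forall>v\<in>W. \<forall>w\<in>W. v + w \<in> W) \<and> (\<forall>c. \<forall>v\<in>W. c \<cdot>\<^sub>v v \<in> W)"

definition series_indecomposable :: "nat \<Rightarrow> complex fls mat \<Rightarrow> bool" where
  "series_indecomposable n T \<longleftrightarrow> (\<forall>W1 W2. vec_subspace n W1 \<and> vec_subspace n W2 \<and>
     (\<forall>k. \<forall>v\<in>W1. coeff_mat T k *\<^sub>v v \<in> W1) \<and> (\<forall>k. \<forall>v\<in>W2. coeff_mat T k *\<^sub>v v \<in> W2) \<and>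
     W1 \<inter> W2 \<subseteq> {0\<^sub>v n} \<and> (\<forall>v\<in>carrier_vec n. \<exists>a\<in>W1. \<exists>b\<in>W2. v = a + b)
     \<longrightarrow> W1 \<subseteq> {0\<^sub>v n} \<or> W2 \<subseteq> {0\<^sub>v n})"

lemma vec_subspace_eigenspace:
  assumes "A \<in> carrier_mat n n"
  shows "vec_subspace n {v \<in> carrier_vec n. A *\<^sub>v v = c \<cdot>\<^sub>v v}"
  unfolding vec_subspace_def
proof (intro conjI ballI allI)
  show "0\<^sub>v n \<in> {v \<in> carrier_vec n. A *\<^sub>v v = c \<cdot>\<^sub>v v}"
    using assms by (auto intro!: eq_vecI)
next
  fix v w assume "v \<in> {v \<in> carrier_vec n. A *\<^sub>v v = c \<cdot>\<^sub>v v}" "w \<in> {v \<in> carrier_vec n. A *\<^sub>v v = c \<cdot>\<^sub>v v}"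
  thus "v + w \<in> {v \<in> carrier_vec n. A *\<^sub>v v = c \<cdot>\<^sub>v v}"
    using assms by (auto simp: mult_add_distrib_mat_vec[of _ n n] smult_add_distrib_vec[of _ n])
next
  fix d v assume "v \<in> {v \<in> carrier_vec n. A *\<^sub>v v = c \<cdot>\<^sub>v v}"
  thus "d \<cdot>\<^sub>v v \<in> {v \<in> carrier_vec n. A *\<^sub>v v = c \<cdot>\<^sub>v v}"
    using assms by (auto simp: mult_mat_vec[of _ n n] smult_smult_assoc mult.commute)
qed auto

context matrix_solution
begin

text \<open>An idempotent in \<open>D\<close> is constant and commutes with the coefficients of \<open>T\<close>; so its eigenspaces for 0 and 1 split the space.\<close>

lemma idempotent_trivial:
  assumes ind: "series_indecomposable n T" and e: "e \<in> D" "e * e = e"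
  shows "e = 0\<^sub>m n n \<or> e = 1\<^sub>m n"
proof -
  define E where "E = coeff_mat e 0"
  have E: "E \<in> carrier_mat n n" and eE: "e = const_mat E"
    using e idempotent_const[OF e] by (auto simp: E_def)
  have EE: "E * E = E" using e(2) E by (simp add: eE const_mat_mult[symmetric] const_mat_inj)
  have comm: "E * coeff_mat T k = coeff_mat T k * E" for k
    using D_sub_Z[OF e(1)] const_mat_in_Z_iff[OF E] by (simp add: eE)
  have Tc: "coeff_mat T k \<in> carrier_mat n n" for k using T_carrier by simp
  let ?W = "\<lambda>c. {v \<in> carrier_vec n. E *\<^sub>v v = c \<cdot>\<^sub>v v}"
  have inv: "coeff_mat T k *\<^sub>v v \<in> ?W c" if v: "v \<in> ?W c" for v k c
  proof -
    have "E *\<^sub>v (coeff_mat T k *\<^sub>v v) = (coeff_mat T k * E) *\<^sub>v v"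
      using v E Tc comm by (simp add: assoc_mult_mat_vec[of _ n n _ n, symmetric])
    also have "\<dots> = coeff_mat T k *\<^sub>v (c \<cdot>\<^sub>v v)"
      using v E Tc by (simp add: assoc_mult_mat_vec[of _ n n _ n])
    also have "\<dots> = c \<cdot>\<^sub>v (coeff_mat T k *\<^sub>v v)" using v Tc by (intro mult_mat_vec[of _ n n]) auto
    finally show ?thesis using v Tc by auto
  qed
  have EEv: "E *\<^sub>v (E *\<^sub>v v) = E *\<^sub>v v" if "v \<in> carrier_vec n" for v
    using E EE that by (simp add: assoc_mult_mat_vec[of _ n n _ n, symmetric])
  have split: "\<exists>a\<in>?W 1. \<exists>b\<in>?W 0. v = a + b" if v: "v \<in> carrier_vec n" for v
  proof (intro bexI)
    show "v = E *\<^sub>v v + (v - E *\<^sub>v v)" using v E by (auto intro!: eq_vecI)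
    show "E *\<^sub>v v \<in> ?W 1" using v E EEv by auto
    have "E *\<^sub>v (v - E *\<^sub>v v) = 0\<^sub>v n"
      using v E EEv by (subst mult_minus_distrib_mat_vec[of _ n n]) (auto simp del: index_mult_mat_vec)
    thus "v - E *\<^sub>v v \<in> ?W 0" using v E by (auto intro!: eq_vecI simp del: index_mult_mat_vec)
  qed
  have zero: "0 \<cdot>\<^sub>v v = 0\<^sub>v n" if "v \<in> carrier_vec n" for v :: "complex vec"
    using that by (auto intro!: eq_vecI)
  have cap: "?W 1 \<inter> ?W 0 \<subseteq> {0\<^sub>v n}" by (auto simp: zero)
  have "?W 1 \<subseteq> {0\<^sub>v n} \<or> ?W 0 \<subseteq> {0\<^sub>v n}"
    using ind[unfolded series_indecomposable_def, rule_format, of "?W 1" "?W 0"]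
      vec_subspace_eigenspace[OF E] inv cap split by blast
  thus ?thesis
  proof
    assume W: "?W 1 \<subseteq> {0\<^sub>v n}"
    have "E = 0\<^sub>m n n"
    proof (rule mat_eq_by_vecI[OF E])
      fix v :: "complex vec" assume v: "v \<in> carrier_vec n"
      hence "E *\<^sub>v v \<in> ?W 1" using E EEv by auto
      with W v show "E *\<^sub>v v = 0\<^sub>m n n *\<^sub>v v" by (auto intro!: eq_vecI)
    qed simp
    thus ?thesis by (auto simp: eE intro!: eq_matI)
  next
    assume W: "?W 0 \<subseteq> {0\<^sub>v n}"
    have "E = 1\<^sub>m n"
    proof (rule mat_eq_by_vecI[OF E])
      fix v :: "complex vec" assume v: "v \<in> carrier_vec n"
      have "E *\<^sub>v (v - E *\<^sub>v v) = 0\<^sub>v n"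
        using v E EEv by (subst mult_minus_distrib_mat_vec[of _ n n]) (auto simp del: index_mult_mat_vec)
      hence "v - E *\<^sub>v v \<in> ?W 0" using v E by (auto intro!: eq_vecI simp del: index_mult_mat_vec)
      with W have "v - E *\<^sub>v v = 0\<^sub>v n" by blast
      hence "v $ i - (E *\<^sub>v v) $ i = 0" if "i < n" for i
        using that v E by (metis index_minus_vec(1) index_zero_vec(1) carrier_vecD mult_vec_carrier_square)
      with v E show "E *\<^sub>v v = 1\<^sub>m n *\<^sub>v v" by (auto intro!: eq_vecI simp del: index_mult_mat_vec)
    qed simp
    thus ?thesis by (simp add: eE)
  qed
qed

end

section \<open>Binomial series of a nilpotent matrix\<close>

lemma eval_poly_mat_cong_nilpotent:
  assumes A: "A \<in> carrier_mat n n" "A ^\<^sub>m n = 0\<^sub>m n n"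
    and eq: "\<And>i. i < n \<Longrightarrow> coeff P i = coeff Q i"
  shows "eval_poly_mat n P A = eval_poly_mat n Q A"
proof (rule eq_matI)
  fix a b assume "a < dim_row (eval_poly_mat n Q A)" "b < dim_col (eval_poly_mat n Q A)"
  hence ab: "a < n" "b < n" by auto
  let ?N = "max (degree P) (degree Q)"
  have vals: "fls_const (coeff P k) * (A ^\<^sub>m k) $$ (a, b) = fls_const (coeff Q k) * (A ^\<^sub>m k) $$ (a, b)" for k
  proof (cases "k < n")
    case False
    hence "A ^\<^sub>m k = A ^\<^sub>m n * A ^\<^sub>m (k - n)"
      using pow_mat_add[OF A(1), of n "k - n"] by simp
    hence "A ^\<^sub>m k = 0\<^sub>m n n" using A by (simp add: left_mult_zero_mat[of _ n n])
    with ab show ?thesis by simp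
  qed (simp add: eq)
  have "eval_poly_mat n P A $$ (a, b) = (\<Sum>k\<le>?N. fls_const (coeff P k) * (A ^\<^sub>m k) $$ (a, b))"
    by (rule eval_poly_mat_index) (use ab in auto)
  also have "\<dots> = (\<Sum>k\<le>?N. fls_const (coeff Q k) * (A ^\<^sub>m k) $$ (a, b))"
    by (rule sum.cong[OF refl vals])
  also have "\<dots> = eval_poly_mat n Q A $$ (a, b)"
    by (rule eval_poly_mat_index[symmetric]) (use ab in auto)
  finally show "eval_poly_mat n P A $$ (a, b) = eval_poly_mat n Q A $$ (a, b)" .
qed auto

definition binomial_poly :: "nat \<Rightarrow> complex \<Rightarrow> complex poly" where
  "binomial_poly n m = Abs_poly (\<lambda>k. if k < n then m gchoose k else 0)"

lemma coeff_binomial_poly: "coeff (binomial_poly n m) k = (if k < n then m gchoose k else 0)"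
  unfolding binomial_poly_def by (subst coeff_Abs_poly[of n]) auto

lemma binomial_mat_eval: "binomial_mat n m A = eval_poly_mat n (binomial_poly n m) A"
proof (rule eq_matI)
  fix a b assume "a < dim_row (eval_poly_mat n (binomial_poly n m) A)" "b < dim_col (eval_poly_mat n (binomial_poly n m) A)"
  hence ab: "a < n" "b < n" by auto
  have "degree (binomial_poly n m) \<le> n" by (rule degree_le) (auto simp: coeff_binomial_poly)
  from eval_poly_mat_index[OF this ab, of A]
  have "eval_poly_mat n (binomial_poly n m) A $$ (a, b) = (\<Sum>k\<le>n. fls_const (coeff (binomial_poly n m) k) * (A ^\<^sub>m k) $$ (a, b))" .
  also have "\<dots> = (\<Sum>k<n. fls_const (m gchoose k) * (A ^\<^sub>m k) $$ (a, b))"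
    by (rule sum.mono_neutral_cong_right) (auto simp: coeff_binomial_poly)
  finally show "binomial_mat n m A $$ (a, b) = eval_poly_mat n (binomial_poly n m) A $$ (a, b)"
    using ab by (simp add: binomial_mat_def)
qed (auto simp: binomial_mat_def)

lemma binomial_mat_carrier [simp]: "binomial_mat n m A \<in> carrier_mat n n"
  by (simp add: binomial_mat_def)

text \<open>Vandermonde's identity, for exponents of binomial series that break off.\<close>

lemma binomial_mat_add:
  assumes A: "A \<in> carrier_mat n n" "A ^\<^sub>m n = 0\<^sub>m n n"
  shows "binomial_mat n a A * binomial_mat n b A = binomial_mat n (a + b) A"
  unfolding binomial_mat_eval eval_poly_mat_mult[OF A(1), symmetric]
proof (rule eval_poly_mat_cong_nilpotent[OF A])
  fix i assume i: "i < n"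
  have "coeff (binomial_poly n a * binomial_poly n b) i = (\<Sum>k\<le>i. (a gchoose k) * (b gchoose (i - k)))"
    unfolding coeff_mult using i by (intro sum.cong) (auto simp: coeff_binomial_poly)
  also have "\<dots> = (a + b) gchoose i" by (simp add: gbinomial_Vandermonde atMost_atLeast0)
  finally show "coeff (binomial_poly n a * binomial_poly n b) i = coeff (binomial_poly n (a + b)) i"
    using i by (simp add: coeff_binomial_poly)
qed

lemma binomial_mat_0:
  assumes A: "A \<in> carrier_mat n n" "A ^\<^sub>m n = 0\<^sub>m n n"
  shows "binomial_mat n 0 A = 1\<^sub>m n"
  unfolding binomial_mat_eval eval_poly_mat_1[OF A(1), symmetric]
  by (rule eval_poly_mat_cong_nilpotent[OF A]) (auto simp: coeff_binomial_poly gbinomial_0_left)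

lemma gbinomial_1_left: "(1 :: complex) gchoose k = (if k \<le> 1 then 1 else 0)"
  using binomial_gbinomial[of 1 k, where ?'a = complex] by (cases k) (auto simp: binomial_eq_0)

lemma binomial_mat_1:
  assumes A: "A \<in> carrier_mat n n" "A ^\<^sub>m n = 0\<^sub>m n n"
  shows "binomial_mat n 1 A = 1\<^sub>m n + A"
proof -
  have "binomial_mat n 1 A = eval_poly_mat n (1 + tvar) A"
    unfolding binomial_mat_eval
    by (rule eval_poly_mat_cong_nilpotent[OF A])
       (auto simp: coeff_binomial_poly gbinomial_1_left coeff_pCons one_pCons split: nat.splits)
  thus ?thesis using A by (simp only: eval_poly_mat_add eval_poly_mat_1 eval_poly_mat_tvar)
qed

lemma binomial_mat_pow:
  assumes A: "A \<in> carrier_mat n n" "A ^\<^sub>m n = 0\<^sub>m n n"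
  shows "binomial_mat n m A ^\<^sub>m k = binomial_mat n (of_nat k * m) A"
proof (induction k)
  case 0
  show ?case using carrier_matD[OF binomial_mat_carrier[of n m A]] by (simp add: binomial_mat_0[OF A])
next
  case (Suc k)
  thus ?case by (simp add: binomial_mat_add[OF A] algebra_simps)
qed

section \<open>The scalar series of the standard modules\<close>

text \<open>For \<open>f(t) = c\<^sub>1 t + c t ^ (p + 1)\<close>, the inverse \<open>p\<close>-th power \<open>S\<close> of a solution \<open>T\<close> satisfies the
  linear equation \<open>S' = - p c\<^sub>1 S - p c\<close>. Here \<open>\<alpha>\<close> is the scalar solution without constant
  term and \<open>\<epsilon>\<close> the solution of the homogeneous equation with value 1, so the matrix
  solutions are \<open>\<alpha> + q \<epsilon> H = \<alpha> (1 + \<kappa> H)\<close> with a constant matrix \<open>H\<close>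
  (\<open>inv_sol\<close>). The factor \<open>q\<close> only serves to give \<open>\<kappa>\<close> the form that is used in the classification. As
  \<open>\<rho>\<close> is an inverse \<open>p\<close>-th root of \<open>\<alpha>\<close> up to a constant factor, \<open>sol\<close> is the
  corresponding matrix \<open>T\<close>, provided that \<open>H\<close> is nilpotent.\<close>

locale scalar_data =
  fixes p :: nat and c1 c q :: complex and \<alpha> \<epsilon> \<rho> \<kappa> :: "complex fls"
  assumes p_ge_2: "p > 1" and c_nonzero: "c \<noteq> 0" and q_nonzero: "q \<noteq> 0"
    and ddx_\<alpha>: "ddx p \<alpha> = fls_const (- (of_nat p * c1)) * \<alpha> + fls_const (- (of_nat p * c))"
    and ddx_\<epsilon>: "ddx p \<epsilon> = fls_const (- (of_nat p * c1)) * \<epsilon>"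
    and \<alpha>_0: "fls_nth \<alpha> 0 = 0" and \<epsilon>_0: "fls_nth \<epsilon> 0 = 1"
    and \<kappa>_\<alpha>: "\<kappa> * \<alpha> = fls_const q * \<epsilon>"
    and \<rho>_\<alpha>: "\<rho> ^ p * \<alpha> = fls_const (- (of_nat p * c))"
    and graded_\<rho>: "graded_fls p 1 \<rho>" and graded_\<kappa>: "graded_fls p 0 \<kappa>"
begin

definition sol :: "nat \<Rightarrow> complex \<Rightarrow> complex mat \<Rightarrow> complex fls mat" where
  "sol n a H = (fls_const a * \<rho>) \<cdot>\<^sub>m binomial_mat n (- 1 / of_nat p) (\<kappa> \<cdot>\<^sub>m const_mat H)"

definition inv_sol :: "nat \<Rightarrow> complex mat \<Rightarrow> complex fls mat" where
  "inv_sol n H = \<alpha> \<cdot>\<^sub>m 1\<^sub>m n + (fls_const q * \<epsilon>) \<cdot>\<^sub>m const_mat H"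

end

lemma X_times_exp_G:
  assumes "b \<noteq> 0"
  shows "fps_X * (1 + exp_G b) = fps_const (1 / b) * (fps_exp b - 1)"
proof -
  have "fps_X * fps_shift 1 (fps_const (1 / b) * (fps_exp b - 1)) = fps_const (1 / b) * (fps_exp b - 1)"
    by (rule fps_ext) (auto simp: fps_X_mult_nth)
  thus ?thesis by (simp add: exp_G_def)
qed

lemma exp_G_0: "b \<noteq> 0 \<Longrightarrow> fps_nth (exp_G b) 0 = 0"
  by (simp add: exp_G_def)

text \<open>The binomial series of exponent \<open>- 1 / p\<close> has the expected \<open>p\<close>-th power.\<close>

lemma root_power_power:
  assumes p: "p > 0" and G: "fps_nth G 0 = 0"
  shows "root_power p (- 1) G ^ p * fls_compose_power (fps_to_fls (fps_X * (1 + G))) p = 1"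
proof -
  let ?F = "fps_compose (fps_binomial (of_int (- 1) / of_nat p :: complex)) G"
  have "?F ^ p = fps_compose (fps_binomial (of_int (- 1) / of_nat p) ^ p) G"
    by (rule fps_compose_power[OF G])
  also have "fps_binomial (of_int (- 1) / of_nat p :: complex) ^ p = fps_binomial (- 1)"
    using p by (simp add: fps_binomial_power)
  finally have Fp: "?F ^ p = fps_compose (fps_binomial (- 1)) G" .
  have "fps_binomial (- 1 :: complex) * (1 + fps_X) = 1"
    using fps_binomial_add_mult[of "- 1 :: complex" 1] by (simp add: fps_binomial_1)
  hence "fps_compose (fps_binomial (- 1 :: complex) * (1 + fps_X)) G = fps_compose 1 G" by simp
  hence F1: "?F ^ p * (1 + G) = 1"
    unfolding Fp using G by (simp add: fps_compose_mult_distrib fps_compose_add_distrib)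
  have "root_power p (- 1) G ^ p * fls_compose_power (fps_to_fls (fps_X * (1 + G))) p =
        fls_X_intpow (- 1) ^ p * fls_compose_power (fps_to_fls (?F ^ p * (fps_X * (1 + G)))) p"
    using p unfolding root_power_def
    by (simp add: power_mult_distrib fls_times_fps_to_fls fps_to_fls_power mult_ac)
  also have "?F ^ p * (fps_X * (1 + G)) = fps_X" using F1 by (simp add: mult_ac)
  also have "fls_X_intpow (- 1) ^ p * fls_compose_power (fps_to_fls fps_X) p = (1 :: complex fls)"
  proof -
    have "fls_X_intpow (- 1) ^ p = (fls_X_intpow (int p * - 1) :: complex fls)" by (rule fls_X_intpow_power)
    moreover have "fls_X_intpow (int p * - 1) * fls_X_intpow (int p) = (fls_X_intpow (int p * - 1 + int p) :: complex fls)"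
      by (rule fls_X_intpow_times_fls_X_intpow)
    ultimately show ?thesis using p by simp
  qed
  finally show ?thesis .
qed

lemma graded_compose_power: "p > 0 \<Longrightarrow> graded_fls p 0 (fls_compose_power F p)"
  by (auto simp: graded_fls_def fls_nth_compose_power split: if_splits)

lemma graded_root_power: "p > 0 \<Longrightarrow> graded_fls p 1 (root_power p (- 1) G)"
proof -
  assume p: "p > 0"
  have "graded_fls p (1 + 0) (root_power p (- 1) G)"
    unfolding root_power_def
    by (rule graded_fls_mult[OF _ graded_compose_power[OF p]]) (simp add: graded_fls_def)
  thus ?thesis by simp
qed

text \<open>For \<open>c\<^sub>1 = 0\<close> the series are \<open>\<alpha> = - p c x\<close>, \<open>\<epsilon> = 1\<close> and \<open>\<kappa> = - 1 / x\<close>.\<close>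

lemma scalar_data_zero:
  assumes "p > 1" "c \<noteq> 0"
  shows "scalar_data p 0 c (of_nat p * c) (fls_compose_power (fls_const (- (of_nat p * c)) * fps_to_fls (fps_X * (1 + 0))) p)
     1 (root_power p (- 1) 0) (fls_compose_power (- fls_X_inv) p)"
proof
  have p: "p > 0" using assms by simp
  let ?\<alpha> = "fls_compose_power (fls_const (- (of_nat p * c)) * fps_to_fls (fps_X * (1 + 0))) p"
  let ?a = "fls_const (- (of_nat p * c)) * fps_to_fls (fps_X * (1 + 0))"
  have "fls_deriv ?a = fls_const (- (of_nat p * c))" by simp
  hence "ddx p ?\<alpha> = fls_compose_power (fls_const (- (of_nat p * c))) p"
    by (simp only: ddx_compose_power[OF p])
  thus "ddx p ?\<alpha> = fls_const (- (of_nat p * 0)) * ?\<alpha> + fls_const (- (of_nat p * c))"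
    by (simp add: fls_compose_power_const_left[OF p])
  show "fls_nth ?\<alpha> 0 = 0" using p by (simp add: fls_nth_compose_power)
  have "fls_compose_power (- fls_X_inv) p * ?\<alpha> = fls_compose_power (- fls_X_inv * (fls_const (- (of_nat p * c)) * fps_to_fls (fps_X * (1 + 0)))) p"
    by simp
  also have "- fls_X_inv * (fls_const (- (of_nat p * c)) * fps_to_fls (fps_X * (1 + 0))) = (fls_const (of_nat p * c) :: complex fls)"
    by (simp add: fls_X_inv_times_conv_shift fls_times_fps_to_fls mult_ac) (simp add: fls_X_times_conv_shift mult.assoc[symmetric])
  finally show "fls_compose_power (- fls_X_inv) p * ?\<alpha> = fls_const (of_nat p * c) * 1" using p by simp
  show "root_power p (- 1) 0 ^ p * ?\<alpha> = fls_const (- (of_nat p * c))"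
    using root_power_power[of p 0] p by (simp add: mult.left_commute)
  show "graded_fls p 0 (fls_compose_power (- fls_X_inv) p)" using p by (rule graded_compose_power)
qed (use assms in \<open>auto intro: graded_root_power\<close>)

text \<open>Here \<open>\<alpha> = (c / c\<^sub>1) (exp(b x) - 1)\<close> and \<open>\<epsilon> = exp(b x)\<close> with \<open>b = - p c\<^sub>1\<close>.\<close>

lemma scalar_data_nonzero:
  assumes "p > 1" "c \<noteq> 0" "c1 \<noteq> 0"
  defines "b \<equiv> - (c1 * of_nat p)"
  defines "e \<equiv> fps_to_fls (fps_exp b)"
  shows "scalar_data p c1 c (- c / c1) (fls_compose_power (fls_const (- (of_nat p * c)) * fps_to_fls (fps_X * (1 + exp_G b))) p)
     (fls_compose_power e p) (root_power p (- 1) (exp_G b)) (fls_compose_power (- (e / (- 1 + e))) p)"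
proof
  have p: "p > 0" using assms by simp
  have b: "b \<noteq> 0" using assms by (simp add: b_def)
  let ?a = "fls_const (- (of_nat p * c)) * fps_to_fls (fps_X * (1 + exp_G b))"
  have a: "?a = fls_const (c / c1) * (e - 1)"
  proof -
    have "?a = fls_const (- (of_nat p * c) * (1 / b)) * (e - 1)"
      unfolding X_times_exp_G[OF b] e_def by (simp add: fls_times_fps_to_fls mult.assoc[symmetric])
    also have "- (of_nat p * c) * (1 / b) = c / c1" using p assms(3) by (simp add: b_def field_simps)
    finally show ?thesis .
  qed
  have de: "fls_deriv e = fls_const b * e"
    unfolding e_def fls_deriv_fps_to_fls by (simp add: fls_times_fps_to_fls)
  have e1: "- 1 + e \<noteq> 0"
  proof
    assume "- 1 + e = 0"
    hence "fls_nth e 1 = fls_nth 1 1" by (metis add_eq_0_iff add.commute minus_minus)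
    thus False using b by (simp add: e_def)
  qed
  have "fls_deriv ?a = fls_const (- (of_nat p * c1)) * ?a + fls_const (- (of_nat p * c))"
  proof -
    have "fls_deriv ?a = fls_const (c / c1 * b) * e"
      unfolding a by (simp add: de mult.assoc[symmetric])
    also have "c / c1 * b = - (of_nat p * c)" using assms(3) by (simp add: b_def)
    also have "fls_const (- (of_nat p * c)) * e = fls_const (- (of_nat p * c1) * (c / c1)) * (e - 1) + fls_const (- (of_nat p * c))"
      using assms(3) by (simp add: algebra_simps)
    finally show ?thesis unfolding a by (simp add: mult.assoc[symmetric])
  qed
  hence "ddx p (fls_compose_power ?a p) = fls_compose_power (fls_const (- (of_nat p * c1)) * ?a + fls_const (- (of_nat p * c))) p"
    by (simp only: ddx_compose_power[OF p])
  also have "\<dots> = fls_const (- (of_nat p * c1)) * fls_compose_power ?a p + fls_const (- (of_nat p * c))"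
    by (simp only: fls_compose_power_add fls_compose_power_mult fls_compose_power_const_left[OF p])
  finally show "ddx p (fls_compose_power ?a p) = fls_const (- (of_nat p * c1)) * fls_compose_power ?a p + fls_const (- (of_nat p * c))" .
  have "b = - (of_nat p * c1)" by (simp add: b_def)
  thus "ddx p (fls_compose_power e p) = fls_const (- (of_nat p * c1)) * fls_compose_power e p"
    using p by (simp only: ddx_compose_power[OF p] de fls_compose_power_mult fls_compose_power_const_left[OF p])
  show "fls_nth (fls_compose_power ?a p) 0 = 0"
    using p by (simp add: fls_nth_compose_power a e_def)
  show "fls_nth (fls_compose_power e p) 0 = 1" using p by (simp add: fls_nth_compose_power e_def)
  have "- (e / (- 1 + e)) * ?a = fls_const (- c / c1) * e"
    unfolding a using e1 by (simp add: field_simps)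
  hence "fls_compose_power (- (e / (- 1 + e)) * ?a) p = fls_compose_power (fls_const (- c / c1) * e) p" by simp
  thus "fls_compose_power (- (e / (- 1 + e))) p * fls_compose_power ?a p = fls_const (- c / c1) * fls_compose_power e p"
    using p by (simp only: fls_compose_power_mult fls_compose_power_const_left[OF p])
  show "root_power p (- 1) (exp_G b) ^ p * fls_compose_power ?a p = fls_const (- (of_nat p * c))"
    using root_power_power[OF p exp_G_0[OF b]] p
    by (simp only: fls_compose_power_mult fls_compose_power_const_left[OF p] mult.left_commute mult_1_right)
  show "graded_fls p 0 (fls_compose_power (- (e / (- 1 + e))) p)" using p by (rule graded_compose_power)
  show "graded_fls p 1 (root_power p (- 1) (exp_G b))" using p by (rule graded_root_power)
qed (use assms in auto)

section \<open>The inverse power turns the equation into a linear one\<close>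

context commuting_matrices
begin

text \<open>The derivative of \<open>T ^ p * S = 1\<close>.\<close>

lemma ddx_inverse_power:
  assumes T: "T \<in> D" and S: "S \<in> D" and TS: "T ^\<^sub>m p * S = 1\<^sub>m n"
  shows "fls_const (of_nat p) \<cdot>\<^sub>m (T ^\<^sub>m (p - 1) * mat_ddx p T * S) + T ^\<^sub>m p * mat_ddx p S = 0\<^sub>m n n"
proof -
  have Tp: "T ^\<^sub>m p \<in> D" using T by simp
  have "mat_ddx p (T ^\<^sub>m p) = fls_const (of_nat p) \<cdot>\<^sub>m (T ^\<^sub>m (p - 1) * mat_ddx p T)"
    using mat_ddx_pow[OF T, of "p - 1"] p_pos by simp
  moreover have "mat_ddx p (T ^\<^sub>m p * S) = mat_ddx p (T ^\<^sub>m p) * S + T ^\<^sub>m p * mat_ddx p S"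
    using Tp S by (intro mat_ddx_mult[of _ n]) auto
  ultimately show ?thesis using T S
    by (simp add: TS mult_smult_assoc_mat[of _ n n _ n])
qed

text \<open>Multiply the derivative of \<open>T ^ p * S = 1\<close> by \<open>T\<close> and insert the linear equation for \<open>S\<close>.\<close>

lemma inverse_power_ode:
  assumes T: "T \<in> D" and S: "S \<in> D" and TS: "T ^\<^sub>m p * S = 1\<^sub>m n"
    and ode: "mat_ddx p S = fls_const (- (of_nat p * c1)) \<cdot>\<^sub>m S + fls_const (- (of_nat p * c)) \<cdot>\<^sub>m 1\<^sub>m n"
  shows "mat_ddx p T = fls_const c1 \<cdot>\<^sub>m T + fls_const c \<cdot>\<^sub>m T ^\<^sub>m (p + 1)"
proof -
  let ?P = "fls_const (of_nat p) :: complex fls" and ?d = "mat_ddx p T"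
  have Tc: "T \<in> carrier_mat n n" using T by simp
  have [simp]: "T ^\<^sub>m k \<in> D" "?d \<in> D" for k using T by auto
  have Tp: "T * T ^\<^sub>m (p - 1) = T ^\<^sub>m p"
    using pow_mat_Suc_left[OF Tc, of "p - 1"] p_pos by simp
  have Tp1: "T * T ^\<^sub>m p = T ^\<^sub>m (p + 1)" using pow_mat_Suc_left[OF Tc, of p] by simp
  have "T * (T ^\<^sub>m (p - 1) * ?d * S) = (T * T ^\<^sub>m (p - 1)) * (?d * S)" using T S by (simp add: D_assoc)
  also have "\<dots> = T ^\<^sub>m p * (S * ?d)" using S D_commute[of ?d S] by (simp only: Tp \<open>?d \<in> D\<close>)
  also have "\<dots> = (T ^\<^sub>m p * S) * ?d" using S by (simp add: D_assoc)
  also have "\<dots> = ?d" using left_mult_one_mat[of ?d n n] T by (simp add: TS)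
  finally have 1: "T * (?P \<cdot>\<^sub>m (T ^\<^sub>m (p - 1) * ?d * S)) = ?P \<cdot>\<^sub>m ?d"
    using T S by (simp add: mult_smult_distrib[of _ n n _ n])
  have "T * (T ^\<^sub>m p * S) = T" using right_mult_one_mat[of T n n] T by (simp add: TS)
  hence 2: "T * (T ^\<^sub>m p * mat_ddx p S) = fls_const (- (of_nat p * c1)) \<cdot>\<^sub>m T + fls_const (- (of_nat p * c)) \<cdot>\<^sub>m T ^\<^sub>m (p + 1)"
    unfolding ode using T S
    by (simp add: mult_add_distrib_mat[of _ n n _ n] mult_smult_distrib[of _ n n _ n] right_mult_one_mat[of _ n n] Tp1
        del: pow_mat.simps)
  have "T * (?P \<cdot>\<^sub>m (T ^\<^sub>m (p - 1) * ?d * S) + T ^\<^sub>m p * mat_ddx p S) = 0\<^sub>m n n"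
    unfolding ddx_inverse_power[OF T S TS] using right_mult_zero_mat[OF Tc] .
  hence eq: "?P \<cdot>\<^sub>m ?d + (fls_const (- (of_nat p * c1)) \<cdot>\<^sub>m T + fls_const (- (of_nat p * c)) \<cdot>\<^sub>m T ^\<^sub>m (p + 1)) = 0\<^sub>m n n"
    using T S by (subst (asm) mult_add_distrib_mat[of _ n n _ n]) (simp_all only: 1 2 D_carrier D_mult D_smult D_pow D_mat_ddx)
  show ?thesis
  proof (rule eq_matI)
    fix i j assume "i < dim_row (fls_const c1 \<cdot>\<^sub>m T + fls_const c \<cdot>\<^sub>m T ^\<^sub>m (p + 1))"
      "j < dim_col (fls_const c1 \<cdot>\<^sub>m T + fls_const c \<cdot>\<^sub>m T ^\<^sub>m (p + 1))"
    moreover have dims: "dim_row (T ^\<^sub>m (p + 1)) = n" "dim_col (T ^\<^sub>m (p + 1)) = n"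
      using carrier_matD[OF pow_carrier_mat[OF Tc, of "p + 1"]] by blast+
    ultimately have ij: "i < n" "j < n" by (simp_all del: pow_mat.simps pow_mat_dim)
    have "?P * ?d $$ (i, j) + (fls_const (- (of_nat p * c1)) * T $$ (i, j) + fls_const (- (of_nat p * c)) * (T ^\<^sub>m (p + 1)) $$ (i, j)) = 0"
      using arg_cong[OF eq, of "\<lambda>M. M $$ (i, j)"] ij dims T by (simp del: pow_mat.simps pow_mat_dim fls_const_uminus)
    moreover have "?P * (fls_const c1 * T $$ (i, j) + fls_const c * (T ^\<^sub>m (p + 1)) $$ (i, j))
      = - (fls_const (- (of_nat p * c1)) * T $$ (i, j) + fls_const (- (of_nat p * c)) * (T ^\<^sub>m (p + 1)) $$ (i, j))"
      by (simp add: distrib_left mult.assoc[symmetric] del: pow_mat.simps)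
    ultimately have "?P * ?d $$ (i, j) = ?P * (fls_const c1 * T $$ (i, j) + fls_const c * (T ^\<^sub>m (p + 1)) $$ (i, j))"
      by (simp add: add_eq_0_iff2 del: pow_mat.simps)
    hence "?d $$ (i, j) = fls_const c1 * T $$ (i, j) + fls_const c * (T ^\<^sub>m (p + 1)) $$ (i, j)"
      using p_pos by (simp del: pow_mat.simps)
    thus "?d $$ (i, j) = (fls_const c1 \<cdot>\<^sub>m T + fls_const c \<cdot>\<^sub>m T ^\<^sub>m (p + 1)) $$ (i, j)"
      using ij dims T by (simp del: pow_mat.simps pow_mat_dim)
  qed (use T carrier_matD[OF pow_carrier_mat[OF Tc, of "p + 1"]] in \<open>simp_all del: pow_mat.simps pow_mat_dim\<close>)
qed

text \<open>Multiply the derivative of \<open>T ^ p * S = 1\<close> by \<open>S\<close> and insert the equation for \<open>T\<close>.\<close>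

lemma ode_inverse_power:
  assumes T: "T \<in> D" and S: "S \<in> D" and TS: "T ^\<^sub>m p * S = 1\<^sub>m n"
    and ode: "mat_ddx p T = fls_const c1 \<cdot>\<^sub>m T + fls_const c \<cdot>\<^sub>m T ^\<^sub>m (p + 1)"
  shows "mat_ddx p S = fls_const (- (of_nat p * c1)) \<cdot>\<^sub>m S + fls_const (- (of_nat p * c)) \<cdot>\<^sub>m 1\<^sub>m n"
proof -
  let ?P = "fls_const (of_nat p) :: complex fls" and ?d = "mat_ddx p S"
  have Tc: "T \<in> carrier_mat n n" using T by simp
  have [simp]: "T ^\<^sub>m k \<in> D" "?d \<in> D" for k using T S by auto
  have Tp: "T ^\<^sub>m (p - 1) * T = T ^\<^sub>m p" and Tpp: "T ^\<^sub>m (p - 1) * T ^\<^sub>m (p + 1) = T ^\<^sub>m p * T ^\<^sub>m p"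
  proof -
    show "T ^\<^sub>m (p - 1) * T = T ^\<^sub>m p" using p_pos by (metis Suc_diff_1 pow_mat.simps(2))
    have "p - 1 + (p + 1) = p + p" using p_pos by simp
    thus "T ^\<^sub>m (p - 1) * T ^\<^sub>m (p + 1) = T ^\<^sub>m p * T ^\<^sub>m p"
      using pow_mat_add[OF Tc, of "p - 1" "p + 1"] pow_mat_add[OF Tc, of p p] by metis
  qed
  have S1: "S * (T ^\<^sub>m p * X) = X" if "X \<in> D" for X
  proof -
    have "S * (T ^\<^sub>m p * X) = (T ^\<^sub>m p * S) * X" using that S by (simp add: D_ac)
    thus ?thesis using that left_mult_one_mat[of X n n] by (simp add: TS)
  qed
  have "S * (T ^\<^sub>m (p - 1) * mat_ddx p T * S) = fls_const c1 \<cdot>\<^sub>m (S * (T ^\<^sub>m p * S)) + fls_const c \<cdot>\<^sub>m (S * (T ^\<^sub>m p * (T ^\<^sub>m p * S)))"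
  proof -
    have "T ^\<^sub>m (p - 1) * mat_ddx p T = fls_const c1 \<cdot>\<^sub>m T ^\<^sub>m p + fls_const c \<cdot>\<^sub>m (T ^\<^sub>m p * T ^\<^sub>m p)"
      unfolding ode using T
      by (simp add: mult_add_distrib_mat[of _ n n _ n] mult_smult_distrib[of _ n n _ n] Tp Tpp del: pow_mat.simps One_nat_def)
    thus ?thesis using T S
      by (simp add: add_mult_distrib_mat[of _ n n _ _ n] mult_smult_assoc_mat[of _ n n _ n] mult_add_distrib_mat[of _ n n _ n]
          mult_smult_distrib[of _ n n _ n] D_assoc del: pow_mat.simps)
  qed
  also have "\<dots> = fls_const c1 \<cdot>\<^sub>m S + fls_const c \<cdot>\<^sub>m 1\<^sub>m n"
    using S by (simp add: S1) (simp add: TS)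
  finally have 1: "S * (?P \<cdot>\<^sub>m (T ^\<^sub>m (p - 1) * mat_ddx p T * S)) = ?P \<cdot>\<^sub>m (fls_const c1 \<cdot>\<^sub>m S + fls_const c \<cdot>\<^sub>m 1\<^sub>m n)"
    using T S by (simp add: mult_smult_distrib[of _ n n _ n])
  have "S * (?P \<cdot>\<^sub>m (T ^\<^sub>m (p - 1) * mat_ddx p T * S) + T ^\<^sub>m p * ?d) = 0\<^sub>m n n"
    unfolding ddx_inverse_power[OF T S TS] using right_mult_zero_mat[OF D_carrier[OF S]] .
  hence eq: "?P \<cdot>\<^sub>m (fls_const c1 \<cdot>\<^sub>m S + fls_const c \<cdot>\<^sub>m 1\<^sub>m n) + ?d = 0\<^sub>m n n"
    using T S by (subst (asm) mult_add_distrib_mat[of _ n n _ n]) (simp_all only: 1 S1 D_carrier D_mult D_smult D_pow D_mat_ddx)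
  show ?thesis
  proof (rule eq_matI)
    fix i j assume "i < dim_row (fls_const (- (of_nat p * c1)) \<cdot>\<^sub>m S + fls_const (- (of_nat p * c)) \<cdot>\<^sub>m 1\<^sub>m n)"
      "j < dim_col (fls_const (- (of_nat p * c1)) \<cdot>\<^sub>m S + fls_const (- (of_nat p * c)) \<cdot>\<^sub>m 1\<^sub>m n)"
    hence ij: "i < n" "j < n" by auto
    have "?P * (fls_const c1 * S $$ (i, j) + fls_const c * 1\<^sub>m n $$ (i, j)) + ?d $$ (i, j) = 0"
      using arg_cong[OF eq, of "\<lambda>M. M $$ (i, j)"] ij S by (simp del: index_one_mat)
    hence "?d $$ (i, j) = - (?P * (fls_const c1 * S $$ (i, j) + fls_const c * 1\<^sub>m n $$ (i, j)))"
      by (simp add: add_eq_0_iff)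
    also have "\<dots> = fls_const (- (of_nat p * c1)) * S $$ (i, j) + fls_const (- (of_nat p * c)) * 1\<^sub>m n $$ (i, j)"
      by (simp add: distrib_left mult.assoc[symmetric] del: index_one_mat)
    finally show "?d $$ (i, j) = (fls_const (- (of_nat p * c1)) \<cdot>\<^sub>m S + fls_const (- (of_nat p * c)) \<cdot>\<^sub>m 1\<^sub>m n) $$ (i, j)"
      using ij S by (simp del: index_one_mat)
  qed (use S in auto)
qed

end

section \<open>The standard series are solutions\<close>

context scalar_data
begin

lemma scaled_nilpotent:
  assumes H: "H \<in> carrier_mat n n" and nil: "H ^\<^sub>m n = 0\<^sub>m n n"
  shows "\<kappa> \<cdot>\<^sub>m const_mat H \<in> carrier_mat n n" "(\<kappa> \<cdot>\<^sub>m const_mat H) ^\<^sub>m n = 0\<^sub>m n n"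
proof -
  show "\<kappa> \<cdot>\<^sub>m const_mat H \<in> carrier_mat n n" using H by simp
  have "(\<kappa> \<cdot>\<^sub>m const_mat H) ^\<^sub>m n = \<kappa> ^ n \<cdot>\<^sub>m const_mat (H ^\<^sub>m n)"
    using H by (simp add: pow_mat_smult[of _ n] const_mat_pow[of _ n])
  also have "\<dots> = 0\<^sub>m n n" unfolding nil by (auto intro!: eq_matI)
  finally show "(\<kappa> \<cdot>\<^sub>m const_mat H) ^\<^sub>m n = 0\<^sub>m n n" .
qed

lemma sol_carrier [simp]: "sol n a H \<in> carrier_mat n n"
  by (simp add: sol_def)

lemma inv_sol_carrier [simp]: "H \<in> carrier_mat n n \<Longrightarrow> inv_sol n H \<in> carrier_mat n n"
  by (simp add: inv_sol_def)

text \<open>The powers of binomial series and of \<open>\<rho>\<close> multiply as expected; the condition on \<open>a\<close> makes the constant factors cancel.\<close>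

lemma sol_pow_inv_sol:
  assumes H: "H \<in> carrier_mat n n" and nil: "H ^\<^sub>m n = 0\<^sub>m n n"
    and a: "a ^ p = inverse (- (of_nat p * c))"
  shows "sol n a H ^\<^sub>m p * inv_sol n H = 1\<^sub>m n"
proof -
  note A = scaled_nilpotent[OF H nil]
  let ?A = "\<kappa> \<cdot>\<^sub>m const_mat H" and ?B = "binomial_mat n (- 1 / of_nat p) (\<kappa> \<cdot>\<^sub>m const_mat H)"
  have inv: "inv_sol n H = \<alpha> \<cdot>\<^sub>m (1\<^sub>m n + ?A)"
  proof (rule eq_matI)
    fix i j assume "i < dim_row (\<alpha> \<cdot>\<^sub>m (1\<^sub>m n + ?A))" "j < dim_col (\<alpha> \<cdot>\<^sub>m (1\<^sub>m n + ?A))"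
    hence ij: "i < n" "j < n" using H by auto
    have "fls_const q * \<epsilon> * fls_const (H $$ (i, j)) = \<alpha> * (\<kappa> * fls_const (H $$ (i, j)))"
      unfolding \<kappa>_\<alpha>[symmetric] by (simp add: mult_ac)
    thus "inv_sol n H $$ (i, j) = (\<alpha> \<cdot>\<^sub>m (1\<^sub>m n + ?A)) $$ (i, j)"
      using ij H by (simp add: inv_sol_def distrib_left)
  qed (use H in \<open>auto simp: inv_sol_def\<close>)
  have Bp: "?B ^\<^sub>m p = binomial_mat n (- 1) ?A"
    using p_ge_2 by (simp add: binomial_mat_pow[OF A])
  have scal: "(fls_const a * \<rho>) ^ p * \<alpha> = 1"
  proof -
    have "(fls_const a * \<rho>) ^ p * \<alpha> = fls_const (a ^ p) * (\<rho> ^ p * \<alpha>)"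
      by (simp add: power_mult_distrib fls_const_power mult_ac)
    also have "\<dots> = fls_const (a ^ p * (- (of_nat p * c)))" unfolding \<rho>_\<alpha> by (simp del: fls_const_uminus)
    also have "a ^ p * (- (of_nat p * c)) = 1"
      unfolding a by (rule left_inverse) (use c_nonzero p_ge_2 in auto)
    finally show ?thesis by simp
  qed
  have "sol n a H ^\<^sub>m p * inv_sol n H = ((fls_const a * \<rho>) ^ p \<cdot>\<^sub>m ?B ^\<^sub>m p) * (\<alpha> \<cdot>\<^sub>m (1\<^sub>m n + ?A))"
    unfolding sol_def inv by (simp add: pow_mat_smult[of _ n])
  also have "\<dots> = ((fls_const a * \<rho>) ^ p * \<alpha>) \<cdot>\<^sub>m (?B ^\<^sub>m p * (1\<^sub>m n + ?A))"
    using A(1) by (simp add: mult_smult_assoc_mat[of _ n n _ n] mult_smult_distrib[of _ n n _ n])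
      (auto intro!: eq_matI simp: mult_ac)
  also have "?B ^\<^sub>m p * (1\<^sub>m n + ?A) = binomial_mat n (- 1) ?A * binomial_mat n 1 ?A"
    by (simp only: Bp binomial_mat_1[OF A])
  also have "\<dots> = 1\<^sub>m n" by (simp add: binomial_mat_add[OF A] binomial_mat_0[OF A])
  finally show ?thesis by (simp add: scal)
qed

lemma inv_sol_ode:
  assumes H: "H \<in> carrier_mat n n"
  shows "mat_ddx p (inv_sol n H) = fls_const (- (of_nat p * c1)) \<cdot>\<^sub>m inv_sol n H + fls_const (- (of_nat p * c)) \<cdot>\<^sub>m 1\<^sub>m n"
proof (rule eq_matI)
  fix i j assume "i < dim_row (fls_const (- (of_nat p * c1)) \<cdot>\<^sub>m inv_sol n H + fls_const (- (of_nat p * c)) \<cdot>\<^sub>m 1\<^sub>m n)"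
    "j < dim_col (fls_const (- (of_nat p * c1)) \<cdot>\<^sub>m inv_sol n H + fls_const (- (of_nat p * c)) \<cdot>\<^sub>m 1\<^sub>m n)"
  hence ij: "i < n" "j < n" by auto
  show "mat_ddx p (inv_sol n H) $$ (i, j) = (fls_const (- (of_nat p * c1)) \<cdot>\<^sub>m inv_sol n H + fls_const (- (of_nat p * c)) \<cdot>\<^sub>m 1\<^sub>m n) $$ (i, j)"
    using ij H by (cases "i = j") (simp_all add: inv_sol_def mat_ddx_def ddx_add ddx_mult ddx_\<alpha> ddx_\<epsilon> algebra_simps
        del: fls_const_uminus)
qed (use H in \<open>auto simp: inv_sol_def\<close>)

lemma sol_in_D:
  assumes "commuting_matrices n p G" and HD: "const_mat H \<in> commuting_matrices.D n G"
  shows "sol n a H \<in> commuting_matrices.D n G" "inv_sol n H \<in> commuting_matrices.D n G"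
proof -
  interpret commuting_matrices n p G by fact
  show "sol n a H \<in> D" unfolding sol_def binomial_mat_eval by (intro D_smult D_eval_poly_mat HD)
  show "inv_sol n H \<in> D" unfolding inv_sol_def by (intro D_smult D_add D_one HD)
qed

lemma graded_sol:
  assumes H: "H \<in> carrier_mat n n"
  shows "graded_mat p 1 (sol n a H)"
  unfolding graded_mat_def
proof (intro allI impI)
  fix i j assume "i < dim_row (sol n a H)" "j < dim_col (sol n a H)"
  hence ij: "i < n" "j < n" by (auto simp: sol_def binomial_mat_def)
  let ?A = "\<kappa> \<cdot>\<^sub>m const_mat H"
  have "graded_mat p 0 ?A"
    unfolding graded_mat_def
  proof (intro allI impI)
    fix i j assume "i < dim_row ?A" "j < dim_col ?A"
    thus "graded_fls p 0 (?A $$ (i, j))"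
      using graded_fls_const_mult[OF graded_\<kappa>, of "H $$ (i, j)"] by (simp add: mult.commute)
  qed
  hence "graded_mat p (int k * 0) (?A ^\<^sub>m k)" for k
    by (rule graded_mat_pow) (use H in auto)
  moreover have Ac: "?A \<in> carrier_mat n n" using H by simp
  ultimately have pw: "graded_fls p 0 ((?A ^\<^sub>m k) $$ (i, j))" for k
    using ij carrier_matD[OF pow_carrier_mat[OF Ac, of k]] by (simp add: graded_mat_def del: pow_mat_dim)
  have "graded_fls p (1 + 0) ((fls_const a * \<rho>) * (\<Sum>k<n. fls_const ((- 1 / of_nat p) gchoose k) * (?A ^\<^sub>m k) $$ (i, j)))"
    by (intro graded_fls_mult graded_fls_const_mult graded_\<rho> graded_fls_sum pw)
  thus "graded_fls p 1 (sol n a H $$ (i, j))"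
    using ij by (simp add: sol_def binomial_mat_def)
qed

lemma sol_is_solution:
  assumes H: "H \<in> carrier_mat n n" and nil: "H ^\<^sub>m n = 0\<^sub>m n n"
    and a: "a ^ p = inverse (- (of_nat p * c))"
  shows "matrix_solution n p (sol n a H) (monom c1 1 + monom c (p + 1))"
proof -
  interpret commuting_matrices n p "{H}"
    by unfold_locales (use p_ge_2 H in auto)
  have HD: "const_mat H \<in> D" by (rule G_in_D) simp
  note mem = sol_in_D[OF commuting_matrices_axioms HD]
  show ?thesis
  proof
    show "mat_ddx p (sol n a H) = eval_poly_mat n (monom c1 1 + monom c (p + 1)) (sol n a H)"
      using inverse_power_ode[OF mem(1,2) sol_pow_inv_sol[OF H nil a] inv_sol_ode[OF H]]
      by (simp add: eval_poly_mat_add eval_poly_mat_monom left_mult_one_mat[of _ n n] del: pow_mat.simps(2))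
         (simp add: carrier_matD[OF sol_carrier])
    show "coeff_mat (sol n a H) j * coeff_mat (sol n a H) k = coeff_mat (sol n a H) k * coeff_mat (sol n a H) j" for j k
      by (rule coeff_mat_commute[OF mem(1) mem(1)])
  qed (use p_ge_2 graded_sol[OF H] in auto)
qed

end

section \<open>Nilpotent matrices and Jordan blocks\<close>

text \<open>Among \<open>v, H v, ..., H ^ n v\<close> one vector is a combination of later ones; if \<open>H ^ n v\<close> were nonzero, a suitable power of \<open>H\<close> would kill all these but not the former.\<close>

lemma nilpotent_pow_dim:
  fixes H :: "complex mat"
  assumes H: "H \<in> carrier_mat n n" and nil: "H ^\<^sub>m k = 0\<^sub>m n n"
  shows "H ^\<^sub>m n = 0\<^sub>m n n"
proof (rule mat_eq_by_vecI[OF pow_carrier_mat[OF H]])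
  fix v :: "complex vec" assume v: "v \<in> carrier_vec n"
  have zero: "0\<^sub>m n n *\<^sub>v v = 0\<^sub>v n" using v by (auto intro!: eq_vecI)
  have "H ^\<^sub>m n *\<^sub>v v = 0\<^sub>v n"
  proof (rule ccontr)
    assume ne: "H ^\<^sub>m n *\<^sub>v v \<noteq> 0\<^sub>v n"
    define m where "m = (LEAST m. H ^\<^sub>m m *\<^sub>v v = 0\<^sub>v n)"
    have m: "H ^\<^sub>m m *\<^sub>v v = 0\<^sub>v n" unfolding m_def by (rule LeastI[of _ k]) (simp add: nil zero)
    have below: "H ^\<^sub>m i *\<^sub>v v \<noteq> 0\<^sub>v n" if "i < m" for i
      using not_less_Least[of i "\<lambda>m. H ^\<^sub>m m *\<^sub>v v = 0\<^sub>v n"] that by (auto simp: m_def)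
    have shift: "H ^\<^sub>m (i + d) *\<^sub>v v = H ^\<^sub>m d *\<^sub>v (H ^\<^sub>m i *\<^sub>v v)" for i d
      using H v pow_mat_add[OF H, of d i] by (simp add: add.commute assoc_mult_mat_vec[of _ n n _ n])
    have above: "H ^\<^sub>m i *\<^sub>v v = 0\<^sub>v n" if "i \<ge> m" for i
    proof -
      have "H ^\<^sub>m (i - m) *\<^sub>v 0\<^sub>v n = 0\<^sub>v n"
        using H by (intro mult_mat_zero_vec) auto
      thus ?thesis using shift[of m "i - m"] that m by simp
    qed
    have mn: "n < m" using above[of n] ne by (meson not_less)
    obtain j a where j: "j \<le> n" and dep: "\<forall>r<n. (H ^\<^sub>m j *\<^sub>v v) $ r = (\<Sum>k\<in>{j<..n}. a k * (H ^\<^sub>m k *\<^sub>v v) $ r)"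
      using linear_dependency[of n "\<lambda>k r. (H ^\<^sub>m k *\<^sub>v v) $ r"] by auto
    let ?d = "m - 1 - j"
    have c: "H ^\<^sub>m i \<in> carrier_mat n n" "H ^\<^sub>m i *\<^sub>v v \<in> carrier_vec n" for i using H v by auto
    have "H ^\<^sub>m (j + ?d) *\<^sub>v v = 0\<^sub>v n"
    proof (rule eq_vecI)
      fix r assume "r < dim_vec (0\<^sub>v n :: complex vec)"
      hence r: "r < n" by simp
      have "(H ^\<^sub>m (j + ?d) *\<^sub>v v) $ r = (\<Sum>l<n. (H ^\<^sub>m ?d) $$ (r, l) * (\<Sum>k\<in>{j<..n}. a k * (H ^\<^sub>m k *\<^sub>v v) $ l))"
        unfolding shift index_mult_vec_sum[OF c r] using dep by (intro sum.cong) auto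
      also have "\<dots> = (\<Sum>l<n. \<Sum>k\<in>{j<..n}. a k * ((H ^\<^sub>m ?d) $$ (r, l) * (H ^\<^sub>m k *\<^sub>v v) $ l))"
        by (simp add: sum_distrib_left mult_ac del: index_mult_mat_vec)
      also have "\<dots> = (\<Sum>k\<in>{j<..n}. a k * (H ^\<^sub>m (k + ?d) *\<^sub>v v) $ r)"
        unfolding shift index_mult_vec_sum[OF c r] by (subst sum.swap) (simp add: sum_distrib_left del: index_mult_mat_vec)
      also have "\<dots> = 0" using above mn j r by (intro sum.neutral) (auto simp del: index_mult_mat_vec)
      finally show "(H ^\<^sub>m (j + ?d) *\<^sub>v v) $ r = 0\<^sub>v n $ r" using r by simp
    qed (use carrier_vecD[OF c(2)] in auto)
    with below[of "j + ?d"] j mn show False by simp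
  qed
  with zero show "H ^\<^sub>m n *\<^sub>v v = 0\<^sub>m n n *\<^sub>v v" by simp
qed simp

lemma jordan_block_nilpotent: "(jordan_block n 0 :: complex mat) ^\<^sub>m n = 0\<^sub>m n n"
  by (rule eq_matI) (auto simp: jordan_block_pow)

lemma eval_poly_vec_add: "eval_poly_vec n A v (q + r) = eval_poly_vec n A v q + eval_poly_vec n A v r"
proof (rule eq_vecI)
  fix i assume "i < dim_vec (eval_poly_vec n A v q + eval_poly_vec n A v r)"
  hence i: "i < n" by (simp add: eval_poly_vec_def)
  let ?N = "max (degree q) (degree r)"
  show "eval_poly_vec n A v (q + r) $ i = (eval_poly_vec n A v q + eval_poly_vec n A v r) $ i"
    using i eval_poly_vec_index[of "q + r" ?N i n A v] eval_poly_vec_index[of q ?N i n A v]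
      eval_poly_vec_index[of r ?N i n A v]
    by (simp add: degree_add_le sum.distrib distrib_right del: index_mult_mat_vec)
qed (simp_all add: eval_poly_vec_def)

lemma eval_poly_vec_smult: "eval_poly_vec n A v (Polynomial.smult c q) = c \<cdot>\<^sub>v eval_poly_vec n A v q"
proof (rule eq_vecI)
  fix i assume "i < dim_vec (c \<cdot>\<^sub>v eval_poly_vec n A v q)"
  hence i: "i < n" by (simp add: eval_poly_vec_def)
  show "eval_poly_vec n A v (Polynomial.smult c q) $ i = (c \<cdot>\<^sub>v eval_poly_vec n A v q) $ i"
    using i eval_poly_vec_index[OF degree_smult_le[of c q] i, of A v] eval_poly_vec_index[of q "degree q" i n A v]
    by (simp add: sum_distrib_left mult.assoc del: index_mult_mat_vec)
qed (simp_all add: eval_poly_vec_def)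

lemma pow_mult_eval_poly_vec:
  assumes A: "A \<in> carrier_mat n n" and v: "v \<in> carrier_vec n" and r: "r < n"
  shows "(A ^\<^sub>m m *\<^sub>v eval_poly_vec n A v q) $ r = (\<Sum>i\<le>degree q. coeff q i * (A ^\<^sub>m (m + i) *\<^sub>v v) $ r)"
proof -
  have "(A ^\<^sub>m m *\<^sub>v eval_poly_vec n A v q) $ r = (\<Sum>l<n. (A ^\<^sub>m m) $$ (r, l) * (\<Sum>i\<le>degree q. coeff q i * (A ^\<^sub>m i *\<^sub>v v) $ l))"
    by (subst index_mult_vec_sum[of _ n n]) (use A r in \<open>auto simp: eval_poly_vec_def simp del: index_mult_mat_vec\<close>)
  also have "\<dots> = (\<Sum>l<n. \<Sum>i\<le>degree q. coeff q i * ((A ^\<^sub>m m) $$ (r, l) * (A ^\<^sub>m i *\<^sub>v v) $ l))"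
    by (simp add: sum_distrib_left mult_ac del: index_mult_mat_vec)
  also have "\<dots> = (\<Sum>i\<le>degree q. coeff q i * (A ^\<^sub>m m *\<^sub>v (A ^\<^sub>m i *\<^sub>v v)) $ r)"
    by (subst sum.swap, subst index_mult_vec_sum[of "A ^\<^sub>m m" n n])
       (use A v r in \<open>auto simp: sum_distrib_left simp del: index_mult_mat_vec\<close>)
  finally show ?thesis
    using A v by (simp add: pow_mat_add[OF A] assoc_mult_mat_vec[of _ n n _ n] del: index_mult_mat_vec)
qed

lemma intertwine_eval_poly_mat:
  assumes A: "A \<in> carrier_mat n n" and B: "B \<in> carrier_mat n n" and X: "X \<in> carrier_mat n n" and c: "X * A = B * X"
  shows "X * eval_poly_mat n P A = eval_poly_mat n P B * X"
proof (induction P)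
  case (pCons a P)
  have "X * (A * eval_poly_mat n P A) = (X * A) * eval_poly_mat n P A"
    using A X by (simp add: assoc_mult_mat[of _ n n _ n _ n])
  also have "\<dots> = B * (X * eval_poly_mat n P A)"
    using B X by (simp add: c assoc_mult_mat[of _ n n _ n _ n])
  also have "\<dots> = (B * eval_poly_mat n P B) * X"
    using B X by (simp add: pCons.IH assoc_mult_mat[of _ n n _ n _ n])
  finally show ?case unfolding eval_poly_mat_pCons[OF A] eval_poly_mat_pCons[OF B]
    using A B X by (simp add: add_mult_distrib_mat[of _ n n _ _ n] mult_add_distrib_mat[of _ n n _ n]
        mult_smult_assoc_mat[of _ n n _ n] mult_smult_distrib[of _ n n _ n]
        right_mult_one_mat[of _ n n] left_mult_one_mat[of _ n n])
qed (use X in auto)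

text \<open>Let \<open>k\<close> be the nilpotency index, and let the entry \<open>(a, b)\<close> of \<open>H ^ (k - 1)\<close> be nonzero. The
  cyclic subspace of the unit vector \<open>b\<close> and the subspace of all \<open>v\<close> such that the coordinate \<open>a\<close> of each
  \<open>H ^ i v\<close> vanishes are complementary: on the former, these coordinates determine the coefficients of the
  powers of \<open>H\<close>, and they can take any values. As the former is nonzero, the latter is zero. So the matrix \<open>R\<close> whose rows
  are the rows \<open>a\<close> of the powers of \<open>H\<close> is injective, and \<open>R H\<close> is \<open>R\<close> with its rows shifted, which is the effect
  of the Jordan block.\<close>

lemma nilpotent_indecomposable_jordan:
  fixes H :: "complex mat"
  assumes H: "H \<in> carrier_mat n n" and nil: "H ^\<^sub>m n = 0\<^sub>m n n" and n: "n > 0"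
    and ind: "\<And>W1 W2. vec_subspace n W1 \<Longrightarrow> vec_subspace n W2 \<Longrightarrow> \<forall>v\<in>W1. H *\<^sub>v v \<in> W1 \<Longrightarrow> \<forall>v\<in>W2. H *\<^sub>v v \<in> W2 \<Longrightarrow>
       W1 \<inter> W2 \<subseteq> {0\<^sub>v n} \<Longrightarrow> \<forall>v\<in>carrier_vec n. \<exists>a\<in>W1. \<exists>b\<in>W2. v = a + b \<Longrightarrow> W1 \<subseteq> {0\<^sub>v n} \<or> W2 \<subseteq> {0\<^sub>v n}"
  obtains R P where "R \<in> carrier_mat n n" "P \<in> carrier_mat n n" "R * P = 1\<^sub>m n" "P * R = 1\<^sub>m n"
    "R * H = jordan_block n 0 * R"
proof -
  define k where "k = (LEAST k. H ^\<^sub>m k = 0\<^sub>m n n)"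
  have Hk: "H ^\<^sub>m k = 0\<^sub>m n n" unfolding k_def by (rule LeastI[of _ n]) (rule nil)
  have kn: "k \<le> n" unfolding k_def by (rule Least_le) (rule nil)
  have k0: "k \<noteq> 0"
  proof
    assume "k = 0"
    hence "(1\<^sub>m n :: complex mat) $$ (0, 0) = 0\<^sub>m n n $$ (0, 0)" using Hk H by simp
    thus False using n by simp
  qed
  have above: "H ^\<^sub>m i = 0\<^sub>m n n" if "i \<ge> k" for i
    using pow_mat_add[OF H, of k "i - k"] that Hk H by simp
  have "H ^\<^sub>m (k - 1) \<noteq> 0\<^sub>m n n"
    using not_less_Least[of "k - 1" "\<lambda>k. H ^\<^sub>m k = 0\<^sub>m n n"] k0 by (auto simp: k_def)
  moreover have Hc: "H ^\<^sub>m i \<in> carrier_mat n n" for i using H by simp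
  ultimately obtain a b where ab: "a < n" "b < n" "(H ^\<^sub>m (k - 1)) $$ (a, b) \<noteq> 0"
    by (metis eq_matI carrier_matD index_zero_mat)
  define w where "w = (unit_vec n b :: complex vec)"
  have w: "w \<in> carrier_vec n" by (simp add: w_def)
  define h where "h = (H ^\<^sub>m (k - 1) *\<^sub>v w) $ a"
  have h: "h \<noteq> 0" using ab carrier_matD[OF Hc[of "k - 1"]] by (simp add: h_def w_def del: pow_mat_dim)
  have vz: "(H ^\<^sub>m i *\<^sub>v v) $ a = 0" if "i \<ge> k" "v \<in> carrier_vec n" for i v
    using above[OF that(1)] that(2) ab by simp
  have Hw: "H ^\<^sub>m (i + d) *\<^sub>v v = H ^\<^sub>m i *\<^sub>v (H ^\<^sub>m d *\<^sub>v v)" if "v \<in> carrier_vec n" for i d v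
    using H that pow_mat_add[OF H, of i d] by (simp add: assoc_mult_mat_vec[of _ n n _ n])
  \<comment> \<open>the cyclic subspace and its complement\<close>
  define W1 where "W1 = range (eval_poly_vec n H w)"
  define W2 where "W2 = {v \<in> carrier_vec n. \<forall>i. (H ^\<^sub>m i *\<^sub>v v) $ a = 0}"
  have sub1: "vec_subspace n W1"
    unfolding vec_subspace_def W1_def
  proof (intro conjI ballI allI)
    show "0\<^sub>v n \<in> range (eval_poly_vec n H w)"
      by (rule image_eqI[of _ _ 0]) (auto simp: eval_poly_vec_def)
  qed (auto simp: eval_poly_vec_add[symmetric] eval_poly_vec_smult[symmetric])
  have lin: "(H ^\<^sub>m i *\<^sub>v (u + v)) $ a = (H ^\<^sub>m i *\<^sub>v u) $ a + (H ^\<^sub>m i *\<^sub>v v) $ a"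
    "(H ^\<^sub>m i *\<^sub>v (u - v)) $ a = (H ^\<^sub>m i *\<^sub>v u) $ a - (H ^\<^sub>m i *\<^sub>v v) $ a"
    "(H ^\<^sub>m i *\<^sub>v (d \<cdot>\<^sub>v u)) $ a = d * (H ^\<^sub>m i *\<^sub>v u) $ a"
    if "u \<in> carrier_vec n" "v \<in> carrier_vec n" for u v i d
    using that ab Hc[of i] carrier_matD[OF Hc[of i]] mult_add_distrib_mat_vec[OF Hc, of u v i] mult_minus_distrib_mat_vec[OF Hc, of u v i]
      mult_mat_vec[OF Hc, of u i d] by (simp_all del: index_mult_mat_vec pow_mat_dim add: dim_mult_mat_vec)
  have sub2: "vec_subspace n W2"
    unfolding vec_subspace_def W2_def
  proof (intro conjI ballI allI)
    show "0\<^sub>v n \<in> {v \<in> carrier_vec n. \<forall>i. (H ^\<^sub>m i *\<^sub>v v) $ a = 0}"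
      using ab Hc by (simp del: index_mult_mat_vec)
  qed (auto simp: lin simp del: index_mult_mat_vec)
  have inv1: "\<forall>v\<in>W1. H *\<^sub>v v \<in> W1"
  proof
    fix v assume "v \<in> W1"
    then obtain q where q: "v = eval_poly_vec n H w q" by (auto simp: W1_def)
    have "eval_poly_vec n H w ([:-0, 1:] * q) = H *\<^sub>v v - 0 \<cdot>\<^sub>v v"
      unfolding q by (rule eval_poly_vec_linear_factor[OF H w])
    also have "\<dots> = H *\<^sub>v v" using H by (auto simp: q eval_poly_vec_def intro!: eq_vecI)
    finally show "H *\<^sub>v v \<in> W1" by (metis W1_def rangeI)
  qed
  have inv2: "\<forall>v\<in>W2. H *\<^sub>v v \<in> W2"
  proof
    fix v assume v: "v \<in> W2"
    hence vc: "v \<in> carrier_vec n" by (simp add: W2_def)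
    have "H ^\<^sub>m i *\<^sub>v (H *\<^sub>v v) = H ^\<^sub>m Suc i *\<^sub>v v" for i
      using H vc by (simp add: assoc_mult_mat_vec[of _ n n _ n])
    thus "H *\<^sub>v v \<in> W2" using v H vc by (simp add: W2_def del: pow_mat.simps index_mult_mat_vec)
  qed
  have cap: "W1 \<inter> W2 \<subseteq> {0\<^sub>v n}"
  proof
    fix v assume v: "v \<in> W1 \<inter> W2"
    then obtain q where q: "v = eval_poly_vec n H w q" by (auto simp: W1_def)
    have "coeff q j = 0" if "j < k" for j
      using that
    proof (induction j rule: less_induct)
      case (less j)
      let ?m = "k - 1 - j"
      have "0 = (H ^\<^sub>m ?m *\<^sub>v v) $ a" using v by (simp add: W2_def)
      also have "\<dots> = (\<Sum>i\<le>degree q. coeff q i * (H ^\<^sub>m (?m + i) *\<^sub>v w) $ a)"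
        unfolding q by (rule pow_mult_eval_poly_vec[OF H w ab(1)])
      also have "\<dots> = (\<Sum>i\<in>{..degree q}. if i = j then coeff q j * h else 0)"
      proof (rule sum.cong[OF refl])
        fix i
        show "coeff q i * (H ^\<^sub>m (?m + i) *\<^sub>v w) $ a = (if i = j then coeff q j * h else 0)"
        proof (cases i j rule: linorder_cases)
          case greater
          hence "?m + i \<ge> k" using less.prems by simp
          with vz[OF this w] greater show ?thesis by simp
        qed (use less in \<open>auto simp: h_def simp del: index_mult_mat_vec\<close>)
      qed
      also have "\<dots> = coeff q j * h" by (auto simp: coeff_eq_0)
      finally show ?case using h by simp
    qed
    hence "coeff q i * (H ^\<^sub>m i *\<^sub>v w) $ r = 0" if "r < n" for i r
      using above[of i] w that by (cases "i < k") auto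
    hence "v = 0\<^sub>v n" unfolding q eval_poly_vec_def by (intro eq_vecI) (auto simp del: index_mult_mat_vec)
    thus "v \<in> {0\<^sub>v n}" by simp
  qed
  have split: "\<forall>v\<in>carrier_vec n. \<exists>a\<in>W1. \<exists>b\<in>W2. v = a + b"
  proof
    fix v :: "complex vec" assume v: "v \<in> carrier_vec n"
    \<comment> \<open>by induction on \<open>m\<close>, the coordinates for the highest \<open>m\<close> powers are removed\<close>
    have "\<exists>q. \<forall>i\<ge>k - m. (H ^\<^sub>m i *\<^sub>v (v - eval_poly_vec n H w q)) $ a = 0" if "m \<le> k" for m
      using that
    proof (induction m)
      case 0
      show ?case by (rule exI[of _ 0]) (use vz v in auto)
    next
      case (Suc m)
      then obtain q where q: "\<forall>i\<ge>k - m. (H ^\<^sub>m i *\<^sub>v (v - eval_poly_vec n H w q)) $ a = 0" by auto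
      define s where "s = (H ^\<^sub>m (k - Suc m) *\<^sub>v (v - eval_poly_vec n H w q)) $ a / h"
      define q' where "q' = monom s m"
      have ev: "(H ^\<^sub>m i *\<^sub>v eval_poly_vec n H w q') $ a = s * (H ^\<^sub>m (i + m) *\<^sub>v w) $ a" for i
      proof -
        have "(H ^\<^sub>m i *\<^sub>v eval_poly_vec n H w q') $ a = (\<Sum>j\<le>degree q'. coeff q' j * (H ^\<^sub>m (i + j) *\<^sub>v w) $ a)"
          by (rule pow_mult_eval_poly_vec[OF H w ab(1)])
        also have "\<dots> = (\<Sum>j\<le>m. if j = m then s * (H ^\<^sub>m (i + m) *\<^sub>v w) $ a else 0)"
        proof (cases "s = 0")
          case False
          hence "degree q' = m" by (simp add: q'_def degree_monom_eq)
          thus ?thesis by (intro sum.cong) (auto simp: q'_def)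
        qed (simp add: q'_def)
        finally show ?thesis by simp
      qed
      have "(H ^\<^sub>m i *\<^sub>v (v - eval_poly_vec n H w (q + q'))) $ a = 0" if i: "i \<ge> k - Suc m" for i
      proof -
        have eq: "v - eval_poly_vec n H w (q + q') = (v - eval_poly_vec n H w q) - eval_poly_vec n H w q'"
          using v carrier_vecD[OF eval_poly_vec_carrier[of n H w]]
          by (auto simp: eval_poly_vec_add intro!: eq_vecI)
        have "(H ^\<^sub>m i *\<^sub>v (v - eval_poly_vec n H w (q + q'))) $ a =
          (H ^\<^sub>m i *\<^sub>v (v - eval_poly_vec n H w q)) $ a - s * (H ^\<^sub>m (i + m) *\<^sub>v w) $ a"
          unfolding eq ev[symmetric] by (rule lin(2)) (use v in auto)
        also have "\<dots> = 0"
        proof (cases "i = k - Suc m")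
          case True
          hence "i + m = k - 1" using Suc.prems by simp
          hence "(H ^\<^sub>m (i + m) *\<^sub>v w) $ a = h" by (simp add: h_def)
          thus ?thesis using True h by (simp add: s_def del: index_mult_mat_vec)
        next
          case False
          hence "i \<ge> k - m" "i + m \<ge> k" using i Suc.prems by auto
          thus ?thesis using q vz[OF _ w] by (simp del: index_mult_mat_vec)
        qed
        finally show ?thesis .
      qed
      thus ?case by blast
    qed
    from this[of k] obtain q where q: "\<forall>i. (H ^\<^sub>m i *\<^sub>v (v - eval_poly_vec n H w q)) $ a = 0" by auto
    show "\<exists>a\<in>W1. \<exists>b\<in>W2. v = a + b"
    proof (intro bexI)
      show "v = eval_poly_vec n H w q + (v - eval_poly_vec n H w q)"
        using v carrier_vecD[OF eval_poly_vec_carrier[of n H w q]] by (auto intro!: eq_vecI)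
    qed (use q v in \<open>auto simp: W1_def W2_def simp del: index_mult_mat_vec\<close>)
  qed
  have "W1 \<subseteq> {0\<^sub>v n} \<or> W2 \<subseteq> {0\<^sub>v n}" by (rule ind[OF sub1 sub2 inv1 inv2 cap split])
  moreover have "w \<in> W1"
  proof -
    have "eval_poly_vec n H w 1 = w" using w H by (auto simp: eval_poly_vec_def intro!: eq_vecI)
    thus ?thesis by (metis W1_def rangeI)
  qed
  moreover have "w \<noteq> 0\<^sub>v n" using ab by (simp add: w_def)
  ultimately have W2: "W2 \<subseteq> {0\<^sub>v n}" by blast
  define R where "R = mat n n (\<lambda>(i, j). (H ^\<^sub>m i) $$ (a, j))"
  have R: "R \<in> carrier_mat n n" by (simp add: R_def)
  have "det R \<noteq> 0"
  proof
    assume "det R = 0"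
    then obtain v where v: "v \<in> carrier_vec n" "v \<noteq> 0\<^sub>v n" "R *\<^sub>v v = 0\<^sub>v n"
      using det_0_iff_vec_prod_zero_field[OF R] by auto
    have "(H ^\<^sub>m i *\<^sub>v v) $ a = 0" for i
    proof (cases "i < n")
      case True
      have "(H ^\<^sub>m i *\<^sub>v v) $ a = (R *\<^sub>v v) $ i"
        unfolding index_mult_vec_sum[OF R v(1) True] index_mult_vec_sum[OF Hc v(1) ab(1)]
        using True by (simp add: R_def)
      thus ?thesis using v True by simp
    next
      case False
      thus ?thesis using vz[OF _ v(1)] kn by simp
    qed
    hence "v \<in> W2" using v by (simp add: W2_def)
    with W2 v(2) show False by blast
  qed
  then obtain P where P: "P \<in> carrier_mat n n" "R * P = 1\<^sub>m n" "P * R = 1\<^sub>m n"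
    using det_non_zero_imp_unit[OF R] by (auto simp: Units_def ring_mat_simps)
  have "R * H = jordan_block n 0 * R"
  proof (rule eq_matI)
    fix i j assume "i < dim_row (jordan_block n 0 * R)" "j < dim_col (jordan_block n 0 * R)"
    hence ij: "i < n" "j < n" by (auto simp: R_def)
    have "(R * H) $$ (i, j) = (\<Sum>l<n. (H ^\<^sub>m i) $$ (a, l) * H $$ (l, j))"
      unfolding index_mult_mat_sum[OF R H ij] using ij by (simp add: R_def)
    also have "\<dots> = (H ^\<^sub>m Suc i) $$ (a, j)"
      unfolding pow_mat.simps by (rule index_mult_mat_sum[OF Hc H ab(1) ij(2), symmetric])
    finally have L: "(R * H) $$ (i, j) = (H ^\<^sub>m Suc i) $$ (a, j)" .
    have "(jordan_block n 0 * R) $$ (i, j) = (\<Sum>l<n. jordan_block n 0 $$ (i, l) * R $$ (l, j))"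
      by (rule index_mult_mat_sum[OF jordan_block_carrier R ij])
    also have "\<dots> = (\<Sum>l<n. if l = Suc i then (H ^\<^sub>m l) $$ (a, j) else 0)"
      by (rule sum.cong) (use ij in \<open>auto simp: R_def simp del: pow_mat.simps\<close>)
    also have "\<dots> = (if Suc i < n then (H ^\<^sub>m Suc i) $$ (a, j) else 0)"
      by (subst sum.delta) (simp_all del: pow_mat.simps)
    also have "\<dots> = (H ^\<^sub>m Suc i) $$ (a, j)"
      using above[of "Suc i"] kn ab ij by (auto simp del: pow_mat.simps)
    finally show "(R * H) $$ (i, j) = (jordan_block n 0 * R) $$ (i, j)" using L by simp
  qed (use R H in auto)
  with R P that show ?thesis by blast
qed

section \<open>Classification of indecomposable solutions\<close>

lemma smult_mat_mult_vec:
  fixes A :: "'a :: comm_semiring_1 mat"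
  shows "A \<in> carrier_mat n n \<Longrightarrow> v \<in> carrier_vec n \<Longrightarrow> (k \<cdot>\<^sub>m A) *\<^sub>v v = k \<cdot>\<^sub>v (A *\<^sub>v v)"
  by (rule eq_vecI) auto

lemma smult_smult_mat: "a \<cdot>\<^sub>m (b \<cdot>\<^sub>m A) = (a * b :: 'a :: semigroup_mult) \<cdot>\<^sub>m A"
  by (rule eq_matI) (auto simp: mult.assoc)

text \<open>Roots of unity among Laurent series are constant, because \<open>p \<mu> ^ (p - 1) \<mu>' = 0\<close>.\<close>

lemma fls_root_of_unity:
  assumes p: "p > 0" and \<mu>: "\<mu> ^ p = (1 :: complex fls)"
  obtains m where "\<mu> = fls_const m" "m ^ p = 1"
proof -
  have "\<mu> \<noteq> 0" using p \<mu> by (auto simp: power_0_left)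
  have "ddx p (\<mu> ^ Suc (p - 1)) = fls_const (of_nat (Suc (p - 1))) * \<mu> ^ (p - 1) * ddx p \<mu>"
    by (rule ddx_power)
  hence "ddx p \<mu> = 0" using p \<mu> \<open>\<mu> \<noteq> 0\<close> by (simp del: power_Suc of_nat_Suc)
  hence \<mu>c: "\<mu> = fls_const (fls_nth \<mu> 0)" by (rule ddx_eq_0_imp_const[OF p])
  have "fls_const (fls_nth \<mu> 0 ^ p) = fls_const 1" using \<mu> \<mu>c by (metis fls_const_1 fls_const_power)
  hence "fls_nth \<mu> 0 ^ p = 1" by simp
  with \<mu>c that show ?thesis by blast
qed

lemma primitive_root_powers:
  assumes \<zeta>: "primitive_root p \<zeta>" and m: "m ^ p = 1"
  obtains l where "l < p" "m = \<zeta> ^ l"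
proof -
  have p: "p > 0" "\<zeta> ^ p = 1" and prim: "\<And>k. 0 < k \<Longrightarrow> k < p \<Longrightarrow> \<zeta> ^ k \<noteq> 1"
    using \<zeta> by (auto simp: primitive_root_def)
  have \<zeta>0: "\<zeta> \<noteq> 0" using p by (auto simp: power_0_left)
  have "inj_on (\<lambda>l. \<zeta> ^ l) {..<p}"
  proof (rule linorder_inj_onI)
    fix i j assume ij: "i < j" "i \<in> {..<p}" "j \<in> {..<p}"
    show "\<zeta> ^ i \<noteq> \<zeta> ^ j"
    proof
      assume "\<zeta> ^ i = \<zeta> ^ j"
      also have "\<zeta> ^ j = \<zeta> ^ i * \<zeta> ^ (j - i)" using ij by (simp add: power_add[symmetric])
      finally have "\<zeta> ^ (j - i) = 1" using \<zeta>0 by simp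
      moreover have "0 < j - i" "j - i < p" using ij by auto
      ultimately show False using prim by blast
    qed
  qed auto
  hence "card ((\<lambda>l. \<zeta> ^ l) ` {..<p}) = card {z. z ^ p = (1 :: complex)}"
    using p by (simp add: card_image card_roots_unity_eq)
  moreover have "(\<lambda>l. \<zeta> ^ l) ` {..<p} \<subseteq> {z. z ^ p = 1}"
    using p by (auto simp: power_mult[symmetric] mult.commute[of _ p]) (simp add: power_mult)
  moreover have "finite {z. z ^ p = (1 :: complex)}"
    using card_roots_unity_eq[OF p(1)] p(1) by (intro card_ge_0_finite) simp
  ultimately have "(\<lambda>l. \<zeta> ^ l) ` {..<p} = {z. z ^ p = 1}" by (intro card_subset_eq)
  with m that show ?thesis by blast
qed

lemma mat_sum_mult_vec_in_subspace:
  assumes W: "vec_subspace n W" and K: "finite K" and X: "\<And>i. i \<in> K \<Longrightarrow> X i \<in> carrier_mat n n"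
    and v: "v \<in> carrier_vec n" and Xv: "\<And>i. i \<in> K \<Longrightarrow> X i *\<^sub>v v \<in> W"
  shows "mat_sum n K b X *\<^sub>v v \<in> W"
  using K X Xv
proof (induction K)
  case empty
  have "mat_sum n {} b X *\<^sub>v v = 0\<^sub>v n" using v by (auto simp: mat_sum_def scalar_prod_def intro!: eq_vecI)
  thus ?case using W by (simp add: vec_subspace_def)
next
  case (insert i K)
  have Xi: "X i \<in> carrier_mat n n" using insert.prems by auto
  have "mat_sum n (insert i K) b X = b i \<cdot>\<^sub>m X i + mat_sum n K b X"
    using insert(1,2) carrier_matD[OF Xi] by (intro eq_matI) (auto simp: mat_sum_index)
  hence "mat_sum n (insert i K) b X *\<^sub>v v = b i \<cdot>\<^sub>v (X i *\<^sub>v v) + mat_sum n K b X *\<^sub>v v"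
    using Xi v by (simp add: add_mult_distrib_mat_vec[of _ n n] smult_mat_mult_vec[of _ n])
  thus ?case using W insert by (simp add: vec_subspace_def)
qed

context scalar_data
begin

text \<open>The coefficients of the solution are polynomials in \<open>H\<close>, so subspaces that are invariant under \<open>H\<close> are invariant under the modes.\<close>

lemma coeff_mat_sol:
  assumes H: "H \<in> carrier_mat n n"
  shows "\<exists>b. coeff_mat (sol n a H) k = mat_sum n {..<n} b (\<lambda>i. H ^\<^sub>m i)"
proof (intro exI eq_matI)
  let ?g = "\<lambda>i. fls_const a * \<rho> * fls_const ((- 1 / of_nat p) gchoose i) * \<kappa> ^ i"
  let ?b = "\<lambda>i. fls_nth (?g i) k"
  fix r s assume "r < dim_row (mat_sum n {..<n} ?b (\<lambda>i. H ^\<^sub>m i))" "s < dim_col (mat_sum n {..<n} ?b (\<lambda>i. H ^\<^sub>m i))"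
  hence rs: "r < n" "s < n" by auto
  have pw: "((\<kappa> \<cdot>\<^sub>m const_mat H) ^\<^sub>m i) $$ (r, s) = \<kappa> ^ i * fls_const ((H ^\<^sub>m i) $$ (r, s))" for i
    using H rs carrier_matD[OF pow_carrier_mat[OF H, of i]]
    by (simp add: pow_mat_smult[of _ n] const_mat_pow[of _ n, symmetric] del: pow_mat_dim)
  have "sol n a H $$ (r, s) = (\<Sum>i<n. ?g i * fls_const ((H ^\<^sub>m i) $$ (r, s)))"
    using rs by (simp add: sol_def binomial_mat_def pw sum_distrib_left mult_ac)
  thus "coeff_mat (sol n a H) k $$ (r, s) = mat_sum n {..<n} ?b (\<lambda>i. H ^\<^sub>m i) $$ (r, s)"
    using rs carrier_matD[OF sol_carrier[of n a H]] by (simp add: mat_sum_index fls_nth_sum)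
qed (auto simp: sol_def binomial_mat_def)

lemma sol_similar:
  assumes H: "H \<in> carrier_mat n n" and J: "J \<in> carrier_mat n n" and R: "R \<in> carrier_mat n n" and RH: "R * H = J * R"
  shows "const_mat R * sol n a H = sol n a J * const_mat R"
proof -
  have "const_mat R * (\<kappa> \<cdot>\<^sub>m const_mat H) = (\<kappa> \<cdot>\<^sub>m const_mat J) * const_mat R"
    using H J R RH by (simp add: mult_smult_distrib[of _ n n _ n] mult_smult_assoc_mat[of _ n n _ n] const_mat_mult[of _ n, symmetric])
  hence "const_mat R * binomial_mat n (- 1 / of_nat p) (\<kappa> \<cdot>\<^sub>m const_mat H) = binomial_mat n (- 1 / of_nat p) (\<kappa> \<cdot>\<^sub>m const_mat J) * const_mat R"
    unfolding binomial_mat_eval using H J R by (intro intertwine_eval_poly_mat) auto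
  thus ?thesis using R unfolding sol_def
    by (simp add: mult_smult_distrib[of _ n n _ n] mult_smult_assoc_mat[of _ n n _ n])
qed

text \<open>On the kernel of \<open>H\<close>, only the constant term of the binomial series acts.\<close>

lemma sol_kernel_vector:
  assumes H: "H \<in> carrier_mat n n" and n: "n > 0" and w: "w \<in> carrier_vec n" and Hw: "H *\<^sub>v w = 0\<^sub>v n"
  shows "sol n a H *\<^sub>v map_vec fls_const w = (fls_const a * \<rho>) \<cdot>\<^sub>v map_vec fls_const w"
proof -
  let ?v = "map_vec fls_const w"
  have v: "?v \<in> carrier_vec n" using w by simp
  have "const_mat H *\<^sub>v ?v = map_vec fls_const (H *\<^sub>v w)" by (rule const_mat_mult_vec[OF H w])
  also have "\<dots> = 0\<^sub>v n" unfolding Hw by auto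
  finally have *: "(\<kappa> \<cdot>\<^sub>m const_mat H) *\<^sub>v ?v = 0 \<cdot>\<^sub>v ?v"
    using H v by (auto intro!: eq_vecI simp: vec_eq_iff)
  have "poly_fls f 0 = fls_const (coeff f 0)" for f
    unfolding poly_fls_def by (subst sum.remove[of _ 0]) auto
  hence "poly_fls (binomial_poly n (- 1 / of_nat p)) 0 = 1"
    using n by (simp add: coeff_binomial_poly)
  hence "binomial_mat n (- 1 / of_nat p) (\<kappa> \<cdot>\<^sub>m const_mat H) *\<^sub>v ?v = 1 \<cdot>\<^sub>v ?v"
    unfolding binomial_mat_eval using eval_poly_mat_eigenvector(2)[OF _ v *] H by simp
  thus ?thesis unfolding sol_def using w
    by (subst smult_mat_mult_vec[of _ n]) auto
qed

end

text \<open>The mean of the powers of a matrix of finite order is the projection to its fixed vectors.\<close>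

lemma cyclic_average:
  assumes "commuting_matrices n p G" and C: "C \<in> commuting_matrices.D n G" and Cp: "C ^\<^sub>m p = 1\<^sub>m n"
  defines "E \<equiv> fls_const (1 / of_nat p) \<cdot>\<^sub>m mat_sum n {..<p} (\<lambda>_. 1) (\<lambda>j. C ^\<^sub>m j)"
  shows "E \<in> commuting_matrices.D n G" "E * E = E" "C * E = E"
    "v \<in> carrier_vec n \<Longrightarrow> C *\<^sub>v v = v \<Longrightarrow> E *\<^sub>v v = v"
proof -
  interpret commuting_matrices n p G by fact
  let ?S = "mat_sum n {..<p} (\<lambda>_. 1) (\<lambda>j. C ^\<^sub>m j)"
  have Cc: "C \<in> carrier_mat n n" using C by simp
  have pw: "C ^\<^sub>m j \<in> carrier_mat n n" for j using Cc by simp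
  show ED: "E \<in> D" unfolding E_def by (intro D_smult D_mat_sum D_pow C)
  have "C * ?S = mat_sum n {..<p} (\<lambda>_. 1) (\<lambda>j. C * C ^\<^sub>m j)" by (rule mat_sum_mult_left[OF pw Cc])
  also have "\<dots> = ?S"
  proof (rule eq_matI)
    fix r s assume "r < dim_row ?S" "s < dim_col ?S"
    hence rs: "r < n" "s < n" by auto
    have "(\<Sum>j<p. (C * C ^\<^sub>m j) $$ (r, s)) = (\<Sum>j<p. (C ^\<^sub>m Suc j) $$ (r, s))"
      by (simp only: pow_mat_Suc_left[OF Cc])
    also have "\<dots> = (\<Sum>j<Suc p. (C ^\<^sub>m j) $$ (r, s)) - (C ^\<^sub>m 0) $$ (r, s)"
      by (subst sum.lessThan_Suc_shift) simp
    also have "\<dots> = (\<Sum>j<p. (C ^\<^sub>m j) $$ (r, s))" using Cc Cp by simp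
    finally show "mat_sum n {..<p} (\<lambda>_. 1) (\<lambda>j. C * C ^\<^sub>m j) $$ (r, s) = ?S $$ (r, s)"
      using rs by (simp add: mat_sum_index del: index_mult_mat)
  qed auto
  finally have "C * ?S = ?S" .
  thus CE: "C * E = E" unfolding E_def using Cc by (simp add: mult_smult_distrib[of _ n n _ n])
  have CjE: "C ^\<^sub>m j * E = E" for j
  proof (induction j)
    case (Suc j)
    thus ?case using Cc ED by (simp add: assoc_mult_mat[of _ n n _ n _ n] CE)
  qed (use Cc left_mult_one_mat[of E n n] ED in auto)
  have avg: "fls_const (1 / of_nat p) * (of_nat p * x) = x" for x :: "complex fls"
    using p_pos by (simp add: fls_of_nat mult.assoc[symmetric])
  have "?S * E = mat_sum n {..<p} (\<lambda>_. 1) (\<lambda>j. E)"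
    using mat_sum_mult_right[OF pw, where K = "{..<p}" and W = E and a = "\<lambda>_. 1"] ED by (simp add: CjE)
  hence "E * E = fls_const (1 / of_nat p) \<cdot>\<^sub>m mat_sum n {..<p} (\<lambda>_. 1) (\<lambda>j. E)"
    unfolding E_def by (subst mult_smult_assoc_mat[of _ n n _ n]) (auto simp: E_def)
  also have "\<dots> = E" by (rule eq_matI) (use ED in \<open>auto simp: mat_sum_index avg\<close>)
  finally show "E * E = E" .
  assume v: "v \<in> carrier_vec n" and Cv: "C *\<^sub>v v = v"
  have Cjv: "C ^\<^sub>m j *\<^sub>v v = v" for j
    using eval_poly_mat_eigenvector(1)[OF Cc v, of 1 j] Cv v by simp
  show "E *\<^sub>v v = v"
  proof (rule eq_vecI)
    fix r assume "r < dim_vec v"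
    hence r: "r < n" using v by simp
    have "(E *\<^sub>v v) $ r = (\<Sum>l<n. fls_const (1 / of_nat p) * (\<Sum>j<p. (C ^\<^sub>m j) $$ (r, l)) * v $ l)"
      by (subst index_mult_vec_sum[of _ n n]) (use r v in \<open>auto simp: E_def mat_sum_index\<close>)
    also have "\<dots> = fls_const (1 / of_nat p) * (\<Sum>l<n. \<Sum>j<p. (C ^\<^sub>m j) $$ (r, l) * v $ l)"
      by (simp add: sum_distrib_left sum_distrib_right mult.assoc)
    also have "(\<Sum>l<n. \<Sum>j<p. (C ^\<^sub>m j) $$ (r, l) * v $ l) = (\<Sum>j<p. (C ^\<^sub>m j *\<^sub>v v) $ r)"
      unfolding index_mult_vec_sum[OF pw v r] by (rule sum.swap)
    also have "\<dots> = of_nat p * v $ r" by (simp add: Cjv)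
    finally show "(E *\<^sub>v v) $ r = v $ r" by (simp add: avg)
  qed (use v ED in auto)
qed

text \<open>The idempotents in the bicommutant are trivial, so by Fitting's lemma \<open>T\<close> is invertible. Its inverse
  \<open>p\<close>-th power solves the linear equation, so it is \<open>\<alpha> + q \<epsilon> H\<close> with \<open>H\<close> constant. The common
  eigenvector \<open>w\<close> has an eigenvalue \<open>\<tau>\<close> with a pole, so \<open>\<tau> ^ (- p)\<close> vanishes at the origin, where
  \<open>\<alpha> + q \<epsilon> H\<close> has the value \<open>q H\<close>; therefore \<open>H w = 0\<close>, and \<open>H\<close> is nilpotent, again by Fitting's lemma.
  Now \<open>T\<close> and the binomial root have the same \<open>p\<close>-th power. Their quotient \<open>C\<close> has order dividing \<open>p\<close>, and
  \<open>C w = \<mu> w\<close> for a root of unity \<open>\<mu>\<close>. The projection to the fixed vectors of \<open>C / \<mu>\<close> is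
  nonzero because of \<open>w\<close>, so it is 1, and \<open>C = \<mu>\<close>. Finally \<open>H\<close> leaves no splitting of the space, and so it is
  similar to a Jordan block.\<close>

theorem classification:
  assumes sd: "scalar_data p c1 c q \<alpha> \<epsilon> \<rho> \<kappa>"
    and ms: "matrix_solution n p T (monom c1 1 + monom c (p + 1))"
    and T0: "T \<noteq> 0\<^sub>m n n" and ind: "series_indecomposable n T"
    and \<gamma>: "\<gamma> ^ p = inverse (- (of_nat p * c))" and \<zeta>: "primitive_root p \<zeta>"
  obtains l R P where "l < p" "R \<in> carrier_mat n n" "P \<in> carrier_mat n n" "R * P = 1\<^sub>m n" "P * R = 1\<^sub>m n"
    "const_mat R * T = scalar_data.sol p \<rho> \<kappa> n (\<gamma> * \<zeta> ^ l) (jordan_block n 0) * const_mat R"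
proof -
  interpret scalar_data p c1 c q \<alpha> \<epsilon> \<rho> \<kappa> by fact
  interpret matrix_solution n p T "monom c1 1 + monom c (p + 1)" by fact
  note Tc = T_carrier
  have n: "n > 0"
  proof (rule ccontr)
    assume "\<not> n > 0"
    hence "T = 0\<^sub>m n n" using Tc by (auto intro!: eq_matI)
    with T0 show False by simp
  qed
  obtain k e Y where ft: "k \<ge> 1" "Y \<in> D" "e \<in> D" "e * e = e" "e = T ^\<^sub>m k * Y" "e \<noteq> 0\<^sub>m n n"
    by (rule fitting_T[OF T0])
  have e1: "e = 1\<^sub>m n" using idempotent_trivial[OF ind ft(3,4)] ft(6) by blast
  obtain w \<tau> where w: "w \<in> carrier_vec n" "w \<noteq> 0\<^sub>v n"
    and Tw: "T *\<^sub>v map_vec fls_const w = \<tau> \<cdot>\<^sub>v map_vec fls_const w"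
    and \<tau>: "\<tau> \<noteq> 0" "graded_fls p 1 \<tau>" "ddx p \<tau> = poly_fls (monom c1 1 + monom c (p + 1)) \<tau>"
    by (rule eigen_data[OF ft(3,4,6,5,1,2)])
  have sd\<tau>: "fls_subdegree \<tau> = -1" by (rule scalar_solution(1)[OF p_gt_1 \<tau>])
  define v where "v = map_vec fls_const w"
  have v: "v \<in> carrier_vec n" using w by (simp add: v_def)
  obtain r where r: "r < n" "w $ r \<noteq> 0" using w by (metis carrier_vecD eq_vecI index_zero_vec)
  have vne: "v \<noteq> 0\<^sub>v n"
    using r w by (metis v_def index_map_vec(1) carrier_vecD index_zero_vec(1) fls_const_nonzero)
  \<comment> \<open>the inverse power of \<open>T\<close>\<close>
  define Ti where "Ti = T ^\<^sub>m (k - 1) * Y"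
  have Ti: "Ti \<in> D" by (simp add: Ti_def ft)
  have TTi: "T * Ti = 1\<^sub>m n"
  proof -
    have "T * Ti = (T * T ^\<^sub>m (k - 1)) * Y" unfolding Ti_def using ft by (simp add: D_assoc)
    also have "T * T ^\<^sub>m (k - 1) = T ^\<^sub>m k" using pow_mat_Suc_left[OF Tc, of "k - 1"] ft(1) by simp
    finally show ?thesis using ft(5) e1 by simp
  qed
  define S where "S = Ti ^\<^sub>m p"
  have S: "S \<in> D" by (simp add: S_def Ti)
  have TS: "T ^\<^sub>m p * S = 1\<^sub>m n"
    unfolding S_def pow_mat_mult_commute[OF Tc D_carrier[OF Ti] D_commute[OF T_in_D Ti], symmetric] TTi by simp
  have ode: "mat_ddx p T = fls_const c1 \<cdot>\<^sub>m T + fls_const c \<cdot>\<^sub>m T ^\<^sub>m (p + 1)"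
    using T_ode Tc by (simp add: eval_poly_mat_add eval_poly_mat_monom left_mult_one_mat[of _ n n] del: pow_mat.simps(2))
       (simp add: left_mult_one_mat[of _ n n])
  note odeS = ode_inverse_power[OF T_in_D S TS ode]
  define \<epsilon>i where "\<epsilon>i = inverse \<epsilon>"
  have \<epsilon>0: "\<epsilon> \<noteq> 0" using \<epsilon>_0 by auto
  have \<epsilon>\<epsilon>i: "\<epsilon> * \<epsilon>i = 1" using \<epsilon>0 by (simp add: \<epsilon>i_def)
  have d\<epsilon>i: "ddx p \<epsilon>i = fls_const (of_nat p * c1) * \<epsilon>i"
  proof -
    have "ddx p (\<epsilon> * \<epsilon>i) = 0" by (simp add: \<epsilon>\<epsilon>i)
    hence "\<epsilon> * (ddx p \<epsilon>i - fls_const (of_nat p * c1) * \<epsilon>i) = 0"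
      by (simp add: ddx_mult ddx_\<epsilon> algebra_simps)
    thus ?thesis using \<epsilon>0 by simp
  qed
  \<comment> \<open>variation of constants: this quotient of solutions is constant\<close>
  define U where "U = \<epsilon>i \<cdot>\<^sub>m (S - \<alpha> \<cdot>\<^sub>m 1\<^sub>m n)"
  have UD: "U \<in> D" by (simp add: U_def S)
  have "mat_ddx p U = 0\<^sub>m n n"
  proof (rule eq_matI)
    fix i j assume "i < dim_row (0\<^sub>m n n :: complex fls mat)" "j < dim_col (0\<^sub>m n n :: complex fls mat)"
    hence ij: "i < n" "j < n" by auto
    have "ddx p (S $$ (i, j)) = mat_ddx p S $$ (i, j)" using ij S by (simp add: mat_ddx_def)
    also have "\<dots> = fls_const (- (of_nat p * c1)) * S $$ (i, j) + fls_const (- (of_nat p * c)) * 1\<^sub>m n $$ (i, j)"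
      unfolding odeS using ij S by simp
    finally have dS: "ddx p (S $$ (i, j)) = fls_const (- (of_nat p * c1)) * S $$ (i, j) + fls_const (- (of_nat p * c)) * 1\<^sub>m n $$ (i, j)" .
    have "ddx p (\<epsilon>i * (s - \<alpha> * t)) = 0"
      if "ddx p s = fls_const (- (of_nat p * c1)) * s + fls_const (- (of_nat p * c)) * t" "ddx p t = 0" for s t
      by (simp add: ddx_mult ddx_diff that d\<epsilon>i ddx_\<alpha> algebra_simps)
    moreover have "ddx p (1\<^sub>m n $$ (i, j)) = 0" using ij by (cases "i = j") auto
    ultimately have "ddx p (\<epsilon>i * (S $$ (i, j) - \<alpha> * 1\<^sub>m n $$ (i, j))) = 0" using dS by blast
    thus "mat_ddx p U $$ (i, j) = 0\<^sub>m n n $$ (i, j)"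
      using ij S by (simp add: U_def mat_ddx_def del: index_one_mat)
  qed (use UD in auto)
  hence Uc: "U = const_mat (coeff_mat U 0)" by (rule mat_ddx_eq_0_imp_const[OF p_pos D_carrier[OF UD]])
  define H where "H = (1 / q) \<cdot>\<^sub>m coeff_mat U 0"
  have H: "H \<in> carrier_mat n n" using UD by (simp add: H_def)
  have cH: "const_mat H = fls_const (1 / q) \<cdot>\<^sub>m U"
    by (subst Uc) (auto simp: H_def intro!: eq_matI)
  have HD: "const_mat H \<in> D" unfolding cH by (rule D_smult[OF UD])
  have S_eq: "S = inv_sol n H"
  proof (rule eq_matI)
    fix i j assume "i < dim_row (inv_sol n H)" "j < dim_col (inv_sol n H)"
    hence ij: "i < n" "j < n" using carrier_matD[OF inv_sol_carrier[OF H]] by auto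
    have "inv_sol n H $$ (i, j) = \<alpha> * 1\<^sub>m n $$ (i, j) + (fls_const q * \<epsilon>) * (fls_const (1 / q) * U $$ (i, j))"
      unfolding inv_sol_def cH using ij UD by simp
    also have "\<dots> = \<alpha> * 1\<^sub>m n $$ (i, j) + (fls_const q * fls_const (1 / q)) * ((\<epsilon> * \<epsilon>i) * (S $$ (i, j) - \<alpha> * 1\<^sub>m n $$ (i, j)))"
      using ij S by (simp add: U_def mult_ac)
    also have "\<dots> = S $$ (i, j)" using q_nonzero by (simp add: \<epsilon>\<epsilon>i)
    finally show "S $$ (i, j) = inv_sol n H $$ (i, j)" by simp
  qed (use S inv_sol_carrier[OF H] in auto)
  \<comment> \<open>\<open>H\<close> kills the eigenvector, because the eigenvalue of \<open>S\<close> vanishes at the origin\<close>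
  have Hw: "H *\<^sub>v w = 0\<^sub>v n"
  proof (rule eq_vecI)
    fix s assume "s < dim_vec (0\<^sub>v n :: complex vec)"
    hence s: "s < n" by simp
    have "v = (S * T ^\<^sub>m p) *\<^sub>v v" using TS D_commute[OF S D_pow[OF T_in_D, of p]] v by simp
    also have "\<dots> = S *\<^sub>v (\<tau> ^ p \<cdot>\<^sub>v v)"
      using S Tc v eval_poly_mat_eigenvector(1)[OF Tc v Tw[folded v_def], of p]
      by (simp add: assoc_mult_mat_vec[of _ n n _ n])
    also have "\<dots> = \<tau> ^ p \<cdot>\<^sub>v (S *\<^sub>v v)" using S v by (intro mult_mat_vec[of _ n n]) auto
    finally have "v $ s = \<tau> ^ p * (S *\<^sub>v v) $ s" using s S by (metis index_smult_vec(1) dim_mult_mat_vec D_dim(1))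
    hence Sv: "(S *\<^sub>v v) $ s = inverse \<tau> ^ p * v $ s" using \<tau>(1) by (simp add: field_simps)
    have "(S *\<^sub>v v) $ s = \<alpha> * v $ s + (fls_const q * \<epsilon>) * (const_mat H *\<^sub>v v) $ s"
      unfolding S_eq inv_sol_def using s H v
      by (subst add_mult_distrib_mat_vec[of _ n n]) (auto simp: smult_mat_mult_vec[of _ n])
    also have "const_mat H *\<^sub>v v = map_vec fls_const (H *\<^sub>v w)" unfolding v_def by (rule const_mat_mult_vec[OF H w(1)])
    finally have "fls_nth (inverse \<tau> ^ p * v $ s) 0 = fls_nth (\<alpha> * v $ s + (fls_const q * \<epsilon>) * map_vec fls_const (H *\<^sub>v w) $ s) 0"
      using Sv by simp
    hence "fls_nth (inverse \<tau> ^ p) 0 * w $ s = q * (H *\<^sub>v w) $ s"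
      using s w H by (simp add: v_def \<alpha>_0 \<epsilon>_0 del: index_mult_mat_vec)
    moreover have "fls_subdegree (inverse \<tau> ^ p) = int p" using \<tau>(1) sd\<tau> by (simp add: fls_subdegree_pow)
    hence "fls_nth (inverse \<tau> ^ p) 0 = 0" using p_pos by (intro fls_eq0_below_subdegree) simp
    ultimately show "(H *\<^sub>v w) $ s = 0\<^sub>v n $ s" using q_nonzero s by simp
  qed (use H in auto)
  \<comment> \<open>hence \<open>H\<close> is nilpotent\<close>
  have nil: "H ^\<^sub>m n = 0\<^sub>m n n"
  proof -
    obtain j e' Y' where f: "j \<ge> 1" "Y' \<in> D" "e' \<in> D" "e' * e' = e'" "e' = const_mat H ^\<^sub>m j * Y'"
        "const_mat H ^\<^sub>m j * e' = const_mat H ^\<^sub>m j"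
      by (rule fitting[OF HD])
    have Hv: "const_mat H *\<^sub>v v = 0\<^sub>v n"
      unfolding v_def const_mat_mult_vec[OF H w(1)] Hw by auto
    have "e' \<noteq> 1\<^sub>m n"
    proof
      assume "e' = 1\<^sub>m n"
      hence "v = e' *\<^sub>v v" using v by simp
      also have "e' = Y' * const_mat H ^\<^sub>m (j - 1) * const_mat H"
      proof -
        have "e' = Y' * const_mat H ^\<^sub>m j" using f HD by (simp add: D_commute)
        also have "const_mat H ^\<^sub>m j = const_mat H ^\<^sub>m (j - 1) * const_mat H" using f(1) by (metis Suc_pred' less_eq_Suc_le One_nat_def pow_mat.simps(2))
        finally show ?thesis using f HD by (simp add: D_assoc)
      qed
      also have "Y' * const_mat H ^\<^sub>m (j - 1) * const_mat H *\<^sub>v v = Y' * const_mat H ^\<^sub>m (j - 1) *\<^sub>v (const_mat H *\<^sub>v v)"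
        using f(2) H HD v by (intro assoc_mult_mat_vec[of _ n n _ n]) auto
      also have "\<dots> = 0\<^sub>v n" unfolding Hv using f(2) HD by (intro mult_mat_zero_vec) auto
      finally show False using vne by simp
    qed
    hence "e' = 0\<^sub>m n n" using idempotent_trivial[OF ind f(3,4)] by blast
    hence "const_mat H ^\<^sub>m j = 0\<^sub>m n n" using f(6) right_mult_zero_mat[OF pow_carrier_mat[OF D_carrier[OF HD]]] by metis
    hence "const_mat (H ^\<^sub>m j) = const_mat (0\<^sub>m n n)" using H by (simp add: const_mat_pow[of _ n]) (auto intro!: eq_matI)
    hence "H ^\<^sub>m j = 0\<^sub>m n n" by (rule const_mat_inj)
    thus ?thesis by (rule nilpotent_pow_dim[OF H])
  qed
  \<comment> \<open>two \<open>p\<close>-th roots of the same matrix\<close>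
  define B where "B = sol n \<gamma> H"
  have BD: "B \<in> D" unfolding B_def by (rule sol_in_D(1)[OF commuting_matrices_axioms HD])
  have BS: "B ^\<^sub>m p * S = 1\<^sub>m n" unfolding B_def S_eq by (rule sol_pow_inv_sol[OF H nil \<gamma>])
  define Bi where "Bi = B ^\<^sub>m (p - 1) * S"
  have BiD: "Bi \<in> D" by (simp add: Bi_def BD S)
  have BBi: "B * Bi = 1\<^sub>m n"
  proof -
    have "B * Bi = (B * B ^\<^sub>m (p - 1)) * S" unfolding Bi_def using BD S by (simp add: D_assoc)
    also have "B * B ^\<^sub>m (p - 1) = B ^\<^sub>m p" using pow_mat_Suc_left[OF D_carrier[OF BD], of "p - 1"] p_pos by simp
    finally show ?thesis using BS by simp
  qed
  have Bv: "B *\<^sub>v v = (fls_const \<gamma> * \<rho>) \<cdot>\<^sub>v v"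
    unfolding B_def v_def by (rule sol_kernel_vector[OF H n w(1) Hw])
  define \<mu> where "\<mu> = \<tau> / (fls_const \<gamma> * \<rho>)"
  have \<gamma>\<rho>: "fls_const \<gamma> * \<rho> \<noteq> 0"
  proof
    assume 0: "fls_const \<gamma> * \<rho> = 0"
    have "v = Bi *\<^sub>v (B *\<^sub>v v)"
      using BBi D_commute[OF BD BiD] BD BiD v by (simp add: assoc_mult_mat_vec[of _ n n _ n, symmetric])
    also have "B *\<^sub>v v = 0\<^sub>v n" unfolding Bv 0 using v by (auto intro!: eq_vecI)
    finally show False using vne BiD by simp
  qed
  define C where "C = T * Bi"
  have CD: "C \<in> D" by (simp add: C_def BiD)
  have CB: "C * B = T"
  proof -
    have "C * B = T * (B * Bi)" unfolding C_def using BD BiD D_commute[OF BD BiD] by (simp add: D_assoc)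
    thus ?thesis using right_mult_one_mat[OF Tc] by (simp add: BBi)
  qed
  have Cv: "C *\<^sub>v v = \<mu> \<cdot>\<^sub>v v"
  proof -
    have "\<tau> \<cdot>\<^sub>v v = C *\<^sub>v (B *\<^sub>v v)"
      using CB CD BD v Tw by (simp add: v_def assoc_mult_mat_vec[of _ n n _ n, symmetric])
    also have "\<dots> = (fls_const \<gamma> * \<rho>) \<cdot>\<^sub>v (C *\<^sub>v v)" unfolding Bv using CD v by (intro mult_mat_vec[of _ n n]) auto
    finally have eq: "\<tau> \<cdot>\<^sub>v v = (fls_const \<gamma> * \<rho>) \<cdot>\<^sub>v (C *\<^sub>v v)" .
    show ?thesis
    proof (rule eq_vecI)
      fix s assume "s < dim_vec (\<mu> \<cdot>\<^sub>v v)"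
      hence s: "s < n" using v by simp
      have "\<tau> * v $ s = (fls_const \<gamma> * \<rho>) * (C *\<^sub>v v) $ s"
        using arg_cong[OF eq, of "\<lambda>u :: complex fls vec. u $ s"] s v CD by (simp del: index_mult_mat_vec)
      thus "(C *\<^sub>v v) $ s = (\<mu> \<cdot>\<^sub>v v) $ s"
        using \<gamma>\<rho> s v by (simp add: \<mu>_def field_simps del: index_mult_mat_vec)
    qed (use v CD in auto)
  qed
  have Cp: "C ^\<^sub>m p = 1\<^sub>m n"
  proof -
    have "C ^\<^sub>m p * (B ^\<^sub>m p * S) = (C * B) ^\<^sub>m p * S"
      using CD BD S pow_mat_mult_commute[OF D_carrier[OF CD] D_carrier[OF BD] D_commute[OF CD BD], of p] by (simp add: D_assoc)
    thus ?thesis using CB TS BS right_mult_one_mat[OF pow_carrier_mat[OF D_carrier[OF CD], of p]] by simp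
  qed
  have "\<mu> ^ p = 1"
  proof -
    have "v = \<mu> ^ p \<cdot>\<^sub>v v"
      using eval_poly_mat_eigenvector(1)[OF D_carrier[OF CD] v Cv, of p] v by (simp add: Cp)
    hence "v $ r = \<mu> ^ p * v $ r" using r v by (metis index_smult_vec(1) carrier_vecD)
    thus ?thesis using r w by (simp add: v_def)
  qed
  then obtain m where m: "\<mu> = fls_const m" "m ^ p = 1" by (rule fls_root_of_unity[OF p_pos])
  have m0: "m \<noteq> 0" using m(2) p_pos by (auto simp: power_0_left)
  obtain l where l: "l < p" "m = \<zeta> ^ l" by (rule primitive_root_powers[OF \<zeta> m(2)])
  define C' where "C' = fls_const (1 / m) \<cdot>\<^sub>m C"
  have C'D: "C' \<in> D" by (simp add: C'_def CD)
  have C'p: "C' ^\<^sub>m p = 1\<^sub>m n"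
  proof -
    have "C' ^\<^sub>m p = fls_const (1 / m) ^ p \<cdot>\<^sub>m C ^\<^sub>m p" unfolding C'_def by (rule pow_mat_smult[OF D_carrier[OF CD]])
    also have "fls_const (1 / m) ^ p = fls_const ((1 / m) ^ p)" by (simp only: fls_const_power)
    finally show ?thesis by (simp add: Cp power_divide m(2))
  qed
  have C'v: "C' *\<^sub>v v = v"
    unfolding C'_def using CD v m0
    by (subst smult_mat_mult_vec[of _ n]) (auto simp: Cv m(1) smult_smult_assoc)
  note avg = cyclic_average[OF commuting_matrices_axioms C'D C'p]
  \<comment> \<open>the projection to the fixed vectors of \<open>C / \<mu>\<close>\<close>
  define E where "E = fls_const (1 / of_nat p) \<cdot>\<^sub>m mat_sum n {..<p} (\<lambda>_. 1) (\<lambda>j. C' ^\<^sub>m j)"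
  have Ev: "E *\<^sub>v v = v" unfolding E_def by (rule avg(4)[OF v C'v])
  have "E \<noteq> 0\<^sub>m n n"
  proof
    assume "E = 0\<^sub>m n n"
    hence "v = 0\<^sub>m n n *\<^sub>v v" using Ev by simp
    also have "\<dots> = 0\<^sub>v n" using v by (auto intro!: eq_vecI)
    finally show False using vne by simp
  qed
  hence "E = 1\<^sub>m n" using idempotent_trivial[OF ind avg(1,2)] by (auto simp: E_def)
  hence "C' = 1\<^sub>m n" using avg(3) right_mult_one_mat[OF D_carrier[OF C'D]] by (simp add: E_def)
  hence "fls_const m \<cdot>\<^sub>m (fls_const (1 / m) \<cdot>\<^sub>m C) = fls_const m \<cdot>\<^sub>m 1\<^sub>m n" by (simp add: C'_def)
  hence C_eq: "C = fls_const m \<cdot>\<^sub>m 1\<^sub>m n" using m0 by (simp add: smult_smult_mat)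
  have T_eq: "T = sol n (\<gamma> * \<zeta> ^ l) H"
  proof -
    have "T = fls_const m \<cdot>\<^sub>m B"
      using CB BD unfolding C_eq by (simp add: mult_smult_assoc_mat[of _ n n _ n] left_mult_one_mat[of _ n n])
    also have "\<dots> = sol n (\<gamma> * \<zeta> ^ l) H"
      unfolding B_def sol_def l(2) by (simp add: smult_smult_mat mult_ac fls_const_mult_const[symmetric] del: fls_const_mult_const)
    finally show ?thesis .
  qed
  have Tinv: "coeff_mat T k *\<^sub>v u \<in> W" if W: "vec_subspace n W" and inv: "\<forall>u\<in>W. H *\<^sub>v u \<in> W" and u: "u \<in> W" for k u W
  proof -
    have uc: "u \<in> carrier_vec n" using W u by (auto simp: vec_subspace_def)
    obtain b where b: "coeff_mat T k = mat_sum n {..<n} b (\<lambda>i. H ^\<^sub>m i)"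
      using coeff_mat_sol[OF H] unfolding T_eq by blast
    have "H ^\<^sub>m i *\<^sub>v u \<in> W" for i
    proof (induction i)
      case (Suc i)
      have "H ^\<^sub>m Suc i *\<^sub>v u = H *\<^sub>v (H ^\<^sub>m i *\<^sub>v u)"
        unfolding pow_mat_Suc_left[OF H] using H uc by (simp add: assoc_mult_mat_vec[of _ n n _ n])
      thus ?case using Suc inv by simp
    qed (use u uc H in auto)
    thus ?thesis unfolding b by (intro mat_sum_mult_vec_in_subspace[OF W _ _ uc]) (use H in auto)
  qed
  obtain R P where RP: "R \<in> carrier_mat n n" "P \<in> carrier_mat n n" "R * P = 1\<^sub>m n" "P * R = 1\<^sub>m n"
    "R * H = jordan_block n 0 * R"
  proof (rule nilpotent_indecomposable_jordan[OF H nil n])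
    fix W1 W2 assume "vec_subspace n W1" "vec_subspace n W2" "\<forall>v\<in>W1. H *\<^sub>v v \<in> W1" "\<forall>v\<in>W2. H *\<^sub>v v \<in> W2"
       "W1 \<inter> W2 \<subseteq> {0\<^sub>v n}" "\<forall>v\<in>carrier_vec n. \<exists>a\<in>W1. \<exists>b\<in>W2. v = a + b"
    thus "W1 \<subseteq> {0\<^sub>v n} \<or> W2 \<subseteq> {0\<^sub>v n}"
      using ind Tinv unfolding series_indecomposable_def by blast
  qed blast
  have "const_mat R * T = sol n (\<gamma> * \<zeta> ^ l) (jordan_block n 0) * const_mat R"
    unfolding T_eq by (rule sol_similar[OF H _ RP(1,5)]) simp
  with l RP that show ?thesis by blast
qed

section \<open>The Jacobi identity for scalar series\<close>

lemma gbinomial_Suc_factor: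
  "of_nat (Suc k) * (x gchoose Suc k) = (x - of_nat k) * (x gchoose k :: complex)"
proof -
  have "fact (Suc k) * (x gchoose Suc k) = fact k * (x gchoose k) * (x - of_nat k)"
    unfolding gbinomial_mult_fact by simp
  hence "fact k * (of_nat (Suc k) * (x gchoose Suc k)) = fact k * ((x - of_nat k) * (x gchoose k))"
    by (simp add: algebra_simps del: of_nat_Suc)
  thus ?thesis using fact_nonzero[of k, where ?'a = complex] by (metis mult_left_cancel)
qed

text \<open>Coefficients are indexed by modes: for a series of grade \<open>a\<close>, the mode \<open>a / p + t\<close> is the coefficient at the exponent \<open>- (a + p t) - p\<close> of \<open>z\<close>.\<close>

lemma ddx_funpow_nth:
  assumes p: "p > 0"
  shows "fls_nth ((ddx p ^^ k) F) (- (a + int p * t) - int p) =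
    fact k * ((- (of_int a / of_nat p) - of_int (t - int k) - 1) gchoose k) * fls_nth F (- (a + int p * (t - int k)) - int p)"
proof (induction k arbitrary: t)
  case (Suc k)
  let ?x = "- (of_int a / of_nat p) - of_int (t - int (Suc k)) - 1 :: complex"
  have e: "- (a + int p * t) - int p + int p = - (a + int p * (t - 1)) - int p" by (simp add: algebra_simps)
  have "fls_nth ((ddx p ^^ Suc k) F) (- (a + int p * t) - int p) =
     of_int (- (a + int p * t)) / of_nat p * fls_nth ((ddx p ^^ k) F) (- (a + int p * (t - 1)) - int p)"
    using ddx_nth[OF p, of "(ddx p ^^ k) F" "- (a + int p * t) - int p"] unfolding e by (simp add: algebra_simps)
  also have "of_int (- (a + int p * t)) / of_nat p = ?x - of_nat k" using p by (simp add: field_simps)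
  also have "fls_nth ((ddx p ^^ k) F) (- (a + int p * (t - 1)) - int p) =
     fact k * (?x gchoose k) * fls_nth F (- (a + int p * (t - int (Suc k))) - int p)"
    unfolding Suc.IH by (simp add: algebra_simps)
  also have "(?x - of_nat k) * (fact k * (?x gchoose k) * fls_nth F (- (a + int p * (t - int (Suc k))) - int p)) =
     fact k * ((?x - of_nat k) * (?x gchoose k)) * fls_nth F (- (a + int p * (t - int (Suc k))) - int p)" by (simp only: mult_ac)
  also have "(?x - of_nat k) * (?x gchoose k) = of_nat (Suc k) * (?x gchoose Suc k)" by (rule gbinomial_Suc_factor[symmetric])
  finally show ?case by (simp only: fact_Suc mult_ac)
qed simp

lemma fls_times_nth_superset:
  fixes F G :: "complex fls"
  assumes S: "finite S" and sup: "\<And>e. fls_nth F e \<noteq> 0 \<Longrightarrow> fls_nth G (m - e) \<noteq> 0 \<Longrightarrow> e \<in> S"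
  shows "fls_nth (F * G) m = (\<Sum>e\<in>S. fls_nth F e * fls_nth G (m - e))"
  unfolding fls_times_nth(2)
proof (rule sum.mono_neutral_cong)
  fix e assume e: "e \<in> S - {fls_subdegree F..m - fls_subdegree G}"
  hence "e < fls_subdegree F \<or> m - e < fls_subdegree G" by auto
  thus "fls_nth F e * fls_nth G (m - e) = 0" by auto
qed (use S sup in auto)

text \<open>The bounds \<open>A\<close> and \<open>B\<close> leave finitely many modes of both factors.\<close>

lemma graded_mode_product:
  assumes p: "p > 0" and F: "graded_fls p a F" and G: "graded_fls p b G"
    and A: "\<And>t. t \<ge> A \<Longrightarrow> fls_nth F (- (a + int p * t) - int p) = 0"
    and B: "\<And>t. t \<ge> B \<Longrightarrow> fls_nth G (- (b + int p * t) - int p) = 0"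
  shows "fls_nth (F * G) (- (a + b + int p * s) - int p) =
    (\<Sum>t\<in>{s - 1 - B..A}. fls_nth F (- (a + int p * t) - int p) * fls_nth G (- (b + int p * (s - 1 - t)) - int p))"
proof -
  define m where "m = - (a + b + int p * s) - int p"
  define h where "h = (\<lambda>t. - (a + int p * t) - int p)"
  have me: "m - h t = - (b + int p * (s - 1 - t)) - int p" for t by (simp add: m_def h_def algebra_simps)
  have inj: "inj_on h X" for X using p by (auto simp: h_def inj_on_def)
  have "fls_nth (F * G) m = (\<Sum>e\<in>h ` {s - 1 - B..A}. fls_nth F e * fls_nth G (m - e))"
  proof (rule fls_times_nth_superset)
    fix e assume e: "fls_nth F e \<noteq> 0" "fls_nth G (m - e) \<noteq> 0"
    hence "int p dvd e + a" using F by (auto simp: graded_fls_def)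
    then obtain d where d: "e + a = int p * d" by auto
    have eh: "e = h (- d - 1)" using d by (simp add: h_def algebra_simps)
    have "- d - 1 < A"
    proof (rule ccontr)
      assume "\<not> - d - 1 < A"
      with A[of "- d - 1"] e(1) show False unfolding eh h_def by simp
    qed
    moreover have "s - 1 - (- d - 1) < B"
    proof (rule ccontr)
      assume "\<not> s - 1 - (- d - 1) < B"
      with B[of "s - 1 - (- d - 1)"] e(2) show False unfolding eh me by simp
    qed
    ultimately show "e \<in> h ` {s - 1 - B..A}" unfolding eh by (intro imageI) auto
  qed simp
  also have "\<dots> = (\<Sum>t\<in>{s - 1 - B..A}. fls_nth F (h t) * fls_nth G (m - h t))"
    by (subst sum.reindex[OF inj]) simp
  finally show ?thesis unfolding me unfolding m_def h_def .
qed

text \<open>In the right side of the Jacobi identity for commuting series, collect the products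
  \<open>u\<^sub>m\<^sub>+\<^sub>t v\<^sub>n\<^sub>+\<^sub>l\<^sub>-\<^sub>t\<close>. For \<open>l \<ge> 0\<close> the two contributions to their coefficient
  cancel; for \<open>l < 0\<close> they are the restrictions of one polynomial in \<open>t\<close> to two ranges, and it vanishes in the gap between them.\<close>

definition jacobi_coeff :: "int \<Rightarrow> int \<Rightarrow> complex" where
  "jacobi_coeff l t = (if l \<ge> 0 then 0 else (of_int (- t - 1) gchoose nat (- 1 - l)))"

lemma minus_one_powi_parity: "(- 1 :: complex) powi k = (if even k then 1 else - 1)"
  by (cases "even k") (auto elim!: evenE oddE simp: power_int_add power_int_mult)

lemma jacobi_coeff_expand:
  "jacobi_coeff l t = (if t \<le> l then (of_int l gchoose nat (l - t)) * (- 1) ^ nat (l - t) else 0)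
     + (if t \<ge> 0 then (of_int l gchoose nat t) * (- 1) ^ nat t * (- 1) powi (l + 1) else 0)"
proof (cases "l \<ge> 0")
  case True
  then obtain L where L: "l = int L" using nonneg_int_cases by blast
  have ch: "(of_int l gchoose k) = (of_nat (L choose k) :: complex)" for k
    by (simp add: L binomial_gbinomial)
  show ?thesis
  proof (cases "0 \<le> t \<and> t \<le> l")
    case True
    then obtain s where s: "t = int s" using nonneg_int_cases by blast
    have sL: "s \<le> L" using True by (simp add: s L)
    have n: "nat (l - t) = L - s" "nat t = s" by (auto simp: s L)
    have "(- 1 :: complex) ^ (L - s) = - ((- 1) ^ s * (- 1) powi (l + 1))"
    proof (cases "even L"; cases "even s")
    qed (use sL in \<open>auto simp: L minus_one_powi_parity\<close>)
    moreover have "L choose (L - s) = L choose s" using binomial_symmetric[OF sL] by simp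
    ultimately show ?thesis using True \<open>l \<ge> 0\<close> by (simp add: jacobi_coeff_def n ch)
  next
    case False
    hence "t < 0 \<or> t > l" by auto
    thus ?thesis using \<open>l \<ge> 0\<close>
      by (auto simp: jacobi_coeff_def L binomial_gbinomial[symmetric] binomial_eq_0)
  qed
next
  case False
  define N where "N = nat (- 1 - l)"
  have l: "l = - int N - 1" using False by (simp add: N_def)
  have neg: "(of_int l gchoose k) = (- 1) ^ k * (of_nat (N + k) gchoose k :: complex)" for k
  proof -
    have "(of_int l :: complex) = - (of_nat N + 1)" by (simp add: l)
    moreover have "of_nat N + 1 + of_nat k - 1 = (of_nat (N + k) :: complex)" by simp
    ultimately show ?thesis by (simp only: gbinomial_minus)
  qed
  have sym: "(of_nat (N + k) gchoose k :: complex) = (of_nat (N + k) gchoose N)" for k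
  proof -
    have "N + k choose k = N + k choose N" using binomial_symmetric[of k "N + k"] by simp
    thus ?thesis by (simp only: binomial_gbinomial[symmetric])
  qed
  have sgn: "(- 1) ^ k * x * (- 1) ^ k * y = y * (x :: complex)" for k x y
    by (cases "even k") auto
  consider "t \<ge> 0" | "t \<le> l" | "l < t" "t < 0" by linarith
  thus ?thesis
  proof cases
    case 1
    then obtain s where s: "t = int s" using nonneg_int_cases by blast
    have "(of_int (- t - 1) gchoose N :: complex) = (- 1) ^ N * (of_nat (N + s) gchoose N)"
    proof -
      have "(of_int (- t - 1) :: complex) = - (of_nat s + 1)" by (simp add: s)
      moreover have "of_nat s + 1 + of_nat N - 1 = (of_nat (N + s) :: complex)" by simp
      ultimately show ?thesis by (simp only: gbinomial_minus)
    qed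
    moreover have "(- 1 :: complex) powi (l + 1) = (- 1) ^ N" by (simp add: l minus_one_powi_parity)
    moreover have "jacobi_coeff l t = (of_int (- t - 1) gchoose N)" using False by (simp add: jacobi_coeff_def N_def)
    moreover have "\<not> t \<le> l" "nat t = s" using 1 False by (auto simp: s)
    ultimately show ?thesis using 1 neg[of s] sym[of s] sgn by (simp only: if_False if_True add_0)
  next
    case 2
    define s where "s = nat (l - t)"
    have s: "t = l - int s" using 2 by (simp add: s_def)
    have "(of_int (- t - 1) gchoose N :: complex) = (of_nat (N + s) gchoose N)" by (simp add: s l algebra_simps)
    moreover have "jacobi_coeff l t = (of_int (- t - 1) gchoose N)" using False by (simp add: jacobi_coeff_def N_def)
    moreover have "\<not> t \<ge> 0" "nat (l - t) = s" using 2 False by (auto simp: s_def)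
    ultimately show ?thesis using 2 neg[of s] sym[of s] sgn[of s _ 1] by (simp only: if_False if_True add_0_right mult_1_right mult_1_left)
  next
    case 3
    define s where "s = nat (- t - 1)"
    have s: "t = - int s - 1" "s < N" using 3 by (auto simp: s_def l)
    have "(of_int (- t - 1) gchoose N :: complex) = of_nat (s choose N)" by (simp add: s binomial_gbinomial)
    thus ?thesis using 3 False s(2) by (simp add: jacobi_coeff_def N_def[symmetric] binomial_eq_0)
  qed
qed

text \<open>On the left side of the identity the same coefficient arises from the binomial coefficients of repeated differentiation.\<close>

lemma jacobi_coeff_Vandermonde:
  assumes "l < 0"
  shows "(\<Sum>i<nat (- l). (x gchoose i) * ((- x - of_int t - 1) gchoose nat (- 1 - (l + int i)))) = jacobi_coeff l t"
proof -
  define N where "N = nat (- 1 - l)"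
  have N: "nat (- l) = Suc N" using assms by (simp add: N_def)
  have "(\<Sum>i<nat (- l). (x gchoose i) * ((- x - of_int t - 1) gchoose nat (- 1 - (l + int i)))) =
     (\<Sum>i=0..N. (x gchoose i) * ((- x - of_int t - 1) gchoose (N - i)))"
    unfolding N atLeast0AtMost lessThan_Suc_atMost
    by (rule sum.cong) (auto simp: N_def nat_diff_distrib algebra_simps intro!: arg_cong2[where f = "(gchoose)"])
  also have "\<dots> = ((x + (- x - of_int t - 1)) gchoose N)" by (rule gbinomial_Vandermonde)
  also have "x + (- x - of_int t - 1) = of_int (- t - 1)" by simp
  finally show ?thesis using assms by (simp add: jacobi_coeff_def N_def)
qed

text \<open>Both sides are combinations of the same products of modes, and their coefficients agree by
  Vandermonde's identity. Scalar series suffice, since the entries of matrices can be treated one by one.\<close>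

lemma scalar_jacobi:
  assumes p: "p > 0" and F: "graded_fls p a F" and G: "graded_fls p b G"
    and A: "A \<ge> 0" "\<And>t. t \<ge> A \<Longrightarrow> fls_nth F (- (a + int p * t) - int p) = 0"
      "\<And>t. t \<ge> A \<Longrightarrow> fls_nth G (- (b + int p * t) - int p) = 0"
    and L: "int L > A + \<bar>l\<bar>"
  shows "(\<Sum>i<L. ((of_int a / of_nat p) gchoose i) * (if l + int i < 0
        then 1 / fact (nat (- 1 - (l + int i))) * fls_nth ((ddx p ^^ nat (- 1 - (l + int i))) F * G) (- (a + b - int p * int i) - int p)
        else 0)) =
    (\<Sum>i<L. (of_int l gchoose i) * (- 1) ^ i *
       (fls_nth F (- (a + int p * (l - int i)) - int p) * fls_nth G (- (b + int p * int i) - int p)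
        + (- 1) powi (l + 1) * (fls_nth F (- (a + int p * int i) - int p) * fls_nth G (- (b + int p * (l - int i)) - int p))))"
    (is "?lhs = ?rhs")
proof -
  define f where "f = (\<lambda>t. fls_nth F (- (a + int p * t) - int p))"
  define g where "g = (\<lambda>t. fls_nth G (- (b + int p * t) - int p))"
  define x where "x = (of_int a / of_nat p :: complex)"
  define I where "I = {l - int L..int L}"
  have f0: "f t = 0" if "t \<ge> A" for t using A(2)[OF that] by (simp add: f_def)
  have g0: "g t = 0" if "t \<ge> A" for t using A(3)[OF that] by (simp add: g_def)
  have gr: "graded_fls p a ((ddx p ^^ k) F)" for k
    by (induction k) (use F p in \<open>auto intro: graded_fls_ddx\<close>)
  have "?rhs = (\<Sum>i<L. (of_int l gchoose i) * (- 1) ^ i * (f (l - int i) * g (int i)))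
     + (\<Sum>i<L. (of_int l gchoose i) * (- 1) ^ i * (- 1) powi (l + 1) * (f (int i) * g (l - int i)))"
    by (simp add: f_def g_def sum.distrib distrib_left mult_ac)
  also have "(\<Sum>i<L. (of_int l gchoose i) * (- 1) ^ i * (f (l - int i) * g (int i))) =
      (\<Sum>t\<in>I. (if t \<le> l then (of_int l gchoose nat (l - t)) * (- 1) ^ nat (l - t) else 0) * (f t * g (l - t)))"
  proof (rule sum.reindex_bij_witness_not_neutral[where S' = "{}" and T' = "{t \<in> I. l < t \<or> int L \<le> l - t}" and i = "\<lambda>t. nat (l - t)" and j = "\<lambda>i. l - int i"])
    fix t assume t: "t \<in> {t \<in> I. l < t \<or> int L \<le> l - t}"
    have "A \<le> l - t" if "\<not> l < t" using t L that abs_ge_zero[of l] by auto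
    with t show "(if t \<le> l then (of_int l gchoose nat (l - t)) * (- 1) ^ nat (l - t) else 0) * (f t * g (l - t)) = 0"
      using g0[of "l - t"] by (cases "l < t") auto
  qed (use L A(1) in \<open>auto simp: I_def intro: finite_subset[of _ "{l - int L..int L}"]\<close>)
  also have "(\<Sum>i<L. (of_int l gchoose i) * (- 1) ^ i * (- 1) powi (l + 1) * (f (int i) * g (l - int i))) =
      (\<Sum>t\<in>I. (if t \<ge> 0 then (of_int l gchoose nat t) * (- 1) ^ nat t * (- 1) powi (l + 1) else 0) * (f t * g (l - t)))"
  proof (rule sum.reindex_bij_witness_not_neutral[where S' = "{}" and T' = "{t \<in> I. t < 0 \<or> L \<le> nat t}" and i = nat and j = int])
    fix t assume "t \<in> {t \<in> I. t < 0 \<or> L \<le> nat t}"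
    thus "(if t \<ge> 0 then (of_int l gchoose nat t) * (- 1) ^ nat t * (- 1) powi (l + 1) else 0) * (f t * g (l - t)) = 0"
      using f0[of t] L by auto
  qed (use L A(1) in \<open>auto simp: I_def intro: finite_subset[of _ "{l - int L..int L}"]\<close>)
  finally have rhs: "?rhs = (\<Sum>t\<in>I. jacobi_coeff l t * (f t * g (l - t)))"
    by (simp only: jacobi_coeff_expand sum.distrib[symmetric] distrib_right)
  have lhs: "?lhs = (\<Sum>t\<in>I. jacobi_coeff l t * (f t * g (l - t)))"
  proof (cases "l \<ge> 0")
    case True
    thus ?thesis by (simp add: jacobi_coeff_def)
  next
    case False
    have "?lhs = (\<Sum>i<nat (- l). (x gchoose i) * (1 / fact (nat (- 1 - (l + int i))) *
        fls_nth ((ddx p ^^ nat (- 1 - (l + int i))) F * G) (- (a + b - int p * int i) - int p)))"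
      unfolding x_def using False A(1) L by (intro sum.mono_neutral_cong_right) auto
    also have "\<dots> = (\<Sum>i<nat (- l). \<Sum>t\<in>I. (x gchoose i) * ((- x - of_int t - 1) gchoose nat (- 1 - (l + int i))) * (f t * g (l - t)))"
    proof (rule sum.cong[OF refl])
      fix i assume i: "i \<in> {..<nat (- l)}"
      define k where "k = nat (- 1 - (l + int i))"
      have k: "int k = - 1 - l - int i" using i by (auto simp: k_def)
      have m: "fls_nth ((ddx p ^^ k) F) (- (a + int p * t) - int p) = fact k * ((- x - of_int (t - int k) - 1) gchoose k) * f (t - int k)" for t
        unfolding f_def x_def by (rule ddx_funpow_nth[OF p])
      have e: "- (a + b - int p * int i) - int p = - (a + b + int p * (- int i)) - int p" by simp
      have "fls_nth ((ddx p ^^ k) F * G) (- (a + b - int p * int i) - int p) =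
        (\<Sum>t\<in>{- int i - 1 - A..A + int k}. fls_nth ((ddx p ^^ k) F) (- (a + int p * t) - int p) * fls_nth G (- (b + int p * (- int i - 1 - t)) - int p))"
        unfolding e
      proof (rule graded_mode_product[OF p gr G])
        fix t assume "t \<ge> A + int k"
        thus "fls_nth ((ddx p ^^ k) F) (- (a + int p * t) - int p) = 0"
          using m[of t] f0[of "t - int k"] by simp
      qed (rule A(3))
      also have "\<dots> = (\<Sum>t\<in>{- int i - 1 - A..A + int k}. fact k * ((- x - of_int (t - int k) - 1) gchoose k) * f (t - int k) * g (- int i - 1 - t))"
        by (simp only: m g_def)
      also have "\<dots> = (\<Sum>t\<in>I. fact k * ((- x - of_int t - 1) gchoose k) * (f t * g (l - t)))"
      proof (rule sum.reindex_bij_witness_not_neutral[where S' = "{}" and T' = "{t \<in> I. t > A \<or> t < l - A}" and i = "\<lambda>t. t + int k" and j = "\<lambda>t. t - int k"])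
        fix t assume "t \<in> {t \<in> I. t > A \<or> t < l - A}"
        thus "fact k * ((- x - of_int t - 1) gchoose k) * (f t * g (l - t)) = 0"
          using f0[of t] g0[of "l - t"] by auto
      next
        fix t assume "t \<in> {- int i - 1 - A..A + int k} - {}"
        thus "t - int k \<in> I - {t \<in> I. t > A \<or> t < l - A}" using k L by (auto simp: I_def)
      next
        fix t assume "t \<in> {- int i - 1 - A..A + int k}"
        have "l - (t - int k) = - int i - 1 - t" using k by simp
        thus "fact k * ((- x - of_int (t - int k) - 1) gchoose k) * (f (t - int k) * g (l - (t - int k))) =
          fact k * ((- x - of_int (t - int k) - 1) gchoose k) * f (t - int k) * g (- int i - 1 - t)"
          by (simp only: mult.assoc)
      qed (use k in \<open>auto simp: I_def intro: finite_subset[of _ "{l - int L..int L}"]\<close>)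
      finally show "(x gchoose i) * (1 / fact (nat (- 1 - (l + int i))) *
          fls_nth ((ddx p ^^ nat (- 1 - (l + int i))) F * G) (- (a + b - int p * int i) - int p)) =
        (\<Sum>t\<in>I. (x gchoose i) * ((- x - of_int t - 1) gchoose nat (- 1 - (l + int i))) * (f t * g (l - t)))"
        unfolding k_def[symmetric] by (simp add: sum_distrib_left mult.assoc)
    qed
    also have "\<dots> = (\<Sum>t\<in>I. (\<Sum>i<nat (- l). (x gchoose i) * ((- x - of_int t - 1) gchoose nat (- 1 - (l + int i)))) * (f t * g (l - t)))"
      by (subst sum.swap) (simp add: sum_distrib_right)
    finally show ?thesis using jacobi_coeff_Vandermonde False by simp
  qed
  show ?thesis unfolding lhs rhs ..
qed

section \<open>The grading of the polynomial ring\<close>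

locale graded_automorphism =
  fixes g :: "complex poly \<Rightarrow> complex poly" and p :: nat
  assumes aut: "poly_alg_automorphism g" and ord: "has_order g p" and p1: "p > 1"
    and line: "g ` line_t \<subseteq> line_t"
begin

abbreviation \<xi> :: complex where "\<xi> \<equiv> eigenvalue_t g"

lemma g_tvar: "g tvar = Polynomial.smult \<xi> tvar"
proof -
  have "tvar \<in> line_t" unfolding line_t_def by (rule CollectI, rule exI[of _ 1]) simp
  hence "g tvar \<in> line_t" using line by blast
  then obtain c where c: "g tvar = Polynomial.smult c tvar" by (auto simp: line_t_def)
  hence "\<xi> = c" by (simp add: eigenvalue_t_def)
  thus ?thesis using c by simp
qed

lemma coeff_g: "coeff (g a) k = \<xi> ^ k * coeff a k"
proof (induction a arbitrary: k)
  case 0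
  have "g (Polynomial.smult 0 1) = Polynomial.smult 0 (g 1)" using aut unfolding poly_alg_automorphism_def by blast
  thus ?case by simp
next
  case (pCons c a)
  have "pCons c a = Polynomial.smult c 1 + tvar * a" by simp
  hence "g (pCons c a) = g (Polynomial.smult c 1) + g tvar * g a"
    using aut unfolding poly_alg_automorphism_def by metis
  also have "g (Polynomial.smult c 1) = Polynomial.smult c 1" using aut unfolding poly_alg_automorphism_def by metis
  finally have "g (pCons c a) = Polynomial.smult c 1 + pCons 0 (Polynomial.smult \<xi> (g a))"
    by (simp add: g_tvar)
  thus ?case by (cases k) (simp_all add: pCons.IH)
qed

lemma coeff_g_funpow: "coeff ((g ^^ j) a) k = (\<xi> ^ k) ^ j * coeff a k"
  by (induction j) (simp_all add: coeff_g)

lemma xi_primitive: "\<xi> ^ p = 1" "0 < k \<Longrightarrow> k < p \<Longrightarrow> \<xi> ^ k \<noteq> 1"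
proof -
  have "(g ^^ p) tvar = tvar" using ord by (simp add: has_order_def)
  hence "coeff ((g ^^ p) tvar) 1 = coeff tvar 1" by simp
  thus "\<xi> ^ p = 1" by (simp add: coeff_g_funpow)
  assume k: "0 < k" "k < p"
  show "\<xi> ^ k \<noteq> 1"
  proof
    assume "\<xi> ^ k = 1"
    hence "(\<xi> ^ i) ^ k = 1" for i by (metis mult.commute power_mult power_one)
    hence "(g ^^ k) a = a" for a by (intro poly_eqI) (simp add: coeff_g_funpow)
    hence "g ^^ k = id" by auto
    thus False using ord k by (auto simp: has_order_def)
  qed
qed

lemma xi_power_eq_iff: "\<xi> ^ i = \<xi> ^ j \<longleftrightarrow> int p dvd int i - int j"
proof -
  have ne: "\<xi> \<noteq> 0" using xi_primitive(1) p1 by (auto simp: power_0_left)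
  have one: "\<xi> ^ d = 1 \<longleftrightarrow> p dvd d" for d
  proof -
    have "\<xi> ^ d = \<xi> ^ (p * (d div p) + d mod p)" by simp
    also have "\<dots> = \<xi> ^ (d mod p)" unfolding power_add power_mult xi_primitive(1) by simp
    finally show ?thesis using xi_primitive(2)[of "d mod p"] p1 by (cases "d mod p = 0") (auto simp: dvd_eq_mod_eq_0)
  qed
  have main: "\<xi> ^ i = \<xi> ^ j \<longleftrightarrow> int p dvd int i - int j" if "j \<le> i" for i j
  proof -
    have "\<xi> ^ i = \<xi> ^ j * \<xi> ^ (i - j)" using that by (simp add: power_add[symmetric])
    hence "\<xi> ^ i = \<xi> ^ j \<longleftrightarrow> p dvd i - j" using ne one[of "i - j"] by auto
    also have "\<dots> \<longleftrightarrow> int p dvd int (i - j)" by simp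
    finally show ?thesis using that by (simp add: of_nat_diff)
  qed
  show ?thesis
  proof (cases "j \<le> i")
    case False
    hence "\<xi> ^ j = \<xi> ^ i \<longleftrightarrow> int p dvd int j - int i" by (intro main) simp
    moreover have "int p dvd int j - int i \<longleftrightarrow> int p dvd int i - int j" by (rule dvd_diff_commute)
    ultimately show ?thesis by auto
  qed (rule main)
qed

text \<open>The automorphism multiplies \<open>t ^ k\<close> by the power \<open>k\<close> of a primitive root of unity.\<close>

lemma graded_part_iff: "u \<in> graded_part g r \<longleftrightarrow> (\<forall>k. coeff u k \<noteq> 0 \<longrightarrow> int p dvd int k - int r)"
proof -
  have "u \<in> graded_part g r \<longleftrightarrow> (\<forall>k. \<xi> ^ k * coeff u k = \<xi> ^ r * coeff u k)"
    by (simp add: graded_part_def poly_eq_iff coeff_g)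
  thus ?thesis by (auto simp: xi_power_eq_iff)
qed

end

section \<open>Solutions give twisted modules\<close>

lemma vec_fsum:
  assumes h: "\<And>i. h i \<in> carrier_vec n" and L: "\<And>i. i \<ge> L \<Longrightarrow> h i = 0\<^sub>v n"
  shows "fsum (module_vec TYPE(complex) n) h \<in> carrier_vec n"
    and "r < n \<Longrightarrow> fsum (module_vec TYPE(complex) n) h $ r = (\<Sum>i<L. h i $ r)"
proof -
  interpret V: vec_space "TYPE(complex)" n .
  let ?S = "{i. h i \<noteq> 0\<^sub>v n}"
  have S: "?S \<subseteq> {..<L}" using L by (auto simp: not_less[symmetric])
  hence fin: "finite ?S" by (rule finite_subset) simp
  have eq: "fsum (module_vec TYPE(complex) n) h = finsum_vec TYPE(complex) n h ?S"
    by (simp add: fsum_def module_vec_simps)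
  show "fsum (module_vec TYPE(complex) n) h \<in> carrier_vec n"
    unfolding eq by (rule finsum_vec_closed) (use h in auto)
  assume r: "r < n"
  have "fsum (module_vec TYPE(complex) n) h $ r = (\<Sum>i\<in>?S. h i $ r)"
    unfolding eq by (rule index_finsum_vec[OF fin r]) (use h in auto)
  also have "\<dots> = (\<Sum>i<L. h i $ r)"
    by (rule sum.mono_neutral_left) (use S r in auto)
  finally show "fsum (module_vec TYPE(complex) n) h $ r = (\<Sum>i<L. h i $ r)" .
qed

lemma linear_map_vecI:
  assumes "\<And>v. v \<in> carrier_vec n \<Longrightarrow> f v \<in> carrier_vec n"
    and "\<And>v w. v \<in> carrier_vec n \<Longrightarrow> w \<in> carrier_vec n \<Longrightarrow> f (v + w) = f v + f w"
    and "\<And>c v. v \<in> carrier_vec n \<Longrightarrow> f (c \<cdot>\<^sub>v v) = c \<cdot>\<^sub>v f v"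
  shows "linear_map class_ring (module_vec TYPE(complex) n) (module_vec TYPE(complex) n) f"
proof -
  have m: "Module.module class_ring (module_vec TYPE(complex) n)" by (rule vec_module)
  have "f \<in> LinearCombinations.module_hom class_ring (module_vec TYPE(complex) n) (module_vec TYPE(complex) n)"
    using assms by (auto simp: LinearCombinations.module_hom_def module_vec_simps)
  thus ?thesis
    by (intro linear_map.intro mod_hom.intro mod_hom_axioms.intro vec_vs m)
qed

lemma series_field_eq:
  assumes "of_nat p * i = of_int a"
  shows "series_field p n T u i w = coeff_mat (eval_poly_mat n u T) (- a - int p) *\<^sub>v w"
proof -
  have "- (of_nat p * (i + 1)) = of_int (- a - int p)" using assms by (simp add: algebra_simps)
  hence "\<lfloor>- (of_nat p * (i + 1))\<rfloor> = - a - int p" by (simp only: floor_of_int)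
  thus ?thesis using assms by (simp add: series_field_def coeff_mat_def)
qed

lemma series_field_0: "of_nat p * i \<notin> \<int> \<Longrightarrow> series_field p n T u i w = 0\<^sub>v n"
  by (simp add: series_field_def)

lemma zero_mat_mult_vec [simp]: "v \<in> carrier_vec n \<Longrightarrow> 0\<^sub>m n n *\<^sub>v v = (0\<^sub>v n :: 'a :: semiring_0 vec)"
  by (rule eq_vecI) auto

context matrix_solution
begin

text \<open>The equation for \<open>T\<close> extends to all polynomials in \<open>T\<close> by the chain rule.\<close>

lemma eval_derivation: "eval_poly_mat n (derivation_of f u) T = mat_ddx p (eval_poly_mat n u T)"
proof -
  have "mat_ddx p (eval_poly_mat n u T) = eval_poly_mat n (pderiv u) T * mat_ddx p T"
    by (rule mat_ddx_eval_poly_mat[OF T_carrier D_commute]) auto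
  also have "\<dots> = eval_poly_mat n (pderiv u * f) T"
    unfolding T_ode by (rule eval_poly_mat_mult[OF T_carrier, symmetric])
  finally show ?thesis by (simp add: derivation_of_def mult.commute)
qed

lemma eval_derivation_funpow:
  assumes "i < n" "j < n"
  shows "eval_poly_mat n ((derivation_of f ^^ k) u) T $$ (i, j) = (ddx p ^^ k) (eval_poly_mat n u T $$ (i, j))"
  by (induction k) (use assms in \<open>simp_all add: eval_derivation mat_ddx_def\<close>)

lemma graded_eval:
  assumes u: "\<forall>k. coeff u k \<noteq> 0 \<longrightarrow> int p dvd int k - r" and ij: "i < n" "j < n"
  shows "graded_fls p r (eval_poly_mat n u T $$ (i, j))"
  unfolding eval_poly_mat_index[OF order.refl ij]
proof (rule graded_fls_sum)
  fix k
  show "graded_fls p r (fls_const (coeff u k) * (T ^\<^sub>m k) $$ (i, j))"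
  proof (cases "coeff u k = 0")
    case False
    have "graded_fls p (int k * 1) ((T ^\<^sub>m k) $$ (i, j))"
      using graded_mat_pow[OF T_graded T_carrier, of k] ij carrier_matD[OF pow_carrier_mat[OF T_carrier, of k]]
      by (simp add: graded_mat_def del: pow_mat_dim)
    thus ?thesis using u False by (intro graded_fls_const_mult) (auto elim: graded_fls_cong)
  qed simp
qed

text \<open>Matrix multiplication is a sum of products of entries, and the Jacobi identity is bilinear; so the scalar identity suffices, as the modes commute.\<close>

lemma series_field_Jacobi:
  assumes u: "\<forall>k. coeff u k \<noteq> 0 \<longrightarrow> int p dvd int k - r" and v: "\<forall>k. coeff v k \<noteq> 0 \<longrightarrow> int p dvd int k - s"
    and m: "of_nat p * m = of_int a" "int p dvd a - r" and m': "of_nat p * m' = of_int b" "int p dvd b - s"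
    and w: "w \<in> carrier_vec n"
  shows "fsum (module_vec TYPE(complex) n) (\<lambda>i. (of_rat m gchoose i) \<cdot>\<^sub>v
          series_field p n T (va_prod (derivation_of f) u (l + int i) v) (m + m' - of_nat i) w)
     = fsum (module_vec TYPE(complex) n) (\<lambda>i. ((of_int l gchoose i) * (- 1) ^ i) \<cdot>\<^sub>v
            (series_field p n T u (of_int l + m - of_nat i) (series_field p n T v (m' + of_nat i) w)
             + ((- 1) powi (l + 1)) \<cdot>\<^sub>v series_field p n T v (of_int l + m' - of_nat i) (series_field p n T u (m + of_nat i) w)))"
    (is "fsum _ ?lhs = fsum _ ?rhs")
proof -
  define U where "U = eval_poly_mat n u T"
  define V where "V = eval_poly_mat n v T"
  have UD: "U \<in> D" and VD: "V \<in> D" by (simp_all add: U_def V_def)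
  have Uc: "U \<in> carrier_mat n n" and Vc: "V \<in> carrier_mat n n" by (simp_all add: U_def V_def)
  obtain NU where NU: "\<forall>k<NU. coeff_mat U k = 0\<^sub>m n n" using coeff_mat_bounded_below[OF Uc] .
  obtain NV where NV: "\<forall>k<NV. coeff_mat V k = 0\<^sub>m n n" using coeff_mat_bounded_below[OF Vc] .
  \<comment> \<open>modes with indices at least \<open>A\<close> above \<open>m\<close> and \<open>m'\<close> vanish\<close>
  define A where "A = \<bar>a\<bar> + \<bar>b\<bar> + \<bar>NU\<bar> + \<bar>NV\<bar>"
  have A0: "A \<ge> 0" by (simp add: A_def)
  have big: "int p * t \<ge> t" if "t \<ge> 0" for t using that p_pos by (simp add: mult_le_cancel_right1)
  have AU: "coeff_mat U (- (a + int p * t) - int p) = 0\<^sub>m n n" if "t \<ge> A" for t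
  proof -
    have "- (a + int p * t) - int p < NU" using big[of t] that p_pos unfolding A_def by linarith
    thus ?thesis using NU by blast
  qed
  have AV: "coeff_mat V (- (b + int p * t) - int p) = 0\<^sub>m n n" if "t \<ge> A" for t
  proof -
    have "- (b + int p * t) - int p < NV" using big[of t] that p_pos unfolding A_def by linarith
    thus ?thesis using NV by blast
  qed
  define L where "L = nat (A + \<bar>l\<bar>) + 1"
  have L: "int L > A + \<bar>l\<bar>" using A0 by (simp add: L_def)
  have rat: "of_rat m = (of_int a / of_nat p :: complex)"
  proof -
    have "m = of_int a / of_nat p" using m(1) p_pos by (simp add: field_simps)
    thus ?thesis by (simp add: of_rat_divide)
  qed
  define W where "W = (\<lambda>i. eval_poly_mat n (va_prod (derivation_of f) u (l + int i) v) T)"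
  have lhs: "?lhs i = (of_int a / of_nat p gchoose i) \<cdot>\<^sub>v (coeff_mat (W i) (- (a + b - int p * int i) - int p) *\<^sub>v w)" for i
    unfolding rat W_def
    by (subst series_field_eq[where a = "a + b - int p * int i"]) (use m m' in \<open>simp_all add: algebra_simps\<close>)
  have rhs: "?rhs i = ((of_int l gchoose i) * (- 1) ^ i) \<cdot>\<^sub>v
     (coeff_mat U (- (a + int p * (l - int i)) - int p) *\<^sub>v (coeff_mat V (- (b + int p * int i) - int p) *\<^sub>v w)
      + ((- 1) powi (l + 1)) \<cdot>\<^sub>v (coeff_mat U (- (a + int p * int i) - int p) *\<^sub>v (coeff_mat V (- (b + int p * (l - int i)) - int p) *\<^sub>v w)))" for i
  proof -
    have 1: "series_field p n T u (of_int l + m - of_nat i) z = coeff_mat U (- (a + int p * (l - int i)) - int p) *\<^sub>v z" for z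
      unfolding U_def by (rule series_field_eq) (use m in \<open>simp add: algebra_simps\<close>)
    have 2: "series_field p n T v (m' + of_nat i) z = coeff_mat V (- (b + int p * int i) - int p) *\<^sub>v z" for z
      unfolding V_def by (rule series_field_eq) (use m' in \<open>simp add: algebra_simps\<close>)
    have 3: "series_field p n T v (of_int l + m' - of_nat i) z = coeff_mat V (- (b + int p * (l - int i)) - int p) *\<^sub>v z" for z
      unfolding V_def by (rule series_field_eq) (use m' in \<open>simp add: algebra_simps\<close>)
    have 4: "series_field p n T u (m + of_nat i) z = coeff_mat U (- (a + int p * int i) - int p) *\<^sub>v z" for z
      unfolding U_def by (rule series_field_eq) (use m in \<open>simp add: algebra_simps\<close>)
    have "coeff_mat V x *\<^sub>v (coeff_mat U y *\<^sub>v w) = coeff_mat U y *\<^sub>v (coeff_mat V x *\<^sub>v w)" for x y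
    proof -
      have "coeff_mat V x *\<^sub>v (coeff_mat U y *\<^sub>v w) = coeff_mat V x * coeff_mat U y *\<^sub>v w"
        by (rule assoc_mult_mat_vec[of _ n n _ n, symmetric]) (use Uc Vc w in auto)
      also have "\<dots> = coeff_mat U y * coeff_mat V x *\<^sub>v w" by (simp only: coeff_mat_commute[OF VD UD])
      also have "\<dots> = coeff_mat U y *\<^sub>v (coeff_mat V x *\<^sub>v w)"
        by (rule assoc_mult_mat_vec[of _ n n _ n]) (use Uc Vc w in auto)
      finally show ?thesis .
    qed
    thus ?thesis unfolding 1 2 3 4 by simp
  qed
  have Wc: "W i \<in> carrier_mat n n" for i by (simp add: W_def)
  have W0: "W i = 0\<^sub>m n n" if "l + int i \<ge> 0" for i using that by (simp add: W_def va_prod_def)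
  have c1: "?lhs i \<in> carrier_vec n" for i unfolding lhs using Wc w by simp
  have c2: "?rhs i \<in> carrier_vec n" for i unfolding rhs using Uc Vc w by simp
  have z1: "?lhs i = 0\<^sub>v n" if "i \<ge> L" for i
    unfolding lhs using W0[of i] that L A0 w by auto
  have z2: "?rhs i = 0\<^sub>v n" if "i \<ge> L" for i
  proof -
    have "int i \<ge> A" using that L by linarith
    thus ?thesis unfolding rhs using AU[of "int i"] AV[of "int i"] Uc Vc w by auto
  qed
  show ?thesis
  proof (rule eq_vecI)
    have d: "dim_vec (fsum (module_vec TYPE(complex) n) ?lhs) = n" "dim_vec (fsum (module_vec TYPE(complex) n) ?rhs) = n"
      using vec_fsum(1)[of ?lhs n L, OF c1 z1] vec_fsum(1)[of ?rhs n L, OF c2 z2] by (simp_all only: carrier_vecD)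
    thus "dim_vec (fsum (module_vec TYPE(complex) n) ?lhs) = dim_vec (fsum (module_vec TYPE(complex) n) ?rhs)" by simp
    fix e assume "e < dim_vec (fsum (module_vec TYPE(complex) n) ?rhs)"
    hence e: "e < n" using d by simp
    let ?k = "\<lambda>i. nat (- 1 - (l + int i))"
    define X where "X = (\<lambda>i c \<beta>. if l + int i < 0
        then 1 / fact (?k i) * fls_nth ((ddx p ^^ ?k i) (U $$ (e, c)) * V $$ (c, \<beta>)) (- (a + b - int p * int i) - int p) else 0)"
    define Y where "Y = (\<lambda>i c \<beta>. fls_nth (U $$ (e, c)) (- (a + int p * (l - int i)) - int p) * fls_nth (V $$ (c, \<beta>)) (- (b + int p * int i) - int p)
        + (- 1) powi (l + 1) * (fls_nth (U $$ (e, c)) (- (a + int p * int i) - int p) * fls_nth (V $$ (c, \<beta>)) (- (b + int p * (l - int i)) - int p)))"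
    \<comment> \<open>the scalar identity for a pair of entries that are multiplied in the matrix product\<close>
    have key: "(\<Sum>i<L. (of_int a / of_nat p gchoose i) * X i c \<beta>) = (\<Sum>i<L. (of_int l gchoose i) * (- 1) ^ i * Y i c \<beta>)"
      if "c < n" "\<beta> < n" for c \<beta>
      unfolding X_def Y_def
    proof (rule scalar_jacobi[OF p_pos _ _ A0 _ _ L])
      show "graded_fls p a (U $$ (e, c))"
        unfolding U_def using graded_eval[OF u e that(1)] m(2) by (rule graded_fls_cong[OF _ iffD1[OF dvd_diff_commute]])
      show "graded_fls p b (V $$ (c, \<beta>))"
        unfolding V_def using graded_eval[OF v that] m'(2) by (rule graded_fls_cong[OF _ iffD1[OF dvd_diff_commute]])
      show "fls_nth (U $$ (e, c)) (- (a + int p * t) - int p) = 0" if "t \<ge> A" for t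
        using arg_cong[OF AU[OF that], of "\<lambda>M. M $$ (e, c)"] Uc e \<open>c < n\<close> by simp
      show "fls_nth (V $$ (c, \<beta>)) (- (b + int p * t) - int p) = 0" if "t \<ge> A" for t
        using arg_cong[OF AV[OF that], of "\<lambda>M. M $$ (c, \<beta>)"] Vc \<open>\<beta> < n\<close> \<open>c < n\<close> by simp
    qed
    have Wn: "fls_nth (W i $$ (e, \<beta>)) (- (a + b - int p * int i) - int p) = (\<Sum>c<n. X i c \<beta>)" if "\<beta> < n" for i \<beta>
    proof (cases "l + int i < 0")
      case True
      have "W i = fls_const (1 / fact (?k i)) \<cdot>\<^sub>m (eval_poly_mat n ((derivation_of f ^^ ?k i) u) T * V)"
        using True T_carrier by (simp add: W_def va_prod_def V_def eval_poly_mat_smult eval_poly_mat_mult mult_smult_assoc_mat[of _ n n _ n])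
      hence "W i $$ (e, \<beta>) = fls_const (1 / fact (?k i)) * (\<Sum>c<n. (ddx p ^^ ?k i) (U $$ (e, c)) * V $$ (c, \<beta>))"
        using e that Vc by (simp add: index_mult_mat_sum[of _ n n _ n] eval_derivation_funpow U_def del: index_mult_mat(1))
      thus ?thesis using True by (simp add: X_def fls_nth_sum sum_distrib_left)
    next
      case False
      thus ?thesis using W0[of i] e that by (simp add: X_def)
    qed
    have "fsum (module_vec TYPE(complex) n) ?lhs $ e = (\<Sum>i<L. ?lhs i $ e)" by (rule vec_fsum(2)[OF c1 z1 e])
    also have "\<dots> = (\<Sum>i<L. (of_int a / of_nat p gchoose i) * (\<Sum>\<beta><n. (\<Sum>c<n. X i c \<beta>) * w $ \<beta>))"
    proof (rule sum.cong[OF refl])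
      fix i
      have "(coeff_mat (W i) (- (a + b - int p * int i) - int p) *\<^sub>v w) $ e = (\<Sum>\<beta><n. (\<Sum>c<n. X i c \<beta>) * w $ \<beta>)"
        by (subst index_mult_vec_sum[of _ n n]) (use Wc w e Wn carrier_matD[OF Wc] in auto)
      thus "?lhs i $ e = (of_int a / of_nat p gchoose i) * (\<Sum>\<beta><n. (\<Sum>c<n. X i c \<beta>) * w $ \<beta>)"
        unfolding lhs using e carrier_matD[OF Wc] by (simp del: index_mult_mat_vec)
    qed
    also have "\<dots> = (\<Sum>\<beta><n. \<Sum>c<n. (\<Sum>i<L. (of_int a / of_nat p gchoose i) * X i c \<beta>) * w $ \<beta>)"
      by (simp add: sum_distrib_left sum_distrib_right mult.assoc)
         (subst sum.swap, rule sum.cong[OF refl], rule sum.swap)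
    also have "\<dots> = (\<Sum>\<beta><n. \<Sum>c<n. (\<Sum>i<L. (of_int l gchoose i) * (- 1) ^ i * Y i c \<beta>) * w $ \<beta>)"
      by (intro sum.cong refl) (simp add: key)
    also have "\<dots> = (\<Sum>i<L. (of_int l gchoose i) * (- 1) ^ i * (\<Sum>\<beta><n. (\<Sum>c<n. Y i c \<beta>) * w $ \<beta>))"
      by (simp add: sum_distrib_left sum_distrib_right mult.assoc)
         (subst (2) sum.swap, rule sum.cong[OF refl], rule sum.swap)
    also have "\<dots> = (\<Sum>i<L. ?rhs i $ e)"
    proof (rule sum.cong[OF refl])
      fix i
      have prod: "(coeff_mat U x *\<^sub>v (coeff_mat V y *\<^sub>v w)) $ e = (\<Sum>\<beta><n. \<Sum>c<n. fls_nth (U $$ (e, c)) x * fls_nth (V $$ (c, \<beta>)) y * w $ \<beta>)" for x y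
      proof -
        have "(coeff_mat U x *\<^sub>v (coeff_mat V y *\<^sub>v w)) $ e = (\<Sum>c<n. fls_nth (U $$ (e, c)) x * (\<Sum>\<beta><n. fls_nth (V $$ (c, \<beta>)) y * w $ \<beta>))"
          using Uc Vc w e by (subst index_mult_vec_sum[of _ n n])
            (auto simp: index_mult_vec_sum[of _ n n] simp del: index_mult_mat_vec)
        thus ?thesis by (subst sum.swap) (simp add: sum_distrib_left mult.assoc)
      qed
      show "(of_int l gchoose i) * (- 1) ^ i * (\<Sum>\<beta><n. (\<Sum>c<n. Y i c \<beta>) * w $ \<beta>) = ?rhs i $ e"
        unfolding rhs using e Uc Vc w carrier_matD[OF Uc]
        by (simp add: prod del: index_mult_mat_vec)
           (simp add: Y_def sum_distrib_right sum_distrib_left sum.distrib distrib_right mult.assoc)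
    qed
    also have "\<dots> = fsum (module_vec TYPE(complex) n) ?rhs $ e" by (rule vec_fsum(2)[OF c2 z2 e, symmetric])
    finally show "fsum (module_vec TYPE(complex) n) ?lhs $ e = fsum (module_vec TYPE(complex) n) ?rhs $ e" .
  qed
qed

theorem series_field_twisted_module:
  assumes "graded_automorphism g p"
  shows "twisted_module (module_vec TYPE(complex) n) p g (derivation_of f) (series_field p n T)"
proof -
  interpret graded_automorphism g p by fact
  let ?M = "module_vec TYPE(complex) n" and ?Y = "series_field p n T"
  note simps = module_vec_simps
  have Y_carrier: "?Y u i w \<in> carrier_vec n" if "w \<in> carrier_vec n" for u i w
    using that by (cases "of_nat p * i \<in> \<int>") (auto simp: series_field_eq series_field_0 elim!: Ints_cases)
  have int_shift: "\<exists>a. of_nat p * i = of_int a \<and> int p dvd a - int r" if "i - of_nat r / of_nat p \<in> \<int>" for i :: rat and r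
  proof -
    from that obtain z where z: "i - of_nat r / of_nat p = of_int z" by (rule Ints_cases)
    have "of_nat p * i = of_int (int p * z + int r)" using z p_pos by (simp add: field_simps)
    thus ?thesis by (intro exI[of _ "int p * z + int r"]) auto
  qed
  show ?thesis
  proof (intro twisted_module.intro twisted_module_axioms.intro, unfold simps)
    show "vectorspace class_ring ?M" by (rule vec_vs)
  next
    fix u i
    show "linear_map class_ring ?M ?M (?Y u i)"
    proof (cases "of_nat p * i \<in> \<int>")
      case True
      then obtain a where a: "of_nat p * i = of_int a" by (auto elim: Ints_cases)
      show ?thesis
        by (rule linear_map_vecI)
           (auto simp: series_field_eq[OF a] mult_add_distrib_mat_vec[of _ n n] mult_mat_vec[of _ n n] intro!: mult_vec_carrier_square)
    next
      case False
      show ?thesis by (rule linear_map_vecI) (auto simp: series_field_0[OF False])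
    qed
  next
    fix i :: rat and w :: "complex vec" and u assume "of_nat p * i \<notin> \<int>" "w \<in> carrier_vec n"
    thus "?Y u i w = 0\<^sub>v n" by (simp add: series_field_0)
  next
    fix w :: "complex vec" and u v and i :: rat assume w: "w \<in> carrier_vec n"
    show "?Y (u + v) i w = ?Y u i w + ?Y v i w"
    proof (cases "of_nat p * i \<in> \<int>")
      case True
      then obtain a where a: "of_nat p * i = of_int a" by (auto elim: Ints_cases)
      have "coeff_mat (X + Z) k = coeff_mat X k + coeff_mat Z k" if "X \<in> carrier_mat n n" "Z \<in> carrier_mat n n" for X Z k
        by (rule eq_matI) (use that in auto)
      thus ?thesis using w by (simp add: series_field_eq[OF a] eval_poly_mat_add add_mult_distrib_mat_vec[of _ n n])
    qed (auto simp: series_field_0)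
  next
    fix w :: "complex vec" and u c and i :: rat assume w: "w \<in> carrier_vec n"
    show "?Y (Polynomial.smult c u) i w = c \<cdot>\<^sub>v ?Y u i w"
    proof (cases "of_nat p * i \<in> \<int>")
      case True
      then obtain a where a: "of_nat p * i = of_int a" by (auto elim: Ints_cases)
      have "coeff_mat (fls_const c \<cdot>\<^sub>m X) k = c \<cdot>\<^sub>m coeff_mat X k" if "X \<in> carrier_mat n n" for X k
        by (rule eq_matI) (use that in auto)
      thus ?thesis using w by (simp add: series_field_eq[OF a] eval_poly_mat_smult smult_mat_mult_vec[of _ n])
    qed (auto simp: series_field_0)
  next
    fix r u and i :: rat and w :: "complex vec" assume r: "r < p" "u \<in> graded_part g r" "i - of_nat r / of_nat p \<notin> \<int>" and w: "w \<in> carrier_vec n"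
    show "?Y u i w = 0\<^sub>v n"
    proof (cases "of_nat p * i \<in> \<int>")
      case True
      then obtain a where a: "of_nat p * i = of_int a" by (auto elim: Ints_cases)
      have ndvd: "\<not> int p dvd - a - int p + int r"
      proof
        assume "int p dvd - a - int p + int r"
        then obtain d where d: "- a - int p + int r = int p * d" by auto
        have "of_int (int r - a) = (of_int (int p * (d + 1)) :: rat)" using d by (simp add: algebra_simps)
        hence "i - of_nat r / of_nat p = of_int (- d - 1)" using a p_pos by (simp add: field_simps)
        thus False using r(3) by simp
      qed
      have "coeff_mat (eval_poly_mat n u T) (- a - int p) = 0\<^sub>m n n"
      proof (rule eq_matI)
        fix j k assume "j < dim_row (0\<^sub>m n n :: complex mat)" "k < dim_col (0\<^sub>m n n :: complex mat)"
        hence "graded_fls p (int r) (eval_poly_mat n u T $$ (j, k))" "j < n" "k < n"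
          using graded_eval[of u "int r" j k] r(2) by (auto simp: graded_part_iff)
        thus "coeff_mat (eval_poly_mat n u T) (- a - int p) $$ (j, k) = 0\<^sub>m n n $$ (j, k)"
          using ndvd by (auto simp: graded_fls_def)
      qed auto
      thus ?thesis using w by (simp add: series_field_eq[OF a])
    qed (simp add: series_field_0)
  next
    fix w :: "complex vec" and u assume w: "w \<in> carrier_vec n"
    obtain N where N: "\<forall>k<N. coeff_mat (eval_poly_mat n u T) k = 0\<^sub>m n n"
      using coeff_mat_bounded_below[of "eval_poly_mat n u T" n] by auto
    show "\<exists>N. \<forall>i>N. ?Y u i w = 0\<^sub>v n"
    proof (intro exI allI impI)
      fix i :: rat assume i: "of_int \<bar>N\<bar> < i"
      show "?Y u i w = 0\<^sub>v n"
      proof (cases "of_nat p * i \<in> \<int>")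
        case True
        then obtain a where a: "of_nat p * i = of_int a" by (auto elim: Ints_cases)
        have "i \<le> of_nat p * i" using i p_pos by (simp add: mult_le_cancel_right1) (meson le_less_trans of_int_nonneg abs_ge_zero not_less of_nat_1 less_le)
        hence "of_int \<bar>N\<bar> < (of_int a :: rat)" using i a by linarith
        hence "\<bar>N\<bar> < a" by (simp only: of_int_less_iff)
        hence "- a - int p < N" using p_pos by linarith
        thus ?thesis using N w by (simp add: series_field_eq[OF a])
      qed (simp add: series_field_0)
    qed
  next
    fix w :: "complex vec" and i :: rat assume w: "w \<in> carrier_vec n"
    show "?Y 1 i w = (if i = - 1 then w else 0\<^sub>v n)"
    proof (cases "of_nat p * i \<in> \<int>")
      case True
      then obtain a where a: "of_nat p * i = of_int a" by (auto elim: Ints_cases)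
      have iff: "i = - 1 \<longleftrightarrow> - a - int p = 0"
      proof
        assume "i = - 1"
        hence "(of_int (- a - int p) :: rat) = of_int 0" using a by simp
        thus "- a - int p = 0" by (simp only: of_int_eq_iff)
      next
        assume "- a - int p = 0"
        hence "of_nat p * i = of_nat p * (- 1)" using a by simp
        thus "i = - 1" using p_pos by (simp only: mult_left_cancel of_nat_0_less_iff)
      qed
      have "coeff_mat (1\<^sub>m n) k = (if k = 0 then 1\<^sub>m n else 0\<^sub>m n n)" for k
        by (rule eq_matI) auto
      thus ?thesis using w T_carrier by (simp add: series_field_eq[OF a] iff)
    next
      case False
      hence "i \<noteq> - 1" by auto
      thus ?thesis using False by (simp add: series_field_0)
    qed
  next
    fix r s u v l and m n' :: rat and w :: "complex vec"
    assume *: "r < p" "s < p" "u \<in> graded_part g r" "v \<in> graded_part g s"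
      "m - of_nat r / of_nat p \<in> \<int>" "n' - of_nat s / of_nat p \<in> \<int>" "w \<in> carrier_vec n"
    obtain a b where ab: "of_nat p * m = of_int a" "int p dvd a - int r" "of_nat p * n' = of_int b" "int p dvd b - int s"
      using int_shift[OF *(5)] int_shift[OF *(6)] by blast
    show "fsum ?M (\<lambda>i. (of_rat m gchoose i) \<cdot>\<^sub>v ?Y (va_prod (derivation_of f) u (l + int i) v) (m + n' - of_nat i) w)
        = fsum ?M (\<lambda>i. ((of_int l gchoose i) * (- 1) ^ i) \<cdot>\<^sub>v
            (?Y u (of_int l + m - of_nat i) (?Y v (n' + of_nat i) w)
             + ((- 1) powi (l + 1)) \<cdot>\<^sub>v ?Y v (of_int l + n' - of_nat i) (?Y u (m + of_nat i) w)))"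
      by (rule series_field_Jacobi[OF _ _ ab *(7), of u v]) (use * in \<open>auto simp: graded_part_iff\<close>)
  qed
qed

end

section \<open>Graded components and derivations\<close>

text \<open>The part of a polynomial with degrees congruent to \<open>r\<close> modulo \<open>p\<close>, which is its component in the grade \<open>r\<close>.\<close>

definition graded_comp :: "nat \<Rightarrow> int \<Rightarrow> complex poly \<Rightarrow> complex poly" where
  "graded_comp p r P = Abs_poly (\<lambda>i. if int p dvd int i - r then coeff P i else 0)"

lemma coeff_graded_comp: "coeff (graded_comp p r P) i = (if int p dvd int i - r then coeff P i else 0)"
  unfolding graded_comp_def by (subst coeff_Abs_poly[of "degree P"]) (auto simp: coeff_eq_0)

lemma graded_comp_add: "graded_comp p r (P + Q) = graded_comp p r P + graded_comp p r Q"
  by (rule poly_eqI) (simp add: coeff_graded_comp)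

lemma graded_comp_smult: "graded_comp p r (Polynomial.smult c P) = Polynomial.smult c (graded_comp p r P)"
  by (rule poly_eqI) (simp add: coeff_graded_comp)

lemma graded_comp_sum: "graded_comp p r (\<Sum>i\<in>A. P i) = (\<Sum>i\<in>A. graded_comp p r (P i))"
proof (induction A rule: infinite_finite_induct)
  case (insert x F)
  thus ?case by (simp add: graded_comp_add)
qed (auto intro!: poly_eqI simp: coeff_graded_comp)

lemma graded_comp_of_nat_mult: "graded_comp p r (of_nat m * P) = of_nat m * graded_comp p r P"
  by (simp add: of_nat_poly graded_comp_smult)

lemma graded_comp_mult_graded:
  assumes A: "\<forall>i. coeff A i \<noteq> 0 \<longrightarrow> int p dvd int i - r"
  shows "graded_comp p (r + s) (A * B) = A * graded_comp p s B"
proof (rule poly_eqI)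
  fix k
  have "(if int p dvd int k - (r + s) then coeff A i * coeff B (k - i) else 0) =
      coeff A i * (if int p dvd int (k - i) - s then coeff B (k - i) else 0)" if "i \<le> k" for i
  proof (cases "coeff A i = 0")
    case False
    hence d: "int p dvd int i - r" using A by blast
    have "int p dvd int k - (r + s) \<longleftrightarrow> int p dvd int (k - i) - s"
    proof
      assume "int p dvd int k - (r + s)"
      hence "int p dvd (int k - (r + s)) - (int i - r)" using d by (rule dvd_diff)
      thus "int p dvd int (k - i) - s" using that by (simp add: of_nat_diff algebra_simps)
    next
      assume "int p dvd int (k - i) - s"
      hence "int p dvd (int (k - i) - s) + (int i - r)" using d by (rule dvd_add)
      thus "int p dvd int k - (r + s)" using that by (simp add: of_nat_diff algebra_simps)
    qed
    thus ?thesis by simp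
  qed auto
  thus "coeff (graded_comp p (r + s) (A * B)) k = coeff (A * graded_comp p s B) k"
    unfolding coeff_graded_comp coeff_mult by (auto intro!: sum.cong sum.neutral simp: coeff_graded_comp)
qed

lemma graded_mult:
  assumes A: "\<forall>i. coeff A i \<noteq> 0 \<longrightarrow> int p dvd int i - r" and B: "\<forall>i. coeff B i \<noteq> 0 \<longrightarrow> int p dvd int i - s"
  shows "\<forall>i. coeff (A * B :: complex poly) i \<noteq> 0 \<longrightarrow> int p dvd int i - (r + s)"
proof -
  have "graded_comp p s B = B" using B by (intro poly_eqI) (auto simp: coeff_graded_comp)
  hence "A * B = graded_comp p (r + s) (A * B)" using graded_comp_mult_graded[OF A, of s B] by simp
  thus ?thesis by (metis coeff_graded_comp)
qed

lemma graded_power: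
  assumes A: "\<forall>i. coeff A i \<noteq> 0 \<longrightarrow> int p dvd int i - r"
  shows "\<forall>i. coeff (A ^ k :: complex poly) i \<noteq> 0 \<longrightarrow> int p dvd int i - int k * r"
proof (induction k)
  case (Suc k)
  show ?case using graded_mult[OF A Suc] by (simp add: algebra_simps)
qed auto

text \<open>The commutator of a derivation with the multiplication by \<open>a\<close> is the multiplication by \<open>d a\<close>; this is
  the effect of the \<open>k\<close>-fold commutator of \<open>d ^ k\<close> with \<open>a\<close> on 1. It expresses the power of
  \<open>d a\<close> by values of \<open>d ^ k\<close> on powers of \<open>a\<close>.\<close>

lemma derivation_commutator:
  fixes d :: "'a::comm_ring_1 \<Rightarrow> 'a"
  assumes add: "\<And>x y. d (x + y) = d x + d y" and mult: "\<And>x y. d (x * y) = d x * y + x * d y"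
  shows "(\<Sum>j\<le>k. of_nat (k choose j) * (- a) ^ j * (d ^^ k) (a ^ (k - j))) = of_nat (fact k) * d a ^ k"
proof -
  define S where "S = (\<lambda>k m b. \<Sum>j\<le>k. of_nat (k choose j) * (- a) ^ j * (d ^^ m) (a ^ (k - j) * b))"
  have d0: "d 0 = 0" using add[of 0 0] by simp
  have d1: "d 1 = 0" using mult[of 1 1] by simp
  have dn: "d (of_nat i) = 0" for i by (induction i) (simp_all add: d0 d1 add)
  have dadd: "(d ^^ m) (x + y) = (d ^^ m) x + (d ^^ m) y" for m x y
    by (induction m) (simp_all add: add)
  have d0m: "(d ^^ m) 0 = 0" for m by (induction m) (simp_all add: d0)
  have dnat: "(d ^^ m) (of_nat i * x) = of_nat i * (d ^^ m) x" for m i x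
    by (induction m) (simp_all add: mult dn)
  have dpow: "d (a ^ i) = of_nat i * a ^ (i - 1) * d a" for i
  proof (induction i)
    case (Suc i)
    have "d (a ^ Suc i) = d a * a ^ i + a * (of_nat i * a ^ (i - 1) * d a)" by (simp add: mult Suc.IH)
    also have "\<dots> = of_nat (Suc i) * a ^ i * d a" by (cases i) (simp_all add: algebra_simps)
    finally show ?case by simp
  qed (simp add: d1)
  have zero: "S k 0 b = (if k = 0 then b else 0)" for k b
  proof -
    have "S k 0 b = (\<Sum>j\<le>k. of_nat (k choose j) * (- a) ^ j * a ^ (k - j)) * b"
      unfolding S_def sum_distrib_right by (simp add: mult.assoc)
    also have "(\<Sum>j\<le>k. of_nat (k choose j) * (- a) ^ j * a ^ (k - j)) = (- a + a) ^ k"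
      by (rule binomial_ring[symmetric])
    finally show ?thesis by (simp add: power_0_left)
  qed
  have step: "S k (Suc m) b = of_nat k * S (k - 1) m (d a * b) + S k m (d b)" for k m b
  proof -
    have "S k (Suc m) b = (\<Sum>j\<le>k. of_nat (k choose j) * (- a) ^ j * (d ^^ m) (of_nat (k - j) * (a ^ (k - j - 1) * (d a * b)) + a ^ (k - j) * d b))"
      unfolding S_def funpow_Suc_right o_def mult dpow by (simp add: mult_ac)
    also have "\<dots> = (\<Sum>j\<le>k. of_nat ((k choose j) * (k - j)) * (- a) ^ j * (d ^^ m) (a ^ (k - j - 1) * (d a * b))) + S k m (d b)"
      unfolding dadd dnat S_def distrib_left sum.distrib of_nat_mult by (simp only: mult_ac)
    also have "(\<Sum>j\<le>k. of_nat ((k choose j) * (k - j)) * (- a) ^ j * (d ^^ m) (a ^ (k - j - 1) * (d a * b))) = of_nat k * S (k - 1) m (d a * b)"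
    proof (cases k)
      case (Suc k')
      have ch: "(k choose j) * (k - j) = k * (k' choose j)" for j
        using binomial_absorb_comp[of k j] unfolding Suc by (simp add: mult.commute)
      have "of_nat ((k choose j) * (k - j)) * (- a) ^ j * (d ^^ m) (a ^ (k - j - 1) * (d a * b)) =
         of_nat k * (of_nat (k' choose j) * (- a) ^ j * (d ^^ m) (a ^ (k' - j) * (d a * b)))" for j
      proof -
        have "k - j - 1 = k' - j" by (simp add: Suc)
        thus ?thesis unfolding ch of_nat_mult by (simp only: mult.assoc)
      qed
      hence "(\<Sum>j\<le>k'. of_nat ((k choose j) * (k - j)) * (- a) ^ j * (d ^^ m) (a ^ (k - j - 1) * (d a * b))) =
         (\<Sum>j\<le>k'. of_nat k * (of_nat (k' choose j) * (- a) ^ j * (d ^^ m) (a ^ (k' - j) * (d a * b))))"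
        by (intro sum.cong refl)
      thus ?thesis unfolding S_def by (simp add: Suc sum_distrib_left del: of_nat_Suc)
    qed simp
    finally show ?thesis .
  qed
  have main: "(m < k \<longrightarrow> S k m b = 0) \<and> (m = k \<longrightarrow> S k m b = of_nat (fact k) * d a ^ k * b)" for m k b
  proof (induction m arbitrary: k b)
    case 0
    show ?case by (simp add: zero)
  next
    case (Suc m)
    show ?case
    proof (cases k)
      case (Suc k')
      have "S k (Suc m) b = of_nat k * S k' m (d a * b) + S k m (d b)" unfolding step by (simp add: Suc del: of_nat_Suc)
      moreover have "of_nat (fact k) * d a ^ k * b = of_nat k * (of_nat (fact k') * d a ^ k' * (d a * b))"
        unfolding Suc fact_Suc of_nat_id of_nat_mult power_Suc by (simp only: mult_ac)
      ultimately show ?thesis using Suc.IH[of k' "d a * b"] Suc.IH[of k "d b"] Suc by (auto simp del: fact_Suc of_nat_Suc power_Suc)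
    qed simp
  qed
  have "S k k 1 = of_nat (fact k) * d a ^ k" using main[of k k 1] by simp
  thus ?thesis by (simp add: S_def)
qed

lemma poly_fls_eval: "poly_fls P \<tau> = eval_poly_mat 1 P (mat 1 1 (\<lambda>_. \<tau>)) $$ (0, 0)"
proof -
  have "(mat 1 1 (\<lambda>_. \<tau>) ^\<^sub>m k) $$ (0, 0) = \<tau> ^ k" for k
    by (induction k) (auto simp: index_mult_mat_sum[of _ 1 1 _ 1] simp del: index_mult_mat(1))
  thus ?thesis by (simp add: eval_poly_mat_def poly_fls_def)
qed

lemma poly_fls_add: "poly_fls (P + Q) \<tau> = poly_fls P \<tau> + poly_fls Q \<tau>"
  by (simp add: poly_fls_eval eval_poly_mat_add)

lemma poly_fls_mult: "poly_fls (P * Q) \<tau> = poly_fls P \<tau> * poly_fls Q \<tau>"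
  by (simp add: poly_fls_eval eval_poly_mat_mult index_mult_mat_sum[of _ 1 1 _ 1] del: index_mult_mat(1))

lemma poly_fls_0 [simp]: "poly_fls 0 \<tau> = 0"
  by (simp add: poly_fls_eval)

lemma poly_fls_1 [simp]: "poly_fls 1 \<tau> = 1"
  by (simp add: poly_fls_eval)

lemma poly_fls_sum: "poly_fls (\<Sum>i\<in>A. P i) \<tau> = (\<Sum>i\<in>A. poly_fls (P i) \<tau>)"
  by (induction A rule: infinite_finite_induct) (simp_all add: poly_fls_add)

lemma poly_fls_power: "poly_fls (P ^ k) \<tau> = poly_fls P \<tau> ^ k"
  by (induction k) (simp_all add: poly_fls_mult)

lemma poly_fls_of_nat: "poly_fls (of_nat k) \<tau> = of_nat k"
  by (induction k) (simp_all add: poly_fls_add)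

lemma poly_fls_tvar: "poly_fls tvar \<tau> = \<tau>"
  by (simp add: poly_fls_eval eval_poly_mat_tvar)

lemma poly_fls_uminus: "poly_fls (- P) \<tau> = - poly_fls P \<tau>"
  using poly_fls_add[of P "- P" \<tau>] by (simp add: eq_neg_iff_add_eq_0 add.commute)

text \<open>Let \<open>f\<^sub>1\<close> be the component of \<open>f = D t\<close> of grade 1. The commutator formula, applied to \<open>D\<close> and to
  \<open>d/dx\<close>, shows that \<open>f ^ k\<close> has \<open>f\<^sub>1 ^ k\<close> as its component of grade \<open>k\<close>, because evaluation at \<open>\<tau>\<close>, which
  has a pole, is injective. Therefore the component of \<open>(f - f\<^sub>1) ^ p\<close> of grade \<open>p\<close> is \<open>(f\<^sub>1 - f\<^sub>1) ^ p = 0\<close>. But the degree of a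
  nonzero \<open>p\<close>-th power is a multiple of \<open>p\<close>, and so its leading term lies in this component.\<close>

lemma homogeneous_from_orbit:
  assumes p: "p > 0" and \<tau>: "\<tau> \<noteq> 0" "fls_subdegree \<tau> < 0"
    and orbit: "\<And>k i. poly_fls (graded_comp p (int i) ((derivation_of f ^^ k) (tvar ^ i))) \<tau> = (ddx p ^^ k) (\<tau> ^ i)"
  shows "graded_comp p 1 f = f"
proof -
  let ?D = "derivation_of f" and ?f1 = "graded_comp p 1 f"
  \<comment> \<open>a series with a pole is transcendental\<close>
  have inj: "P = Q" if "poly_fls P \<tau> = poly_fls Q \<tau>" for P Q
  proof -
    have "poly_fls (P + - Q) \<tau> = 0" unfolding poly_fls_add poly_fls_uminus using that by simp
    hence "P + - Q = 0" using subdegree_poly_fls_neg(1)[OF _ \<tau>] by blast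
    thus ?thesis by simp
  qed
  have D_t: "?D tvar = f" by (simp add: derivation_of_def pderiv_pCons)
  have graded_t: "\<forall>m. coeff ((- tvar) ^ j) m \<noteq> 0 \<longrightarrow> int p dvd int m - int j * 1" for j
    by (rule graded_power) (auto simp: coeff_pCons split: nat.splits)
  have comp_pow: "graded_comp p (int k) (f ^ k) = ?f1 ^ k" for k
  proof (rule inj)
    have dc: "(\<Sum>j\<le>k. of_nat (k choose j) * (- tvar) ^ j * (?D ^^ k) (tvar ^ (k - j))) = of_nat (fact k) * ?D tvar ^ k"
      by (rule derivation_commutator) (simp_all add: derivation_of_def pderiv_add pderiv_mult algebra_simps)
    have "of_nat (fact k) * f ^ k = (\<Sum>j\<le>k. of_nat (k choose j) * (- tvar) ^ j * (?D ^^ k) (tvar ^ (k - j)))"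
      using dc unfolding D_t by (rule sym)
    hence "graded_comp p (int k) (of_nat (fact k) * f ^ k) =
      (\<Sum>j\<le>k. of_nat (k choose j) * graded_comp p (int k) ((- tvar) ^ j * (?D ^^ k) (tvar ^ (k - j))))"
      by (simp add: graded_comp_sum graded_comp_of_nat_mult mult.assoc)
    also have "\<dots> = (\<Sum>j\<le>k. of_nat (k choose j) * ((- tvar) ^ j * graded_comp p (int (k - j)) ((?D ^^ k) (tvar ^ (k - j)))))"
    proof (rule sum.cong[OF refl])
      fix j assume "j \<in> {..k}"
      hence "int k = int j * 1 + int (k - j)" by (simp add: of_nat_diff)
      thus "of_nat (k choose j) * graded_comp p (int k) ((- tvar) ^ j * (?D ^^ k) (tvar ^ (k - j))) =
        of_nat (k choose j) * ((- tvar) ^ j * graded_comp p (int (k - j)) ((?D ^^ k) (tvar ^ (k - j))))"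
        using graded_comp_mult_graded[OF graded_t, of j "int (k - j)"] by metis
    qed
    finally have "poly_fls (of_nat (fact k) * graded_comp p (int k) (f ^ k)) \<tau> =
      poly_fls (\<Sum>j\<le>k. of_nat (k choose j) * ((- tvar) ^ j * graded_comp p (int (k - j)) ((?D ^^ k) (tvar ^ (k - j))))) \<tau>"
      by (simp only: graded_comp_of_nat_mult)
    hence "of_nat (fact k) * poly_fls (graded_comp p (int k) (f ^ k)) \<tau> =
      (\<Sum>j\<le>k. of_nat (k choose j) * ((- \<tau>) ^ j * (ddx p ^^ k) (\<tau> ^ (k - j))))"
      by (simp only: poly_fls_sum poly_fls_mult poly_fls_of_nat poly_fls_power poly_fls_uminus poly_fls_tvar orbit)
    also have "\<dots> = (\<Sum>j\<le>k. of_nat (k choose j) * (- \<tau>) ^ j * (ddx p ^^ k) (\<tau> ^ (k - j)))"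
      by (simp only: mult.assoc)
    also have "\<dots> = of_nat (fact k) * ddx p \<tau> ^ k"
      by (rule derivation_commutator) (simp_all add: ddx_add ddx_mult)
    also have "ddx p \<tau> = poly_fls ?f1 \<tau>"
      using orbit[of 1 1] by (simp add: D_t)
    finally have "of_nat (fact k) * poly_fls (graded_comp p (int k) (f ^ k)) \<tau> = of_nat (fact k) * poly_fls (?f1 ^ k) \<tau>"
      by (simp add: poly_fls_power)
    thus "poly_fls (graded_comp p (int k) (f ^ k)) \<tau> = poly_fls (?f1 ^ k) \<tau>" by simp
  qed
  define h where "h = f + - ?f1"
  have graded_f1: "\<forall>m. coeff ((- ?f1) ^ j) m \<noteq> 0 \<longrightarrow> int p dvd int m - int j * 1" for j
    by (rule graded_power) (auto simp: coeff_graded_comp)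
  have "graded_comp p (int p) (h ^ p) = (\<Sum>j\<le>p. of_nat (p choose j) * graded_comp p (int p) ((- ?f1) ^ (p - j) * f ^ j))"
    unfolding h_def binomial_ring by (simp add: graded_comp_sum graded_comp_of_nat_mult mult.assoc mult.commute[of "f ^ _"])
  also have "\<dots> = (\<Sum>j\<le>p. of_nat (p choose j) * ?f1 ^ j * (- ?f1) ^ (p - j))"
  proof (rule sum.cong[OF refl])
    fix j assume "j \<in> {..p}"
    hence "int p = int (p - j) * 1 + int j" by (simp add: of_nat_diff)
    hence "graded_comp p (int p) ((- ?f1) ^ (p - j) * f ^ j) = (- ?f1) ^ (p - j) * ?f1 ^ j"
      using graded_comp_mult_graded[OF graded_f1, of "p - j" "int j" "f ^ j"] comp_pow[of j] by metis
    thus "of_nat (p choose j) * graded_comp p (int p) ((- ?f1) ^ (p - j) * f ^ j) = of_nat (p choose j) * ?f1 ^ j * (- ?f1) ^ (p - j)"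
      by (simp only: mult_ac)
  qed
  also have "\<dots> = (?f1 + - ?f1) ^ p" by (rule binomial_ring[symmetric])
  also have "\<dots> = 0" using p by simp
  finally have z: "graded_comp p (int p) (h ^ p) = 0" .
  have "h = 0"
  proof (rule ccontr)
    assume h: "h \<noteq> 0"
    have "coeff (graded_comp p (int p) (h ^ p)) (p * degree h) = coeff (h ^ p) (degree (h ^ p))"
      using h by (simp add: coeff_graded_comp degree_power_eq mult.commute)
    also have "\<dots> \<noteq> 0" using h by simp
    finally show False using z by simp
  qed
  thus ?thesis by (simp add: h_def)
qed

section \<open>Coordinates of finite-dimensional spaces\<close>

lemma linear_vec_as_matrix:
  fixes F :: "complex vec \<Rightarrow> complex vec"
  assumes carr: "\<And>v. v \<in> carrier_vec n \<Longrightarrow> F v \<in> carrier_vec n"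
    and add: "\<And>v w. v \<in> carrier_vec n \<Longrightarrow> w \<in> carrier_vec n \<Longrightarrow> F (v + w) = F v + F w"
    and smult: "\<And>c v. v \<in> carrier_vec n \<Longrightarrow> F (c \<cdot>\<^sub>v v) = c \<cdot>\<^sub>v F v"
    and x: "x \<in> carrier_vec n"
  shows "F x = mat n n (\<lambda>(r, s). F (unit_vec n s) $ r) *\<^sub>v x"
proof (rule eq_vecI)
  fix r assume "r < dim_vec (mat n n (\<lambda>(r, s). F (unit_vec n s) $ r) *\<^sub>v x)"
  hence r: "r < n" by simp
  have part: "F (vec n (\<lambda>i. if i < k then x $ i else 0)) $ r = (\<Sum>s<k. F (unit_vec n s) $ r * x $ s)" if "k \<le> n" for k
    using that
  proof (induction k)
    case 0
    have "vec n (\<lambda>i. if i < 0 then x $ i else 0) = (0 \<cdot>\<^sub>v 0\<^sub>v n :: complex vec)" by (auto intro!: eq_vecI)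
    thus ?case using r carrier_vecD[OF carr[of "0\<^sub>v n"]] by (simp add: smult)
  next
    case (Suc k)
    have "vec n (\<lambda>i. if i < Suc k then x $ i else 0) = vec n (\<lambda>i. if i < k then x $ i else 0) + x $ k \<cdot>\<^sub>v unit_vec n k"
      using Suc.prems by (auto intro!: eq_vecI simp: unit_vec_def less_Suc_eq)
    hence "F (vec n (\<lambda>i. if i < Suc k then x $ i else 0)) = F (vec n (\<lambda>i. if i < k then x $ i else 0)) + x $ k \<cdot>\<^sub>v F (unit_vec n k)"
      by (simp add: add smult)
    thus ?case using Suc r carrier_vecD[OF carr[of "unit_vec n k"]] by simp
  qed
  have "vec n (\<lambda>i. if i < n then x $ i else 0) = x" using x by (auto intro!: eq_vecI)
  hence "F x $ r = (\<Sum>s<n. F (unit_vec n s) $ r * x $ s)" using part[of n] by simp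
  also have "\<dots> = (mat n n (\<lambda>(r, s). F (unit_vec n s) $ r) *\<^sub>v x) $ r"
    by (subst index_mult_vec_sum[of _ n n]) (use r x in auto)
  finally show "F x $ r = (mat n n (\<lambda>(r, s). F (unit_vec n s) $ r) *\<^sub>v x) $ r" .
qed (use carr[OF x] in auto)

lemma fin_dim_coordinates:
  fixes M :: "(complex, 'm) module"
  assumes vs: "vectorspace class_ring M" and fd: "vectorspace.fin_dim class_ring M" and n: "vectorspace.dim class_ring M = n"
  obtains \<phi> where "\<phi> \<in> LinearCombinations.module_hom class_ring M (module_vec TYPE(complex) n)"
    "bij_betw \<phi> (carrier M) (carrier_vec n)"
proof -
  interpret vectorspace class_ring M by (rule vs)
  obtain \<beta> where \<beta>: "finite \<beta>" "basis \<beta>" using finite_basis_exists[OF fd] by blast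
  have card: "card \<beta> = n" using dim_basis[OF \<beta>] n by simp
  have \<beta>c: "\<beta> \<subseteq> carrier M" using \<beta> by (simp add: basis_def)
  obtain b where b: "bij_betw b {0..<n} \<beta>" using ex_bij_betw_nat_finite[OF \<beta>(1)] card by auto
  define bi where "bi = the_inv_into {0..<n} b"
  have bi: "bi v < n" "b (bi v) = v" if "v \<in> \<beta>" for v
    using that b the_inv_into_into[of b "{0..<n}" v "{0..<n}"] f_the_inv_into_f_bij_betw[OF b, of v]
    by (auto simp: bi_def bij_betw_def)
  have bib: "bi (b i) = i" if "i < n" for i
    using that b by (auto simp: bi_def bij_betw_def intro!: the_inv_into_f_f)
  define \<psi> where "\<psi> = (\<lambda>x :: complex vec. lincomb (\<lambda>v. x $ bi v) \<beta>)"
  have crit: "\<exists>!a. a \<in> \<beta> \<rightarrow>\<^sub>E UNIV \<and> lincomb a \<beta> = v" if "v \<in> carrier M" for v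
    using basis_criterion[OF \<beta>(1) \<beta>c] \<beta>(2) that by simp
  have \<psi>c: "\<psi> x \<in> carrier M" for x unfolding \<psi>_def by (rule lincomb_closed) (use \<beta>c in auto)
  have lc: "lincomb a \<beta> = lincomb (restrict a \<beta>) \<beta>" for a
    by (rule lincomb_cong) (use \<beta>c in auto)
  have \<psi>_add: "\<psi> (x + y) = \<psi> x \<oplus>\<^bsub>M\<^esub> \<psi> y" if "x \<in> carrier_vec n" "y \<in> carrier_vec n" for x y
  proof -
    have "\<psi> (x + y) = lincomb (\<lambda>v. (x $ bi v) \<oplus>\<^bsub>class_ring\<^esub> (y $ bi v)) \<beta>"
      unfolding \<psi>_def by (rule lincomb_cong) (use that bi \<beta>c in auto)
    also have "\<dots> = \<psi> x \<oplus>\<^bsub>M\<^esub> \<psi> y"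
      unfolding \<psi>_def by (rule lincomb_sum) (use \<beta> \<beta>c in auto)
    finally show ?thesis .
  qed
  have \<psi>_smult: "\<psi> (c \<cdot>\<^sub>v x) = c \<odot>\<^bsub>M\<^esub> \<psi> x" if "x \<in> carrier_vec n" for c x
  proof -
    have "\<psi> (c \<cdot>\<^sub>v x) = lincomb (\<lambda>v. c \<otimes>\<^bsub>class_ring\<^esub> (x $ bi v)) \<beta>"
      unfolding \<psi>_def by (rule lincomb_cong) (use that bi \<beta>c in auto)
    also have "\<dots> = c \<odot>\<^bsub>M\<^esub> \<psi> x"
      unfolding \<psi>_def by (rule lincomb_smult) (use \<beta> \<beta>c in auto)
    finally show ?thesis .
  qed
  have inj: "inj_on \<psi> (carrier_vec n)"
  proof (rule inj_onI)
    fix x y :: "complex vec" assume xy: "x \<in> carrier_vec n" "y \<in> carrier_vec n" "\<psi> x = \<psi> y"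
    have "restrict (\<lambda>v. x $ bi v) \<beta> = restrict (\<lambda>v. y $ bi v) \<beta>"
      using crit[OF \<psi>c[of x]] xy(3) unfolding \<psi>_def lc[of "\<lambda>v. x $ bi v"] lc[of "\<lambda>v. y $ bi v"]
      by (metis (no_types, lifting) UNIV_I restrict_PiE_iff)
    hence eq: "x $ bi v = y $ bi v" if "v \<in> \<beta>" for v using that by (metis restrict_apply')
    show "x = y"
    proof (rule eq_vecI)
      fix i assume "i < dim_vec y"
      hence i: "i < n" using xy by simp
      hence "b i \<in> \<beta>" using b by (auto simp: bij_betw_def)
      thus "x $ i = y $ i" using eq[of "b i"] bib[OF i] by simp
    qed (use xy in auto)
  qed
  have surj: "\<psi> ` carrier_vec n = carrier M"
  proof
    show "carrier M \<subseteq> \<psi> ` carrier_vec n"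
    proof
      fix v assume "v \<in> carrier M"
      then obtain a where a: "lincomb a \<beta> = v" using crit by blast
      have "\<psi> (vec n (\<lambda>i. a (b i))) = v"
        unfolding \<psi>_def a[symmetric] by (rule lincomb_cong) (use bi \<beta>c in auto)
      thus "v \<in> \<psi> ` carrier_vec n" by (metis image_eqI vec_carrier)
    qed
  qed (use \<psi>c in auto)
  define \<phi> where "\<phi> = the_inv_into (carrier_vec n) \<psi>"
  have bij: "bij_betw \<psi> (carrier_vec n) (carrier M)" using inj surj by (simp add: bij_betw_def)
  have \<phi>bij: "bij_betw \<phi> (carrier M) (carrier_vec n)" unfolding \<phi>_def by (rule bij_betw_the_inv_into[OF bij])
  have \<phi>\<psi>: "\<phi> (\<psi> x) = x" if "x \<in> carrier_vec n" for x
    unfolding \<phi>_def by (rule the_inv_into_f_f[OF inj that])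
  have \<psi>\<phi>: "\<psi> (\<phi> v) = v" and \<phi>c: "\<phi> v \<in> carrier_vec n" if "v \<in> carrier M" for v
    using that f_the_inv_into_f_bij_betw[OF bij, of v] \<phi>bij by (auto simp: \<phi>_def bij_betw_def)
  have "\<phi> \<in> LinearCombinations.module_hom class_ring M (module_vec TYPE(complex) n)"
  proof -
    have "\<phi> (v \<oplus>\<^bsub>M\<^esub> w) = \<phi> v + \<phi> w" if "v \<in> carrier M" "w \<in> carrier M" for v w
      using \<phi>\<psi>[of "\<phi> v + \<phi> w"] \<psi>_add[of "\<phi> v" "\<phi> w"] \<psi>\<phi> \<phi>c that by simp
    moreover have "\<phi> (c \<odot>\<^bsub>M\<^esub> v) = c \<cdot>\<^sub>v \<phi> v" if "v \<in> carrier M" for c v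
      using \<phi>\<psi>[of "c \<cdot>\<^sub>v \<phi> v"] \<psi>_smult[of "\<phi> v" c] \<psi>\<phi> \<phi>c that by simp
    ultimately show ?thesis using \<phi>c by (auto simp: LinearCombinations.module_hom_def module_vec_simps)
  qed
  with \<phi>bij that show ?thesis by blast
qed

section \<open>Twisted modules in coordinates\<close>

lemma poly_additive_induct:
  fixes u :: "complex poly"
  assumes monom: "\<And>c k. P (monom c k)" and add: "\<And>u v. P u \<Longrightarrow> P v \<Longrightarrow> P (u + v)"
  shows "P u"
proof -
  have "P (\<Sum>i\<in>A. monom (coeff u i) i)" for A :: "nat set"
  proof (induction A rule: infinite_finite_induct)
    case (insert x F)
    thus ?case using add[OF monom] by simp
  qed (use monom[of 0 0] in auto)
  from this[of "{..degree u}"] show ?thesis by (simp add: poly_as_sum_of_monoms)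
qed

text \<open>In coordinates, the modes become matrices and the fields become matrices of Laurent series.\<close>

locale coordinatized_module = twisted_module M p g "derivation_of f" Y + graded_automorphism g p
  for M :: "(complex, 'm) module" (structure) and p g f Y +
  fixes n :: nat and \<phi> :: "'m \<Rightarrow> complex vec"
  assumes \<phi>_hom: "\<phi> \<in> LinearCombinations.module_hom class_ring M (module_vec TYPE(complex) n)"
    and \<phi>_bij: "bij_betw \<phi> (carrier M) (carrier_vec n)"
begin

definition \<psi> :: "complex vec \<Rightarrow> 'm" where "\<psi> = the_inv_into (carrier M) \<phi>"

lemma p_pos: "p > 0" using p1 by simp

lemma \<phi>_carrier [simp]: "w \<in> carrier M \<Longrightarrow> \<phi> w \<in> carrier_vec n"
  using \<phi>_bij by (auto simp: bij_betw_def)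

lemma \<phi>_add: "v \<in> carrier M \<Longrightarrow> w \<in> carrier M \<Longrightarrow> \<phi> (v \<oplus> w) = \<phi> v + \<phi> w"
  using \<phi>_hom by (auto simp: LinearCombinations.module_hom_def module_vec_simps)

lemma \<phi>_smult: "w \<in> carrier M \<Longrightarrow> \<phi> (c \<odot> w) = c \<cdot>\<^sub>v \<phi> w"
  using \<phi>_hom by (auto simp: LinearCombinations.module_hom_def module_vec_simps)

lemma \<phi>_inj: "v \<in> carrier M \<Longrightarrow> w \<in> carrier M \<Longrightarrow> \<phi> v = \<phi> w \<longleftrightarrow> v = w"
  using \<phi>_bij by (auto simp: bij_betw_def inj_on_def)

lemma \<phi>_zero [simp]: "\<phi> \<zero> = 0\<^sub>v n"
proof -
  have "\<phi> (\<zero> \<oplus> \<zero>) = \<phi> \<zero> + \<phi> \<zero>" by (rule \<phi>_add) auto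
  hence "\<phi> \<zero> = \<phi> \<zero> + \<phi> \<zero>" by simp
  hence "\<phi> \<zero> $ i = \<phi> \<zero> $ i + \<phi> \<zero> $ i" if "i < n" for i
    using that by (metis index_add_vec(1) carrier_vecD \<phi>_carrier M.zero_closed)
  thus ?thesis using \<phi>_carrier[of \<zero>] by (intro eq_vecI) auto
qed

lemma \<psi>_carrier [simp]: "x \<in> carrier_vec n \<Longrightarrow> \<psi> x \<in> carrier M"
  using \<phi>_bij unfolding \<psi>_def by (auto simp: bij_betw_def intro!: the_inv_into_into)

lemma \<phi>_\<psi> [simp]: "x \<in> carrier_vec n \<Longrightarrow> \<phi> (\<psi> x) = x"
  unfolding \<psi>_def by (rule f_the_inv_into_f_bij_betw[OF \<phi>_bij]) simp

lemma \<psi>_\<phi> [simp]: "w \<in> carrier M \<Longrightarrow> \<psi> (\<phi> w) = w"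
  using \<phi>_bij unfolding \<psi>_def by (auto simp: bij_betw_def intro!: the_inv_into_f_f)

lemma \<psi>_add: "x \<in> carrier_vec n \<Longrightarrow> y \<in> carrier_vec n \<Longrightarrow> \<psi> (x + y) = \<psi> x \<oplus> \<psi> y"
  by (subst \<phi>_inj[symmetric]) (auto simp: \<phi>_add)

lemma \<psi>_smult: "x \<in> carrier_vec n \<Longrightarrow> \<psi> (c \<cdot>\<^sub>v x) = c \<odot> \<psi> x"
  by (subst \<phi>_inj[symmetric]) (auto simp: \<phi>_smult intro!: smult_closed)

lemma Y_hom: "Y u i \<in> LinearCombinations.module_hom class_ring M M"
  using mode_linear[of u i] by (simp add: linear_map_def mod_hom_def mod_hom_axioms_def)

lemma Y_carrier [simp]: "w \<in> carrier M \<Longrightarrow> Y u i w \<in> carrier M"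
  using Y_hom[of u i] by (auto simp: LinearCombinations.module_hom_def)

lemma Y_vec_add: "v \<in> carrier M \<Longrightarrow> w \<in> carrier M \<Longrightarrow> Y u i (v \<oplus> w) = Y u i v \<oplus> Y u i w"
  using Y_hom[of u i] by (auto simp: LinearCombinations.module_hom_def)

lemma Y_vec_smult: "w \<in> carrier M \<Longrightarrow> Y u i (c \<odot> w) = c \<odot> Y u i w"
  using Y_hom[of u i] by (auto simp: LinearCombinations.module_hom_def)

definition mode :: "complex poly \<Rightarrow> int \<Rightarrow> complex mat" where
  "mode u a = mat n n (\<lambda>(r, s). \<phi> (Y u (of_int a / of_nat p) (\<psi> (unit_vec n s))) $ r)"

lemma mode_carrier [simp]: "mode u a \<in> carrier_mat n n" by (simp add: mode_def)

lemma mode_dim [simp]: "dim_row (mode u a) = n" "dim_col (mode u a) = n" by (simp_all add: mode_def)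

lemma mode_apply':
  assumes "x \<in> carrier_vec n"
  shows "mode u a *\<^sub>v x = \<phi> (Y u (of_int a / of_nat p) (\<psi> x))"
  unfolding mode_def
  by (rule linear_vec_as_matrix[symmetric])
     (use assms in \<open>auto simp: \<psi>_add \<psi>_smult Y_vec_add Y_vec_smult \<phi>_add \<phi>_smult\<close>)

lemma mode_apply:
  assumes "of_nat p * i = of_int a" "w \<in> carrier M"
  shows "\<phi> (Y u i w) = mode u a *\<^sub>v \<phi> w"
proof -
  have "i = of_int a / of_nat p" using assms p_pos by (simp add: field_simps)
  thus ?thesis using assms by (simp add: mode_apply')
qed

lemma mode_add: "mode (u + v) a = mode u a + mode v a"
  by (rule mat_eq_by_vecI[of _ n])
     (auto simp: mode_apply' add_mult_distrib_mat_vec[of _ n n] field_add \<phi>_add)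

lemma mode_smult: "mode (Polynomial.smult c u) a = c \<cdot>\<^sub>m mode u a"
  by (rule mat_eq_by_vecI[of _ n]) (auto simp: mode_apply' smult_mat_mult_vec[of _ n] field_smult \<phi>_smult)

lemma mode_0 [simp]: "mode 0 a = 0\<^sub>m n n"
proof -
  have z: "mode 0 a = 0 \<cdot>\<^sub>m mode 0 a" using mode_smult[of 0 0 a] by simp
  show ?thesis by (rule eq_matI, subst z) auto
qed

lemma mode_vacuum: "mode 1 a = (if a = - int p then 1\<^sub>m n else 0\<^sub>m n n)"
proof -
  have "(of_int a :: rat) / of_nat p = - 1 \<longleftrightarrow> (of_int a :: rat) = of_int (- int p)"
    using p_pos by (simp add: field_simps)
  hence iff: "(of_int a :: rat) / of_nat p = - 1 \<longleftrightarrow> a = - int p" by (simp only: of_int_eq_iff)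
  show ?thesis by (rule mat_eq_by_vecI[of _ n]) (auto simp: mode_apply' vacuum iff)
qed

text \<open>The bound in the truncation condition depends on the vector, but a basis is finite.\<close>

lemma mode_truncation: "\<exists>N. \<forall>a>N. mode u a = 0\<^sub>m n n"
proof -
  have "\<exists>N. \<forall>a>N. Y u (of_int a / of_nat p) (\<psi> (unit_vec n s)) = \<zero>" for s
  proof -
    obtain N where N: "\<forall>i>N. Y u i (\<psi> (unit_vec n s)) = \<zero>"
      using truncation[of "\<psi> (unit_vec n s)" u] by auto
    show ?thesis
    proof (intro exI allI impI)
      fix a assume "int p * \<lceil>N\<rceil> < a"
      hence "of_int (int p * \<lceil>N\<rceil>) < (of_int a :: rat)" by (simp only: of_int_less_iff)
      hence "of_nat p * of_int \<lceil>N\<rceil> < (of_int a :: rat)" by simp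
      hence "of_int \<lceil>N\<rceil> < (of_int a :: rat) / of_nat p" using p_pos by (simp add: field_simps)
      hence "N < of_int a / of_nat p" by linarith
      thus "Y u (of_int a / of_nat p) (\<psi> (unit_vec n s)) = \<zero>" using N by blast
    qed
  qed
  then obtain N where N: "\<And>s a. a > N s \<Longrightarrow> Y u (of_int a / of_nat p) (\<psi> (unit_vec n s)) = \<zero>" by metis
  show ?thesis
  proof (intro exI allI impI eq_matI)
    fix a r s assume a: "a > Max (insert 0 (N ` {..<n}))" and "r < dim_row (0\<^sub>m n n :: complex mat)" "s < dim_col (0\<^sub>m n n :: complex mat)"
    hence rs: "r < n" "s < n" by auto
    hence "N s \<le> Max (insert 0 (N ` {..<n}))" by (intro Max_ge) auto
    with a have "a > N s" by linarith
    thus "mode u a $$ (r, s) = 0\<^sub>m n n $$ (r, s)" using rs N[of s a] by (simp add: mode_def)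
  qed auto
qed

lemma residue_index:
  assumes "int p dvd a - r"
  shows "(of_int a :: rat) / of_nat p - of_nat (nat (r mod int p)) / of_nat p \<in> \<int>"
proof -
  have "int p dvd (a - r) + (r - r mod int p)" using assms by (rule dvd_add) (simp add: minus_mod_eq_mult_div)
  then obtain z where z: "a - r mod int p = int p * z" by auto
  have "(of_nat (nat (r mod int p)) :: rat) = of_int (r mod int p)" using p_pos by simp
  hence "(of_int a :: rat) / of_nat p - of_nat (nat (r mod int p)) / of_nat p = of_int (a - r mod int p) / of_nat p"
    by (simp add: diff_divide_distrib)
  also have "\<dots> = of_int z" using p_pos by (simp add: z)
  finally show ?thesis by simp
qed

lemma graded_part_mod:
  assumes "\<forall>k. coeff u k \<noteq> 0 \<longrightarrow> int p dvd int k - r"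
  shows "u \<in> graded_part g (nat (r mod int p))"
  unfolding graded_part_iff
proof (intro allI impI)
  fix k assume "coeff u k \<noteq> 0"
  hence "int p dvd (int k - r) + (r - r mod int p)"
    using assms by (intro dvd_add) (auto simp: minus_mod_eq_mult_div)
  thus "int p dvd int k - int (nat (r mod int p))" using p_pos by simp
qed

lemma nat_mod_less: "nat (r mod int p) < p"
  using p_pos pos_mod_bound[of "int p" r] by (simp add: nat_less_iff)

lemma mode_grading:
  assumes u: "\<forall>k. coeff u k \<noteq> 0 \<longrightarrow> int p dvd int k - r" and a: "\<not> int p dvd a - r"
  shows "mode u a = 0\<^sub>m n n"
proof -
  have "(of_int a :: rat) / of_nat p - of_nat (nat (r mod int p)) / of_nat p \<notin> \<int>"
  proof
    assume "(of_int a :: rat) / of_nat p - of_nat (nat (r mod int p)) / of_nat p \<in> \<int>"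
    then obtain z where "(of_int a :: rat) / of_nat p - of_nat (nat (r mod int p)) / of_nat p = of_int z" by (rule Ints_cases)
    moreover have "(of_nat (nat (r mod int p)) :: rat) = of_int (r mod int p)" using p_pos by simp
    ultimately have "(of_int a :: rat) = of_int (r mod int p + int p * z)" using p_pos by (simp add: field_simps)
    hence "a = r mod int p + int p * z" by (simp only: of_int_eq_iff)
    hence "a - r = int p * z - (r - r mod int p)" by simp
    hence "int p dvd a - r" by (metis dvd_diff dvd_triv_left minus_mod_eq_mult_div)
    with a show False by blast
  qed
  hence "Y u (of_int a / of_nat p) w = \<zero>" if "w \<in> carrier M" for w
    using grading[OF nat_mod_less graded_part_mod[OF u]] that by blast
  thus ?thesis by (intro mat_eq_by_vecI[of _ n]) (auto simp: mode_apply')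
qed

text \<open>A finitely supported sum becomes a sum over an initial segment, which may be taken as long as convenient.\<close>

lemma \<phi>_fsum:
  assumes h: "\<And>i. h i \<in> carrier M" and L: "\<And>i. i \<ge> L \<Longrightarrow> h i = \<zero>" and r: "r < n"
  shows "\<phi> (fsum M h) $ r = (\<Sum>i<L. \<phi> (h i) $ r)"
proof -
  let ?S = "{i. h i \<noteq> \<zero>}"
  have S: "?S \<subseteq> {..<L}" using L by (auto simp: not_less[symmetric])
  hence fin: "finite ?S" by (rule finite_subset) simp
  have cl: "finsum M h A \<in> carrier M" for A using h by (intro M.finsum_closed) auto
  have "\<phi> (finsum M h A) $ r = (\<Sum>i\<in>A. \<phi> (h i) $ r)" if "finite A" for A
    using that
  proof (induction A)
    case (insert i A)
    have "finsum M h (insert i A) = h i \<oplus> finsum M h A" using insert h by (intro M.finsum_insert) auto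
    hence "\<phi> (finsum M h (insert i A)) = \<phi> (h i) + \<phi> (finsum M h A)" using h cl by (simp add: \<phi>_add)
    thus ?case using insert r carrier_vecD[OF \<phi>_carrier[OF cl[of A]]] by simp
  qed (use r in simp)
  hence "\<phi> (fsum M h) $ r = (\<Sum>i\<in>?S. \<phi> (h i) $ r)" using fin by (simp add: fsum_def)
  also have "\<dots> = (\<Sum>i<L. \<phi> (h i) $ r)" by (rule sum.mono_neutral_left) (use S r in auto)
  finally show ?thesis .
qed

text \<open>Any bound \<open>L\<close> beyond which all terms vanish may be used, so that both sides are ordinary finite sums of matrix entries.\<close>

lemma mode_jacobi:
  assumes u: "\<forall>k. coeff u k \<noteq> 0 \<longrightarrow> int p dvd int k - r" and v: "\<forall>k. coeff v k \<noteq> 0 \<longrightarrow> int p dvd int k - s"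
    and a: "int p dvd a - r" and b: "int p dvd b - s"
    and L: "l + int L \<ge> 0" "\<And>i. i \<ge> L \<Longrightarrow> mode u (a + int p * int i) = 0\<^sub>m n n" "\<And>i. i \<ge> L \<Longrightarrow> mode v (b + int p * int i) = 0\<^sub>m n n"
    and xy: "x < n" "y < n"
  shows "(\<Sum>i<L. (of_int a / of_nat p gchoose i) * mode (va_prod (derivation_of f) u (l + int i) v) (a + b - int p * int i) $$ (x, y))
    = (\<Sum>i<L. ((of_int l gchoose i) * (- 1) ^ i) *
        ((mode u (int p * l + a - int p * int i) * mode v (b + int p * int i)) $$ (x, y)
         + (- 1) powi (l + 1) * (mode v (int p * l + b - int p * int i) * mode u (a + int p * int i)) $$ (x, y)))"
proof -
  let ?m = "of_int a / of_nat p :: rat" and ?n = "of_int b / of_nat p :: rat"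
  define w where "w = \<psi> (unit_vec n y)"
  have w: "w \<in> carrier M" and \<phi>w: "\<phi> w = unit_vec n y" by (simp_all add: w_def)
  let ?lhs = "\<lambda>i. (of_rat ?m gchoose i) \<odot> Y (va_prod (derivation_of f) u (l + int i) v) (?m + ?n - of_nat i) w"
  let ?rhs = "\<lambda>i. ((of_int l gchoose i) * (- 1) ^ i) \<odot>
            (Y u (of_int l + ?m - of_nat i) (Y v (?n + of_nat i) w)
             \<oplus> ((- 1) powi (l + 1)) \<odot> Y v (of_int l + ?n - of_nat i) (Y u (?m + of_nat i) w))"
  have J: "fsum M ?lhs = fsum M ?rhs"
    by (rule jacobi[OF nat_mod_less nat_mod_less graded_part_mod[OF u] graded_part_mod[OF v] residue_index[OF a] residue_index[OF b] w])
  have col: "(A *\<^sub>v unit_vec n y) $ x = A $$ (x, y)" if "A \<in> carrier_mat n n" for A :: "complex mat"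
    using that xy by (simp add: scalar_prod_def unit_vec_def)
       (subst sum.remove[of _ y], auto intro!: sum.neutral)
  have rat: "of_rat ?m = (of_int a / of_nat p :: complex)" by (simp add: of_rat_divide)
  have lhs: "\<phi> (?lhs i) = (of_int a / of_nat p gchoose i) \<cdot>\<^sub>v (mode (va_prod (derivation_of f) u (l + int i) v) (a + b - int p * int i) *\<^sub>v unit_vec n y)" for i
  proof -
    have "of_nat p * (?m + ?n - of_nat i) = of_int (a + b - int p * int i)" using p_pos by (simp add: field_simps)
    from mode_apply[OF this w] show ?thesis unfolding rat by (simp add: \<phi>_smult w \<phi>w)
  qed
  have rhs: "\<phi> (?rhs i) = ((of_int l gchoose i) * (- 1) ^ i) \<cdot>\<^sub>v
      ((mode u (int p * l + a - int p * int i) * mode v (b + int p * int i)) *\<^sub>v unit_vec n y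
         + (- 1) powi (l + 1) \<cdot>\<^sub>v ((mode v (int p * l + b - int p * int i) * mode u (a + int p * int i)) *\<^sub>v unit_vec n y))" for i
  proof -
    have e: "of_nat p * (of_int l + ?m - of_nat i) = of_int (int p * l + a - int p * int i)"
       "of_nat p * (of_int l + ?n - of_nat i) = of_int (int p * l + b - int p * int i)"
       "of_nat p * (?m + of_nat i) = of_int (a + int p * int i)"
       "of_nat p * (?n + of_nat i) = of_int (b + int p * int i)" using p_pos by (simp_all add: field_simps)
    show ?thesis
      by (simp add: \<phi>_smult \<phi>_add w mode_apply[OF e(1)] mode_apply[OF e(2)] mode_apply[OF e(3)] mode_apply[OF e(4)] \<phi>w assoc_mult_mat_vec[of _ n n _ n])
  qed
  have lz: "?lhs i = \<zero>" if "i \<ge> L" for i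
  proof (subst \<phi>_inj[symmetric])
    have "va_prod (derivation_of f) u (l + int i) v = 0" using that L(1) by (simp add: va_prod_def)
    thus "\<phi> (?lhs i) = \<phi> \<zero>" unfolding lhs by (auto intro!: eq_vecI)
  qed (use w in auto)
  have rz: "?rhs i = \<zero>" if "i \<ge> L" for i
  proof (subst \<phi>_inj[symmetric])
    show "\<phi> (?rhs i) = \<phi> \<zero>" unfolding rhs using L(2,3)[OF that] by (auto intro!: eq_vecI)
  qed (use w in auto)
  have "\<phi> (fsum M ?lhs) $ x = (\<Sum>i<L. \<phi> (?lhs i) $ x)"
    by (rule \<phi>_fsum[OF _ lz xy(1)]) (use w in auto)
  moreover have "\<phi> (fsum M ?rhs) $ x = (\<Sum>i<L. \<phi> (?rhs i) $ x)"
    by (rule \<phi>_fsum[OF _ rz xy(1)]) (use w in auto)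
  ultimately have "(\<Sum>i<L. \<phi> (?lhs i) $ x) = (\<Sum>i<L. \<phi> (?rhs i) $ x)" using J by simp
  thus ?thesis unfolding lhs rhs using xy by (simp add: col del: index_mult_mat_vec)
qed

lemma mode_eventually_0: "\<exists>L. \<forall>i\<ge>L. mode u (a + int p * int i) = 0\<^sub>m n n"
proof -
  obtain N where N: "\<forall>a>N. mode u a = 0\<^sub>m n n" using mode_truncation by blast
  show ?thesis
  proof (intro exI allI impI)
    fix i assume i: "i \<ge> nat (N - a + 1)"
    have "int i \<le> int p * int i" using p_pos by (simp add: mult_le_cancel_right1)
    hence "a + int p * int i > N" using i by linarith
    thus "mode u (a + int p * int i) = 0\<^sub>m n n" using N by blast
  qed
qed

text \<open>The Jacobi identity for \<open>l = 0\<close>: the nonnegative products of the vertex algebra vanish.\<close>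

lemma mode_commute:
  assumes u: "\<forall>k. coeff u k \<noteq> 0 \<longrightarrow> int p dvd int k - r" and v: "\<forall>k. coeff v k \<noteq> 0 \<longrightarrow> int p dvd int k - s"
  shows "mode u a * mode v b = mode v b * mode u a"
proof (cases "int p dvd a - r \<and> int p dvd b - s")
  case True
  obtain L1 L2 where L: "\<forall>i\<ge>L1. mode u (a + int p * int i) = 0\<^sub>m n n" "\<forall>i\<ge>L2. mode v (b + int p * int i) = 0\<^sub>m n n"
    using mode_eventually_0 by metis
  define L where "L = Suc (max L1 L2)"
  show ?thesis
  proof (rule eq_matI)
    fix x y assume "x < dim_row (mode v b * mode u a)" "y < dim_col (mode v b * mode u a)"
    hence xy: "x < n" "y < n" by auto
    have J: "(\<Sum>i<L. (of_int a / of_nat p gchoose i) * mode (va_prod (derivation_of f) u (0 + int i) v) (a + b - int p * int i) $$ (x, y))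
    = (\<Sum>i<L. ((of_int 0 gchoose i) * (- 1) ^ i) *
        ((mode u (int p * 0 + a - int p * int i) * mode v (b + int p * int i)) $$ (x, y)
         + (- 1) powi (0 + 1) * (mode v (int p * 0 + b - int p * int i) * mode u (a + int p * int i)) $$ (x, y)))"
      by (rule mode_jacobi[OF u v _ _ _ _ _ xy]) (use True L in \<open>auto simp: L_def\<close>)
    have "(\<Sum>i<L. (of_int a / of_nat p gchoose i) * mode (va_prod (derivation_of f) u (0 + int i) v) (a + b - int p * int i) $$ (x, y)) = 0"
      by (rule sum.neutral) (use xy in \<open>auto simp: va_prod_def\<close>)
    moreover have "(0 gchoose i) = (0 :: complex)" if "i > 0" for i using that by (cases i) auto
    hence "(\<Sum>i<L. ((of_int 0 gchoose i) * (- 1) ^ i) *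
        ((mode u (int p * 0 + a - int p * int i) * mode v (b + int p * int i)) $$ (x, y)
         + (- 1) powi (0 + 1) * (mode v (int p * 0 + b - int p * int i) * mode u (a + int p * int i)) $$ (x, y)))
      = (mode u a * mode v b) $$ (x, y) - (mode v b * mode u a) $$ (x, y)"
      unfolding L_def by (subst sum.lessThan_Suc_shift) (auto intro!: sum.neutral)
    ultimately show "(mode u a * mode v b) $$ (x, y) = (mode v b * mode u a) $$ (x, y)" using J by simp
  qed auto
next
  case False
  hence "mode u a = 0\<^sub>m n n \<or> mode v b = 0\<^sub>m n n" using mode_grading[OF u] mode_grading[OF v] by blast
  thus ?thesis by (auto simp: left_mult_zero_mat[of _ n n] right_mult_zero_mat[of _ n n])
qed

text \<open>The Jacobi identity for \<open>l = - 1\<close>. The mode \<open>b\<close> of \<open>v\<close> is taken so large that on the right only the products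
  with a mode of \<open>v\<close> on the left remain.\<close>

lemma mode_product:
  assumes u: "\<forall>k. coeff u k \<noteq> 0 \<longrightarrow> int p dvd int k - r" and v: "\<forall>k. coeff v k \<noteq> 0 \<longrightarrow> int p dvd int k - s"
    and a: "int p dvd a - r" and b: "int p dvd b - s"
    and b0: "\<And>i. mode v (b + int p * int i) = 0\<^sub>m n n" and L: "\<And>i. i \<ge> L \<Longrightarrow> mode u (a + int p * int i) = 0\<^sub>m n n"
    and xy: "x < n" "y < n"
  shows "mode (u * v) (a + b) $$ (x, y) = (\<Sum>i<Suc L. (mode v (b - int p - int p * int i) * mode u (a + int p * int i)) $$ (x, y))"
proof -
  have J: "(\<Sum>i<Suc L. (of_int a / of_nat p gchoose i) * mode (va_prod (derivation_of f) u (- 1 + int i) v) (a + b - int p * int i) $$ (x, y))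
    = (\<Sum>i<Suc L. ((of_int (- 1) gchoose i) * (- 1) ^ i) *
        ((mode u (int p * (- 1) + a - int p * int i) * mode v (b + int p * int i)) $$ (x, y)
         + (- 1) powi (- 1 + 1) * (mode v (int p * (- 1) + b - int p * int i) * mode u (a + int p * int i)) $$ (x, y)))"
    by (rule mode_jacobi[OF u v a b _ _ _ xy]) (use b0 L in auto)
  have "(\<Sum>i<Suc L. (of_int a / of_nat p gchoose i) * mode (va_prod (derivation_of f) u (- 1 + int i) v) (a + b - int p * int i) $$ (x, y))
    = mode (u * v) (a + b) $$ (x, y)"
    by (subst sum.lessThan_Suc_shift) (use xy in \<open>auto intro!: sum.neutral simp: va_prod_def\<close>)
  moreover have "(of_int (- 1) gchoose i) * (- 1) ^ i = (1 :: complex)" for i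
  proof -
    have "(- 1 gchoose i) = ((- 1) ^ i :: complex)"
      using gbinomial_minus[of "1 :: complex" i] by (simp add: binomial_gbinomial[symmetric])
    thus ?thesis by (simp flip: power_mult_distrib)
  qed
  ultimately show ?thesis using J xy b0
    by (simp add: right_mult_zero_mat[of _ n n] algebra_simps del: index_mult_mat sum.lessThan_Suc)
qed

text \<open>The Jacobi identity for \<open>l = - k - 1\<close> and the vacuum vector, whose only nonzero mode does not occur on the right for
  \<open>k > 0\<close>. It determines the modes of \<open>D ^ k u\<close> recursively. Only the modes in the grade of \<open>u\<close> are
  covered: \<open>D u\<close> need not be homogeneous.\<close>

lemma mode_derivation:
  assumes u: "\<forall>k. coeff u k \<noteq> 0 \<longrightarrow> int p dvd int k - r" and a: "int p dvd a - r"
  shows "mode ((derivation_of f ^^ k) u) a = (fact k * (- 1) ^ k * (of_int a / of_nat p gchoose k)) \<cdot>\<^sub>m mode u (a - int p * int k)"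
  using a
proof (induction k arbitrary: a rule: less_induct)
  case (less k)
  show ?case
  proof (cases "k = 0")
    case True
    thus ?thesis by (auto intro!: eq_matI)
  next
    case False
    hence k: "k > 0" by simp
    let ?D = "derivation_of f" and ?x = "of_int a / of_nat p :: complex"
    obtain L1 where L1: "\<forall>i\<ge>L1. mode u (a + int p * int i) = 0\<^sub>m n n" using mode_eventually_0 by metis
    define L where "L = max L1 (Suc k)"
    have L: "Suc k \<le> L" "L1 \<le> L" by (auto simp: L_def)
    have nz: "int p * int i \<noteq> - int p" for i
    proof
      assume "int p * int i = - int p"
      moreover have "int p * int i \<ge> 0" by simp
      ultimately show False using p_pos by linarith
    qed
    have one: "\<forall>j. coeff (1 :: complex poly) j \<noteq> 0 \<longrightarrow> int p dvd int j - 0" by (auto simp: coeff_1)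
    show ?thesis
    proof (rule eq_matI)
      fix x y assume "x < dim_row ((fact k * (- 1) ^ k * (?x gchoose k)) \<cdot>\<^sub>m mode u (a - int p * int k))"
        "y < dim_col ((fact k * (- 1) ^ k * (?x gchoose k)) \<cdot>\<^sub>m mode u (a - int p * int k))"
      hence xy: "x < n" "y < n" by auto
      let ?U = "mode u (a - int p * int k) $$ (x, y)"
      have "(\<Sum>i<L. (of_int a / of_nat p gchoose i) * mode (va_prod ?D u (- int k - 1 + int i) 1) (a + 0 - int p * int i) $$ (x, y))
        = (\<Sum>i<L. ((of_int (- int k - 1) gchoose i) * (- 1) ^ i) *
        ((mode u (int p * (- int k - 1) + a - int p * int i) * mode 1 (0 + int p * int i)) $$ (x, y)
         + (- 1) powi (- int k - 1 + 1) * (mode 1 (int p * (- int k - 1) + 0 - int p * int i) * mode u (a + int p * int i)) $$ (x, y)))"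
        by (rule mode_jacobi[OF u one less.prems _ _ _ _ xy]) (use L L1 nz in \<open>auto simp: mode_vacuum\<close>)
      also have "\<dots> = 0"
      proof (rule sum.neutral, rule ballI)
        fix i
        have "int p * (- int k - 1) + 0 - int p * int i \<noteq> - int p"
        proof
          assume "int p * (- int k - 1) + 0 - int p * int i = - int p"
          hence "int p * (int k + int i) = 0" by (simp add: algebra_simps)
          thus False using p_pos k by simp
        qed
        thus "((of_int (- int k - 1) gchoose i) * (- 1) ^ i) *
        ((mode u (int p * (- int k - 1) + a - int p * int i) * mode 1 (0 + int p * int i)) $$ (x, y)
         + (- 1) powi (- int k - 1 + 1) * (mode 1 (int p * (- int k - 1) + 0 - int p * int i) * mode u (a + int p * int i)) $$ (x, y)) = 0"
          using xy nz[of i] by (simp add: mode_vacuum left_mult_zero_mat[of _ n n] right_mult_zero_mat[of _ n n])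
      qed
      also have "(\<Sum>i<L. (of_int a / of_nat p gchoose i) * mode (va_prod ?D u (- int k - 1 + int i) 1) (a + 0 - int p * int i) $$ (x, y))
        = (\<Sum>i<Suc k. (?x gchoose i) * (1 / fact (k - i) * mode ((?D ^^ (k - i)) u) (a - int p * int i) $$ (x, y)))"
      proof (rule sum.mono_neutral_cong_right)
        fix i assume "i \<in> {..<Suc k}"
        hence "nat (int k - int i) = k - i" "- int k - 1 + int i < 0" by auto
        thus "(of_int a / of_nat p gchoose i) * mode (va_prod ?D u (- int k - 1 + int i) 1) (a + 0 - int p * int i) $$ (x, y) =
          (?x gchoose i) * (1 / fact (k - i) * mode ((?D ^^ (k - i)) u) (a - int p * int i) $$ (x, y))"
          using xy by (simp add: va_prod_def mode_smult)
      qed (use L xy in \<open>auto simp: va_prod_def\<close>)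
      also have "\<dots> = 1 / fact k * mode ((?D ^^ k) u) a $$ (x, y) + (\<Sum>i<k. (?x gchoose Suc i) * (1 / fact (k - Suc i) * mode ((?D ^^ (k - Suc i)) u) (a - int p * int (Suc i)) $$ (x, y)))"
        by (subst sum.lessThan_Suc_shift) simp
      also have "(\<Sum>i<k. (?x gchoose Suc i) * (1 / fact (k - Suc i) * mode ((?D ^^ (k - Suc i)) u) (a - int p * int (Suc i)) $$ (x, y)))
         = (\<Sum>i<k. (?x gchoose k) * ?U * (of_nat (k choose Suc i) * (- 1) ^ (k - Suc i)))"
      proof (rule sum.cong[OF refl])
        fix i assume "i \<in> {..<k}"
        hence i: "k - Suc i < k" "Suc i \<le> k" by auto
        have d: "int p dvd (a - int p * int (Suc i)) - r"
        proof -
          have "(a - int p * int (Suc i)) - r = (a - r) - int p * int (Suc i)" by simp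
          thus ?thesis using less.prems by (metis dvd_diff dvd_triv_left)
        qed
        have e: "a - int p * int (Suc i) - int p * int (k - Suc i) = a - int p * int k" using i(2) by (simp add: of_nat_diff algebra_simps)
        have x: "of_int (a - int p * int (Suc i)) / of_nat p = ?x - of_nat (Suc i)" using p_pos by (simp add: field_simps)
        have tri: "(?x gchoose Suc i) * (?x - of_nat (Suc i) gchoose (k - Suc i)) = (?x gchoose k) * of_nat (k choose Suc i)"
          using gbinomial_trinomial_revision[of "Suc i" k ?x] i(2) by (simp add: binomial_gbinomial)
        have "(?x gchoose Suc i) * (1 / fact (k - Suc i) * mode ((?D ^^ (k - Suc i)) u) (a - int p * int (Suc i)) $$ (x, y))
          = ((?x gchoose Suc i) * (?x - of_nat (Suc i) gchoose (k - Suc i))) * ?U * (- 1) ^ (k - Suc i)"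
          unfolding less.IH[OF i(1) d] e x using xy by simp
        thus "(?x gchoose Suc i) * (1 / fact (k - Suc i) * mode ((?D ^^ (k - Suc i)) u) (a - int p * int (Suc i)) $$ (x, y))
          = (?x gchoose k) * ?U * (of_nat (k choose Suc i) * (- 1) ^ (k - Suc i))"
          unfolding tri by simp
      qed
      \<comment> \<open>the alternating sum of a row of binomial coefficients vanishes\<close>
      also have "\<dots> = (?x gchoose k) * ?U * (- ((- 1) ^ k))"
      proof -
        have "0 = (1 + (- 1 :: complex)) ^ k" using k by simp
        also have "\<dots> = (\<Sum>i<Suc k. of_nat (k choose i) * (- 1) ^ (k - i))" by (subst binomial_ring) (simp add: lessThan_Suc_atMost)
        also have "\<dots> = (- 1) ^ k + (\<Sum>i<k. of_nat (k choose Suc i) * (- 1) ^ (k - Suc i))" by (subst sum.lessThan_Suc_shift) simp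
        finally have "(\<Sum>i<k. of_nat (k choose Suc i) * (- 1) ^ (k - Suc i)) = (- ((- 1) ^ k) :: complex)"
          by (metis add_eq_0_iff)
        thus ?thesis by (simp only: sum_distrib_left[symmetric])
      qed
      finally have "1 / fact k * mode ((?D ^^ k) u) a $$ (x, y) = (?x gchoose k) * ?U * (- 1) ^ k" by simp
      thus "mode ((?D ^^ k) u) a $$ (x, y) = ((fact k * (- 1) ^ k * (?x gchoose k)) \<cdot>\<^sub>m mode u (a - int p * int k)) $$ (x, y)"
        using xy by (simp add: field_simps)
    qed auto
  qed
qed

text \<open>The other components of \<open>u\<close> have no mode of this index.\<close>

lemma mode_graded_comp:
  assumes a: "int p dvd a - r"
  shows "mode (graded_comp p r u) a = mode u a"
proof (induction u rule: poly_additive_induct)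
  case (1 c k)
  show ?case
  proof (cases "int p dvd int k - r")
    case True
    hence "graded_comp p r (monom c k) = monom c k" by (intro poly_eqI) (auto simp: coeff_graded_comp)
    thus ?thesis by simp
  next
    case False
    hence "graded_comp p r (monom c k) = 0" by (intro poly_eqI) (auto simp: coeff_graded_comp)
    moreover have "mode (monom c k) a = 0\<^sub>m n n"
    proof (rule mode_grading)
      show "\<not> int p dvd a - int k"
      proof
        assume "int p dvd a - int k"
        hence "int p dvd (a - r) - (a - int k)" by (rule dvd_diff[OF a])
        with False show False by simp
      qed
    qed auto
    ultimately show ?thesis by simp
  qed
next
  case (2 u v)
  thus ?case by (simp add: graded_comp_add mode_add)
qed

definition Ymat :: "complex poly \<Rightarrow> complex fls mat" where
  "Ymat u = mat n n (\<lambda>(i, j). Abs_fls (\<lambda>e. mode u (- e - int p) $$ (i, j)))"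

lemma Ymat_carrier [simp]: "Ymat u \<in> carrier_mat n n" by (simp add: Ymat_def)

lemma Ymat_dim [simp]: "dim_row (Ymat u) = n" "dim_col (Ymat u) = n" by (simp_all add: Ymat_def)

lemma Ymat_nth:
  assumes "i < n" "j < n"
  shows "fls_nth (Ymat u $$ (i, j)) e = mode u (- e - int p) $$ (i, j)"
proof -
  obtain N where N: "\<forall>a>N. mode u a = 0\<^sub>m n n" using mode_truncation by blast
  have "\<forall>e<(- N - int p). mode u (- e - int p) $$ (i, j) = 0" using N assms by simp
  from nth_Abs_fls_lower_bound[OF this] show ?thesis using assms by (simp add: Ymat_def)
qed

lemma coeff_Ymat: "coeff_mat (Ymat u) e = mode u (- e - int p)"
  by (rule eq_matI) (auto simp: Ymat_nth)

lemma Ymat_add: "Ymat (u + v) = Ymat u + Ymat v"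
  by (rule mat_eq_coeff_matI[of _ n n]) (auto intro!: eq_matI simp: Ymat_nth mode_add)

lemma Ymat_smult: "Ymat (Polynomial.smult c u) = fls_const c \<cdot>\<^sub>m Ymat u"
  by (rule mat_eq_coeff_matI[of _ n n]) (auto intro!: eq_matI simp: Ymat_nth mode_smult)

lemma Ymat_1: "Ymat 1 = 1\<^sub>m n"
  by (rule mat_eq_coeff_matI[of _ n n]) (auto intro!: eq_matI simp: Ymat_nth mode_vacuum)

lemma Ymat_graded:
  assumes u: "\<forall>k. coeff u k \<noteq> 0 \<longrightarrow> int p dvd int k - r" and ij: "i < n" "j < n"
  shows "graded_fls p r (Ymat u $$ (i, j))"
  unfolding graded_fls_def
proof (intro allI impI)
  fix e assume "fls_nth (Ymat u $$ (i, j)) e \<noteq> 0"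
  hence "mode u (- e - int p) \<noteq> 0\<^sub>m n n" using ij by (auto simp: Ymat_nth)
  hence "int p dvd - e - int p - r" using mode_grading[OF u] by blast
  hence "int p dvd - (- e - int p - r) - int p" by (intro dvd_diff) (auto simp only: dvd_minus_iff dvd_refl)
  thus "int p dvd e + r" by (simp add: add.commute)
qed

text \<open>The coefficients of the product are the finite sums in the Jacobi identity for \<open>l = - 1\<close>.\<close>

lemma Ymat_mult:
  assumes u: "\<forall>k. coeff u k \<noteq> 0 \<longrightarrow> int p dvd int k - r" and v: "\<forall>k. coeff v k \<noteq> 0 \<longrightarrow> int p dvd int k - s"
  shows "Ymat (u * v) = Ymat v * Ymat u"
proof (rule eq_matI)
  fix x y assume "x < dim_row (Ymat v * Ymat u)" "y < dim_col (Ymat v * Ymat u)"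
  hence xy: "x < n" "y < n" by auto
  have gr: "graded_fls p (r + s) (Ymat (u * v) $$ (x, y))"
    by (rule Ymat_graded[OF graded_mult[OF u v] xy])
  have gm: "graded_fls p (s + r) ((Ymat v * Ymat u) $$ (x, y))"
    using graded_mat_mult[of p s "Ymat v" r "Ymat u" n] Ymat_graded[OF u] Ymat_graded[OF v] xy by (simp add: graded_mat_def)
  show "Ymat (u * v) $$ (x, y) = (Ymat v * Ymat u) $$ (x, y)"
  proof (rule fls_eqI)
    fix e
    show "fls_nth (Ymat (u * v) $$ (x, y)) e = fls_nth ((Ymat v * Ymat u) $$ (x, y)) e"
    proof (cases "int p dvd e + (r + s)")
      case False
      hence "fls_nth (Ymat (u * v) $$ (x, y)) e = 0" "fls_nth ((Ymat v * Ymat u) $$ (x, y)) e = 0"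
        using gr gm unfolding graded_fls_def add.commute[of s r] by blast+
      thus ?thesis by simp
    next
      case True
      obtain N where N: "\<forall>a>N. mode v a = 0\<^sub>m n n" using mode_truncation by blast
      \<comment> \<open>an index \<open>b\<close> in the grade of \<open>v\<close> beyond all nonzero modes\<close>
      define K where "K = \<bar>N\<bar> + \<bar>s\<bar> + 1"
      define b where "b = s + int p * K"
      define a where "a = - e - int p - b"
      have "1 * K \<le> int p * K" using p_pos by (intro mult_right_mono) (auto simp: K_def)
      moreover have "K > N - s" unfolding K_def by linarith
      ultimately have bN: "b > N" unfolding b_def by linarith
      have b0: "mode v (b + int p * int i) = 0\<^sub>m n n" for i
      proof -
        have "int p * int i \<ge> 0" by simp
        hence "b + int p * int i > N" using bN by linarith
        thus ?thesis using N by blast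
      qed
      have b: "int p dvd b - s" by (simp add: b_def)
      have a: "int p dvd a - r"
      proof -
        have "a - r = - (e + (r + s)) - int p - (b - s)" by (simp add: a_def)
        thus ?thesis using True b by (metis dvd_diff dvd_minus_iff dvd_refl)
      qed
      obtain L where L: "\<forall>i\<ge>L. mode u (a + int p * int i) = 0\<^sub>m n n" using mode_eventually_0 by metis
      \<comment> \<open>the exponents of \<open>z\<close> that contribute from the first factor\<close>
      define h where "h = (\<lambda>i. - b + int p * int i)"
      have inj: "inj_on h A" for A using p_pos by (auto simp: h_def inj_on_def)
      have ab: "a + b = - e - int p" by (simp add: a_def)
      have entry: "fls_nth (Ymat v $$ (x, l) * Ymat u $$ (l, y)) e = (\<Sum>i<Suc L. mode v (b - int p - int p * int i) $$ (x, l) * mode u (a + int p * int i) $$ (l, y))"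
        if l: "l < n" for l
      proof -
        have "fls_nth (Ymat v $$ (x, l) * Ymat u $$ (l, y)) e = (\<Sum>e'\<in>h ` {..<Suc L}. fls_nth (Ymat v $$ (x, l)) e' * fls_nth (Ymat u $$ (l, y)) (e - e'))"
        proof (rule fls_times_nth_superset)
          fix e' assume e': "fls_nth (Ymat v $$ (x, l)) e' \<noteq> 0" "fls_nth (Ymat u $$ (l, y)) (e - e') \<noteq> 0"
          have "int p dvd e' + s" using e'(1) Ymat_graded[OF v xy(1) l] by (auto simp: graded_fls_def)
          hence "int p dvd (e' + s) + (b - s)" using b by (rule dvd_add)
          then obtain z where z: "e' + b = int p * z" by auto
          have "mode v (- e' - int p) \<noteq> 0\<^sub>m n n" using e'(1) xy l by (auto simp: Ymat_nth)
          hence "\<not> z < 0"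
          proof (rule contrapos_nn)
            assume "z < 0"
            hence "- e' - int p = b + int p * int (nat (- z - 1))" using z by (simp add: algebra_simps)
            thus "mode v (- e' - int p) = 0\<^sub>m n n" by (simp only: b0)
          qed
          then obtain i where i: "z = int i" by (metis nonneg_int_cases not_less)
          have e'i: "e' = h i" using z i by (simp add: h_def)
          have "mode u (- (e - e') - int p) \<noteq> 0\<^sub>m n n" using e'(2) xy l by (auto simp: Ymat_nth)
          moreover have "- (e - e') - int p = a + int p * int i" by (simp add: e'i h_def a_def)
          ultimately have "i < L" using L by (metis not_less)
          thus "e' \<in> h ` {..<Suc L}" using e'i by auto
        qed simp
        also have "\<dots> = (\<Sum>i<Suc L. fls_nth (Ymat v $$ (x, l)) (h i) * fls_nth (Ymat u $$ (l, y)) (e - h i))"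
          by (simp add: sum.reindex[OF inj])
        also have "\<dots> = (\<Sum>i<Suc L. mode v (b - int p - int p * int i) $$ (x, l) * mode u (a + int p * int i) $$ (l, y))"
        proof (rule sum.cong[OF refl])
          fix i
          have "- h i - int p = b - int p - int p * int i" "- (e - h i) - int p = a + int p * int i"
            by (simp_all add: h_def a_def)
          thus "fls_nth (Ymat v $$ (x, l)) (h i) * fls_nth (Ymat u $$ (l, y)) (e - h i) = mode v (b - int p - int p * int i) $$ (x, l) * mode u (a + int p * int i) $$ (l, y)"
            using xy l by (simp only: Ymat_nth)
        qed
        finally show ?thesis .
      qed
      have "fls_nth (Ymat (u * v) $$ (x, y)) e = mode (u * v) (a + b) $$ (x, y)" using xy by (simp add: Ymat_nth ab)
      also have "\<dots> = (\<Sum>i<Suc L. (mode v (b - int p - int p * int i) * mode u (a + int p * int i)) $$ (x, y))"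
        by (rule mode_product[OF u v a b b0 _ xy]) (use L in auto)
      also have "\<dots> = (\<Sum>i<Suc L. \<Sum>l<n. mode v (b - int p - int p * int i) $$ (x, l) * mode u (a + int p * int i) $$ (l, y))"
        by (rule sum.cong[OF refl], rule index_mult_mat_sum[of _ n n _ n]) (use xy in auto)
      also have "\<dots> = (\<Sum>l<n. \<Sum>i<Suc L. mode v (b - int p - int p * int i) $$ (x, l) * mode u (a + int p * int i) $$ (l, y))"
        by (rule sum.swap)
      also have "\<dots> = (\<Sum>l<n. fls_nth (Ymat v $$ (x, l) * Ymat u $$ (l, y)) e)"
        by (rule sum.cong[OF refl]) (simp only: entry lessThan_iff)
      also have "\<dots> = fls_nth ((Ymat v * Ymat u) $$ (x, y)) e"
        by (subst index_mult_mat_sum[of _ n n _ n]) (use xy in \<open>auto simp: fls_nth_sum\<close>)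
      finally show ?thesis .
    qed
  qed
qed auto

definition T :: "complex fls mat" where "T = Ymat tvar"

lemma T_carrier [simp]: "T \<in> carrier_mat n n" by (simp add: T_def)

lemma T_dim [simp]: "dim_row T = n" "dim_col T = n" by (simp_all add: T_def)

lemma tvar_graded: "\<forall>k. coeff tvar k \<noteq> 0 \<longrightarrow> int p dvd int k - 1"
  by (auto simp: coeff_pCons split: nat.splits)

lemma Ymat_tvar_power: "Ymat (tvar ^ k) = T ^\<^sub>m k"
proof (induction k)
  case (Suc k)
  have gr: "\<forall>i. coeff (tvar ^ k) i \<noteq> 0 \<longrightarrow> int p dvd int i - int k * 1" by (rule graded_power[OF tvar_graded])
  have "Ymat (tvar * tvar ^ k) = Ymat (tvar ^ k) * Ymat tvar" by (rule Ymat_mult[OF tvar_graded gr])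
  thus ?case using Suc by (simp add: T_def)
qed (simp add: Ymat_1)

text \<open>So the module is determined by the single matrix \<open>T\<close>.\<close>

lemma Ymat_eq_eval: "Ymat u = eval_poly_mat n u T"
proof (induction u rule: poly_additive_induct)
  case (1 c k)
  have "Ymat (monom c k) = fls_const c \<cdot>\<^sub>m T ^\<^sub>m k" by (simp add: monom_altdef Ymat_smult Ymat_tvar_power)
  thus ?case by (simp add: eval_poly_mat_monom)
next
  case (2 u v)
  thus ?case by (simp add: Ymat_add eval_poly_mat_add)
qed

lemma \<phi>_field:
  assumes w: "w \<in> carrier M"
  shows "\<phi> (Y u i w) = series_field p n T u i (\<phi> w)"
proof (cases "of_nat p * i \<in> \<int>")
  case True
  then obtain a where a: "of_nat p * i = of_int a" by (auto elim: Ints_cases)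
  show ?thesis
    unfolding series_field_eq[OF a] mode_apply[OF a w] Ymat_eq_eval[symmetric] coeff_Ymat by simp
next
  case False
  thus ?thesis using w mode_exponents[of i w u] by (simp add: series_field_0)
qed

text \<open>The modes of \<open>D ^ k u\<close> carry the same binomial coefficients as those of the \<open>k\<close>-th derivative; outside the grade of \<open>u\<close>, both sides vanish.\<close>

lemma orbit_derivation:
  assumes u: "\<forall>k. coeff u k \<noteq> 0 \<longrightarrow> int p dvd int k - r" and ij: "i < n" "j < n"
  shows "Ymat (graded_comp p r ((derivation_of f ^^ k) u)) $$ (i, j) = (ddx p ^^ k) (Ymat u $$ (i, j))" (is "?l = ?r")
proof (rule fls_eqI)
  fix e
  have gc: "\<forall>m. coeff (graded_comp p r ((derivation_of f ^^ k) u)) m \<noteq> 0 \<longrightarrow> int p dvd int m - r"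
    by (auto simp: coeff_graded_comp)
  define a where "a = - e - int p"
  have e: "e = - (a + int p * 0) - int p" by (simp add: a_def)
  have r: "fls_nth ?r e = fact k * ((- (of_int a / of_nat p) - of_int (0 - int k) - 1) gchoose k) * fls_nth (Ymat u $$ (i, j)) (- (a + int p * (0 - int k)) - int p)"
    unfolding e by (rule ddx_funpow_nth[OF p_pos])
  have idx: "- (- (a + int p * (0 - int k)) - int p) - int p = a - int p * int k" by simp
  show "fls_nth ?l e = fls_nth ?r e"
  proof (cases "int p dvd a - r")
    case True
    have "fls_nth ?l e = mode ((derivation_of f ^^ k) u) a $$ (i, j)"
      using ij by (simp add: Ymat_nth a_def[symmetric] mode_graded_comp[OF True])
    also have "\<dots> = fact k * ((- 1) ^ k * (of_int a / of_nat p gchoose k)) * mode u (a - int p * int k) $$ (i, j)"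
      unfolding mode_derivation[OF u True] using ij by simp
    also have "(- 1) ^ k * (of_int a / of_nat p gchoose k) = ((- (of_int a / of_nat p) - of_int (0 - int k) - 1) gchoose k :: complex)"
      using gbinomial_minus[of "of_int a / of_nat p :: complex" k] gbinomial_negated_upper[of "of_int a / of_nat p :: complex" k]
      by (simp add: power_mult_distrib[symmetric] mult.assoc[symmetric] algebra_simps)
    finally show ?thesis unfolding r Ymat_nth[OF ij] idx .
  next
    case False
    have "\<not> int p dvd (a - int p * int k) - r"
    proof
      assume "int p dvd (a - int p * int k) - r"
      hence "int p dvd ((a - int p * int k) - r) + int p * int k" by (intro dvd_add) auto
      with False show False by simp
    qed
    hence "mode u (a - int p * int k) = 0\<^sub>m n n" by (rule mode_grading[OF u])
    moreover have "fls_nth ?l e = 0" using ij mode_grading[OF gc False] by (simp add: Ymat_nth a_def[symmetric])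
    ultimately show ?thesis unfolding r Ymat_nth[OF ij] idx using ij by simp
  qed
qed

text \<open>A priori, only the component of grade 1 of \<open>f\<close> governs \<open>T\<close>.\<close>

lemma matrix_solution_graded_comp: "matrix_solution n p T (graded_comp p 1 f)"
proof
  show "p > 1" by (rule p1)
  show "T \<in> carrier_mat n n" by simp
  show "coeff_mat T j * coeff_mat T k = coeff_mat T k * coeff_mat T j" for j k
    unfolding T_def coeff_Ymat by (rule mode_commute[OF tvar_graded tvar_graded])
  show "graded_mat p 1 T" unfolding graded_mat_def T_def using Ymat_graded[OF tvar_graded] by simp
  show "mat_ddx p T = eval_poly_mat n (graded_comp p 1 f) T"
  proof (rule eq_matI)
    fix i j assume "i < dim_row (eval_poly_mat n (graded_comp p 1 f) T)" "j < dim_col (eval_poly_mat n (graded_comp p 1 f) T)"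
    hence ij: "i < n" "j < n" by auto
    have "derivation_of f tvar = f" by (simp add: derivation_of_def pderiv_pCons)
    thus "mat_ddx p T $$ (i, j) = eval_poly_mat n (graded_comp p 1 f) T $$ (i, j)"
      using orbit_derivation[OF tvar_graded ij, of 1] ij by (simp add: mat_ddx_def Ymat_eq_eval eval_poly_mat_tvar)
  qed (auto simp: T_def)
qed

text \<open>Evaluate the formula for the higher derivatives on a common eigenvector of the modes of \<open>t\<close>, with eigenvalue \<open>\<tau>\<close>.\<close>

theorem homogeneous_derivation:
  assumes T0: "T \<noteq> 0\<^sub>m n n"
  shows "graded_comp p 1 f = f"
proof -
  interpret S: matrix_solution n p T "graded_comp p 1 f" by (rule matrix_solution_graded_comp)
  obtain k e Z where ft: "k \<ge> 1" "Z \<in> S.D" "e \<in> S.D" "e * e = e" "e = T ^\<^sub>m k * Z" "e \<noteq> 0\<^sub>m n n"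
    by (rule S.fitting_T[OF T0])
  obtain w \<tau> where w: "w \<in> carrier_vec n" "w \<noteq> 0\<^sub>v n"
    and Tw: "T *\<^sub>v map_vec fls_const w = \<tau> \<cdot>\<^sub>v map_vec fls_const w"
    and \<tau>: "\<tau> \<noteq> 0" "graded_fls p 1 \<tau>" "ddx p \<tau> = poly_fls (graded_comp p 1 f) \<tau>"
    by (rule S.eigen_data[OF ft(3,4,6,5,1,2)])
  have sub: "fls_subdegree \<tau> < 0" using scalar_solution(1)[OF p1 \<tau>] by simp
  define v where "v = map_vec fls_const w"
  have v: "v \<in> carrier_vec n" using w by (simp add: v_def)
  obtain x where x: "x < n" "w $ x \<noteq> 0" using w by (auto simp: vec_eq_iff)
  have ev: "eval_poly_mat n P T *\<^sub>v v = poly_fls P \<tau> \<cdot>\<^sub>v v" for P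
    by (rule eval_poly_mat_eigenvector(2)[OF T_carrier v Tw[folded v_def]])
  have evx: "(\<Sum>l<n. eval_poly_mat n P T $$ (x, l) * fls_const (w $ l)) = poly_fls P \<tau> * fls_const (w $ x)" for P
  proof -
    have "(eval_poly_mat n P T *\<^sub>v v) $ x = (\<Sum>l<n. eval_poly_mat n P T $$ (x, l) * v $ l)"
      by (rule index_mult_vec_sum) (use v x in auto)
    thus ?thesis unfolding ev using w x by (simp add: v_def)
  qed
  have ddxk: "(ddx p ^^ k) (\<Sum>l<m. F l * fls_const (c l)) = (\<Sum>l<m. (ddx p ^^ k) (F l) * fls_const (c l))" for k F c and m :: nat
    by (induction k) (simp_all add: ddx_sum ddx_mult)
  show ?thesis
  proof (rule homogeneous_from_orbit[OF p_pos \<tau>(1) sub])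
    fix k i
    have gr: "\<forall>j. coeff (tvar ^ i) j \<noteq> 0 \<longrightarrow> int p dvd int j - int i"
      using graded_power[OF tvar_graded, of i] by simp
    let ?P = "graded_comp p (int i) ((derivation_of f ^^ k) (tvar ^ i))"
    have "poly_fls ?P \<tau> * fls_const (w $ x) = (\<Sum>l<n. Ymat ?P $$ (x, l) * fls_const (w $ l))"
      by (simp only: evx[symmetric] Ymat_eq_eval)
    also have "\<dots> = (\<Sum>l<n. (ddx p ^^ k) (Ymat (tvar ^ i) $$ (x, l)) * fls_const (w $ l))"
      by (rule sum.cong[OF refl]) (use orbit_derivation[OF gr x(1)] in simp)
    also have "\<dots> = (ddx p ^^ k) (poly_fls (tvar ^ i) \<tau> * fls_const (w $ x))"
      by (simp only: ddxk[symmetric] Ymat_eq_eval evx)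
    also have "\<dots> = (ddx p ^^ k) (\<tau> ^ i) * fls_const (w $ x)"
      using ddxk[of k "\<lambda>_. \<tau> ^ i" "\<lambda>_. w $ x" 1] by (simp add: poly_fls_power poly_fls_tvar)
    finally show "poly_fls ?P \<tau> = (ddx p ^^ k) (\<tau> ^ i)" using x by simp
  qed
qed

lemma T_is_solution: "T \<noteq> 0\<^sub>m n n \<Longrightarrow> matrix_solution n p T f"
  using matrix_solution_graded_comp homogeneous_derivation by simp

lemma T_nonzero:
  assumes "field_nonzero M Y tvar"
  shows "T \<noteq> 0\<^sub>m n n"
proof
  assume T: "T = 0\<^sub>m n n"
  obtain i w where w: "w \<in> carrier M" "Y tvar i w \<noteq> \<zero>" using assms by (auto simp: field_nonzero_def)
  have "coeff_mat T e = 0\<^sub>m n n" for e unfolding T by (rule eq_matI) auto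
  hence "\<phi> (Y tvar i w) = 0\<^sub>v n"
    using w unfolding \<phi>_field[OF w(1)]
    by (cases "of_nat p * i \<in> \<int>") (auto simp: series_field_0 series_field_eq eval_poly_mat_tvar elim!: Ints_cases)
  hence "Y tvar i w = \<zero>" using w \<phi>_inj[of "Y tvar i w" \<zero>] by simp
  with w show False by simp
qed

end

section \<open>Submodules and isomorphisms in coordinates\<close>

lemma vec_subspace_sum:
  assumes W: "vec_subspace n W" and A: "finite A" and h: "\<And>k. k \<in> A \<Longrightarrow> h k \<in> W"
  shows "vec n (\<lambda>r. \<Sum>k\<in>A. (h k :: complex vec) $ r) \<in> W"
  using A h
proof (induction A)
  case empty
  have "vec n (\<lambda>r. \<Sum>k\<in>{}. (h k :: complex vec) $ r) = 0\<^sub>v n" by (rule eq_vecI) auto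
  thus ?case using W by (simp add: vec_subspace_def)
next
  case (insert a A)
  have "h a \<in> carrier_vec n" using insert W by (auto simp: vec_subspace_def)
  hence "vec n (\<lambda>r. \<Sum>k\<in>insert a A. h k $ r) = h a + vec n (\<lambda>r. \<Sum>k\<in>A. h k $ r)"
    using insert by (intro eq_vecI) auto
  thus ?case using insert W by (simp add: vec_subspace_def)
qed

lemma coeff_mat_mult_invariant:
  assumes W: "vec_subspace n W" and X: "X \<in> carrier_mat n n" and Z: "Z \<in> carrier_mat n n"
    and iX: "\<And>k v. v \<in> W \<Longrightarrow> coeff_mat X k *\<^sub>v v \<in> W" and iZ: "\<And>k v. v \<in> W \<Longrightarrow> coeff_mat Z k *\<^sub>v v \<in> W"
    and v: "v \<in> W"
  shows "coeff_mat (X * Z) m *\<^sub>v v \<in> W"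
proof -
  obtain N where N: "\<forall>k<N. coeff_mat X k = 0\<^sub>m n n" using coeff_mat_bounded_below[OF X] .
  obtain N' where N': "\<forall>k<N'. coeff_mat Z k = 0\<^sub>m n n" using coeff_mat_bounded_below[OF Z] .
  have vc: "v \<in> carrier_vec n" using v W by (auto simp: vec_subspace_def)
  have "coeff_mat (X * Z) m *\<^sub>v v = vec n (\<lambda>r. \<Sum>k\<in>{N..m - N'}. (coeff_mat X k *\<^sub>v (coeff_mat Z (m - k) *\<^sub>v v)) $ r)"
  proof (rule eq_vecI)
    fix r assume "r < dim_vec (vec n (\<lambda>r. \<Sum>k\<in>{N..m - N'}. (coeff_mat X k *\<^sub>v (coeff_mat Z (m - k) *\<^sub>v v)) $ r))"
    hence r: "r < n" by simp
    have "(coeff_mat (X * Z) m *\<^sub>v v) $ r = (\<Sum>l<n. coeff_mat (X * Z) m $$ (r, l) * v $ l)"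
      by (rule index_mult_vec_sum) (use X Z vc r in auto)
    also have "\<dots> = (\<Sum>l<n. \<Sum>k\<in>{N..m - N'}. (coeff_mat X k * coeff_mat Z (m - k)) $$ (r, l) * v $ l)"
      by (rule sum.cong[OF refl]) (simp only: coeff_mat_mult_index[OF X Z N N' r] sum_distrib_right lessThan_iff)
    also have "\<dots> = (\<Sum>k\<in>{N..m - N'}. \<Sum>l<n. (coeff_mat X k * coeff_mat Z (m - k)) $$ (r, l) * v $ l)"
      by (rule sum.swap)
    also have "\<dots> = (\<Sum>k\<in>{N..m - N'}. (coeff_mat X k *\<^sub>v (coeff_mat Z (m - k) *\<^sub>v v)) $ r)"
    proof (rule sum.cong[OF refl])
      fix k
      have "(\<Sum>l<n. (coeff_mat X k * coeff_mat Z (m - k)) $$ (r, l) * v $ l) = (coeff_mat X k * coeff_mat Z (m - k) *\<^sub>v v) $ r"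
        by (rule index_mult_vec_sum[symmetric]) (use X Z vc r in auto)
      also have "coeff_mat X k * coeff_mat Z (m - k) *\<^sub>v v = coeff_mat X k *\<^sub>v (coeff_mat Z (m - k) *\<^sub>v v)"
        by (rule assoc_mult_mat_vec[of _ n n _ n]) (use X Z vc in auto)
      finally show "(\<Sum>l<n. (coeff_mat X k * coeff_mat Z (m - k)) $$ (r, l) * v $ l) = (coeff_mat X k *\<^sub>v (coeff_mat Z (m - k) *\<^sub>v v)) $ r" .
    qed
    finally show "(coeff_mat (X * Z) m *\<^sub>v v) $ r = vec n (\<lambda>r. \<Sum>k\<in>{N..m - N'}. (coeff_mat X k *\<^sub>v (coeff_mat Z (m - k) *\<^sub>v v)) $ r) $ r"
      using r by simp
  qed (use X Z in auto)
  moreover have "vec n (\<lambda>r. \<Sum>k\<in>{N..m - N'}. (coeff_mat X k *\<^sub>v (coeff_mat Z (m - k) *\<^sub>v v)) $ r) \<in> W"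
    by (rule vec_subspace_sum[OF W]) (auto intro: iX iZ v)
  ultimately show ?thesis by simp
qed

text \<open>Although the modes of \<open>u\<close> are infinite combinations of products of modes of \<open>t\<close>, each coefficient of a product is a finite sum.\<close>

lemma eval_poly_mat_invariant:
  assumes W: "vec_subspace n W" and T: "T \<in> carrier_mat n n"
    and iT: "\<And>k v. v \<in> W \<Longrightarrow> coeff_mat T k *\<^sub>v v \<in> W" and v: "v \<in> W"
  shows "coeff_mat (eval_poly_mat n u T) m *\<^sub>v v \<in> W"
  using v
proof (induction u arbitrary: m v)
  case 0
  have "coeff_mat (0\<^sub>m n n) m = 0\<^sub>m n n" by (rule eq_matI) auto
  moreover have "v \<in> carrier_vec n" using 0 W by (auto simp: vec_subspace_def)
  ultimately show ?case using W by (simp add: vec_subspace_def)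
next
  case (pCons c u)
  let ?U = "eval_poly_mat n u T"
  have vc: "v \<in> carrier_vec n" using pCons.prems W by (auto simp: vec_subspace_def)
  have "coeff_mat (eval_poly_mat n (pCons c u) T) m = (if m = 0 then c else 0) \<cdot>\<^sub>m 1\<^sub>m n + coeff_mat (T * ?U) m"
    unfolding eval_poly_mat_pCons[OF T] by (rule eq_matI) (use T in auto)
  hence "coeff_mat (eval_poly_mat n (pCons c u) T) m *\<^sub>v v = (if m = 0 then c else 0) \<cdot>\<^sub>v v + coeff_mat (T * ?U) m *\<^sub>v v"
    using vc T by (simp add: add_mult_distrib_mat_vec[of _ n n] smult_mat_mult_vec[of _ n])
  moreover have "coeff_mat (T * ?U) m *\<^sub>v v \<in> W"
    by (rule coeff_mat_mult_invariant[OF W T _ iT pCons.IH pCons.prems]) auto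
  ultimately show ?case using W pCons.prems by (simp add: vec_subspace_def)
qed

context coordinatized_module
begin

lemma field_submodule_vec_subspace:
  assumes W: "vec_subspace n W" and iT: "\<forall>k. \<forall>v\<in>W. coeff_mat T k *\<^sub>v v \<in> W"
  shows "field_submodule M Y (\<psi> ` W)"
  unfolding field_submodule_def
proof (intro conjI allI ballI)
  have Wc: "x \<in> carrier_vec n" if "x \<in> W" for x using W that by (auto simp: vec_subspace_def)
  have zero: "\<psi> (0\<^sub>v n) = \<zero>" by (subst \<phi>_inj[symmetric]) auto
  show "VectorSpace.subspace class_ring (\<psi> ` W) M"
  proof (intro VectorSpace.subspace.intro submodule.intro)
    show "vectorspace class_ring M" by unfold_locales
    show "Module.module class_ring M" by unfold_locales
    show "\<psi> ` W \<subseteq> carrier M" using Wc by auto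
    show "\<zero> \<in> \<psi> ` W" using W zero by (metis image_eqI vec_subspace_def)
    fix v w assume "v \<in> \<psi> ` W" "w \<in> \<psi> ` W"
    then obtain x y where xy: "v = \<psi> x" "w = \<psi> y" "x \<in> W" "y \<in> W" by blast
    hence "v \<oplus> w = \<psi> (x + y)" using Wc by (simp add: \<psi>_add)
    thus "v \<oplus> w \<in> \<psi> ` W" using xy W by (auto simp: vec_subspace_def)
  next
    fix c v assume "v \<in> \<psi> ` W"
    then obtain x where x: "v = \<psi> x" "x \<in> W" by blast
    hence "c \<odot> v = \<psi> (c \<cdot>\<^sub>v x)" using Wc by (simp add: \<psi>_smult)
    thus "c \<odot> v \<in> \<psi> ` W" using x W by (auto simp: vec_subspace_def)
  qed
  fix u i w assume "w \<in> \<psi> ` W"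
  then obtain x where x: "w = \<psi> x" "x \<in> W" by blast
  have wc: "w \<in> carrier M" using x Wc by simp
  have "\<phi> (Y u i w) = series_field p n T u i x" using \<phi>_field[OF wc, of u i] x Wc by simp
  also have "\<dots> \<in> W"
  proof (cases "of_nat p * i \<in> \<int>")
    case True
    then obtain a where a: "of_nat p * i = of_int a" by (auto elim: Ints_cases)
    show ?thesis unfolding series_field_eq[OF a] by (rule eval_poly_mat_invariant[OF W]) (use iT x in auto)
  next
    case False
    thus ?thesis using W by (simp add: series_field_0 vec_subspace_def)
  qed
  finally have "\<psi> (\<phi> (Y u i w)) \<in> \<psi> ` W" by (rule imageI)
  thus "Y u i w \<in> \<psi> ` W" using wc by simp
qed

lemma indecomposable_series:
  assumes ind: "field_indecomposable M Y"
  shows "series_indecomposable n T"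
  unfolding series_indecomposable_def
proof (intro allI impI, elim conjE)
  fix W1 W2
  assume W: "vec_subspace n W1" "vec_subspace n W2"
    and inv: "\<forall>k. \<forall>v\<in>W1. coeff_mat T k *\<^sub>v v \<in> W1" "\<forall>k. \<forall>v\<in>W2. coeff_mat T k *\<^sub>v v \<in> W2"
    and int: "W1 \<inter> W2 \<subseteq> {0\<^sub>v n}" and sum: "\<forall>v\<in>carrier_vec n. \<exists>a\<in>W1. \<exists>b\<in>W2. v = a + b"
  have Wc: "x \<in> carrier_vec n" if "x \<in> W1 \<union> W2" for x using W that by (auto simp: vec_subspace_def)
  have W0: "0\<^sub>v n \<in> W1" "0\<^sub>v n \<in> W2" using W by (auto simp: vec_subspace_def)
  have zero: "\<psi> (0\<^sub>v n) = \<zero>" by (subst \<phi>_inj[symmetric]) auto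
  have \<psi>_inj: "x = y" if "\<psi> x = \<psi> y" "x \<in> carrier_vec n" "y \<in> carrier_vec n" for x y using that \<phi>_\<psi> by metis
  have "\<psi> ` W1 \<inter> \<psi> ` W2 = {\<zero>}"
  proof
    show "\<psi> ` W1 \<inter> \<psi> ` W2 \<subseteq> {\<zero>}"
    proof
      fix w assume "w \<in> \<psi> ` W1 \<inter> \<psi> ` W2"
      then obtain x y where xy: "w = \<psi> x" "w = \<psi> y" "x \<in> W1" "y \<in> W2" by blast
      hence "x = y" using Wc by (intro \<psi>_inj) auto
      thus "w \<in> {\<zero>}" using xy int zero by auto
    qed
    show "{\<zero>} \<subseteq> \<psi> ` W1 \<inter> \<psi> ` W2" using W0 zero by (metis IntI empty_subsetI image_eqI insert_subset)
  qed
  moreover have "submodule_sum (\<psi> ` W1) (\<psi> ` W2) = carrier M"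
  proof
    show "submodule_sum (\<psi> ` W1) (\<psi> ` W2) \<subseteq> carrier M"
      using Wc by (auto simp: submodule_sum_def)
    show "carrier M \<subseteq> submodule_sum (\<psi> ` W1) (\<psi> ` W2)"
    proof
      fix w assume w: "w \<in> carrier M"
      then obtain a b where ab: "a \<in> W1" "b \<in> W2" "\<phi> w = a + b" using sum \<phi>_carrier by blast
      have "w = \<psi> a \<oplus> \<psi> b" using \<psi>_\<phi>[OF w] ab Wc by (simp add: \<psi>_add)
      thus "w \<in> submodule_sum (\<psi> ` W1) (\<psi> ` W2)" using ab by (auto simp: submodule_sum_def image_iff)
    qed
  qed
  ultimately have "\<psi> ` W1 = {\<zero>} \<or> \<psi> ` W2 = {\<zero>}"
    using ind field_submodule_vec_subspace[OF W(1) inv(1)] field_submodule_vec_subspace[OF W(2) inv(2)]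
    unfolding field_indecomposable_def by blast
  moreover have "W' \<subseteq> {0\<^sub>v n}" if "\<psi> ` W' = {\<zero>}" "W' \<subseteq> carrier_vec n" for W'
  proof
    fix x assume x: "x \<in> W'"
    hence "\<psi> x = \<psi> (0\<^sub>v n)" using that(1) zero by auto
    hence "x = 0\<^sub>v n" by (rule \<psi>_inj) (use x that(2) in auto)
    thus "x \<in> {0\<^sub>v n}" by simp
  qed
  ultimately show "W1 \<subseteq> {0\<^sub>v n} \<or> W2 \<subseteq> {0\<^sub>v n}" using W by (auto simp: vec_subspace_def)
qed

text \<open>A constant matrix that intertwines \<open>Y(t,x)\<close> intertwines all fields, as these are polynomials in it.\<close>

lemma isomorphic_series_field:
  assumes R: "R \<in> carrier_mat n n" and P: "P \<in> carrier_mat n n" and RP: "R * P = 1\<^sub>m n" "P * R = 1\<^sub>m n"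
    and S: "S \<in> carrier_mat n n" and int: "const_mat R * T = S * const_mat R"
  shows "field_isomorphic M Y (module_vec TYPE(complex) n) (series_field p n S)"
  unfolding field_isomorphic_def
proof (intro exI[of _ "\<lambda>w. R *\<^sub>v \<phi> w"] conjI allI ballI)
  show "(\<lambda>w. R *\<^sub>v \<phi> w) \<in> LinearCombinations.module_hom class_ring M (module_vec TYPE(complex) n)"
    using R by (auto simp: LinearCombinations.module_hom_def module_vec_simps \<phi>_add \<phi>_smult
        mult_add_distrib_mat_vec[of _ n n] mult_mat_vec[of _ n n] intro!: mult_vec_carrier_square)
  have "bij_betw (\<lambda>v. R *\<^sub>v v) (carrier_vec n) (carrier_vec n)"
  proof (rule bij_betw_byWitness[where f' = "\<lambda>v. P *\<^sub>v v"])
    show "\<forall>a\<in>carrier_vec n. P *\<^sub>v (R *\<^sub>v a) = a" using R P RP by (simp add: assoc_mult_mat_vec[of _ n n _ n, symmetric])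
    show "\<forall>a\<in>carrier_vec n. R *\<^sub>v (P *\<^sub>v a) = a" using R P RP by (simp add: assoc_mult_mat_vec[of _ n n _ n, symmetric])
  qed (use R P in \<open>auto intro!: mult_vec_carrier_square\<close>)
  from bij_betw_trans[OF \<phi>_bij this] show "bij_betw (\<lambda>w. R *\<^sub>v \<phi> w) (carrier M) (carrier (module_vec TYPE(complex) n))"
    by (simp add: o_def module_vec_simps)
  fix u i w assume w: "w \<in> carrier M"
  show "R *\<^sub>v \<phi> (Y u i w) = series_field p n S u i (R *\<^sub>v \<phi> w)"
  proof (cases "of_nat p * i \<in> \<int>")
    case True
    then obtain a where a: "of_nat p * i = of_int a" by (auto elim: Ints_cases)
    let ?k = "- a - int p"
    have Rc: "const_mat R \<in> carrier_mat n n" using R by simp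
    have "const_mat R * eval_poly_mat n u T = eval_poly_mat n u S * const_mat R"
      by (rule intertwine_eval_poly_mat[OF T_carrier S Rc int])
    hence "coeff_mat (const_mat R * eval_poly_mat n u T) ?k = coeff_mat (eval_poly_mat n u S * const_mat R) ?k" by simp
    hence c: "R * coeff_mat (eval_poly_mat n u T) ?k = coeff_mat (eval_poly_mat n u S) ?k * R"
      using R by (simp add: coeff_mat_const_mult)
    have "R *\<^sub>v \<phi> (Y u i w) = (R * coeff_mat (eval_poly_mat n u T) ?k) *\<^sub>v \<phi> w"
      unfolding \<phi>_field[OF w] series_field_eq[OF a] by (rule assoc_mult_mat_vec[of _ n n _ n, symmetric]) (use R w in auto)
    also have "\<dots> = series_field p n S u i (R *\<^sub>v \<phi> w)"
      unfolding c series_field_eq[OF a] by (rule assoc_mult_mat_vec[of _ n n _ n]) (use R w in auto)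
    finally show ?thesis .
  next
    case False
    have "R *\<^sub>v 0\<^sub>v n = 0\<^sub>v n" using R by (intro eq_vecI) auto
    thus ?thesis using False w by (simp add: \<phi>_field series_field_0)
  qed
qed

end

section \<open>Existence and classification of twisted modules\<close>

lemma coordinatized_moduleI:
  assumes "graded_automorphism g p" "twisted_module M p g (derivation_of f) Y" "vectorspace.fin_dim class_ring M"
  obtains \<phi> where "coordinatized_module M p g f Y (vectorspace.dim class_ring M) \<phi>"
proof -
  interpret twisted_module M p g "derivation_of f" Y by fact
  have vs: "vectorspace class_ring M" by unfold_locales
  obtain \<phi> where "\<phi> \<in> LinearCombinations.module_hom class_ring M (module_vec TYPE(complex) (vectorspace.dim class_ring M))"
    "bij_betw \<phi> (carrier M) (carrier_vec (vectorspace.dim class_ring M))"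
    by (rule fin_dim_coordinates[OF vs assms(3) refl])
  with assms that show ?thesis
    by (auto intro!: coordinatized_module.intro coordinatized_module_axioms.intro)
qed

lemma derivation_form:
  assumes "graded_automorphism g p" "twisted_module M p g (derivation_of f) Y" "vectorspace.fin_dim class_ring M"
    and nz: "field_nonzero M Y tvar"
  shows "\<exists>c1 c. c \<noteq> 0 \<and> f = monom c1 1 + monom c (p + 1)"
proof -
  obtain \<phi> where "coordinatized_module M p g f Y (vectorspace.dim class_ring M) \<phi>"
    by (rule coordinatized_moduleI[OF assms(1-3)])
  then interpret coordinatized_module M p g f Y "vectorspace.dim class_ring M" \<phi> .
  interpret S: matrix_solution "vectorspace.dim class_ring M" p T f by (rule T_is_solution[OF T_nonzero[OF nz]])
  show ?thesis by (rule S.nonzero_solution_form[OF T_nonzero[OF nz]])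
qed

text \<open>The two cases of the classification are instances of the same formula.\<close>

lemma normal_form_as_sol:
  assumes "p > 1" "c \<noteq> 0"
  obtains q \<alpha> \<epsilon> \<rho> \<kappa> where "scalar_data p c1 c q \<alpha> \<epsilon> \<rho> \<kappa>"
    "\<And>a n. (if c1 = 0 then T_zero p a n else T_nonzero p c1 a n) = scalar_data.sol p \<rho> \<kappa> n a (jordan_block n 0)"
proof -
  have J: "const_mat (jordan_block n 0 :: complex mat) = jordan_block n 0" for n
    by (rule eq_matI) (auto simp: jordan_block_def)
  show ?thesis
  proof (cases "c1 = 0")
    case True
    note sd = scalar_data_zero[OF assms]
    show ?thesis
      by (rule that[OF sd[folded True]]) (simp only: True refl if_True T_zero_def scalar_data.sol_def[OF sd] J)
  next
    case False
    note sd = scalar_data_nonzero[OF assms False]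
    show ?thesis
      by (rule that[OF sd]) (simp only: False if_False T_nonzero_def Let_def scalar_data.sol_def[OF sd] J)
  qed
qed

lemma normal_form_twisted_module:
  assumes "graded_automorphism g p" and sd: "scalar_data p c1 c q \<alpha> \<epsilon> \<rho> \<kappa>" and a: "a ^ p = inverse (- (of_nat p * c))"
  shows "twisted_module (module_vec TYPE(complex) n) p g (derivation_of (monom c1 1 + monom c (p + 1)))
     (series_field p n (scalar_data.sol p \<rho> \<kappa> n a (jordan_block n 0)))"
proof -
  interpret scalar_data p c1 c q \<alpha> \<epsilon> \<rho> \<kappa> by fact
  interpret matrix_solution n p "sol n a (jordan_block n 0)" "monom c1 1 + monom c (p + 1)"
    by (rule sol_is_solution[OF _ jordan_block_nilpotent a]) auto
  show ?thesis by (rule series_field_twisted_module[OF assms(1)])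
qed

text \<open>In dimension 1, the standard series is invertible, so it has a nonzero coefficient.\<close>

lemma module_exists:
  assumes "graded_automorphism g p" and c: "c \<noteq> 0"
  shows "\<exists>(M :: (complex, complex vec) module) Y.
         twisted_module M p g (derivation_of (monom c1 1 + monom c (p + 1))) Y \<and>
         vectorspace.fin_dim class_ring M \<and> field_nonzero M Y tvar"
proof -
  interpret graded_automorphism g p by fact
  obtain q \<alpha> \<epsilon> \<rho> \<kappa> where sd: "scalar_data p c1 c q \<alpha> \<epsilon> \<rho> \<kappa>"
    by (rule normal_form_as_sol[OF p1 c])
  interpret scalar_data p c1 c q \<alpha> \<epsilon> \<rho> \<kappa> by fact
  obtain a where a: "a ^ p = inverse (- (of_nat p * c))" using nth_root_exists[of p] p1 by auto
  define S where "S = sol 1 a (jordan_block 1 0)"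
  have Sc: "S \<in> carrier_mat 1 1" by (simp add: S_def)
  have "S \<noteq> 0\<^sub>m 1 1"
  proof
    assume "S = 0\<^sub>m 1 1"
    hence "S ^\<^sub>m p = 0\<^sub>m 1 1" using p1 by (cases p) (auto simp: right_mult_zero_mat[of _ 1 1])
    moreover have "S ^\<^sub>m p * inv_sol 1 (jordan_block 1 0) = 1\<^sub>m 1"
      unfolding S_def by (rule sol_pow_inv_sol[OF _ jordan_block_nilpotent a]) auto
    ultimately have "(0\<^sub>m 1 1 :: complex fls mat) = 1\<^sub>m 1"
      by (metis inv_sol_carrier jordan_block_carrier left_mult_zero_mat)
    hence "(0\<^sub>m 1 1 :: complex fls mat) $$ (0, 0) = 1\<^sub>m 1 $$ (0, 0)" by simp
    thus False by simp
  qed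
  then obtain k where k: "fls_nth (S $$ (0, 0)) k \<noteq> 0"
    using Sc by (metis (no_types, lifting) eq_matI carrier_matD fls_eq_iff fls_zero_nth index_zero_mat less_one)
  let ?M = "module_vec TYPE(complex) 1" and ?Y = "series_field p 1 S"
  have "field_nonzero ?M ?Y tvar"
    unfolding field_nonzero_def
  proof (intro exI bexI)
    have a: "of_nat p * (of_int (- k - int p) / of_nat p :: rat) = of_int (- k - int p)" using p1 by simp
    have "(coeff_mat S k *\<^sub>v unit_vec 1 0) $ 0 = fls_nth (S $$ (0, 0)) k"
      using Sc by (simp add: scalar_prod_def)
    hence "coeff_mat S k *\<^sub>v unit_vec 1 0 \<noteq> 0\<^sub>v 1" using k by (metis index_zero_vec(1) less_one)
    thus "?Y tvar (of_int (- k - int p) / of_nat p) (unit_vec 1 0) \<noteq> \<zero>\<^bsub>?M\<^esub>"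
      unfolding series_field_eq[OF a] eval_poly_mat_tvar[OF Sc] by (simp add: module_vec_simps)
    show "unit_vec 1 0 \<in> carrier ?M" by (simp add: module_vec_simps)
  qed
  moreover have "twisted_module ?M p g (derivation_of (monom c1 1 + monom c (p + 1))) ?Y"
    unfolding S_def by (rule normal_form_twisted_module[OF assms(1) sd a])
  moreover have "vectorspace.fin_dim class_ring ?M" by (rule vec_space.fin_dim)
  ultimately show ?thesis by blast
qed

theorem theorem2:
  fixes g :: "complex poly \<Rightarrow> complex poly" and p :: nat and f :: "complex poly"
  assumes aut: "poly_alg_automorphism g"
    and ord: "has_order g p"
    and p: "p > 1"
    and line: "g ` line_t \<subseteq> line_t"
  shows
    "((\<exists>(M :: (complex, complex vec) module) Y.
         twisted_module M p g (derivation_of f) Y \<and>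
         vectorspace.fin_dim class_ring M \<and> field_nonzero M Y tvar)
      \<longleftrightarrow> (\<exists>c1 c. c \<noteq> 0 \<and> f = monom c1 1 + monom c (p + 1)))
   \<and> (\<forall>(M :: (complex, 'm) module) Y.
         twisted_module M p g (derivation_of f) Y \<and>
         vectorspace.fin_dim class_ring M \<and> field_nonzero M Y tvar
         \<longrightarrow> (\<exists>c1 c. c \<noteq> 0 \<and> f = monom c1 1 + monom c (p + 1)))
   \<and> (\<forall>c1 c \<gamma> \<zeta> n.
         c \<noteq> 0 \<and> f = monom c1 1 + monom c (p + 1) \<and>
         \<gamma> ^ p = inverse (- (of_nat p * c)) \<and> primitive_root p \<zeta> \<and> n > 0
         \<longrightarrow>
         (let T = (\<lambda>l. if c1 = 0 then T_zero p (\<gamma> * \<zeta> ^ l) n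
                       else T_nonzero p c1 (\<gamma> * \<zeta> ^ l) n)
          in (\<forall>l<p. twisted_module (module_vec TYPE(complex) n) p g (derivation_of f)
                       (series_field p n (T l)))
           \<and> (\<forall>(M :: (complex, 'm) module) Y.
                twisted_module M p g (derivation_of f) Y \<and>
                vectorspace.fin_dim class_ring M \<and> vectorspace.dim class_ring M = n \<and>
                field_indecomposable M Y \<and> field_nonzero M Y tvar
                \<longrightarrow> (\<exists>l<p. field_isomorphic M Y
                          (module_vec TYPE(complex) n) (series_field p n (T l))))))"
proof (intro conjI)
  have g: "graded_automorphism g p" using assms by (rule graded_automorphism.intro)
  show "(\<exists>(M :: (complex, complex vec) module) Y.
         twisted_module M p g (derivation_of f) Y \<and>
         vectorspace.fin_dim class_ring M \<and> field_nonzero M Y tvar)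
      \<longleftrightarrow> (\<exists>c1 c. c \<noteq> 0 \<and> f = monom c1 1 + monom c (p + 1))"
    using derivation_form[OF g] module_exists[OF g] by blast
  show "\<forall>(M :: (complex, 'm) module) Y.
         twisted_module M p g (derivation_of f) Y \<and>
         vectorspace.fin_dim class_ring M \<and> field_nonzero M Y tvar
         \<longrightarrow> (\<exists>c1 c. c \<noteq> 0 \<and> f = monom c1 1 + monom c (p + 1))"
    using derivation_form[OF g] by blast
  show "\<forall>c1 c \<gamma> \<zeta> n.
         c \<noteq> 0 \<and> f = monom c1 1 + monom c (p + 1) \<and>
         \<gamma> ^ p = inverse (- (of_nat p * c)) \<and> primitive_root p \<zeta> \<and> n > 0
         \<longrightarrow>
         (let T = (\<lambda>l. if c1 = 0 then T_zero p (\<gamma> * \<zeta> ^ l) n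
                       else T_nonzero p c1 (\<gamma> * \<zeta> ^ l) n)
          in (\<forall>l<p. twisted_module (module_vec TYPE(complex) n) p g (derivation_of f)
                       (series_field p n (T l)))
           \<and> (\<forall>(M :: (complex, 'm) module) Y.
                twisted_module M p g (derivation_of f) Y \<and>
                vectorspace.fin_dim class_ring M \<and> vectorspace.dim class_ring M = n \<and>
                field_indecomposable M Y \<and> field_nonzero M Y tvar
                \<longrightarrow> (\<exists>l<p. field_isomorphic M Y
                          (module_vec TYPE(complex) n) (series_field p n (T l)))))"
    unfolding Let_def
  proof (intro allI impI conjI; elim conjE)
    fix c1 c \<gamma> \<zeta> :: complex and n l :: nat
    assume c: "c \<noteq> 0" and f: "f = monom c1 1 + monom c (p + 1)"
      and \<gamma>: "\<gamma> ^ p = inverse (- (of_nat p * c))" and \<zeta>: "primitive_root p \<zeta>"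
    obtain q \<alpha> \<epsilon> \<rho> \<kappa> where sd: "scalar_data p c1 c q \<alpha> \<epsilon> \<rho> \<kappa>"
      and T: "\<And>a n. (if c1 = 0 then T_zero p a n else T_nonzero p c1 a n) = scalar_data.sol p \<rho> \<kappa> n a (jordan_block n 0)"
      using normal_form_as_sol[OF p c, of c1] by metis
    have "\<zeta> ^ p = 1" using \<zeta> by (simp add: primitive_root_def)
    hence "(\<zeta> ^ l) ^ p = 1" by (metis mult.commute power_mult power_one)
    hence a: "(\<gamma> * \<zeta> ^ l) ^ p = inverse (- (of_nat p * c))" by (simp add: power_mult_distrib \<gamma>)
    show "twisted_module (module_vec TYPE(complex) n) p g (derivation_of f)
        (series_field p n (if c1 = 0 then T_zero p (\<gamma> * \<zeta> ^ l) n else T_nonzero p c1 (\<gamma> * \<zeta> ^ l) n))"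
      unfolding T f by (rule normal_form_twisted_module[OF g sd a])
  next
    fix c1 c \<gamma> \<zeta> :: complex and n :: nat and M :: "(complex, 'm) module" and Y
    assume c: "c \<noteq> 0" and f: "f = monom c1 1 + monom c (p + 1)"
      and \<gamma>: "\<gamma> ^ p = inverse (- (of_nat p * c))" and \<zeta>: "primitive_root p \<zeta>"
      and M: "twisted_module M p g (derivation_of f) Y" "vectorspace.fin_dim class_ring M"
        "vectorspace.dim class_ring M = n" "field_indecomposable M Y" "field_nonzero M Y tvar"
    obtain q \<alpha> \<epsilon> \<rho> \<kappa> where sd: "scalar_data p c1 c q \<alpha> \<epsilon> \<rho> \<kappa>"
      and T: "\<And>a n. (if c1 = 0 then T_zero p a n else T_nonzero p c1 a n) = scalar_data.sol p \<rho> \<kappa> n a (jordan_block n 0)"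
      using normal_form_as_sol[OF p c, of c1] by metis
    interpret scalar_data p c1 c q \<alpha> \<epsilon> \<rho> \<kappa> by fact
    obtain \<phi> where "coordinatized_module M p g f Y n \<phi>"
      using coordinatized_moduleI[OF g M(1,2)] M(3) by blast
    then interpret C: coordinatized_module M p g f Y n \<phi> .
    have nz: "C.T \<noteq> 0\<^sub>m n n" by (rule C.T_nonzero[OF M(5)])
    have ms: "matrix_solution n p C.T (monom c1 1 + monom c (p + 1))" using C.T_is_solution[OF nz] f by simp
    obtain l R P where *: "l < p" "R \<in> carrier_mat n n" "P \<in> carrier_mat n n" "R * P = 1\<^sub>m n" "P * R = 1\<^sub>m n"
      "const_mat R * C.T = sol n (\<gamma> * \<zeta> ^ l) (jordan_block n 0) * const_mat R"
      by (rule classification[OF sd ms nz C.indecomposable_series[OF M(4)] \<gamma> \<zeta>])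
    have "field_isomorphic M Y (module_vec TYPE(complex) n) (series_field p n (sol n (\<gamma> * \<zeta> ^ l) (jordan_block n 0)))"
      by (rule C.isomorphic_series_field[OF *(2-5) _ *(6)]) simp
    thus "\<exists>l<p. field_isomorphic M Y (module_vec TYPE(complex) n)
        (series_field p n (if c1 = 0 then T_zero p (\<gamma> * \<zeta> ^ l) n else T_nonzero p c1 (\<gamma> * \<zeta> ^ l) n))"
      unfolding T using *(1) by blast
  qed
qed

end
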